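(* There exists a constant $C>0$ which depends only on $\Omega$, $n$, and the shape regularity (constant $\gamma$) of $\mathcal{T}$ such that $$C^{-1}\,|||\phi|||_{\mathcal{Y}} \le \|\phi\|_{-1,\sim} \le C\,|||\phi|||_{\mathcal{Y}}\qquad\text{for all }\phi\in\mathcal{P}^0(\mathcal{T}),$$ where, with $\mathcal{X}_0:=\mathrm{span}\{1\}$ and $\mathcal{X}_E:=\mathrm{span}\{\mathrm{div}\,\boldsymbol\psi_E\}$, $$|||\phi|||_{\mathcal{Y}}^2 := \inf\Big\{\|\phi_0\|_{-1,\sim}^2+\sum_{E\in\mathcal{E}^\Omega}\|\phi_E\|_{-1,\sim}^2 \,:\, \phi_0\in\mathcal{X}_0,\ \phi_E\in\mathcal{X}_E\ (E\in\mathcal{E}^\Omega),\ \phi=\phi_0+\sum_{E\in\mathcal{E}^\Omega}\phi_E\Big\}.$$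
   Context: Domain: $n\ge 2$ and $\Omega\subset\mathbb{R}^n$ is a bounded connected polyhedral domain with Lipschitz boundary $\Gamma$. $(\cdot,\cdot)$ and $\|\cdot\|$ are the $L^2(\Omega)$ scalar product and norm; $\widetilde H^{-1}(\Omega)=(H^1(\Omega))^*$ with duality extending $(\cdot,\cdot)$ and norm $\|\phi\|_{-1,\sim}:=\sup_{0\ne v\in H^1(\Omega)}\frac{(\phi,v)}{\|v\|_1}$, where $\|v\|_1^2=\|v\|^2+\|\nabla v\|^2$. Mesh: $\mathcal{T}$ is a regular (finite, conforming, i.e. without hanging nodes) mesh of open, pairwise disjoint $n$-simplices with $\overline\Omega=\bigcup_{T\in\mathcal{T}}\overline T$. It is shape regular with constant $\gamma$: $\max_{T\in\mathcal{T}}\mathrm{diam}(T)^n/|T|\le\gamma<\infty$, where $|T|$ is the volume of $T$. $\mathcal{E}^\Omega$ is the set of interior facets, i.e. the facets (relatively open $(n-1)$-dimensional boundary simplices) of elements of $\mathcal{T}$ not contained in $\Gamma$; $|E|$ is the $(n-1)$-dimensional measure of $E$. $\mathcal{P}^0(\mathcal{T})$ is the space of $\mathcal{T}$-piecewise constant functions. Raviart--Thomas functions: each $E\in\mathcal{E}^\Omega$ is shared by exactly two elements $T^+,T^-$ (with a fixed labelling), $\overline{T^+}\cap\overline{T^-}=\overline E$; $\boldsymbol p_E^\pm$ is the vertex of $T^\pm$ opposite to $E$. Define $\boldsymbol\psi_E(\boldsymbol x):=\pm\frac{|E|}{n|T^\pm|}(\boldsymbol x-\boldsymbol p_E^\pm)$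 for $\boldsymbol x\in T^\pm$, and $\boldsymbol\psi_E:=0$ elsewhere. Then $\mathrm{div}\,\boldsymbol\psi_E=\pm|E|/|T^\pm|$ on $T^\pm$ and $0$ elsewhere. One has $\mathcal{P}^0(\mathcal{T})=\mathcal{X}_0+\sum_{E\in\mathcal{E}^\Omega}\mathcal{X}_E$, so the infimum is over a nonempty set. *)

theory Defs
  imports "HOL-Analysis.Analysis"
begin

text \<open>Near each boundary point the domain is the strict epigraph of a Lipschitz function of the
  coordinates orthogonal to a unit vector \<open>e\<close>; \<open>x - (x \<bullet> e) *\<^sub>R e\<close> is the projection of \<open>x\<close> onto the
  hyperplane orthogonal to \<open>e\<close>.\<close>

definition lipschitz_boundary :: "(real^'n) set \<Rightarrow> bool" where
  "lipschitz_boundary \<Omega> \<longleftrightarrow>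
     (\<forall>z\<in>frontier \<Omega>. \<exists>U e g L. open U \<and> z \<in> U \<and> norm e = 1 \<and>
        L-lipschitz_on {y. y \<bullet> e = 0} g \<and>
        \<Omega> \<inter> U = {x \<in> U. (g (x - (x \<bullet> e) *\<^sub>R e) :: real) < x \<bullet> e})"

definition polyhedral_lipschitz_domain :: "(real^'n) set \<Rightarrow> bool" where
  "polyhedral_lipschitz_domain \<Omega> \<longleftrightarrow>
     open \<Omega> \<and> connected \<Omega> \<and> bounded \<Omega> \<and> \<Omega> \<noteq> {} \<and>
     (\<exists>P. finite P \<and> (\<forall>K\<in>P. polytope K) \<and> closure \<Omega> = \<Union>P) \<and>
     lipschitz_boundary \<Omega>"

definition L2 :: "(real^'n) set \<Rightarrow> (real^'n \<Rightarrow> 'b::euclidean_space) set" where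
  "L2 \<Omega> = {f. f \<in> borel_measurable (lebesgue_on \<Omega>) \<and>
               integrable (lebesgue_on \<Omega>) (\<lambda>x. (norm (f x))\<^sup>2)}"

definition L2_inner :: "(real^'n) set \<Rightarrow> (real^'n \<Rightarrow> real) \<Rightarrow> (real^'n \<Rightarrow> real) \<Rightarrow> real" where
  "L2_inner \<Omega> f g = integral\<^sup>L (lebesgue_on \<Omega>) (\<lambda>x. f x * g x)"

definition L2_norm :: "(real^'n) set \<Rightarrow> (real^'n \<Rightarrow> 'b::euclidean_space) \<Rightarrow> real" where
  "L2_norm \<Omega> f = sqrt (integral\<^sup>L (lebesgue_on \<Omega>) (\<lambda>x. (norm (f x))\<^sup>2))"

primrec cont_diff :: "nat \<Rightarrow> (real^'n \<Rightarrow> real) \<Rightarrow> bool" where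
  "cont_diff 0 f = continuous_on UNIV f"
| "cont_diff (Suc k) f = (\<exists>G. (\<forall>x. GDERIV f x :> G x) \<and> (\<forall>i. cont_diff k (\<lambda>x. G x $ i)))"

definition test_function :: "(real^'n) set \<Rightarrow> (real^'n \<Rightarrow> real) \<Rightarrow> bool" where
  "test_function \<Omega> \<eta> \<longleftrightarrow>
     (\<forall>k. cont_diff k \<eta>) \<and> compact (closure {x. \<eta> x \<noteq> 0}) \<and> closure {x. \<eta> x \<noteq> 0} \<subseteq> \<Omega>"

definition gradient :: "(real^'n \<Rightarrow> real) \<Rightarrow> real^'n \<Rightarrow> real^'n" where
  "gradient f x = (THE D. GDERIV f x :> D)"

definition has_weak_gradient ::
    "(real^'n) set \<Rightarrow> (real^'n \<Rightarrow> real) \<Rightarrow> (real^'n \<Rightarrow> real^'n) \<Rightarrow> bool" where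
  "has_weak_gradient \<Omega> v g \<longleftrightarrow>
     (\<forall>\<eta>. test_function \<Omega> \<eta> \<longrightarrow>
        integral\<^sup>L (lebesgue_on \<Omega>) (\<lambda>x. v x *\<^sub>R gradient \<eta> x) =
        - integral\<^sup>L (lebesgue_on \<Omega>) (\<lambda>x. \<eta> x *\<^sub>R g x))"

definition H1 :: "(real^'n) set \<Rightarrow> (real^'n \<Rightarrow> real) set" where
  "H1 \<Omega> = {v \<in> L2 \<Omega>. \<exists>g\<in>L2 \<Omega>. has_weak_gradient \<Omega> v g}"

text \<open>The weak gradient is unique up to null sets, so the choice does not affect norms.\<close>

definition weak_gradient :: "(real^'n) set \<Rightarrow> (real^'n \<Rightarrow> real) \<Rightarrow> real^'n \<Rightarrow> real^'n" where
  "weak_gradient \<Omega> v = (SOME g. g \<in> L2 \<Omega> \<and> has_weak_gradient \<Omega> v g)"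

definition H1_norm :: "(real^'n) set \<Rightarrow> (real^'n \<Rightarrow> real) \<Rightarrow> real" where
  "H1_norm \<Omega> v = sqrt ((L2_norm \<Omega> v)\<^sup>2 + (L2_norm \<Omega> (weak_gradient \<Omega> v))\<^sup>2)"

text \<open>The norm of \<open>(H\<^sup>1(\<Omega>))\<^sup>*\<close> on square integrable functions \<open>\<phi>\<close>, for which the duality is
  the \<open>L\<^sup>2\<close> scalar product and the supremum is over a bounded set. Elements of \<open>H1\<close> are functions
  rather than classes, so nonzero means not almost everywhere zero.\<close>

definition dual_norm :: "(real^'n) set \<Rightarrow> (real^'n \<Rightarrow> real) \<Rightarrow> real" where
  "dual_norm \<Omega> \<phi> =
     (SUP v\<in>{v \<in> H1 \<Omega>. \<not> (AE x in lebesgue_on \<Omega>. v x = 0)}. L2_inner \<Omega> \<phi> v / H1_norm \<Omega> v)"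

definition open_simplex :: "(real^'n) set \<Rightarrow> bool" where
  "open_simplex T \<longleftrightarrow> (\<exists>S. int CARD('n) simplex S \<and> T = interior S)"

text \<open>\<^const>\<open>triangulation\<close> expresses conformity: closed elements meet in a common face.\<close>

definition regular_mesh :: "(real^'n) set \<Rightarrow> (real^'n) set set \<Rightarrow> bool" where
  "regular_mesh \<Omega> \<T> \<longleftrightarrow>
     finite \<T> \<and> (\<forall>T\<in>\<T>. open_simplex T) \<and> pairwise disjnt \<T> \<and>
     closure \<Omega> = (\<Union>T\<in>\<T>. closure T) \<and> triangulation (closure ` \<T>)"

definition shape_regular :: "real \<Rightarrow> (real^'n) set set \<Rightarrow> bool" where
  "shape_regular \<gamma> \<T> \<longleftrightarrow> (\<forall>T\<in>\<T>. diameter T ^ CARD('n) / measure lebesgue T \<le> \<gamma>)"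

definition interior_facets :: "(real^'n) set \<Rightarrow> (real^'n) set set \<Rightarrow> (real^'n) set set" where
  "interior_facets \<Omega> \<T> =
     {E. \<exists>T\<in>\<T>. \<exists>F. F facet_of closure T \<and> E = rel_interior F \<and> \<not> E \<subseteq> frontier \<Omega>}"

definition P0 :: "(real^'n) set set \<Rightarrow> (real^'n \<Rightarrow> real) set" where
  "P0 \<T> = {\<phi>. \<forall>T\<in>\<T>. \<phi> constant_on T}"

definition facet_labelling ::
    "(real^'n) set \<Rightarrow> (real^'n) set set \<Rightarrow> ((real^'n) set \<Rightarrow> (real^'n) set) \<Rightarrow>
     ((real^'n) set \<Rightarrow> (real^'n) set) \<Rightarrow> bool" where
  "facet_labelling \<Omega> \<T> Tp Tm \<longleftrightarrow>
     (\<forall>E\<in>interior_facets \<Omega> \<T>. Tp E \<in> \<T> \<and> Tm E \<in> \<T> \<and> Tp E \<noteq> Tm E \<and>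
        closure (Tp E) \<inter> closure (Tm E) = closure E)"

text \<open>The Lebesgue measure of a set \<open>E\<close> within its affine hull, of dimension \<^term>\<open>aff_dim E\<close>:
  the Lebesgue measure of the coordinates of \<open>E\<close> with respect to an origin in \<open>E\<close> and an orthonormal
  basis \<open>B\<close> of the direction space of the hull. It does not depend on these choices.\<close>

definition flat_measure :: "(real^'n) set \<Rightarrow> real" where
  "flat_measure E =
     (let a = (SOME a. a \<in> E);
          V = span {x - y | x y. x \<in> E \<and> y \<in> E};
          B = (SOME B. pairwise orthogonal B \<and> (\<forall>b\<in>B. norm b = 1) \<and> span B = V);
          M = Pi\<^sub>M B (\<lambda>_. lborel :: real measure)
      in measure M {c \<in> space M. a + (\<Sum>b\<in>B. c b *\<^sub>R b) \<in> E})"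

definition opposite_vertex :: "(real^'n) set \<Rightarrow> (real^'n) set \<Rightarrow> real^'n" where
  "opposite_vertex T E = (THE p. p extreme_point_of closure T \<and> p \<notin> closure E)"

text \<open>In the following \<open>Tp\<close> and \<open>Tm\<close> are the two elements sharing the facet \<open>E\<close>.\<close>

definition rt_function ::
    "(real^'n) set \<Rightarrow> (real^'n) set \<Rightarrow> (real^'n) set \<Rightarrow> real^'n \<Rightarrow> real^'n" where
  "rt_function Tp Tm E x =
     (if x \<in> Tp then (flat_measure E / (CARD('n) * measure lebesgue Tp)) *\<^sub>R
                       (x - opposite_vertex Tp E)
      else if x \<in> Tm then - (flat_measure E / (CARD('n) * measure lebesgue Tm)) *\<^sub>R
                       (x - opposite_vertex Tm E)
      else 0)"

text \<open>The pointwise divergence, the trace of the derivative, with value 0 at points where the field is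
  not differentiable. For \<^const>\<open>rt_function\<close> these points lie in the boundaries of the two elements;
  since the normal component of the field is continuous across \<open>E\<close> and vanishes on the
  other facets, the pointwise divergence also represents the distributional one.\<close>

definition divergence :: "(real^'n \<Rightarrow> real^'n) \<Rightarrow> real^'n \<Rightarrow> real" where
  "divergence F x =
     (if F differentiable (at x)
      then (\<Sum>i\<in>UNIV. frechet_derivative F (at x) (axis i 1) $ i) else 0)"

lemma divergence_affine:
  fixes F :: "real^'n \<Rightarrow> real^'n" and c :: real
  assumes "open T" "x \<in> T" "\<And>y. y \<in> T \<Longrightarrow> F y = c *\<^sub>R (y - p)"
  shows "divergence F x = CARD('n) * c"
proof -
  have "((\<lambda>y. c *\<^sub>R (y - p)) has_derivative (\<lambda>h. c *\<^sub>R h)) (at x)"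
    by (auto intro!: derivative_eq_intros)
  then have d: "(F has_derivative (\<lambda>h. c *\<^sub>R h)) (at x)"
    by (rule has_derivative_transform_within_open[OF _ assms(1,2)]) (simp add: assms(3))
  then have "frechet_derivative F (at x) = (\<lambda>h. c *\<^sub>R h)"
    using frechet_derivative_at by metis
  moreover have "F differentiable (at x)"
    using d by (auto simp: differentiable_def)
  ultimately show ?thesis
    by (simp add: divergence_def axis_def)
qed

lemma divergence_rt_plus:
  fixes Tp Tm E :: "(real^'n) set"
  assumes "open Tp" "x \<in> Tp"
  shows "divergence (rt_function Tp Tm E) x = flat_measure E / measure lebesgue Tp"
  by (subst divergence_affine[OF assms, where p = "opposite_vertex Tp E" and
        c = "flat_measure E / (CARD('n) * measure lebesgue Tp)"]) (auto simp: rt_function_def)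

lemma divergence_rt_minus:
  fixes Tp Tm E :: "(real^'n) set"
  assumes "open Tm" "x \<in> Tm" "disjnt Tp Tm"
  shows "divergence (rt_function Tp Tm E) x = - (flat_measure E / measure lebesgue Tm)"
proof -
  have "rt_function Tp Tm E y = (- (flat_measure E / (CARD('n) * measure lebesgue Tm))) *\<^sub>R
          (y - opposite_vertex Tm E)" if "y \<in> Tm" for y
    using that assms(3) by (auto simp: rt_function_def disjnt_def)
  from divergence_affine[OF assms(1,2) this] show ?thesis
    by simp
qed

definition X0 :: "(real^'n \<Rightarrow> real) set" where
  "X0 = {\<lambda>x. c * 1 | c. True}"

definition XE :: "(real^'n) set \<Rightarrow> (real^'n) set \<Rightarrow> (real^'n) set \<Rightarrow> (real^'n \<Rightarrow> real) set" where
  "XE Tp Tm E = {\<lambda>x. c * divergence (rt_function Tp Tm E) x | c. True}"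

text \<open>Decompositions are equalities of elements of \<open>L\<^sup>2(\<Omega>)\<close>, hence almost everywhere.\<close>

definition Y_norm ::
    "(real^'n) set \<Rightarrow> (real^'n) set set \<Rightarrow> ((real^'n) set \<Rightarrow> (real^'n) set) \<Rightarrow>
     ((real^'n) set \<Rightarrow> (real^'n) set) \<Rightarrow> (real^'n \<Rightarrow> real) \<Rightarrow> real" where
  "Y_norm \<Omega> \<T> Tp Tm \<phi> = sqrt (Inf
     {(dual_norm \<Omega> \<phi>0)\<^sup>2 + (\<Sum>E\<in>interior_facets \<Omega> \<T>. (dual_norm \<Omega> (\<phi>E E))\<^sup>2) | \<phi>0 \<phi>E.
        \<phi>0 \<in> X0 \<and> (\<forall>E\<in>interior_facets \<Omega> \<T>. \<phi>E E \<in> XE (Tp E) (Tm E) E) \<and>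
        (AE x in lebesgue_on \<Omega>. \<phi> x = \<phi>0 x + (\<Sum>E\<in>interior_facets \<Omega> \<T>. \<phi>E E x))})"

end

theory Submission
  imports Defs
begin

text \<open>Testing \<open>div \<psi>\<^sub>E\<close> with \<open>v\<close> gives \<open>\<bar>E\<bar>\<close> times the jump of the element averages of \<open>v\<close> across \<open>E\<close>. Its
  square is at most a multiple of \<open>h\<^sup>2\<^sup>-\<^sup>n\<close> times the energy of \<open>v\<close> on the two elements, where \<open>h\<close> is the
  local mesh size, and a bubble function on one of the elements shows that this order is attained.
  Hence the norm of a multiple \<open>c div \<psi>\<^sub>E\<close> is equivalent to the weighted coefficient
  \<open>\<bar>c\<bar> \<bar>E\<bar> h\<^sup>(\<^sup>2\<^sup>-\<^sup>n\<^sup>)\<^sup>/\<^sup>2\<close>, and the Cauchy-Schwarz inequality over the facets bounds the dual norm by any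
  decomposition. For a stable decomposition, let the coefficients be the weighted jumps of the
  solution \<open>u\<close> of the graph Laplace equation on the mesh whose right-hand side is \<open>\<phi>\<close> minus its mean,
  and test \<open>\<phi>\<close> with a function in \<open>H\<^sup>1\<close> having the element averages \<open>u\<close> and the jump energy of \<open>u\<close> as
  energy. Such a function is built from nodal values of \<open>u\<close> and element bubbles. The Poincare
  inequality bounds its full norm.

  The estimates of averages do not use density of smooth functions: the average over a convex set is
  transported along dilations, using only the definition of the weak gradient.\<close>

subsection \<open>Test functions\<close>

text \<open>The constant must not depend on the mesh, and this shapes the tools. Comparing averages
  on two adjacent elements needs a convex set, but their union is in general not convex; a ball
  about the barycentre of the common facet bridges them. Its radius relative to the element size is
  controlled by \<open>\<gamma>\<close>, since a thin element would have too little volume. Nodal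
  values are compared along chains of facets through one vertex. Such chains exist because a
  Lipschitz domain is locally connected near every boundary point and faces of codimension two do
  not disconnect; their length is bounded by packing the elements at the vertex into a small ball.
  The measure of a facet cancels, as it only rescales a coefficient. A Poincare inequality cannot be
  obtained in this way uniformly in the mesh, because chains through the whole domain are
  arbitrarily long; its constant is therefore treated as a quantity of \<Omega>, needed only for
  functions continuous up to the boundary.\<close>

lemma cont_diff_mono: "cont_diff (Suc k) f \<Longrightarrow> cont_diff k f"
proof (induction k arbitrary: f)
  case 0
  then obtain G where "\<forall>x. GDERIV f x :> G x" by auto
  then have "isCont f x" for x
    using has_derivative_continuous unfolding gderiv_def by blast
  then show ?case by (simp add: continuous_on_eq_continuous_at)
next
  case (Suc k)
  then show ?case by (auto simp only: cont_diff.simps)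
qed

lemma cont_diff_zero [simp]: "cont_diff k (\<lambda>x. 0)"
  by (induction k) (auto intro!: exI[of _ "\<lambda>x. 0"] GDERIV_const)

lemma cont_diff_const [simp]: "cont_diff k (\<lambda>x. c)"
  by (cases k) (auto intro!: exI[of _ "\<lambda>x. 0"] GDERIV_const)

lemma cont_diff_add: "cont_diff k f \<Longrightarrow> cont_diff k g \<Longrightarrow> cont_diff k (\<lambda>x. f x + g x)"
proof (induction k arbitrary: f g)
  case 0 then show ?case by (auto intro: continuous_on_add)
next
  case (Suc k)
  then obtain F G where "\<forall>x. GDERIV f x :> F x" "\<forall>i. cont_diff k (\<lambda>x. F x $ i)"
    "\<forall>x. GDERIV g x :> G x" "\<forall>i. cont_diff k (\<lambda>x. G x $ i)" by auto
  then show ?case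
    by (auto intro!: exI[of _ "\<lambda>x. F x + G x"] GDERIV_add Suc.IH)
qed

lemma cont_diff_mult: "cont_diff k f \<Longrightarrow> cont_diff k g \<Longrightarrow> cont_diff k (\<lambda>x. f x * g x)"
proof (induction k arbitrary: f g)
  case 0 then show ?case by (auto intro: continuous_on_mult)
next
  case (Suc k)
  then obtain F G where FG: "\<forall>x. GDERIV f x :> F x" "\<forall>i. cont_diff k (\<lambda>x. F x $ i)"
    "\<forall>x. GDERIV g x :> G x" "\<forall>i. cont_diff k (\<lambda>x. G x $ i)" by auto
  have "cont_diff k f" "cont_diff k g" using Suc.prems cont_diff_mono by blast+
  then show ?case using FG
    by (auto intro!: exI[of _ "\<lambda>x. f x *\<^sub>R G x + g x *\<^sub>R F x"] GDERIV_mult Suc.IH cont_diff_add)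
qed

lemma cont_diff_coord [simp]: "cont_diff k (\<lambda>x::real^'n. x $ i)"
proof (cases k)
  case 0 then show ?thesis by (auto intro: continuous_intros)
next
  case (Suc m)
  have "GDERIV (\<lambda>x::real^'n. x $ i) x :> axis i 1" for x
    unfolding gderiv_def by (simp add: inner_axis bounded_linear_vec_nth bounded_linear_imp_has_derivative)
  then show ?thesis using Suc by (auto intro!: exI[of _ "\<lambda>x. axis i 1"])
qed

lemma cont_diff_sum: "(\<And>a. a \<in> S \<Longrightarrow> cont_diff k (f a)) \<Longrightarrow> cont_diff k (\<lambda>x. \<Sum>a\<in>S. f a x)"
  by (induction S rule: infinite_finite_induct) (auto intro!: cont_diff_add)

lemma cont_diff_prod: "(\<And>a. a \<in> S \<Longrightarrow> cont_diff k (f a)) \<Longrightarrow> cont_diff k (\<lambda>x. \<Prod>a\<in>S. f a x)"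
  by (induction S rule: infinite_finite_induct) (auto intro!: cont_diff_mult)

lemma GDERIV_compose_affine:
  assumes "GDERIV f (a + s *\<^sub>R x) :> D"
  shows "GDERIV (\<lambda>x. f (a + s *\<^sub>R x)) x :> s *\<^sub>R D"
proof -
  have "((\<lambda>x. a + s *\<^sub>R x) has_derivative (\<lambda>h. s *\<^sub>R h)) (at x)"
    by (auto intro!: derivative_eq_intros)
  from has_derivative_compose[OF this] assms show ?thesis
    unfolding gderiv_def by (fastforce simp: inner_commute)
qed

lemma cont_diff_affine: "cont_diff k f \<Longrightarrow> cont_diff k (\<lambda>x. f (a + s *\<^sub>R x))"
proof (induction k arbitrary: f)
  case 0 then show ?case
    by (auto intro!: continuous_on_compose2[of UNIV f] continuous_intros)
next
  case (Suc k)
  then obtain F where "\<forall>x. GDERIV f x :> F x" "\<forall>i. cont_diff k (\<lambda>x. F x $ i)" by auto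
  then have "\<forall>x. GDERIV (\<lambda>x. f (a + s *\<^sub>R x)) x :> s *\<^sub>R F (a + s *\<^sub>R x)"
    "\<forall>i. cont_diff k (\<lambda>x. (s *\<^sub>R F (a + s *\<^sub>R x)) $ i)"
    by (simp_all add: GDERIV_compose_affine)
      (intro allI cont_diff_mult[OF cont_diff_const] Suc.IH[where f = "\<lambda>x. F x $ _"], simp)
  then show ?case
    by (subst cont_diff.simps, intro exI[of _ "\<lambda>x. s *\<^sub>R F (a + s *\<^sub>R x)"]) simp
qed

lemma gradient_eq: "GDERIV f x :> D \<Longrightarrow> gradient f x = D"
  unfolding gradient_def
proof (rule the_equality)
  fix E assume "GDERIV f x :> D" "GDERIV f x :> E"
  then have "(\<lambda>h. h \<bullet> D) = (\<lambda>h. h \<bullet> E)"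
    unfolding gderiv_def by (rule has_derivative_unique)
  then have "h \<bullet> D = h \<bullet> E" for h by metis
  then show "E = D" by (metis vector_eq_ldot)
qed

text \<open>\<open>cont_diff\<close> asserts a gradient field separately for every order. Uniqueness
  of the gradient identifies all these fields, so that \<open>gradient f\<close> itself inherits
  every order of smoothness.\<close>

lemma cont_diff_gradient:
  assumes "\<forall>k. cont_diff k f"
  shows "GDERIV f x :> gradient f x" "cont_diff k (\<lambda>x. gradient f x $ i)"
    "continuous_on UNIV f" "continuous_on UNIV (gradient f)"
proof -
  have *: "(\<forall>x. GDERIV f x :> gradient f x) \<and> (\<forall>i. cont_diff k (\<lambda>x. gradient f x $ i))" for k
  proof -
    obtain G where G: "\<forall>x. GDERIV f x :> G x" "\<forall>i. cont_diff k (\<lambda>x. G x $ i)"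
      using assms[rule_format, of "Suc k"] by auto
    then have "gradient f = G" by (auto intro: gradient_eq)
    with G show ?thesis by auto
  qed
  then show "GDERIV f x :> gradient f x" "cont_diff k (\<lambda>x. gradient f x $ i)" by auto
  show "continuous_on UNIV f" using assms[rule_format, of 0] by simp
  have "continuous_on UNIV (\<lambda>x. gradient f x $ i)" for i using *[of 0] by simp
  then show "continuous_on UNIV (gradient f)"
    by (auto simp: continuous_on_def intro: vec_tendstoI)
qed

section \<open>Smooth cutoff functions\<close>

text \<open>The extra power \<open>m\<close> makes the family closed under differentiation up to
  linear combinations; the classical flat function is the member \<open>m = 0\<close>.\<close>

definition flat_exp :: "nat \<Rightarrow> real \<Rightarrow> real" where
  "flat_exp m t = (if t > 0 then exp (- inverse t) * inverse t ^ m else 0)"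

lemma flat_exp_tendsto_0: "((\<lambda>t. exp (- inverse t) * inverse t ^ m) \<longlongrightarrow> (0::real)) (at_right 0)"
proof -
  have "((\<lambda>x::real. x ^ m / exp x) \<longlongrightarrow> 0) at_top" by (rule tendsto_power_div_exp_0)
  then have "((\<lambda>t::real. inverse t ^ m / exp (inverse t)) \<longlongrightarrow> 0) (at_right 0)"
    by (rule filterlim_compose) (rule filterlim_inverse_at_top_right)
  then show ?thesis by (simp add: exp_minus field_simps)
qed

lemma flat_exp_has_derivative:
  "(flat_exp m has_real_derivative (flat_exp (m + 2) t - m * flat_exp (m + 1) t)) (at t)"
proof -
  consider "t > 0" | "t < 0" | "t = 0" by linarith
  then show ?thesis
  proof cases
    case 1
    have "((\<lambda>t. exp (- inverse t) * inverse t ^ m) has_real_derivative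
       (flat_exp (m + 2) t - m * flat_exp (m + 1) t)) (at t)"
    proof -
      have "((\<lambda>u. exp (- u) * u ^ m) has_real_derivative
          (- exp (- u) * u ^ m + exp (- u) * (real m * u ^ (m - 1)))) (at u)" for u :: real
        by (auto intro!: derivative_eq_intros)
      from DERIV_chain2[OF this, of inverse "- (inverse t ^ 2)" t UNIV]
      have "((\<lambda>t. exp (- inverse t) * inverse t ^ m) has_real_derivative
          (- exp (- inverse t) * inverse t ^ m + exp (- inverse t) * (real m * inverse t ^ (m - 1)))
            * (- (inverse t ^ 2))) (at t)"
        using 1 DERIV_inverse[of t UNIV] by (simp add: numeral_2_eq_2)
      moreover have "(- exp (- u) * u ^ m + exp (- u) * (real m * u ^ (m - 1))) * (- (u ^ 2)) =
          exp (- u) * u ^ (m + 2) - real m * (exp (- u) * u ^ (m + 1))" for u :: real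
        by (cases m) (simp_all add: algebra_simps power2_eq_square)
      ultimately show ?thesis using 1 by (simp add: flat_exp_def)
    qed
    then show ?thesis
      by (rule DERIV_cong_ev[THEN iffD1, rotated 3])
        (use 1 eventually_at_topological in \<open>auto simp: flat_exp_def eventually_nhds intro!: exI[of _ "{0<..}"]\<close>)
  next
    case 2
    have "((\<lambda>t. 0) has_real_derivative 0) (at t)" by simp
    then have "(flat_exp m has_real_derivative 0) (at t)"
      by (rule DERIV_cong_ev[THEN iffD1, rotated 3])
        (use 2 in \<open>auto simp: flat_exp_def eventually_nhds intro!: exI[of _ "{..<0}"]\<close>)
    with 2 show ?thesis by (simp add: flat_exp_def)
  next
    case 3
    \<comment> \<open>At the junction the quotient is zero on the left and
      \<open>flat_exp (Suc m)\<close> on the right, which tends to zero because exponentials beat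
      powers.\<close>
    have "((\<lambda>h. flat_exp m h / h) \<longlongrightarrow> 0) (at 0)"
    proof (rule filterlim_split_at_real)
      show "((\<lambda>h. flat_exp m h / h) \<longlongrightarrow> 0) (at_left 0)"
        by (rule Lim_transform_eventually[of "\<lambda>_. 0"])
          (auto simp: flat_exp_def eventually_at_filter)
      show "((\<lambda>h. flat_exp m h / h) \<longlongrightarrow> 0) (at_right 0)"
        by (rule Lim_transform_eventually[OF flat_exp_tendsto_0[of "Suc m"]])
          (auto simp: flat_exp_def eventually_at_filter field_simps)
    qed
    with 3 show ?thesis by (simp add: DERIV_def flat_exp_def)
  qed
qed

text \<open>The induction runs over all \<open>m\<close> simultaneously, since each derivative
  raises \<open>m\<close>.\<close>

lemma cont_diff_flat_exp:
  assumes "\<And>k. cont_diff k q"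
  shows "cont_diff k (\<lambda>x. flat_exp m (q x))"
proof (induction k arbitrary: m)
  case 0
  have "continuous_on UNIV (flat_exp m)"
    using flat_exp_has_derivative by (meson DERIV_isCont continuous_at_imp_continuous_on)
  then show ?case using assms[of 0] by (auto intro: continuous_on_compose2)
next
  case (Suc k)
  let ?D = "\<lambda>x. flat_exp (m + 2) (q x) - m * flat_exp (m + 1) (q x)"
  have "GDERIV (\<lambda>x. flat_exp m (q x)) x :> ?D x *\<^sub>R gradient q x" for x
    by (rule GDERIV_DERIV_compose[OF cont_diff_gradient(1) flat_exp_has_derivative]) (use assms in auto)
  moreover have "cont_diff k (\<lambda>x. (?D x *\<^sub>R gradient q x) $ i)" for i
  proof -
    have "cont_diff k (\<lambda>x. (flat_exp (m + 2) (q x) + (- real m) * flat_exp (m + 1) (q x)) * (gradient q x $ i))"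
      by (intro cont_diff_mult cont_diff_add cont_diff_const Suc.IH cont_diff_gradient(2)) (use assms in auto)
    then show ?thesis by simp
  qed
  ultimately show ?case by (auto intro!: exI[of _ "\<lambda>x. ?D x *\<^sub>R gradient q x"])
qed

lemma test_function_outside: "test_function \<Omega> \<eta> \<Longrightarrow> x \<notin> \<Omega> \<Longrightarrow> \<eta> x = 0"
  unfolding test_function_def using closure_subset[of "{x. \<eta> x \<noteq> 0}"] by blast

lemma gradient_zero_on_open:
  assumes "open U" "x \<in> U" "\<And>y. y \<in> U \<Longrightarrow> f y = 0"
  shows "gradient f x = 0"
proof (rule gradient_eq)
  have "GDERIV (\<lambda>x. 0) x :> 0" by (rule GDERIV_const)
  then show "GDERIV f x :> 0" unfolding gderiv_def
    by (rule has_derivative_transform_within_open[OF _ assms(1,2)]) (simp add: assms(3))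
qed

lemma gradient_test_function_outside:
  assumes "x \<notin> closure {x. \<eta> x \<noteq> 0}"
  shows "gradient \<eta> x = 0"
  by (rule gradient_zero_on_open[of "- closure {x. \<eta> x \<noteq> 0}"])
    (use assms closure_subset[of "{x. \<eta> x \<noteq> 0}"] in auto)

lemma test_function_gradient:
  assumes "test_function \<Omega> \<eta>"
  shows "GDERIV \<eta> x :> gradient \<eta> x" "continuous_on UNIV \<eta>" "continuous_on UNIV (gradient \<eta>)"
  using assms cont_diff_gradient unfolding test_function_def by blast+

lemma test_functionI:
  assumes "\<And>k. cont_diff k \<eta>" "compact K" "\<And>x. \<eta> x \<noteq> 0 \<Longrightarrow> x \<in> K" "K \<subseteq> \<Omega>"
  shows "test_function \<Omega> \<eta>"
proof -
  have "closure {x. \<eta> x \<noteq> 0} \<subseteq> K"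
    using assms(2,3) by (intro closure_minimal) (auto simp: compact_imp_closed)
  then show ?thesis using assms unfolding test_function_def
    by (auto intro: closed_subset compact_closure[THEN iffD2] bounded_subset compact_imp_bounded
      simp: compact_eq_bounded_closed)
qed

lemma test_function_mono: "test_function A \<eta> \<Longrightarrow> A \<subseteq> B \<Longrightarrow> test_function B \<eta>"
  unfolding test_function_def by auto

lemma test_function_mult:
  assumes "test_function \<Omega> \<eta>" "\<And>k. cont_diff k p"
  shows "test_function \<Omega> (\<lambda>x. p x * \<eta> x)"
  by (rule test_functionI[of _ "closure {x. \<eta> x \<noteq> 0}"])
    (use assms closure_subset[of "{x. \<eta> x \<noteq> 0}"] in
      \<open>auto simp: test_function_def intro: cont_diff_mult\<close>)

text \<open>Since \<open>exp (- 1 / (j t))\<close> increases to 1 as \<open>j\<close> grows, these bumps approximate the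
  indicator function of a ball, and products of their complements that of a countable union.\<close>

lemma test_functions_approximate_open:
  fixes A :: "(real^'n) set"
  assumes "open A"
  obtains \<eta> :: "nat \<Rightarrow> real^'n \<Rightarrow> real"
  where "\<And>j. test_function A (\<eta> j)" "\<And>j x. 0 \<le> \<eta> j x" "\<And>j x. \<eta> j x \<le> 1"
    "\<And>x. (\<lambda>j. \<eta> j x) \<longlonglongrightarrow> indicator A x"
proof (cases "A = {}")
  case True
  then show ?thesis
    by (intro that[of "\<lambda>j x. 0"]) (auto simp: test_function_def)
next
  case False
  \<comment> \<open>The closed balls lie in \<open>A\<close> as well, so finitely many of them
    provide a compact support.\<close>
  define \<B> where "\<B> = {ball c r | c r. r > 0 \<and> cball c r \<subseteq> A}"
  have "\<Union>\<B> = A"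
  proof
    show "\<Union>\<B> \<subseteq> A" unfolding \<B>_def using ball_subset_cball by blast
    show "A \<subseteq> \<Union>\<B>"
    proof
      fix x assume "x \<in> A"
      then obtain r where "r > 0" "cball x r \<subseteq> A" using assms open_contains_cball by blast
      then show "x \<in> \<Union>\<B>" unfolding \<B>_def by (auto intro!: exI[of _ "ball x r"])
    qed
  qed
  moreover obtain \<C> where "\<C> \<subseteq> \<B>" "countable \<C>" "\<Union>\<C> = \<Union>\<B>"
    using Lindelof[of \<B>] unfolding \<B>_def by blast
  ultimately have C: "\<C> \<subseteq> \<B>" "countable \<C>" "\<Union>\<C> = A" "\<C> \<noteq> {}" using False by auto
  define f where "f = from_nat_into \<C>"
  have f: "range f = \<C>" unfolding f_def using C by (simp add: range_from_nat_into)
  have "f i \<in> \<B>" for i using f C(1) by blast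
  then have "\<forall>i. \<exists>c r. f i = ball c r \<and> r > 0 \<and> cball c r \<subseteq> A"
    unfolding \<B>_def by blast
  then obtain c r where cr: "\<And>i. f i = ball (c i) (r i)" "\<And>i. r i > 0" "\<And>i. cball (c i) (r i) \<subseteq> A"
    by metis
  have A: "A = (\<Union>i. ball (c i) (r i))" using C(3) f cr(1) by auto
  \<comment> \<open>In coordinates this is visibly a polynomial, hence smooth; it is positive
    exactly on the ball.\<close>
  define q where "q i x = (r i)\<^sup>2 - (\<Sum>k\<in>UNIV. (x $ k - c i $ k) * (x $ k - c i $ k))" for i and x :: "real^'n"
  have q: "q i x = (r i)\<^sup>2 - (dist (c i) x)\<^sup>2" for i x
    unfolding q_def dist_norm power2_norm_eq_inner inner_vec_def by (simp add: algebra_simps)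
  have qpos: "q i x > 0 \<longleftrightarrow> x \<in> ball (c i) (r i)" for i x
  proof -
    have "(dist (c i) x)\<^sup>2 < (r i)\<^sup>2 \<longleftrightarrow> dist (c i) x < r i"
      using cr(2)[of i] power_strict_mono[of "dist (c i) x" "r i" 2] power2_less_imp_less[of "dist (c i) x" "r i"]
      by auto
    then show ?thesis unfolding q by auto
  qed
  define b where "b i j x = flat_exp 0 (real (Suc j) * q i x)" for i j x
  have b01: "0 \<le> b i j x" "b i j x \<le> 1" for i j x
    unfolding b_def flat_exp_def by (auto simp del: of_nat_Suc inverse_mult_distrib)
  have b0: "x \<in> ball (c i) (r i)" if "b i j x \<noteq> 0" for i j x
    using that unfolding qpos[symmetric] b_def flat_exp_def
    by (auto split: if_splits simp: zero_less_mult_iff)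
  have bcd: "cont_diff k (b i j)" for k i j
  proof -
    have "cont_diff k (q i)" for k
    proof -
      have "cont_diff k (\<lambda>x. (r i)\<^sup>2 + (-1) * (\<Sum>k\<in>UNIV. (x $ k + - c i $ k) * (x $ k + - c i $ k)))"
        by (intro cont_diff_add cont_diff_mult cont_diff_sum cont_diff_const cont_diff_coord)
      then show ?thesis unfolding q_def by simp
    qed
    then show ?thesis unfolding b_def[abs_def]
      by (intro cont_diff_flat_exp cont_diff_mult) auto
  qed
  have blim: "(\<lambda>j. b i j x) \<longlonglongrightarrow> 1" if "x \<in> ball (c i) (r i)" for i x
  proof -
    have qp: "q i x > 0" using that qpos by simp
    have "(\<lambda>j. exp (- (inverse (real (Suc j)) * inverse (q i x)))) \<longlonglongrightarrow> exp (- (0 * inverse (q i x)))"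
      by (intro tendsto_intros LIMSEQ_inverse_real_of_nat)
    moreover have "b i j x = exp (- (inverse (real (Suc j)) * inverse (q i x)))" for j
      unfolding b_def flat_exp_def using qp by (simp add: zero_less_mult_iff del: of_nat_Suc)
    ultimately show ?thesis by simp
  qed
  \<comment> \<open>Only the first \<open>j\<close> balls enter at stage \<open>j\<close>, which
    keeps the support compact although the cover is countable.\<close>
  define \<eta> where "\<eta> j x = 1 - (\<Prod>i<j. 1 - b i j x)" for j x
  have p01: "0 \<le> (\<Prod>i\<in>S. 1 - b i j x)" "(\<Prod>i\<in>S. 1 - b i j x) \<le> 1" for S j x
    using b01 by (auto intro!: prod_nonneg prod_le_1)
  show ?thesis
  proof (rule that[of \<eta>])
    fix j x
    show "0 \<le> \<eta> j x" "\<eta> j x \<le> 1" unfolding \<eta>_def using p01 by auto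
    show "test_function A (\<eta> j)"
    proof (rule test_functionI[of _ "\<Union>i<j. cball (c i) (r i)"])
      fix k
      have "cont_diff k (\<lambda>x. 1 + (-1) * (\<Prod>i<j. 1 + (-1) * b i j x))"
        by (intro cont_diff_add cont_diff_mult cont_diff_prod cont_diff_const bcd)
      then show "cont_diff k (\<eta> j)" unfolding \<eta>_def by simp
    next
      fix x assume "\<eta> j x \<noteq> 0"
      then obtain i where "i < j" "b i j x \<noteq> 0"
        unfolding \<eta>_def by (metis (no_types, lifting) diff_0_right diff_self lessThan_iff prod.neutral)
      then show "x \<in> (\<Union>i<j. cball (c i) (r i))" using b0[of i j x] by (force intro: less_imp_le)
    next
      show "compact (\<Union>i<j. cball (c i) (r i))" by auto
      show "(\<Union>i<j. cball (c i) (r i)) \<subseteq> A" using cr(3) by auto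
    qed
  next
    fix x
    show "(\<lambda>j. \<eta> j x) \<longlonglongrightarrow> indicator A x"
    proof (cases "x \<in> A")
      case True
      then obtain i where i: "x \<in> ball (c i) (r i)" using A by auto
      have le: "b i j x \<le> \<eta> j x" if "j > i" for j
      proof -
        have "(\<Prod>i<j. 1 - b i j x) = (1 - b i j x) * (\<Prod>i\<in>{..<j}-{i}. 1 - b i j x)"
          using that by (simp add: prod.remove)
        also have "\<dots> \<le> (1 - b i j x) * 1"
          using p01 b01 by (intro mult_left_mono) auto
        finally show ?thesis unfolding \<eta>_def by simp
      qed
      have "(\<lambda>j. \<eta> j x) \<longlonglongrightarrow> 1"
        by (rule tendsto_sandwich[OF _ _ blim[OF i] tendsto_const])
          (use le p01 in \<open>auto simp: eventually_sequentially \<eta>_def intro!: exI[of _ "Suc i"]\<close>)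
      then show ?thesis using True by simp
    next
      case False
      then have "b i j x = 0" for i j using b0[of i j x] unfolding A by auto
      then show ?thesis using False unfolding \<eta>_def by simp
    qed
  qed
qed

subsection \<open>Square integrable functions\<close>

text \<open>The square integral of \<open>f + t * g\<close> is a nonnegative quadratic polynomial in
  \<open>t\<close>; its minimum gives the inequality, and a vanishing leading coefficient forces the
  linear one to vanish.\<close>

lemma
  fixes f g :: "'a \<Rightarrow> real"
  assumes [measurable]: "f \<in> borel_measurable M" "g \<in> borel_measurable M"
    and sq: "integrable M (\<lambda>x. (f x)\<^sup>2)" "integrable M (\<lambda>x. (g x)\<^sup>2)"
  shows integrable_mult_square: "integrable M (\<lambda>x. f x * g x)"
    and Cauchy_Schwarz_integral:
      "\<bar>\<integral>x. f x * g x \<partial>M\<bar> \<le> sqrt (\<integral>x. (f x)\<^sup>2 \<partial>M) * sqrt (\<integral>x. (g x)\<^sup>2 \<partial>M)"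
proof -
  have *: "\<bar>f x * g x\<bar> \<le> (f x)\<^sup>2 + (g x)\<^sup>2" for x
  proof -
    have "2 * (\<bar>f x\<bar> * \<bar>g x\<bar>) \<le> (f x)\<^sup>2 + (g x)\<^sup>2"
      using sum_squares_bound[of "\<bar>f x\<bar>" "\<bar>g x\<bar>"] by simp
    moreover have "0 \<le> \<bar>f x\<bar> * \<bar>g x\<bar>" by simp
    ultimately show ?thesis unfolding abs_mult by linarith
  qed
  show int: "integrable M (\<lambda>x. f x * g x)"
    by (rule Bochner_Integration.integrable_bound[of _ "\<lambda>x. (f x)\<^sup>2 + (g x)\<^sup>2"]) (use sq * in auto)
  define A B C where "A = (\<integral>x. (f x)\<^sup>2 \<partial>M)" and "B = (\<integral>x. f x * g x \<partial>M)" and "C = (\<integral>x. (g x)\<^sup>2 \<partial>M)"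
  have quad: "0 \<le> A + 2 * t * B + t\<^sup>2 * C" for t
  proof -
    have "0 \<le> (\<integral>x. (f x + t * g x)\<^sup>2 \<partial>M)" by simp
    also have "\<dots> = (\<integral>x. (f x)\<^sup>2 + 2 * t * (f x * g x) + t\<^sup>2 * (g x)\<^sup>2 \<partial>M)"
      by (rule Bochner_Integration.integral_cong) (auto simp: power2_eq_square algebra_simps)
    also have "\<dots> = A + 2 * t * B + t\<^sup>2 * C" unfolding A_def B_def C_def using int sq by simp
    finally show ?thesis .
  qed
  have "C \<ge> 0" unfolding C_def by simp
  have "B\<^sup>2 \<le> A * C"
  proof (cases "C = 0")
    case True
    have "B = 0"
    proof (rule ccontr)
      assume "B \<noteq> 0"
      \<comment> \<open>With \<open>C = 0\<close> this \<open>t\<close> gives the polynomial the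
        value -1.\<close>
      then show False using quad[of "- (A + 1) / (2 * B)"] True by (simp add: field_simps)
    qed
    then show ?thesis using True by simp
  next
    case False
    then have "C > 0" using \<open>C \<ge> 0\<close> by simp
    have "A + 2 * (- B / C) * B + (- B / C)\<^sup>2 * C = A - B\<^sup>2 / C"
      using False by (simp add: field_simps power2_eq_square)
    then have "B\<^sup>2 / C \<le> A" using quad[of "- B / C"] by simp
    then show ?thesis using \<open>C > 0\<close> by (simp add: field_simps)
  qed
  then have "sqrt (B\<^sup>2) \<le> sqrt (A * C)" by (rule real_sqrt_le_mono)
  then show "\<bar>\<integral>x. f x * g x \<partial>M\<bar> \<le> sqrt (\<integral>x. (f x)\<^sup>2 \<partial>M) * sqrt (\<integral>x. (g x)\<^sup>2 \<partial>M)"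
    unfolding A_def B_def C_def by (simp add: real_sqrt_mult)
qed

lemma (in finite_measure) integrable_of_square:
  fixes f :: "'a \<Rightarrow> 'b::{banach, second_countable_topology}"
  assumes [measurable]: "f \<in> borel_measurable M" and "integrable M (\<lambda>x. (norm (f x))\<^sup>2)"
  shows "integrable M f"
proof (rule Bochner_Integration.integrable_bound[of _ "\<lambda>x. 1 + (norm (f x))\<^sup>2"])
  show "AE x in M. norm (f x) \<le> norm (1 + (norm (f x))\<^sup>2)"
  proof (intro AE_I2)
    fix x
    have "2 * norm (f x) \<le> 1 + (norm (f x))\<^sup>2"
      using sum_squares_bound[of 1 "norm (f x)"] by simp
    then show "norm (f x) \<le> norm (1 + (norm (f x))\<^sup>2)"
      using norm_ge_zero[of "f x"] by (smt (verit) real_norm_def)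
  qed
qed (use assms in auto)

text \<open>Differentiation under the integral sign by dominated convergence along sequences; the
  mean value inequality bounds the difference quotients by \<open>w\<close>. A second mean value
  inequality, for the integral itself, gives the estimate.\<close>

lemma integral_parameter_bound:
  fixes f f' :: "real \<Rightarrow> 'a \<Rightarrow> real"
  assumes "a \<le> b"
    and int: "\<And>t. t \<in> {a..b} \<Longrightarrow> integrable M (f t)"
    and meas: "\<And>t. t \<in> {a..b} \<Longrightarrow> f' t \<in> borel_measurable M"
    and deriv: "\<And>t x. t \<in> {a..b} \<Longrightarrow> x \<in> space M \<Longrightarrow>
      ((\<lambda>t. f t x) has_real_derivative f' t x) (at t within {a..b})"
    and dom: "\<And>t x. t \<in> {a..b} \<Longrightarrow> x \<in> space M \<Longrightarrow> \<bar>f' t x\<bar> \<le> w x"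
    and w: "integrable M w"
    and bound: "\<And>t. t \<in> {a..b} \<Longrightarrow> \<bar>\<integral>x. f' t x \<partial>M\<bar> \<le> B"
  shows "\<bar>(\<integral>x. f b x \<partial>M) - (\<integral>x. f a x \<partial>M)\<bar> \<le> B * (b - a)"
proof -
  have "((\<lambda>t. \<integral>x. f t x \<partial>M) has_real_derivative (\<integral>x. f' t x \<partial>M)) (at t within {a..b})"
    if t: "t \<in> {a..b}" for t
    unfolding has_field_derivative_iff tendsto_at_iff_sequentially
  proof (intro allI impI)
    fix X assume X: "\<forall>i. X i \<in> {a..b} - {t}" "X \<longlonglongrightarrow> t"
    have Xi: "X i \<in> {a..b}" "X i \<noteq> t" for i using X by auto
    have "(\<lambda>i. \<integral>x. (f (X i) x - f t x) / (X i - t) \<partial>M) \<longlonglongrightarrow> (\<integral>x. f' t x \<partial>M)"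
    proof (rule integral_dominated_convergence[where w = w])
      show "f' t \<in> borel_measurable M" using meas t by simp
      show "(\<lambda>x. (f (X i) x - f t x) / (X i - t)) \<in> borel_measurable M" for i
        using int[OF t] int[OF Xi(1)[of i]] by measurable
      show "AE x in M. (\<lambda>i. (f (X i) x - f t x) / (X i - t)) \<longlonglongrightarrow> f' t x"
      proof (intro AE_I2)
        fix x assume "x \<in> space M"
        from deriv[OF t this] show "(\<lambda>i. (f (X i) x - f t x) / (X i - t)) \<longlonglongrightarrow> f' t x"
          unfolding has_field_derivative_iff tendsto_at_iff_sequentially using X by (auto simp: o_def)
      qed
      show "AE x in M. norm ((f (X i) x - f t x) / (X i - t)) \<le> w x" for i
      proof (intro AE_I2)
        fix x assume x: "x \<in> space M"
        have "norm (f (X i) x - f t x) \<le> w x * norm (X i - t)"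
          by (rule field_differentiable_bound[where S = "{a..b}" and f' = "\<lambda>t. f' t x"])
            (use x t Xi deriv dom in auto)
        then show "norm ((f (X i) x - f t x) / (X i - t)) \<le> w x"
          using Xi(2)[of i] by (simp add: field_simps)
      qed
    qed (rule w)
    moreover have "(\<integral>x. (f (X i) x - f t x) / (X i - t) \<partial>M) =
        ((\<integral>x. f (X i) x \<partial>M) - (\<integral>x. f t x \<partial>M)) / (X i - t)" for i
      using int[OF t] int[OF Xi(1)[of i]] by simp
    ultimately show "((\<lambda>s. ((\<integral>x. f s x \<partial>M) - (\<integral>x. f t x \<partial>M)) / (s - t)) \<circ> X)
        \<longlonglongrightarrow> (\<integral>x. f' t x \<partial>M)"
      unfolding o_def by (simp only:)
  qed
  then have "norm ((\<integral>x. f b x \<partial>M) - (\<integral>x. f a x \<partial>M)) \<le> B * norm (b - a)"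
    by (rule field_differentiable_bound[where S = "{a..b}", rotated]) (use assms in auto)
  then show ?thesis using \<open>a \<le> b\<close> by simp
qed

section \<open>Integrals over the domain\<close>

lemma measurable_id_lebesgue_on [measurable]: "(\<lambda>x. x) \<in> borel_measurable (lebesgue_on \<Omega>)"
  by (intro measurable_restrict_space1 measurable_completion) simp

lemma continuous_measurable_lebesgue_on:
  assumes "continuous_on UNIV f"
  shows "f \<in> borel_measurable (lebesgue_on \<Omega>)"
  by (intro measurable_restrict_space1 measurable_completion)
    (use assms borel_measurable_continuous_onI in simp)

lemma integral_lborel_affine:
  fixes f :: "'a::euclidean_space \<Rightarrow> real"
  assumes f[measurable]: "f \<in> borel_measurable borel" and "c \<noteq> 0"
  shows "(\<integral>x. f (t + c *\<^sub>R x) \<partial>lborel) = (\<integral>x. f x \<partial>lborel) / \<bar>c\<bar> ^ DIM('a)"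
proof -
  have "(\<integral>x. f x \<partial>lborel) = (\<integral>x. \<bar>c\<bar> ^ DIM('a) * f (t + c *\<^sub>R x) \<partial>lborel)"
    by (subst lborel_affine[OF assms(2), of t])
      (subst integral_density, auto simp: integral_distr)
  then show ?thesis using assms(2) by (simp add: field_simps)
qed

text \<open>Moves an integral to the whole space, where translation, reflection and scaling are
  available.\<close>

lemma integral_lebesgue_on_supported:
  fixes f :: "'a::euclidean_space \<Rightarrow> real"
  assumes f[measurable]: "f \<in> borel_measurable borel" and "\<Omega> \<in> sets lebesgue"
    and "\<And>x. x \<notin> \<Omega> \<Longrightarrow> f x = 0"
  shows "(\<integral>x. f x \<partial>lebesgue_on \<Omega>) = (\<integral>x. f x \<partial>lborel)"
proof -
  have "(\<integral>x. f x \<partial>lebesgue_on \<Omega>) = (\<integral>x. indicator \<Omega> x *\<^sub>R f x \<partial>lebesgue)"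
    using assms(2) by (intro integral_restrict_space) simp
  also have "\<dots> = (\<integral>x. f x \<partial>lebesgue)"
    by (rule Bochner_Integration.integral_cong) (use assms(3) in \<open>auto simp: indicator_def\<close>)
  also have "\<dots> = (\<integral>x. f x \<partial>lborel)" by (rule integral_completion) simp
  finally show ?thesis .
qed

lemma test_function_bounded:
  assumes "test_function \<Omega> \<eta>"
  shows "\<exists>B\<ge>0. (\<forall>x. \<bar>\<eta> x\<bar> \<le> B) \<and> (\<forall>x. norm (gradient \<eta> x) \<le> B)"
proof -
  let ?K = "closure {x. \<eta> x \<noteq> 0}"
  have K: "compact ?K" using assms unfolding test_function_def by auto
  have c: "continuous_on ?K \<eta>" "continuous_on ?K (gradient \<eta>)"
    using test_function_gradient[OF assms] continuous_on_subset by blast+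
  have "bounded (\<eta> ` ?K)" "bounded (gradient \<eta> ` ?K)"
    using K c by (auto intro!: compact_imp_bounded compact_continuous_image)
  then obtain B1 B2 where B: "\<And>x. x \<in> ?K \<Longrightarrow> \<bar>\<eta> x\<bar> \<le> B1" "\<And>x. x \<in> ?K \<Longrightarrow> norm (gradient \<eta> x) \<le> B2"
    by (auto simp: bounded_iff)
  have "\<bar>\<eta> x\<bar> \<le> \<bar>B1\<bar> + \<bar>B2\<bar>" "norm (gradient \<eta> x) \<le> \<bar>B1\<bar> + \<bar>B2\<bar>" for x
  proof -
    show "\<bar>\<eta> x\<bar> \<le> \<bar>B1\<bar> + \<bar>B2\<bar>"
      using B(1)[of x] closure_subset[of "{x. \<eta> x \<noteq> 0}"] by (cases "\<eta> x = 0") auto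
    show "norm (gradient \<eta> x) \<le> \<bar>B1\<bar> + \<bar>B2\<bar>"
      using B(2)[of x] gradient_test_function_outside[of x \<eta>] by (cases "x \<in> ?K") auto
  qed
  then show ?thesis by (intro exI[of _ "\<bar>B1\<bar> + \<bar>B2\<bar>"]) auto
qed

lemma L2_integrable:
  assumes "bounded \<Omega>" "open \<Omega>" "v \<in> L2 \<Omega>"
  shows "integrable (lebesgue_on \<Omega>) v"
proof -
  interpret finite_measure "lebesgue_on \<Omega>"
    using assms by (intro finite_measure_lebesgue_on lmeasurable_open) auto
  show ?thesis by (rule integrable_of_square) (use assms(3) in \<open>simp_all add: L2_def\<close>)
qed

lemma integrable_mult_continuous_bounded:
  fixes v :: "'a::euclidean_space \<Rightarrow> real" and \<eta> :: "'a \<Rightarrow> 'b::euclidean_space"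
  assumes v: "integrable (lebesgue_on \<Omega>) v"
    and \<eta>: "continuous_on UNIV \<eta>" "\<And>x. norm (\<eta> x) \<le> B"
  shows "integrable (lebesgue_on \<Omega>) (\<lambda>x. v x *\<^sub>R \<eta> x)"
proof (rule Bochner_Integration.integrable_bound[of _ "\<lambda>x. B * v x"])
  have [measurable]: "\<eta> \<in> borel_measurable (lebesgue_on \<Omega>)" "v \<in> borel_measurable (lebesgue_on \<Omega>)"
    using continuous_measurable_lebesgue_on[OF \<eta>(1)] v by auto
  show "(\<lambda>x. v x *\<^sub>R \<eta> x) \<in> borel_measurable (lebesgue_on \<Omega>)" by simp
  show "AE x in lebesgue_on \<Omega>. norm (v x *\<^sub>R \<eta> x) \<le> norm (B * v x)"
  proof (intro AE_I2)
    fix x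
    have "\<bar>v x\<bar> * norm (\<eta> x) \<le> \<bar>v x\<bar> * B" by (intro mult_left_mono \<eta>) auto
    moreover have "B \<ge> 0" using \<eta>(2)[of x] norm_ge_zero order_trans by blast
    ultimately show "norm (v x *\<^sub>R \<eta> x) \<le> norm (B * v x)" by (simp add: abs_mult mult.commute)
  qed
qed (use v in simp)

text \<open>Coordinates may be taken inside a vector valued integral only for integrable fields.
  Boundedness of \<eta> and of its gradient supplies this for both sides of the weak
  identity.\<close>

lemma has_weak_gradient_component:
  assumes \<Omega>: "bounded \<Omega>" "open \<Omega>" and v: "v \<in> L2 \<Omega>" "g \<in> L2 \<Omega>"
    and wg: "has_weak_gradient \<Omega> v g" and \<eta>: "test_function \<Omega> \<eta>"
  shows "(\<integral>x. v x * gradient \<eta> x $ i \<partial>lebesgue_on \<Omega>) = - (\<integral>x. \<eta> x * g x $ i \<partial>lebesgue_on \<Omega>)"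
    "integrable (lebesgue_on \<Omega>) (\<lambda>x. v x * gradient \<eta> x $ i)"
    "integrable (lebesgue_on \<Omega>) (\<lambda>x. \<eta> x * g x $ i)"
proof -
  obtain B where "B \<ge> 0" and B: "\<And>x. \<bar>\<eta> x\<bar> \<le> B" "\<And>x. norm (gradient \<eta> x) \<le> B"
    using test_function_bounded[OF \<eta>] by auto
  have i1: "integrable (lebesgue_on \<Omega>) (\<lambda>x. v x *\<^sub>R gradient \<eta> x)"
    using L2_integrable[OF \<Omega> v(1)] test_function_gradient(3)[OF \<eta>] B(2)
    by (rule integrable_mult_continuous_bounded)
  have [measurable]: "\<eta> \<in> borel_measurable (lebesgue_on \<Omega>)"
    using continuous_measurable_lebesgue_on test_function_gradient(2)[OF \<eta>] by blast
  have g: "integrable (lebesgue_on \<Omega>) g" by (rule L2_integrable[OF \<Omega> v(2)])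
  then have [measurable]: "g \<in> borel_measurable (lebesgue_on \<Omega>)" by auto
  have i2: "integrable (lebesgue_on \<Omega>) (\<lambda>x. \<eta> x *\<^sub>R g x)"
  proof (rule Bochner_Integration.integrable_bound[of _ "\<lambda>x. B *\<^sub>R g x"])
    show "AE x in lebesgue_on \<Omega>. norm (\<eta> x *\<^sub>R g x) \<le> norm (B *\<^sub>R g x)"
      using B(1) by (intro AE_I2) (auto intro!: mult_right_mono order_trans[OF _ abs_ge_self])
  qed (use g in auto)
  have "(\<integral>x. v x *\<^sub>R gradient \<eta> x \<partial>lebesgue_on \<Omega>) $ i = (\<integral>x. (v x *\<^sub>R gradient \<eta> x) $ i \<partial>lebesgue_on \<Omega>)"
    "(\<integral>x. \<eta> x *\<^sub>R g x \<partial>lebesgue_on \<Omega>) $ i = (\<integral>x. (\<eta> x *\<^sub>R g x) $ i \<partial>lebesgue_on \<Omega>)"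
    by (rule integral_bounded_linear[OF bounded_linear_vec_nth, symmetric], fact)+
  moreover have "(\<integral>x. v x *\<^sub>R gradient \<eta> x \<partial>lebesgue_on \<Omega>) = - (\<integral>x. \<eta> x *\<^sub>R g x \<partial>lebesgue_on \<Omega>)"
    using wg \<eta> unfolding has_weak_gradient_def by blast
  ultimately show "(\<integral>x. v x * gradient \<eta> x $ i \<partial>lebesgue_on \<Omega>) = - (\<integral>x. \<eta> x * g x $ i \<partial>lebesgue_on \<Omega>)"
    by simp
  show "integrable (lebesgue_on \<Omega>) (\<lambda>x. v x * gradient \<eta> x $ i)"
    using integrable_bounded_linear[OF bounded_linear_vec_nth i1, of i] by simp
  show "integrable (lebesgue_on \<Omega>) (\<lambda>x. \<eta> x * g x $ i)"
    using integrable_bounded_linear[OF bounded_linear_vec_nth i2, of i] by simp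
qed

subsection \<open>Averages of functions with a weak gradient over convex sets\<close>

text \<open>The dilations \<open>z \<mapsto> y + s (z - y)\<close> carry \<open>\<eta>\<close> towards the centre \<open>y\<close>. The derivative in \<open>s\<close> of
  the transported weight is the divergence of the field \<open>s ^ (n - 1) * \<eta> (y + s (z - y)) * (z - y)\<close>,
  which is supported in the convex set \<open>K\<close>.\<close>

lemma dilation_bound:
  fixes v :: "real^'n \<Rightarrow> real" and g :: "real^'n \<Rightarrow> real^'n"
  assumes \<Omega>: "bounded \<Omega>" "open \<Omega>" and v: "v \<in> L2 \<Omega>" and g: "g \<in> L2 \<Omega>"
    and wg: "has_weak_gradient \<Omega> v g"
    and K: "convex K" "open K" "K \<subseteq> \<Omega>" and d: "\<And>x z. x \<in> K \<Longrightarrow> z \<in> K \<Longrightarrow> norm (x - z) \<le> d"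
    and \<eta>: "test_function K \<eta>" and y: "y \<in> K"
  shows "\<bar>2 ^ CARD('n) * (\<integral>z. v z * \<eta> (2 *\<^sub>R z - y) \<partial>lebesgue_on \<Omega>) - (\<integral>z. v z * \<eta> z \<partial>lebesgue_on \<Omega>)\<bar>
    \<le> 2 ^ CARD('n) * d * sqrt (\<integral>z. indicator K z * (norm (g z))\<^sup>2 \<partial>lebesgue_on \<Omega>) * sqrt (\<integral>z. (\<eta> z)\<^sup>2 \<partial>lborel)"
proof -
  let ?M = "lebesgue_on \<Omega>" and ?n = "CARD('n)"
  define a where "a s = (1 - s) *\<^sub>R y" for s :: real
  define G where "G = sqrt (\<integral>z. indicator K z * (norm (g z))\<^sup>2 \<partial>?M)"
  define N where "N = sqrt (\<integral>z. (\<eta> z)\<^sup>2 \<partial>lborel)"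
  have d0: "d \<ge> 0" using d[OF y y] by simp
  have GN: "G \<ge> 0" "N \<ge> 0" unfolding G_def N_def by (auto intro!: Bochner_Integration.integral_nonneg)
  obtain B where B: "B \<ge> 0" "\<And>x. \<bar>\<eta> x\<bar> \<le> B" "\<And>x. norm (gradient \<eta> x) \<le> B"
    using test_function_bounded[OF \<eta>] by auto
  note \<eta>c = test_function_gradient[OF \<eta>]
  have vi: "integrable ?M v" by (rule L2_integrable[OF \<Omega> v])
  have gi: "integrable ?M g" by (rule L2_integrable[OF \<Omega> g])
  have vm[measurable]: "v \<in> borel_measurable ?M" and gm[measurable]: "g \<in> borel_measurable ?M"
    using vi gi by auto
  have lin: "continuous_on UNIV (\<lambda>z. a s + s *\<^sub>R z)" for s by (intro continuous_intros)
  \<comment> \<open>For \<open>s \<ge> 1\<close> the point \<open>z\<close> is a convex combination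
    of \<open>y\<close> and its dilated image.\<close>
  have inK: "z \<in> K" if "a s + s *\<^sub>R z \<in> K" "s \<in> {1..2}" for s :: real and z
  proof -
    have u: "0 \<le> inverse s" "inverse s \<le> 1" using that(2) by (auto simp: field_simps)
    have "(1 - inverse s) *\<^sub>R y + inverse s *\<^sub>R (a s + s *\<^sub>R z) \<in> K"
      by (rule convexD_alt[OF K(1) y that(1) u])
    also have "(1 - inverse s) *\<^sub>R y + inverse s *\<^sub>R (a s + s *\<^sub>R z) =
        ((1 - inverse s) + inverse s * (1 - s)) *\<^sub>R y + (inverse s * s) *\<^sub>R z"
      unfolding a_def by (simp only: scaleR_add_right scaleR_add_left scaleR_scaleR add.assoc)
    also have "\<dots> = z" using that(2) by (simp add: field_simps)
    finally show ?thesis .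
  qed
  have \<eta>0: "\<eta> x = 0" if "x \<notin> K" for x using test_function_outside[OF \<eta> that] .
  have g0: "gradient \<eta> x = 0" if "x \<notin> K" for x
    using gradient_test_function_outside[of x \<eta>] \<eta> that unfolding test_function_def by blast
  \<comment> \<open>The factor \<open>s ^ n\<close> normalises the weight: its total integral does
    not change with \<open>s\<close>. At \<open>s = 1\<close> it is \<eta>, at \<open>s = 2\<close>
    the weight concentrated at the midpoints; \<open>k'\<close> is its derivative in
    \<open>s\<close>.\<close>
  define k :: "real \<Rightarrow> real^'n \<Rightarrow> real" where "k s z = s ^ ?n * \<eta> (a s + s *\<^sub>R z)" for s z
  define k' :: "real \<Rightarrow> real^'n \<Rightarrow> real" where "k' s z = real ?n * s ^ (?n - 1) * \<eta> (a s + s *\<^sub>R z)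
     + s ^ ?n * (gradient \<eta> (a s + s *\<^sub>R z) \<bullet> (z - y))" for s z
  have ders: "((\<lambda>s. k s z) has_real_derivative k' s z) (at s within {1..2})" for s :: real and z
  proof -
    have "((\<lambda>s. a s + s *\<^sub>R z) has_derivative (\<lambda>h. h *\<^sub>R (z - y))) (at s within {1..2})"
      unfolding a_def by (auto intro!: derivative_eq_intros simp: algebra_simps)
    moreover have "(\<eta> has_derivative (\<lambda>h. h \<bullet> gradient \<eta> (a s + s *\<^sub>R z))) (at (a s + s *\<^sub>R z))"
      using \<eta>c(1) unfolding gderiv_def by blast
    ultimately have "((\<lambda>s. \<eta> (a s + s *\<^sub>R z)) has_derivative
        (\<lambda>h. (h *\<^sub>R (z - y)) \<bullet> gradient \<eta> (a s + s *\<^sub>R z))) (at s within {1..2})"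
      by (rule has_derivative_compose)
    then have "((\<lambda>s. \<eta> (a s + s *\<^sub>R z)) has_real_derivative
        (gradient \<eta> (a s + s *\<^sub>R z) \<bullet> (z - y))) (at s within {1..2})"
      unfolding has_field_derivative_def by (simp add: inner_commute mult.commute[of _ "_ \<bullet> _"])
    then show ?thesis unfolding k_def k'_def
      by (auto intro!: derivative_eq_intros simp: algebra_simps)
  qed
  have kc: "continuous_on UNIV (k s)" "continuous_on UNIV (k' s)" for s :: real
    unfolding k_def[abs_def] k'_def[abs_def]
    by (intro continuous_intros continuous_on_compose2[OF \<eta>c(2) lin] continuous_on_compose2[OF \<eta>c(3) lin]; simp)+
  define W where "W = real ?n * 2 ^ ?n * B + 2 ^ ?n * (B * d)"
  have kb: "\<bar>k s z\<bar> \<le> 2 ^ ?n * B" "\<bar>k' s z\<bar> \<le> W" if s: "s \<in> {1..2}" for s :: real and z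
  proof -
    have p: "\<bar>s ^ ?n\<bar> \<le> 2 ^ ?n" "\<bar>s ^ (?n - 1)\<bar> \<le> 2 ^ ?n"
    proof -
      show "\<bar>s ^ ?n\<bar> \<le> 2 ^ ?n" using s by (auto simp: power_mono)
      have "s ^ (?n - 1) \<le> s ^ ?n" using s by (intro power_increasing) auto
      moreover have "s ^ ?n \<le> 2 ^ ?n" "0 \<le> s ^ (?n - 1)" using s by (auto intro: power_mono)
      ultimately show "\<bar>s ^ (?n - 1)\<bar> \<le> 2 ^ ?n" by linarith
    qed
    show "\<bar>k s z\<bar> \<le> 2 ^ ?n * B" unfolding k_def abs_mult by (intro mult_mono p B) auto
    have "\<bar>gradient \<eta> (a s + s *\<^sub>R z) \<bullet> (z - y)\<bar> \<le> B * d"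
    proof (cases "a s + s *\<^sub>R z \<in> K")
      case True
      then have "norm (z - y) \<le> d" using inK s d y by blast
      then show ?thesis
        using Cauchy_Schwarz_ineq2[of "gradient \<eta> (a s + s *\<^sub>R z)" "z - y"] B(1,3)
          mult_mono[of "norm (gradient \<eta> (a s + s *\<^sub>R z))" B "norm (z - y)" d] by force
    next
      case False
      then show ?thesis using g0 B(1) d0 by simp
    qed
    then have "\<bar>s ^ ?n\<bar> * \<bar>gradient \<eta> (a s + s *\<^sub>R z) \<bullet> (z - y)\<bar> \<le> 2 ^ ?n * (B * d)"
      by (intro mult_mono p) auto
    moreover have "\<bar>real ?n * s ^ (?n - 1) * \<eta> (a s + s *\<^sub>R z)\<bar> \<le> real ?n * 2 ^ ?n * B"
      unfolding abs_mult by (intro mult_mono p B) (use p B in auto)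
    ultimately have "\<bar>real ?n * s ^ (?n - 1) * \<eta> (a s + s *\<^sub>R z)\<bar>
        + \<bar>s ^ ?n * (gradient \<eta> (a s + s *\<^sub>R z) \<bullet> (z - y))\<bar> \<le> W"
      unfolding W_def abs_mult[of "s ^ ?n"] by (intro add_mono)
    then show "\<bar>k' s z\<bar> \<le> W" unfolding k'_def by (rule order_trans[OF abs_triangle_ineq])
  qed
  have main: "\<bar>\<integral>z. v z * k' s z \<partial>?M\<bar> \<le> 2 ^ ?n * d * G * N" if s: "s \<in> {1..2}" for s :: real
  proof -
    define \<Phi> where "\<Phi> i z = (s ^ (?n - 1) * (z $ i + - y $ i)) * \<eta> (a s + s *\<^sub>R z)" for i and z :: "real^'n"
    have \<Phi>t: "test_function \<Omega> (\<Phi> i)" for i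
    proof (rule test_functionI)
      show "cont_diff m (\<Phi> i)" for m
        unfolding \<Phi>_def[abs_def]
        by (intro cont_diff_mult[OF cont_diff_mult[OF cont_diff_const cont_diff_add[OF cont_diff_coord cont_diff_const]]]
            cont_diff_affine[where f = \<eta>])
          (use \<eta> in \<open>simp add: test_function_def\<close>)
      let ?S = "closure {x. \<eta> x \<noteq> 0}"
      let ?h = "\<lambda>x. (1 - inverse s) *\<^sub>R y + inverse s *\<^sub>R x"
      show "compact (?h ` ?S)"
        using \<eta> unfolding test_function_def
        by (intro compact_continuous_image continuous_intros) auto
      show "?h ` ?S \<subseteq> \<Omega>"
      proof safe
        fix x assume "x \<in> ?S"
        then have "x \<in> K" using \<eta> unfolding test_function_def by auto
        moreover have "0 \<le> inverse s" "inverse s \<le> 1" using s by (auto simp: field_simps)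
        ultimately have "?h x \<in> K" using convexD_alt[OF K(1) y] by blast
        then show "?h x \<in> \<Omega>" using K by auto
      qed
      fix z assume "\<Phi> i z \<noteq> 0"
      then have "\<eta> (a s + s *\<^sub>R z) \<noteq> 0" unfolding \<Phi>_def by auto
      then have "a s + s *\<^sub>R z \<in> ?S" using closure_subset[of "{x. \<eta> x \<noteq> 0}"] by auto
      moreover have "z = ?h (a s + s *\<^sub>R z)"
      proof -
        have "?h (a s + s *\<^sub>R z) = ((1 - inverse s) + inverse s * (1 - s)) *\<^sub>R y + (inverse s * s) *\<^sub>R z"
          unfolding a_def by (simp only: scaleR_add_right scaleR_add_left scaleR_scaleR add.assoc)
        also have "\<dots> = z" using s by (simp add: field_simps)
        finally show ?thesis by simp
      qed
      ultimately show "z \<in> ?h ` ?S" by blast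
    qed
    have \<Phi>g: "gradient (\<Phi> i) z = (s ^ (?n - 1) * (z $ i + - y $ i)) *\<^sub>R (s *\<^sub>R gradient \<eta> (a s + s *\<^sub>R z))
        + \<eta> (a s + s *\<^sub>R z) *\<^sub>R (s ^ (?n - 1) *\<^sub>R axis i 1)" for i z
    proof (rule gradient_eq)
      have "GDERIV (\<lambda>z. s ^ (?n - 1) * (z $ i + - y $ i)) z :> s ^ (?n - 1) *\<^sub>R axis i 1"
        unfolding gderiv_def
        by (auto intro!: derivative_eq_intros bounded_linear_imp_has_derivative[OF bounded_linear_vec_nth]
          simp: inner_axis)
      from GDERIV_mult[OF this GDERIV_compose_affine[where a = "a s" and s = s and x = z, OF \<eta>c(1)]]
      show "GDERIV (\<Phi> i) z :> (s ^ (?n - 1) * (z $ i + - y $ i)) *\<^sub>R (s *\<^sub>R gradient \<eta> (a s + s *\<^sub>R z))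
        + \<eta> (a s + s *\<^sub>R z) *\<^sub>R (s ^ (?n - 1) *\<^sub>R axis i 1)"
        unfolding \<Phi>_def[abs_def] .
    qed
    have sn: "s ^ (?n - 1) * s = s ^ ?n" by (simp add: power_eq_if mult.commute)
    have div: "k' s z = (\<Sum>i\<in>UNIV. gradient (\<Phi> i) z $ i)" for z
      unfolding \<Phi>g k'_def inner_vec_def
      by (simp add: sum.distrib algebra_simps sum_distrib_left sum_subtractf sn[symmetric] flip: sum_distrib_right)
    note comp = has_weak_gradient_component[OF \<Omega> v g wg \<Phi>t]
    have "(\<integral>z. v z * k' s z \<partial>?M) = (\<integral>z. (\<Sum>i\<in>UNIV. v z * gradient (\<Phi> i) z $ i) \<partial>?M)"
      unfolding div by (simp add: sum_distrib_left)
    also have "\<dots> = (\<Sum>i\<in>UNIV. - (\<integral>x. \<Phi> i x * g x $ i \<partial>?M))"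
      using comp by (subst Bochner_Integration.integral_sum) auto
    also have "\<dots> = - (\<integral>x. (\<Sum>i\<in>UNIV. \<Phi> i x * g x $ i) \<partial>?M)"
      using comp by (subst Bochner_Integration.integral_sum) (auto simp: sum_negf)
    finally have eq: "(\<integral>z. v z * k' s z \<partial>?M) = - (\<integral>x. (\<Sum>i\<in>UNIV. \<Phi> i x * g x $ i) \<partial>?M)" .
    \<comment> \<open>A majorant of the length of the field: \<open>s ^ (n - 1)\<close> is at most
      \<open>2 ^ n\<close>, and \<open>z - y\<close> has length at most \<open>d\<close> wherever
      the transported \<eta> does not vanish.\<close>
    define e where "e z = 2 ^ ?n * d * \<bar>\<eta> (a s + s *\<^sub>R z)\<bar>" for z
    have em: "continuous_on UNIV e" unfolding e_def[abs_def]
      by (intro continuous_intros continuous_on_compose2[OF \<eta>c(2) lin]) auto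
    have [measurable]: "e \<in> borel_measurable ?M" using em by (rule continuous_measurable_lebesgue_on)
    have [measurable]: "K \<in> sets ?M" using K by (auto simp: sets_restrict_space)
    have gK: "integrable ?M (\<lambda>z. (indicator K z * norm (g z))\<^sup>2)"
    proof (rule Bochner_Integration.integrable_bound[of _ "\<lambda>z. (norm (g z))\<^sup>2"])
      show "integrable ?M (\<lambda>z. (norm (g z))\<^sup>2)" using g unfolding L2_def by auto
    qed (auto simp: indicator_def)
    have etabd: "\<bar>e x\<bar> \<le> 2 ^ ?n * d * B" for x
      unfolding e_def using B d0 by (auto simp: abs_mult intro!: mult_left_mono)
    interpret M: finite_measure ?M
      using \<Omega> by (intro finite_measure_lebesgue_on lmeasurable_open) auto
    have e2: "integrable ?M (\<lambda>z. (e z)\<^sup>2)"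
      by (rule M.integrable_const_bound[of _ "(2 ^ ?n * d * B)\<^sup>2"])
        (use etabd B d0 in \<open>auto intro!: AE_I2 simp: abs_le_square_iff[symmetric]\<close>)
    have pt: "\<bar>\<Sum>i\<in>UNIV. \<Phi> i z * g z $ i\<bar> \<le> e z * (indicator K z * norm (g z))" for z
    proof (cases "a s + s *\<^sub>R z \<in> K")
      case True
      then have zK: "z \<in> K" using inK s by blast
      have "(\<Sum>i\<in>UNIV. \<Phi> i z * g z $ i) = s ^ (?n - 1) * \<eta> (a s + s *\<^sub>R z) * ((z - y) \<bullet> g z)"
        unfolding \<Phi>_def inner_vec_def by (simp add: sum_distrib_left algebra_simps)
      also have "\<bar>\<dots>\<bar> \<le> 2 ^ ?n * \<bar>\<eta> (a s + s *\<^sub>R z)\<bar> * (d * norm (g z))"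
      proof -
        have "s ^ (?n - 1) \<le> s ^ ?n" using s by (intro power_increasing) auto
        also have "\<dots> \<le> 2 ^ ?n" using s by (auto simp: power_mono)
        finally have p: "\<bar>s ^ (?n - 1)\<bar> \<le> 2 ^ ?n" using s by auto
        have "\<bar>(z - y) \<bullet> g z\<bar> \<le> d * norm (g z)"
          using Cauchy_Schwarz_ineq2[of "z - y" "g z"] mult_right_mono[OF d[OF zK y], of "norm (g z)"]
          by simp
        then show ?thesis unfolding abs_mult by (intro mult_mono p) (use B in auto)
      qed
      finally show ?thesis using zK unfolding e_def by (simp add: algebra_simps)
    next
      case False
      then show ?thesis using \<eta>0 unfolding \<Phi>_def e_def by simp
    qed
    have "\<bar>\<integral>x. (\<Sum>i\<in>UNIV. \<Phi> i x * g x $ i) \<partial>?M\<bar> \<le> (\<integral>x. \<bar>\<Sum>i\<in>UNIV. \<Phi> i x * g x $ i\<bar> \<partial>?M)"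
      by (rule integral_abs_bound)
    also have "\<dots> \<le> (\<integral>z. e z * (indicator K z * norm (g z)) \<partial>?M)"
    proof (rule integral_mono)
      show "integrable ?M (\<lambda>z. e z * (indicator K z * norm (g z)))"
        by (rule integrable_mult_square) (use e2 gK in auto)
    qed (use comp pt in auto)
    also have "\<dots> \<le> sqrt (\<integral>z. (e z)\<^sup>2 \<partial>?M) * sqrt (\<integral>z. (indicator K z * norm (g z))\<^sup>2 \<partial>?M)"
      by (rule order_trans[OF abs_ge_self Cauchy_Schwarz_integral]) (use e2 gK in auto)
    also have "(\<lambda>z. (indicator K z * norm (g z))\<^sup>2) = (\<lambda>z. indicator K z * (norm (g z))\<^sup>2)"
      by (auto simp: indicator_def)
    also have "(\<integral>z. (e z)\<^sup>2 \<partial>?M) = (\<integral>z. (e z)\<^sup>2 \<partial>lborel)"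
    proof (rule integral_lebesgue_on_supported)
      show "(\<lambda>z. (e z)\<^sup>2) \<in> borel_measurable borel"
        by (intro borel_measurable_continuous_onI continuous_intros em)
      show "\<Omega> \<in> sets lebesgue" using \<Omega> by auto
      show "(e x)\<^sup>2 = 0" if "x \<notin> \<Omega>" for x
      proof -
        have "a s + s *\<^sub>R x \<notin> K" using inK s that K by blast
        then show ?thesis unfolding e_def using \<eta>0 by simp
      qed
    qed
    also have "\<dots> = (2 ^ ?n * d)\<^sup>2 * (\<integral>z. (\<eta> (a s + s *\<^sub>R z))\<^sup>2 \<partial>lborel)"
      unfolding e_def by (simp add: power_mult_distrib)
    also have "(\<integral>z. (\<eta> (a s + s *\<^sub>R z))\<^sup>2 \<partial>lborel) = (\<integral>z. (\<eta> z)\<^sup>2 \<partial>lborel) / \<bar>s\<bar> ^ DIM(real^'n)"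
      by (rule integral_lborel_affine)
        (use s \<eta>c(2) in \<open>auto intro!: borel_measurable_continuous_onI continuous_intros\<close>)
    also note G_def[symmetric]
    \<comment> \<open>The change of variables contributes \<open>1 / s ^ n\<close>, which is at most
      1.\<close>
    also have "sqrt ((2 ^ ?n * d)\<^sup>2 * ((\<integral>z. (\<eta> z)\<^sup>2 \<partial>lborel) / \<bar>s\<bar> ^ DIM(real^'n))) * G
       \<le> sqrt ((2 ^ ?n * d)\<^sup>2 * (\<integral>z. (\<eta> z)\<^sup>2 \<partial>lborel)) * G"
    proof -
      have "(\<integral>z. (\<eta> z)\<^sup>2 \<partial>lborel) / \<bar>s\<bar> ^ DIM(real^'n) \<le> (\<integral>z. (\<eta> z)\<^sup>2 \<partial>lborel) / 1"
        using s by (intro divide_left_mono) auto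
      then show ?thesis using GN by (intro mult_right_mono real_sqrt_le_mono mult_left_mono) auto
    qed
    finally show ?thesis unfolding eq G_def[symmetric] using d0
      by (simp add: real_sqrt_mult N_def[symmetric] mult.commute mult.left_commute)
  qed
  have "\<bar>(\<integral>z. v z * k 2 z \<partial>?M) - (\<integral>z. v z * k 1 z \<partial>?M)\<bar> \<le> (2 ^ ?n * d * G * N) * (2 - 1)"
  proof (rule integral_parameter_bound[where f = "\<lambda>s z. v z * k s z" and f' = "\<lambda>s z. v z * k' s z"
      and w = "\<lambda>z. \<bar>v z\<bar> * W"])
    fix s :: real assume s: "s \<in> {1..2}"
    have "integrable ?M (\<lambda>z. v z *\<^sub>R k s z)"
      by (rule integrable_mult_continuous_bounded[OF vi kc(1)]) (use kb(1)[OF s] in auto)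
    then show "integrable ?M (\<lambda>z. v z * k s z)" by simp
    have "k' s \<in> borel_measurable ?M" using kc(2) by (rule continuous_measurable_lebesgue_on)
    then show "(\<lambda>z. v z * k' s z) \<in> borel_measurable ?M" by simp
    fix z
    show "((\<lambda>s. v z * k s z) has_real_derivative v z * k' s z) (at s within {1..2})"
      by (intro DERIV_cmult ders)
    show "\<bar>v z * k' s z\<bar> \<le> \<bar>v z\<bar> * W" unfolding abs_mult by (intro mult_left_mono kb s) auto
  qed (use vi main in auto)
  moreover have "k 1 = \<eta>" "\<And>z. k 2 z = 2 ^ ?n * \<eta> (2 *\<^sub>R z - y)"
    unfolding k_def a_def by (auto simp: algebra_simps)
  moreover have "(\<integral>z. v z * k 2 z \<partial>?M) = 2 ^ ?n * (\<integral>z. v z * \<eta> (2 *\<^sub>R z - y) \<partial>?M)"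
    unfolding calculation(3) by (subst integral_mult_right_zero[symmetric]) (simp add: mult.left_commute)
  ultimately show ?thesis unfolding G_def N_def by simp
qed

lemma finite_measure_lebesgue_on_open:
  "bounded \<Omega> \<Longrightarrow> open \<Omega> \<Longrightarrow> finite_measure (lebesgue_on \<Omega>)"
  by (intro finite_measure_lebesgue_on lmeasurable_open) auto

lemma integrable_indicator_L2:
  assumes "g \<in> L2 \<Omega>" "K \<in> sets lebesgue"
  shows "integrable (lebesgue_on \<Omega>) (\<lambda>z. indicator K z * (norm (g z))\<^sup>2)"
proof -
  have g: "(\<lambda>z. (norm (g z))\<^sup>2) \<in> borel_measurable (lebesgue_on \<Omega>)"
    using assms unfolding L2_def by (intro borel_measurable_power borel_measurable_norm) auto
  have "(indicator K :: _ \<Rightarrow> real) \<in> borel_measurable (lebesgue_on \<Omega>)"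
    using assms(2) by (intro measurable_restrict_space1 borel_measurable_indicator)
  from borel_measurable_times[OF this g]
  have "(\<lambda>z. indicator K z * (norm (g z))\<^sup>2) \<in> borel_measurable (lebesgue_on \<Omega>)" .
  then show ?thesis
  proof (rule Bochner_Integration.integrable_bound[rotated])
    show "integrable (lebesgue_on \<Omega>) (\<lambda>z. (norm (g z))\<^sup>2)" using assms unfolding L2_def by simp
    show "AE z in lebesgue_on \<Omega>. norm (indicator K z * (norm (g z))\<^sup>2) \<le> norm ((norm (g z))\<^sup>2)"
      by (intro AE_I2) (simp add: indicator_def)
  qed
qed

text \<open>Both halves of the segment between \<open>x\<close> and \<open>y\<close> are handled by dilations, the first one
  towards \<open>y\<close> and the second one towards \<open>x\<close>; the integrals over the midpoints agree by Fubini.\<close>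

lemma weighted_average_difference:
  fixes v :: "real^'n \<Rightarrow> real" and g :: "real^'n \<Rightarrow> real^'n"
  assumes \<Omega>: "bounded \<Omega>" "open \<Omega>" and v: "v \<in> L2 \<Omega>" and g: "g \<in> L2 \<Omega>"
    and wg: "has_weak_gradient \<Omega> v g"
    and K: "convex K" "open K" "K \<subseteq> \<Omega>" and d: "\<And>x z. x \<in> K \<Longrightarrow> z \<in> K \<Longrightarrow> norm (x - z) \<le> d"
    and \<eta>: "test_function K \<eta>" and \<psi>: "test_function K \<psi>"
  shows "\<bar>(\<integral>z. v z * \<eta> z \<partial>lebesgue_on \<Omega>) * (\<integral>y. \<psi> y \<partial>lborel)
      - (\<integral>z. v z * \<psi> z \<partial>lebesgue_on \<Omega>) * (\<integral>y. \<eta> y \<partial>lborel)\<bar>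
    \<le> 2 ^ CARD('n) * d * sqrt (\<integral>z. indicator K z * (norm (g z))\<^sup>2 \<partial>lebesgue_on \<Omega>) *
      (sqrt (\<integral>z. (\<eta> z)\<^sup>2 \<partial>lborel) * (\<integral>y. \<bar>\<psi> y\<bar> \<partial>lborel)
        + sqrt (\<integral>z. (\<psi> z)\<^sup>2 \<partial>lborel) * (\<integral>y. \<bar>\<eta> y\<bar> \<partial>lborel))"
proof -
  let ?M = "lebesgue_on \<Omega>" and ?n = "CARD('n)"
  define G where "G = sqrt (\<integral>z. indicator K z * (norm (g z))\<^sup>2 \<partial>?M)"
  define E where "E \<eta> = 2 ^ ?n * d * G * sqrt (\<integral>z. (\<eta> z)\<^sup>2 \<partial>lborel)" for \<eta> :: "real^'n \<Rightarrow> real"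
  interpret M: finite_measure ?M by (rule finite_measure_lebesgue_on_open[OF \<Omega>])
  interpret MM: pair_sigma_finite ?M ?M ..
  have vi: "integrable ?M v" by (rule L2_integrable[OF \<Omega> v])
  then have [measurable]: "v \<in> borel_measurable ?M" by auto
  have \<Omega>s: "\<Omega> \<in> sets lebesgue" using \<Omega> by auto
  \<comment> \<open>The weight \<eta> after dilation towards \<open>y\<close>, averaged over all
    centres \<open>y\<close> with weight \<psi>.\<close>
  define D where "D \<eta> \<psi> = (\<integral>y. \<psi> y * (2 ^ ?n * (\<integral>z. v z * \<eta> (2 *\<^sub>R z - y) \<partial>?M)) \<partial>?M)" for \<eta> \<psi>
  have half: "\<bar>D \<eta> \<psi> - (\<integral>z. v z * \<eta> z \<partial>?M) * (\<integral>y. \<psi> y \<partial>lborel)\<bar> \<le> E \<eta> * (\<integral>y. \<bar>\<psi> y\<bar> \<partial>lborel)"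
    and swap: "D \<eta> \<psi> = 2 ^ ?n * (\<integral>z. v z * (\<integral>y. \<psi> y * \<eta> (2 *\<^sub>R z - y) \<partial>lborel) \<partial>?M)"
    if \<eta>: "test_function K \<eta>" and \<psi>: "test_function K \<psi>" for \<eta> \<psi>
  proof -
    note \<eta>c = test_function_gradient(2)[OF \<eta>] and \<psi>c = test_function_gradient(2)[OF \<psi>]
    have [measurable]: "\<eta> \<in> borel_measurable borel" "\<psi> \<in> borel_measurable borel"
      using \<eta>c \<psi>c borel_measurable_continuous_onI by blast+
    have \<psi>m[measurable]: "\<psi> \<in> borel_measurable ?M" using \<psi>c by (rule continuous_measurable_lebesgue_on)
    obtain B where B: "B \<ge> 0" "\<And>x. \<bar>\<eta> x\<bar> \<le> B" using test_function_bounded[OF \<eta>] by auto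
    obtain B' where B': "B' \<ge> 0" "\<And>x. \<bar>\<psi> x\<bar> \<le> B'" using test_function_bounded[OF \<psi>] by auto
    define f where "f = (\<lambda>(z, y). v z * (\<psi> y * \<eta> (2 *\<^sub>R z - y)))"
    have fm[measurable]: "f \<in> borel_measurable (?M \<Otimes>\<^sub>M ?M)"
    proof -
      have [measurable]: "(\<lambda>p. fst p) \<in> borel_measurable (?M \<Otimes>\<^sub>M ?M)" "(\<lambda>p. snd p) \<in> borel_measurable (?M \<Otimes>\<^sub>M ?M)"
        using measurable_compose[OF measurable_fst measurable_id_lebesgue_on]
          measurable_compose[OF measurable_snd measurable_id_lebesgue_on] by auto
      have "(\<lambda>p. v (fst p)) \<in> borel_measurable (?M \<Otimes>\<^sub>M ?M)" by measurable
      moreover have "(\<lambda>p. \<psi> (snd p) * \<eta> (2 *\<^sub>R fst p - snd p)) \<in> borel_measurable (?M \<Otimes>\<^sub>M ?M)" by measurable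
      ultimately show ?thesis unfolding f_def case_prod_beta by (rule borel_measurable_times)
    qed
    have fb: "\<bar>f (z, y)\<bar> \<le> \<bar>v z\<bar> * (B' * B)" for z y
      unfolding f_def using B B' by (auto simp: abs_mult intro!: mult_mono mult_left_mono)
    have fy: "integrable ?M (\<lambda>y. f (z, y))" if "z \<in> space ?M" for z
      by (rule M.integrable_const_bound[of _ "\<bar>v z\<bar> * (B' * B)"]) (use fb that in \<open>auto intro: AE_I2\<close>)
    have fi: "integrable (?M \<Otimes>\<^sub>M ?M) f"
    proof (rule MM.Fubini_integrable)
      show "integrable ?M (\<lambda>z. \<integral>y. norm (f (z, y)) \<partial>?M)"
      proof (rule Bochner_Integration.integrable_bound[of _ "\<lambda>z. \<bar>v z\<bar> * (B' * B) * measure ?M (space ?M)"])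
        show "AE z in ?M. norm (\<integral>y. norm (f (z, y)) \<partial>?M) \<le> norm (\<bar>v z\<bar> * (B' * B) * measure ?M (space ?M))"
        proof (intro AE_I2)
          fix z assume "z \<in> space ?M"
          then have "(\<integral>y. norm (f (z, y)) \<partial>?M) \<le> (\<integral>y. \<bar>v z\<bar> * (B' * B) \<partial>?M)"
            by (intro integral_mono integrable_norm fy) (use fb in auto)
          then show "norm (\<integral>y. norm (f (z, y)) \<partial>?M) \<le> norm (\<bar>v z\<bar> * (B' * B) * measure ?M (space ?M))"
            using B B' by (simp add: mult_ac)
        qed
      qed (use vi in auto)
    qed (use fy in \<open>auto intro: AE_I2\<close>)
    have Dyz: "D \<eta> \<psi> = 2 ^ ?n * (\<integral>y. (\<integral>z. f (z, y) \<partial>?M) \<partial>?M)"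
    proof -
      have "(\<integral>z. f (z, y) \<partial>?M) = \<psi> y * (\<integral>z. v z * \<eta> (2 *\<^sub>R z - y) \<partial>?M)" for y
        unfolding f_def by (simp add: mult.left_commute)
      then show ?thesis unfolding D_def
        by (subst integral_mult_right_zero[symmetric]) (simp add: mult.left_commute)
    qed
    have fz: "integrable ?M (\<lambda>y. (\<integral>z. f (z, y) \<partial>?M))"
      using MM.integrable_snd[of "\<lambda>z y. f (z, y)"] fi by simp
    have K0: "\<psi> y = 0" if "y \<notin> K" for y using test_function_outside[OF \<psi> that] .
    have "(\<integral>y. (\<integral>z. f (z, y) \<partial>?M) \<partial>?M) = (\<integral>z. (\<integral>y. f (z, y) \<partial>?M) \<partial>?M)"
      using MM.Fubini_integral[of "\<lambda>z y. f (z, y)"] fi by simp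
    also have "\<dots> = (\<integral>z. v z * (\<integral>y. \<psi> y * \<eta> (2 *\<^sub>R z - y) \<partial>lborel) \<partial>?M)"
    proof (rule Bochner_Integration.integral_cong[OF refl])
      fix z
      have "(\<integral>y. \<psi> y * \<eta> (2 *\<^sub>R z - y) \<partial>?M) = (\<integral>y. \<psi> y * \<eta> (2 *\<^sub>R z - y) \<partial>lborel)"
        by (rule integral_lebesgue_on_supported) (use \<Omega>s K0 K in auto)
      then show "(\<integral>y. f (z, y) \<partial>?M) = v z * (\<integral>y. \<psi> y * \<eta> (2 *\<^sub>R z - y) \<partial>lborel)"
        unfolding f_def by simp
    qed
    finally show "D \<eta> \<psi> = 2 ^ ?n * (\<integral>z. v z * (\<integral>y. \<psi> y * \<eta> (2 *\<^sub>R z - y) \<partial>lborel) \<partial>?M)"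
      unfolding Dyz by simp
    have \<psi>i: "integrable ?M \<psi>"
      by (rule M.integrable_const_bound[of _ B']) (use B' in \<open>auto intro: AE_I2\<close>)
    have \<psi>int: "(\<integral>y. \<psi> y \<partial>?M) = (\<integral>y. \<psi> y \<partial>lborel)" "(\<integral>y. \<bar>\<psi> y\<bar> \<partial>?M) = (\<integral>y. \<bar>\<psi> y\<bar> \<partial>lborel)"
      by (rule integral_lebesgue_on_supported; use \<Omega>s K0 K in auto)+
    have "D \<eta> \<psi> - (\<integral>z. v z * \<eta> z \<partial>?M) * (\<integral>y. \<psi> y \<partial>lborel)
       = (\<integral>y. 2 ^ ?n * (\<integral>z. f (z, y) \<partial>?M) - (\<integral>z. v z * \<eta> z \<partial>?M) * \<psi> y \<partial>?M)"
      unfolding Dyz \<psi>int(1)[symmetric] using fz \<psi>i by simp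
    also have "\<bar>\<dots>\<bar> \<le> (\<integral>y. \<bar>2 ^ ?n * (\<integral>z. f (z, y) \<partial>?M) - (\<integral>z. v z * \<eta> z \<partial>?M) * \<psi> y\<bar> \<partial>?M)"
      by (rule integral_abs_bound)
    also have "\<dots> \<le> (\<integral>y. E \<eta> * \<bar>\<psi> y\<bar> \<partial>?M)"
    proof (rule integral_mono)
      fix y
      show "\<bar>2 ^ ?n * (\<integral>z. f (z, y) \<partial>?M) - (\<integral>z. v z * \<eta> z \<partial>?M) * \<psi> y\<bar> \<le> E \<eta> * \<bar>\<psi> y\<bar>"
      proof (cases "y \<in> K")
        case True
        have "2 ^ ?n * (\<integral>z. f (z, y) \<partial>?M) - (\<integral>z. v z * \<eta> z \<partial>?M) * \<psi> y
          = (2 ^ ?n * (\<integral>z. v z * \<eta> (2 *\<^sub>R z - y) \<partial>?M) - (\<integral>z. v z * \<eta> z \<partial>?M)) * \<psi> y"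
          unfolding f_def by (simp add: algebra_simps)
        also have "\<bar>\<dots>\<bar> \<le> E \<eta> * \<bar>\<psi> y\<bar>"
          unfolding abs_mult E_def G_def
          by (intro mult_right_mono dilation_bound[OF \<Omega> v g wg K d \<eta> True]) auto
        finally show ?thesis .
      next
        case False
        then show ?thesis using K0 unfolding f_def by simp
      qed
    qed (use fz \<psi>i in auto)
    finally show "\<bar>D \<eta> \<psi> - (\<integral>z. v z * \<eta> z \<partial>?M) * (\<integral>y. \<psi> y \<partial>lborel)\<bar> \<le> E \<eta> * (\<integral>y. \<bar>\<psi> y\<bar> \<partial>lborel)"
      using \<psi>int(2) by simp
  qed
  \<comment> \<open>The point reflection of \<open>y\<close> through \<open>z\<close> exchanges the
    two weights, whence \<open>D\<close> is symmetric.\<close>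
  have "(\<integral>y. \<psi> y * \<eta> (2 *\<^sub>R z - y) \<partial>lborel) = (\<integral>y. \<eta> y * \<psi> (2 *\<^sub>R z - y) \<partial>lborel)" for z
  proof -
    have [measurable]: "\<eta> \<in> borel_measurable borel" "\<psi> \<in> borel_measurable borel"
      using test_function_gradient(2)[OF \<eta>] test_function_gradient(2)[OF \<psi>] borel_measurable_continuous_onI by blast+
    have "(\<integral>y. \<psi> (2 *\<^sub>R z + (-1) *\<^sub>R y) * \<eta> (2 *\<^sub>R z - (2 *\<^sub>R z + (-1) *\<^sub>R y)) \<partial>lborel)
        = (\<integral>y. \<psi> y * \<eta> (2 *\<^sub>R z - y) \<partial>lborel) / \<bar>-1\<bar> ^ DIM(real^'n)"
      by (rule integral_lborel_affine) auto
    then show ?thesis by (simp add: mult.commute)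
  qed
  then have "D \<eta> \<psi> = D \<psi> \<eta>" unfolding swap[OF \<eta> \<psi>] swap[OF \<psi> \<eta>] by simp
  then have "\<bar>(\<integral>z. v z * \<eta> z \<partial>?M) * (\<integral>y. \<psi> y \<partial>lborel) - (\<integral>z. v z * \<psi> z \<partial>?M) * (\<integral>y. \<eta> y \<partial>lborel)\<bar>
    \<le> E \<eta> * (\<integral>y. \<bar>\<psi> y\<bar> \<partial>lborel) + E \<psi> * (\<integral>y. \<bar>\<eta> y\<bar> \<partial>lborel)"
    using half[OF \<eta> \<psi>] half[OF \<psi> \<eta>] by linarith
  then show ?thesis unfolding E_def G_def[symmetric] by (simp add: algebra_simps)
qed

text \<open>Makes the comparison available for weights that are not smooth, such as indicator
  functions. All approximants are bounded by a constant on \<open>K\<close>, a set of finite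
  measure, and vanish outside it, so dominated convergence applies to every term.\<close>

lemma weighted_average_difference_limit:
  fixes v :: "real^'n \<Rightarrow> real" and g :: "real^'n \<Rightarrow> real^'n"
  assumes \<Omega>: "bounded \<Omega>" "open \<Omega>" and v: "v \<in> L2 \<Omega>" and g: "g \<in> L2 \<Omega>"
    and wg: "has_weak_gradient \<Omega> v g"
    and K: "convex K" "open K" "K \<subseteq> \<Omega>" and d: "\<And>x z. x \<in> K \<Longrightarrow> z \<in> K \<Longrightarrow> norm (x - z) \<le> d"
    and \<eta>: "\<And>j. test_function K (\<eta> j)" "\<And>j x. \<bar>\<eta> j x\<bar> \<le> c" "\<And>x. (\<lambda>j. \<eta> j x) \<longlonglongrightarrow> e x"
    and \<psi>: "\<And>j. test_function K (\<psi> j)" "\<And>j x. \<bar>\<psi> j x\<bar> \<le> c'" "\<And>x. (\<lambda>j. \<psi> j x) \<longlonglongrightarrow> p x"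
  shows "\<bar>(\<integral>z. v z * e z \<partial>lebesgue_on \<Omega>) * (\<integral>y. p y \<partial>lborel)
      - (\<integral>z. v z * p z \<partial>lebesgue_on \<Omega>) * (\<integral>y. e y \<partial>lborel)\<bar>
    \<le> 2 ^ CARD('n) * d * sqrt (\<integral>z. indicator K z * (norm (g z))\<^sup>2 \<partial>lebesgue_on \<Omega>) *
      (sqrt (\<integral>z. (e z)\<^sup>2 \<partial>lborel) * (\<integral>y. \<bar>p y\<bar> \<partial>lborel)
        + sqrt (\<integral>z. (p z)\<^sup>2 \<partial>lborel) * (\<integral>y. \<bar>e y\<bar> \<partial>lborel))"
proof -
  let ?M = "lebesgue_on \<Omega>"
  have vi: "integrable ?M v" by (rule L2_integrable[OF \<Omega> v])
  then have [measurable]: "v \<in> borel_measurable ?M" by auto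
  have lim: "(\<lambda>j. \<integral>z. v z * \<eta> j z \<partial>?M) \<longlonglongrightarrow> (\<integral>z. v z * e z \<partial>?M)"
    "(\<lambda>j. \<integral>z. \<eta> j z \<partial>lborel) \<longlonglongrightarrow> (\<integral>z. e z \<partial>lborel)"
    "(\<lambda>j. \<integral>z. \<bar>\<eta> j z\<bar> \<partial>lborel) \<longlonglongrightarrow> (\<integral>z. \<bar>e z\<bar> \<partial>lborel)"
    "(\<lambda>j. \<integral>z. (\<eta> j z)\<^sup>2 \<partial>lborel) \<longlonglongrightarrow> (\<integral>z. (e z)\<^sup>2 \<partial>lborel)"
    if \<eta>: "\<And>j. test_function K (\<eta> j)" "\<And>j x. \<bar>\<eta> j x\<bar> \<le> c" "\<And>x. (\<lambda>j. \<eta> j x) \<longlonglongrightarrow> e x"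
    for \<eta> :: "nat \<Rightarrow> real^'n \<Rightarrow> real" and e c
  proof -
    have \<eta>c: "continuous_on UNIV (\<eta> j)" for j using test_function_gradient(2)[OF \<eta>(1)] .
    have m1[measurable]: "\<eta> j \<in> borel_measurable ?M" for j using \<eta>c by (rule continuous_measurable_lebesgue_on)
    have m2[measurable]: "\<eta> j \<in> borel_measurable lborel" for j using borel_measurable_continuous_onI[OF \<eta>c] by simp
    have e1[measurable]: "e \<in> borel_measurable ?M" using borel_measurable_LIMSEQ_real[OF \<eta>(3) m1] by simp
    have e2[measurable]: "e \<in> borel_measurable lborel" using borel_measurable_LIMSEQ_real[OF \<eta>(3) m2] by simp
    have Ks[measurable]: "K \<in> sets lborel" using K by auto
    have Kf: "emeasure lborel K < \<infinity>"
      using bounded_subset[OF \<Omega>(1) K(3)] by (rule emeasure_bounded_finite)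
    have bd: "\<bar>\<eta> j x\<bar> \<le> c * indicator K x" for j x
      using \<eta>(2)[of j x] test_function_outside[OF \<eta>(1), of x j] by (auto simp: indicator_def)
    have c0: "c \<ge> 0" using \<eta>(2)[of 0 0] by linarith
    have bd2: "(\<eta> j x)\<^sup>2 \<le> c\<^sup>2 * indicator K x" for j x
      using bd[of j x] c0 abs_le_square_iff[of "\<eta> j x" c] by (auto simp: indicator_def split: if_splits)
    show "(\<lambda>j. \<integral>z. v z * \<eta> j z \<partial>?M) \<longlonglongrightarrow> (\<integral>z. v z * e z \<partial>?M)"
    proof (rule integral_dominated_convergence[where w = "\<lambda>z. \<bar>v z\<bar> * c"])
      show "AE x in ?M. norm (v x * \<eta> j x) \<le> \<bar>v x\<bar> * c" for j
        using \<eta>(2) by (auto intro!: AE_I2 mult_left_mono simp: abs_mult)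
    qed (use vi \<eta>(3) in \<open>auto intro!: AE_I2 tendsto_mult_left\<close>)
    have K1: "integrable lborel (\<lambda>x. c * indicator K x)" for c :: real
      using Kf K by (intro integrable_mult_right integrable_real_indicator) auto
    show "(\<lambda>j. \<integral>z. \<eta> j z \<partial>lborel) \<longlonglongrightarrow> (\<integral>z. e z \<partial>lborel)"
      by (rule integral_dominated_convergence[where w = "\<lambda>x. c * indicator K x"])
        (use K1 bd \<eta>(3) in \<open>auto intro!: AE_I2\<close>)
    show "(\<lambda>j. \<integral>z. \<bar>\<eta> j z\<bar> \<partial>lborel) \<longlonglongrightarrow> (\<integral>z. \<bar>e z\<bar> \<partial>lborel)"
      by (rule integral_dominated_convergence[where w = "\<lambda>x. c * indicator K x"])
        (use K1 bd \<eta>(3) in \<open>auto intro!: AE_I2 tendsto_rabs\<close>)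
    show "(\<lambda>j. \<integral>z. (\<eta> j z)\<^sup>2 \<partial>lborel) \<longlonglongrightarrow> (\<integral>z. (e z)\<^sup>2 \<partial>lborel)"
      by (rule integral_dominated_convergence[where w = "\<lambda>x. c\<^sup>2 * indicator K x"])
        (use K1 bd2 \<eta>(3) in \<open>auto intro!: AE_I2 tendsto_power\<close>)
  qed
  note l1 = lim[OF \<eta>] and l2 = lim[OF \<psi>]
  show ?thesis
    by (rule LIMSEQ_le[OF _ _ exI[of _ 0]])
      (rule tendsto_rabs tendsto_diff tendsto_mult tendsto_add tendsto_const tendsto_real_sqrt l1 l2
        | intro allI impI weighted_average_difference[OF \<Omega> v g wg K d \<eta>(1) \<psi>(1)])+
qed

section \<open>Differences of averages and the Poincare inequality on a convex set\<close>

definition avg :: "(real^'n) set \<Rightarrow> (real^'n) set \<Rightarrow> (real^'n \<Rightarrow> real) \<Rightarrow> real" where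
  "avg \<Omega> A v = (\<integral>z. v z * indicator A z \<partial>lebesgue_on \<Omega>) / measure lebesgue A"

lemma indicator_square_abs:
  "(indicator A z)\<^sup>2 = (indicator A z :: real)" "\<bar>indicator A z\<bar> = (indicator A z :: real)"
  by (auto simp: indicator_def)

lemma integral_indicator_lborel_open:
  assumes "open A" shows "(\<integral>x. indicator A x \<partial>lborel) = measure lebesgue A"
proof -
  have "A \<in> sets borel" using assms by simp
  then show ?thesis by (simp add: measure_completion)
qed

text \<open>The weights are the indicators of \<open>A\<close> and \<open>B\<close>. Division by
  both volumes leaves the sum of their inverse square roots, and squaring this sum costs the factor
  2.\<close>

lemma avg_difference:
  fixes v :: "real^'n \<Rightarrow> real" and g :: "real^'n \<Rightarrow> real^'n"
  assumes \<Omega>: "bounded \<Omega>" "open \<Omega>" and v: "v \<in> L2 \<Omega>" and g: "g \<in> L2 \<Omega>"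
    and wg: "has_weak_gradient \<Omega> v g"
    and K: "convex K" "open K" "K \<subseteq> \<Omega>" and d: "\<And>x z. x \<in> K \<Longrightarrow> z \<in> K \<Longrightarrow> norm (x - z) \<le> d"
    and A: "open A" "A \<subseteq> K" "measure lebesgue A > 0" and B: "open B" "B \<subseteq> K" "measure lebesgue B > 0"
  shows "(avg \<Omega> A v - avg \<Omega> B v)\<^sup>2 \<le> 2 * 4 ^ CARD('n) * d\<^sup>2 *
    (1 / measure lebesgue A + 1 / measure lebesgue B) *
    (\<integral>z. indicator K z * (norm (g z))\<^sup>2 \<partial>lebesgue_on \<Omega>)"
proof -
  define G where "G = (\<integral>z. indicator K z * (norm (g z))\<^sup>2 \<partial>lebesgue_on \<Omega>)"
  define a where "a = measure lebesgue A"
  define b where "b = measure lebesgue B"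
  have ab: "a > 0" "b > 0" using A B unfolding a_def b_def by auto
  have G0: "G \<ge> 0" unfolding G_def by (auto intro!: Bochner_Integration.integral_nonneg)
  obtain \<eta> where \<eta>: "\<And>j. test_function A (\<eta> j)" "\<And>j x. 0 \<le> \<eta> j x" "\<And>j x. \<eta> j x \<le> 1"
    "\<And>x. (\<lambda>j. \<eta> j x) \<longlonglongrightarrow> indicator A x" using test_functions_approximate_open[OF A(1)] by metis
  obtain \<psi> where \<psi>: "\<And>j. test_function B (\<psi> j)" "\<And>j x. 0 \<le> \<psi> j x" "\<And>j x. \<psi> j x \<le> 1"
    "\<And>x. (\<lambda>j. \<psi> j x) \<longlonglongrightarrow> indicator B x" using test_functions_approximate_open[OF B(1)] by metis
  have "\<bar>(\<integral>z. v z * indicator A z \<partial>lebesgue_on \<Omega>) * (\<integral>y. indicator B y \<partial>lborel)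
      - (\<integral>z. v z * indicator B z \<partial>lebesgue_on \<Omega>) * (\<integral>y. indicator A y \<partial>lborel)\<bar>
    \<le> 2 ^ CARD('n) * d * sqrt G * (sqrt (\<integral>z. (indicator A z)\<^sup>2 \<partial>lborel) * (\<integral>y. \<bar>indicator B y\<bar> \<partial>lborel)
        + sqrt (\<integral>z. (indicator B z)\<^sup>2 \<partial>lborel) * (\<integral>y. \<bar>indicator A y\<bar> \<partial>lborel))"
    unfolding G_def
    by (rule weighted_average_difference_limit[OF \<Omega> v g wg K d, where \<eta> = \<eta> and \<psi> = \<psi> and c = 1 and c' = 1])
      (use \<eta> \<psi> test_function_mono[OF _ A(2)] test_function_mono[OF _ B(2)] in auto)
  also have "\<dots> = 2 ^ CARD('n) * d * sqrt G * (sqrt a * b + sqrt b * a)"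
    using integral_indicator_lborel_open[OF A(1)] integral_indicator_lborel_open[OF B(1)]
    unfolding a_def b_def indicator_square_abs by simp
  finally have "\<bar>avg \<Omega> A v * (a * b) - avg \<Omega> B v * (a * b)\<bar> \<le> 2 ^ CARD('n) * d * sqrt G * (sqrt a * b + sqrt b * a)"
    using ab integral_indicator_lborel_open[OF A(1)] integral_indicator_lborel_open[OF B(1)]
    unfolding avg_def a_def b_def by (simp add: mult.commute)
  then have "\<bar>avg \<Omega> A v - avg \<Omega> B v\<bar> * (a * b) \<le> 2 ^ CARD('n) * d * sqrt G * (sqrt a * b + sqrt b * a)"
    using ab by (simp add: abs_mult flip: left_diff_distrib)
  then have "\<bar>avg \<Omega> A v - avg \<Omega> B v\<bar> \<le> 2 ^ CARD('n) * d * sqrt G * (sqrt a * b + sqrt b * a) / (a * b)"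
    using ab by (simp add: field_simps)
  also have "(sqrt a * b + sqrt b * a) / (a * b) = 1 / sqrt a + 1 / sqrt b"
    using ab real_sqrt_mult_self[of a] real_sqrt_mult_self[of b] by (simp add: field_simps)
  then have "2 ^ CARD('n) * d * sqrt G * (sqrt a * b + sqrt b * a) / (a * b)
    = 2 ^ CARD('n) * d * sqrt G * (1 / sqrt a + 1 / sqrt b)" by (metis times_divide_eq_right)
  finally have "\<bar>avg \<Omega> A v - avg \<Omega> B v\<bar> \<le> 2 ^ CARD('n) * d * sqrt G * (1 / sqrt a + 1 / sqrt b)" .
  then have "\<bar>avg \<Omega> A v - avg \<Omega> B v\<bar>\<^sup>2 \<le> (2 ^ CARD('n) * d * sqrt G * (1 / sqrt a + 1 / sqrt b))\<^sup>2"
    by (rule power_mono) simp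
  also have "\<dots> = 4 ^ CARD('n) * d\<^sup>2 * G * (1 / sqrt a + 1 / sqrt b)\<^sup>2"
  proof -
    have "((2::real) ^ CARD('n))\<^sup>2 = 4 ^ CARD('n)"
      by (metis power_mult_distrib power2_eq_square mult_2_right numeral_Bit0 power_commutes power_mult mult.commute num_double)
    then show ?thesis using G0 by (simp add: power_mult_distrib)
  qed
  also have "\<dots> \<le> 4 ^ CARD('n) * d\<^sup>2 * G * (2 * (1 / a + 1 / b))"
  proof (rule mult_left_mono)
    have "(p + q)\<^sup>2 \<le> 2 * (p\<^sup>2 + q\<^sup>2)" for p q :: real
      using sum_squares_bound[of p q] unfolding power2_sum by simp
    from this[of "1 / sqrt a" "1 / sqrt b"]
    show "(1 / sqrt a + 1 / sqrt b)\<^sup>2 \<le> 2 * (1 / a + 1 / b)" using ab by (simp add: power_divide)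
  qed (use G0 in auto)
  finally show ?thesis unfolding G_def a_def b_def by (simp add: algebra_simps)
qed

text \<open>One weight is the indicator of \<open>K\<close>, the other is \<open>v\<close> itself on
  \<open>K\<close>; their comparison contains the square integral of \<open>v\<close>. Continuity up
  to the boundary allows a uniform approximation of \<open>v\<close> by polynomials, which become
  test functions after multiplication by cutoffs.\<close>

lemma Poincare_convex:
  fixes v :: "real^'n \<Rightarrow> real" and g :: "real^'n \<Rightarrow> real^'n"
  assumes \<Omega>: "bounded \<Omega>" "open \<Omega>" and v: "v \<in> L2 \<Omega>" and g: "g \<in> L2 \<Omega>"
    and wg: "has_weak_gradient \<Omega> v g"
    and K: "convex K" "open K" "K \<subseteq> \<Omega>" and d: "\<And>x z. x \<in> K \<Longrightarrow> z \<in> K \<Longrightarrow> norm (x - z) \<le> d"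
    and K0: "measure lebesgue K > 0" and vc: "continuous_on (closure K) v"
  shows "(\<integral>z. indicator K z * (v z)\<^sup>2 \<partial>lebesgue_on \<Omega>) \<le> 2 * measure lebesgue K * (avg \<Omega> K v)\<^sup>2 +
    4 * 4 ^ CARD('n) * d\<^sup>2 * (\<integral>z. indicator K z * (norm (g z))\<^sup>2 \<partial>lebesgue_on \<Omega>)"
proof -
  define G where "G = (\<integral>z. indicator K z * (norm (g z))\<^sup>2 \<partial>lebesgue_on \<Omega>)"
  define S where "S = (\<integral>z. indicator K z * (v z)\<^sup>2 \<partial>lebesgue_on \<Omega>)"
  define k where "k = measure lebesgue K"
  have k: "k > 0" using K0 unfolding k_def .
  have G0: "G \<ge> 0" and S0: "S \<ge> 0"
    unfolding G_def S_def by (auto intro!: Bochner_Integration.integral_nonneg)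
  have d0: "d \<ge> 0"
  proof -
    obtain x where "x \<in> K" using K0 by fastforce
    then show ?thesis using d[of x x] by simp
  qed
  obtain \<eta> where \<eta>: "\<And>j. test_function K (\<eta> j)" "\<And>j x. 0 \<le> \<eta> j x" "\<And>j x. \<eta> j x \<le> 1"
    "\<And>x. (\<lambda>j. \<eta> j x) \<longlonglongrightarrow> indicator K x" using test_functions_approximate_open[OF K(2)] by metis
  have Kc: "compact (closure K)" using bounded_subset[OF \<Omega>(1) K(3)] by simp
  have "\<forall>j. \<exists>p. real_polynomial_function p \<and> (\<forall>x\<in>closure K. \<bar>v x - p x\<bar> < inverse (real (Suc j)))"
  proof
    fix j
    have "inverse (real (Suc j)) > 0" by simp
    from Stone_Weierstrass_real_polynomial_function[OF Kc vc this]
    show "\<exists>p. real_polynomial_function p \<and> (\<forall>x\<in>closure K. \<bar>v x - p x\<bar> < inverse (real (Suc j)))"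
      by metis
  qed
  then obtain p where p: "\<And>j. real_polynomial_function (p j)"
    "\<And>j x. x \<in> closure K \<Longrightarrow> \<bar>v x - p j x\<bar> < inverse (real (Suc j))" by metis
  have pcd: "cont_diff m q" if "real_polynomial_function q" for m and q :: "real^'n \<Rightarrow> real"
    using that
  proof (induction rule: real_polynomial_function.induct)
    case (linear f)
    then have "f x = (\<Sum>i\<in>UNIV. x $ i * f (axis i 1))" for x
    proof -
      interpret bounded_linear f by fact
      have "f x = f (\<Sum>i\<in>UNIV. x $ i *\<^sub>R axis i 1)"
        using basis_expansion[of x] by (simp add: scalar_mult_eq_scaleR)
      then show ?thesis by (simp add: sum scale)
    qed
    then have "f = (\<lambda>x. \<Sum>i\<in>UNIV. x $ i * f (axis i 1))" by (rule ext)
    moreover have "cont_diff m (\<lambda>x. \<Sum>i\<in>UNIV. x $ i * f (axis i 1))"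
      by (intro cont_diff_sum cont_diff_mult cont_diff_coord cont_diff_const)
    ultimately show ?case by (simp only:)
  qed (auto intro: cont_diff_add cont_diff_mult)
  obtain b where b: "\<And>x. x \<in> closure K \<Longrightarrow> \<bar>v x\<bar> \<le> b"
    using compact_imp_bounded[OF compact_continuous_image[OF vc Kc]] by (auto simp: bounded_iff)
  define w where "w x = v x * indicator K x" for x
  have wlim: "(\<lambda>j. p j x * \<eta> j x) \<longlonglongrightarrow> w x" for x
  proof (cases "x \<in> K")
    case True
    then have x: "x \<in> closure K" using closure_subset by blast
    have "(\<lambda>j. v x - p j x) \<longlonglongrightarrow> 0"
      by (rule Lim_null_comparison[OF _ LIMSEQ_inverse_real_of_nat])
        (use p(2)[OF x] in \<open>auto simp: less_imp_le simp del: of_nat_Suc\<close>)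
    then have "(\<lambda>j. v x - (v x - p j x)) \<longlonglongrightarrow> v x - 0" by (intro tendsto_intros)
    then have "(\<lambda>j. p j x) \<longlonglongrightarrow> v x" by simp
    from tendsto_mult[OF this \<eta>(4)] show ?thesis unfolding w_def .
  next
    case False
    then have "\<eta> j x = 0" for j using test_function_outside[OF \<eta>(1)] by blast
    then show ?thesis using False unfolding w_def by simp
  qed
  have pb: "\<bar>p j x * \<eta> j x\<bar> \<le> b + 1" for j x
  proof (cases "x \<in> K")
    case True
    then have x: "x \<in> closure K" using closure_subset by blast
    have "inverse (real (Suc j)) \<le> 1" by (simp add: field_simps)
    then have "\<bar>p j x\<bar> \<le> b + 1" using b[OF x] p(2)[OF x, of j] by linarith
    then have "\<bar>p j x\<bar> * \<bar>\<eta> j x\<bar> \<le> (b + 1) * 1" using \<eta>(2,3) by (intro mult_mono) auto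
    then show ?thesis by (simp add: abs_mult)
  next
    case False
    obtain x where "x \<in> closure K" using K0 closure_subset[of K] by fastforce
    then have "b \<ge> 0" using b[of x] by linarith
    with False show ?thesis using test_function_outside[OF \<eta>(1) False] by simp
  qed
  have \<Omega>s: "\<Omega> \<in> sets lebesgue" using \<Omega> by auto
  have "integrable (lebesgue_on \<Omega>) v" by (rule L2_integrable[OF \<Omega> v])
  then have [measurable]: "v \<in> borel_measurable (lebesgue_on \<Omega>)" by auto
  have [measurable]: "w \<in> borel_measurable borel"
  proof -
    have "(\<lambda>x. p j x * \<eta> j x) \<in> borel_measurable borel" for j
      using test_function_gradient(2)[OF test_function_mult[OF \<eta>(1) pcd[OF p(1)]]] borel_measurable_continuous_onI by blast
    from borel_measurable_LIMSEQ_real[OF wlim this] show ?thesis by simp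
  qed
  have w0: "w x = 0" if "x \<notin> \<Omega>" for x using that K unfolding w_def by (auto simp: indicator_def)
  have e1: "(\<integral>z. v z * w z \<partial>lebesgue_on \<Omega>) = S"
    unfolding S_def w_def by (simp add: power2_eq_square mult.commute mult.left_commute)
  have e2: "(\<integral>z. (w z)\<^sup>2 \<partial>lborel) = S"
  proof -
    have "(\<integral>z. (w z)\<^sup>2 \<partial>lebesgue_on \<Omega>) = (\<integral>z. (w z)\<^sup>2 \<partial>lborel)"
      by (rule integral_lebesgue_on_supported) (use \<Omega>s w0 in auto)
    moreover have "(w z)\<^sup>2 = indicator K z * (v z)\<^sup>2" for z unfolding w_def by (auto simp: indicator_def)
    ultimately show ?thesis unfolding S_def by simp
  qed
  have e3: "(\<integral>z. v z * indicator K z \<partial>lebesgue_on \<Omega>) = avg \<Omega> K v * k"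
    using k unfolding avg_def k_def by simp
  have e4: "(\<integral>z. w z \<partial>lborel) = avg \<Omega> K v * k"
  proof -
    have "(\<integral>z. w z \<partial>lebesgue_on \<Omega>) = (\<integral>z. w z \<partial>lborel)"
      by (rule integral_lebesgue_on_supported) (use \<Omega>s w0 in auto)
    then show ?thesis using e3 unfolding w_def by simp
  qed
  have i1: "integrable lborel (\<lambda>x. (w x)\<^sup>2)" "integrable lborel (\<lambda>x. (indicator K x :: real)\<^sup>2)"
  proof -
    have Kf: "emeasure lborel K < \<infinity>"
      using bounded_subset[OF \<Omega>(1) K(3)] by (rule emeasure_bounded_finite)
    have K1: "integrable lborel (\<lambda>x. c * indicator K x)" for c :: real
      using Kf K by (intro integrable_mult_right integrable_real_indicator) auto
    show "integrable lborel (\<lambda>x. (indicator K x :: real)\<^sup>2)"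
      unfolding indicator_square_abs using K1[of 1] by simp
    have "(w x)\<^sup>2 \<le> b\<^sup>2 * indicator K x" for x
      using b[of x] closure_subset[of K] abs_le_square_iff[of "v x" b]
      unfolding w_def by (auto simp: indicator_def subset_iff)
    then show "integrable lborel (\<lambda>x. (w x)\<^sup>2)"
      by (intro Bochner_Integration.integrable_bound[OF K1[of "b\<^sup>2"]]) (auto intro: order_trans[OF _ abs_ge_self])
  qed
  have e5: "(\<integral>z. \<bar>w z\<bar> \<partial>lborel) \<le> sqrt k * sqrt S"
  proof -
    have "\<bar>\<integral>z. \<bar>w z\<bar> * indicator K z \<partial>lborel\<bar> \<le> sqrt (\<integral>z. \<bar>w z\<bar>\<^sup>2 \<partial>lborel) * sqrt (\<integral>z. (indicator K z)\<^sup>2 \<partial>lborel)"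
      by (rule Cauchy_Schwarz_integral) (use i1 K in auto)
    moreover have "\<bar>w z\<bar> * indicator K z = \<bar>w z\<bar>" "(indicator K z)\<^sup>2 = (indicator K z :: real)" for z
      unfolding w_def by (auto simp: indicator_def)
    ultimately show ?thesis
      using e2 integral_indicator_lborel_open[OF K(2)] unfolding k_def by (simp add: mult.commute)
  qed
  have "\<bar>(\<integral>z. v z * indicator K z \<partial>lebesgue_on \<Omega>) * (\<integral>y. w y \<partial>lborel)
      - (\<integral>z. v z * w z \<partial>lebesgue_on \<Omega>) * (\<integral>y. indicator K y \<partial>lborel)\<bar>
    \<le> 2 ^ CARD('n) * d * sqrt G * (sqrt (\<integral>z. (indicator K z)\<^sup>2 \<partial>lborel) * (\<integral>y. \<bar>w y\<bar> \<partial>lborel)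
        + sqrt (\<integral>z. (w z)\<^sup>2 \<partial>lborel) * (\<integral>y. \<bar>indicator K y\<bar> \<partial>lborel))"
    unfolding G_def
  proof (rule weighted_average_difference_limit[OF \<Omega> v g wg K d, where \<eta> = \<eta> and \<psi> = "\<lambda>j x. p j x * \<eta> j x"
        and c = 1 and c' = "b + 1"])
    show "test_function K (\<lambda>x. p j x * \<eta> j x)" for j
      by (rule test_function_mult[OF \<eta>(1) pcd[OF p(1)]])
  qed (use \<eta> pb wlim in auto)
  also have "\<dots> \<le> 2 ^ CARD('n) * d * sqrt G * (sqrt k * (sqrt k * sqrt S) + sqrt S * k)"
  proof (rule mult_left_mono)
    have "(\<integral>z. (indicator K z)\<^sup>2 \<partial>lborel) = k" "(\<integral>y. \<bar>indicator K y\<bar> \<partial>lborel) = k"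
      using integral_indicator_lborel_open[OF K(2)] unfolding k_def indicator_square_abs by simp_all
    then show "sqrt (\<integral>z. (indicator K z)\<^sup>2 \<partial>lborel) * (\<integral>y. \<bar>w y\<bar> \<partial>lborel)
        + sqrt (\<integral>z. (w z)\<^sup>2 \<partial>lborel) * (\<integral>y. \<bar>indicator K y\<bar> \<partial>lborel) \<le> sqrt k * (sqrt k * sqrt S) + sqrt S * k"
      using e2 e5 k by (auto intro!: mult_left_mono)
  qed (use d0 G0 in auto)
  finally have "\<bar>(avg \<Omega> K v * k) * (avg \<Omega> K v * k) - S * k\<bar>
      \<le> 2 ^ CARD('n) * d * sqrt G * (sqrt k * (sqrt k * sqrt S) + sqrt S * k)"
    unfolding e1 e3 e4 integral_indicator_lborel_open[OF K(2)] k_def[symmetric] .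
  moreover have "sqrt k * (sqrt k * sqrt S) + sqrt S * k = 2 * k * sqrt S"
    using k by (simp flip: mult.assoc)
  ultimately have "S * k \<le> (avg \<Omega> K v * k) * (avg \<Omega> K v * k) + 2 ^ CARD('n) * d * sqrt G * (2 * k * sqrt S)"
    by (simp only:)
  then have "S * k \<le> (k * (avg \<Omega> K v)\<^sup>2 + 2 * (2 ^ CARD('n) * d * sqrt G) * sqrt S) * k"
    by (simp add: algebra_simps power2_eq_square)
  then have "S \<le> k * (avg \<Omega> K v)\<^sup>2 + 2 * (2 ^ CARD('n) * d * sqrt G) * sqrt S"
    using k mult_le_cancel_right_pos by blast
  \<comment> \<open>Young's inequality, with weights such that half of \<open>S\<close> is absorbed
    on the left.\<close>
  also have "2 * (2 ^ CARD('n) * d * sqrt G) * sqrt S \<le> 2 * (2 ^ CARD('n) * d * sqrt G)\<^sup>2 + S / 2"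
  proof -
    have "0 \<le> (2 * (2 ^ CARD('n) * d * sqrt G) - sqrt S)\<^sup>2" by simp
    then show ?thesis using S0 unfolding power2_diff by (simp add: power_mult_distrib)
  qed
  also have "(2 ^ CARD('n) * d * sqrt G)\<^sup>2 = 4 ^ CARD('n) * d\<^sup>2 * G"
  proof -
    have "((2::real) ^ CARD('n))\<^sup>2 = 4 ^ CARD('n)" by (simp flip: power_mult_distrib add: power2_eq_square)
    then show ?thesis using G0 by (simp add: power_mult_distrib)
  qed
  finally show ?thesis unfolding S_def[symmetric] G_def[symmetric] k_def[symmetric] by simp
qed

subsection \<open>Uniqueness of weak gradients\<close>

text \<open>By outer regularity a measurable set agrees up to a null set with a countable
  intersection of open sets, so the vanishing integrals extend from open to all measurable
  sets.\<close>

lemma integral_zero_open_imp_AE_zero: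
  fixes f :: "'a::euclidean_space \<Rightarrow> 'b::{banach, second_countable_topology}"
  assumes f: "integrable lebesgue f"
    and zero: "\<And>U. open U \<Longrightarrow> (\<integral>x. indicator U x *\<^sub>R f x \<partial>lebesgue) = 0"
  shows "AE x in lebesgue. f x = 0"
proof -
  interpret sigma_finite_measure "lebesgue :: 'a measure"
  proof
    have "sigma_finite_measure (lborel :: 'a measure)" by (rule sigma_finite_lborel)
    then obtain A :: "'a set set" where "countable A" "A \<subseteq> sets lborel" "\<Union>A = space lborel"
      "\<And>a. a \<in> A \<Longrightarrow> emeasure lborel a \<noteq> \<infinity>"
      unfolding sigma_finite_measure_def by blast
    then show "\<exists>A. countable A \<and> A \<subseteq> sets (lebesgue :: 'a measure) \<and> \<Union>A = space lebesgue \<and>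
        (\<forall>a\<in>A. emeasure lebesgue a \<noteq> \<infinity>)"
      by (intro exI[of _ A]) (auto simp: subset_iff)
  qed
  show ?thesis
  proof (rule density_zero[OF f])
    fix A :: "'a set" assume A: "A \<in> sets lebesgue"
    have "\<exists>T. open T \<and> A \<subseteq> T \<and> T - A \<in> lmeasurable \<and> emeasure lebesgue (T - A) < ennreal (inverse (real (Suc j)))" for j
      using sets_lebesgue_outer_open[OF A, of "inverse (real (Suc j))"]
      by (metis inverse_positive_iff_positive of_nat_0_less_iff zero_less_Suc)
    then obtain T where T: "\<And>j. open (T j)" "\<And>j. A \<subseteq> T j" "\<And>j. T j - A \<in> lmeasurable"
      "\<And>j. emeasure lebesgue (T j - A) < ennreal (inverse (real (Suc j)))" by metis
    \<comment> \<open>Finite intersections are still open and in addition decreasing, so that their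
      indicators converge.\<close>
    define S where "S j = (\<Inter>i\<le>j. T i)" for j
    have oS: "open (S j)" for j unfolding S_def using T by (intro open_INT) auto
    define R where "R = (\<Inter>j. S j)"
    have "(\<lambda>j. \<integral>x. indicator (S j) x *\<^sub>R f x \<partial>lebesgue) \<longlonglongrightarrow> (\<integral>x. indicator R x *\<^sub>R f x \<partial>lebesgue)"
    proof (rule integral_dominated_convergence[where w = "\<lambda>x. norm (f x)"])
      have S: "S j \<in> sets lebesgue" for j using oS by auto
      then have R: "R \<in> sets lebesgue" unfolding R_def by auto
      show "(\<lambda>x. indicator R x *\<^sub>R f x) \<in> borel_measurable lebesgue"
        "(\<lambda>x. indicator (S j) x *\<^sub>R f x) \<in> borel_measurable lebesgue" for j
        using f S R by auto
      show "AE x in lebesgue. (\<lambda>j. indicator (S j) x *\<^sub>R f x) \<longlonglongrightarrow> indicator R x *\<^sub>R f x"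
      proof (intro AE_I2 tendsto_scaleR tendsto_const)
        fix x
        have "decseq S" unfolding S_def decseq_def by force
        from LIMSEQ_indicator_decseq[OF this, of x] show "(\<lambda>j. indicator (S j) x) \<longlonglongrightarrow> (indicator R x :: real)"
          unfolding R_def .
      qed
    qed (use f in \<open>auto simp: indicator_def intro!: AE_I2\<close>)
    moreover have "(\<integral>x. indicator (S j) x *\<^sub>R f x \<partial>lebesgue) = 0" for j using zero oS by blast
    ultimately have "(\<integral>x. indicator R x *\<^sub>R f x \<partial>lebesgue) = 0"
      by (simp add: LIMSEQ_const_iff)
    moreover have "(\<integral>x. indicator A x *\<^sub>R f x \<partial>lebesgue) = (\<integral>x. indicator R x *\<^sub>R f x \<partial>lebesgue)"
    proof (rule integral_cong_AE)
      have RA: "A \<subseteq> R" "R \<subseteq> T j" for j using T(2) unfolding R_def S_def by auto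
      have R: "R \<in> sets lebesgue" unfolding R_def using oS by auto
      have "emeasure lebesgue (R - A) \<le> ennreal (inverse (real (Suc j)))" for j
      proof -
        have "emeasure lebesgue (R - A) \<le> emeasure lebesgue (T j - A)"
          using RA T(3) by (intro emeasure_mono) auto
        then show ?thesis using T(4)[of j] by (meson less_imp_le order_trans)
      qed
      then have "emeasure lebesgue (R - A) \<le> ennreal 0"
      proof (intro LIMSEQ_le_const[OF tendsto_ennrealI[OF LIMSEQ_inverse_real_of_nat]])
      qed auto
      then have "R - A \<in> null_sets lebesgue" using R A by auto
      then have "AE x in lebesgue. x \<notin> R - A" by (rule AE_not_in)
      then show "AE x in lebesgue. indicator A x *\<^sub>R f x = indicator R x *\<^sub>R f x"
        by eventually_elim (use RA in \<open>auto simp: indicator_def\<close>)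
      show "(\<lambda>x. indicator A x *\<^sub>R f x) \<in> borel_measurable lebesgue"
        "(\<lambda>x. indicator R x *\<^sub>R f x) \<in> borel_measurable lebesgue" using f A R by auto
    qed
    ultimately show "set_lebesgue_integral lebesgue A f = 0"
      unfolding set_lebesgue_integral_def by simp
  qed
qed

text \<open>Test functions converge boundedly to the indicator of any open part of \<Omega>, and
  against each of them \<open>g\<close> and \<open>h\<close> have the same integral.\<close>

lemma weak_gradient_unique:
  fixes v :: "real^'n \<Rightarrow> real"
  assumes \<Omega>: "bounded \<Omega>" "open \<Omega>"
    and g: "g \<in> L2 \<Omega>" "has_weak_gradient \<Omega> v g" and h: "h \<in> L2 \<Omega>" "has_weak_gradient \<Omega> v h"
  shows "AE x in lebesgue_on \<Omega>. g x = h x"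
proof -
  have gi: "integrable (lebesgue_on \<Omega>) g" and hi: "integrable (lebesgue_on \<Omega>) h"
    using L2_integrable[OF \<Omega>] g h by auto
  have \<Omega>s: "\<Omega> \<in> sets lebesgue" using \<Omega> by auto
  define f where "f x = indicator \<Omega> x *\<^sub>R (g x - h x)" for x
  have fi: "integrable lebesgue f"
    unfolding f_def using gi hi \<Omega>s by (subst integrable_restrict_space[symmetric]) auto
  have "AE x in lebesgue. f x = 0"
  proof (rule integral_zero_open_imp_AE_zero[OF fi])
    fix U :: "(real^'n) set" assume U: "open U"
    obtain \<eta> where \<eta>: "\<And>j. test_function (U \<inter> \<Omega>) (\<eta> j)" "\<And>j x. 0 \<le> \<eta> j x" "\<And>j x. \<eta> j x \<le> 1"
      "\<And>x. (\<lambda>j. \<eta> j x) \<longlonglongrightarrow> indicator (U \<inter> \<Omega>) x"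
      using test_functions_approximate_open[of "U \<inter> \<Omega>"] U \<Omega> by (metis open_Int)
    have "(\<lambda>j. \<integral>x. \<eta> j x *\<^sub>R f x \<partial>lebesgue) \<longlonglongrightarrow> (\<integral>x. indicator (U \<inter> \<Omega>) x *\<^sub>R f x \<partial>lebesgue)"
    proof (rule integral_dominated_convergence[where w = "\<lambda>x. norm (f x)"])
      have "U \<inter> \<Omega> \<in> sets lebesgue" using U \<Omega> by auto
      then show "(\<lambda>x. indicator (U \<inter> \<Omega>) x *\<^sub>R f x) \<in> borel_measurable lebesgue" using fi by auto
      have "\<eta> j \<in> borel_measurable lebesgue" for j
        using borel_measurable_continuous_onI[OF test_function_gradient(2)[OF \<eta>(1)]]
        by (intro measurable_completion) simp
      then show "(\<lambda>x. \<eta> j x *\<^sub>R f x) \<in> borel_measurable lebesgue" for j using fi by auto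
      show "AE x in lebesgue. norm (\<eta> j x *\<^sub>R f x) \<le> norm (f x)" for j
        using \<eta>(2,3) by (intro AE_I2) (simp add: mult_left_le_one_le)
    qed (use fi \<eta>(4) in \<open>auto intro!: AE_I2 tendsto_scaleR\<close>)
    moreover have "(\<integral>x. \<eta> j x *\<^sub>R f x \<partial>lebesgue) = 0" for j
    proof -
      have t: "test_function \<Omega> (\<eta> j)" using test_function_mono[OF \<eta>(1)] by auto
      have "(\<integral>x. \<eta> j x *\<^sub>R f x \<partial>lebesgue) = (\<integral>x. \<eta> j x *\<^sub>R (g x - h x) \<partial>lebesgue_on \<Omega>)"
        unfolding f_def using \<Omega>s by (subst integral_restrict_space) (auto simp: mult.commute)
      also have "\<dots> = (\<integral>x. \<eta> j x *\<^sub>R g x \<partial>lebesgue_on \<Omega>) - (\<integral>x. \<eta> j x *\<^sub>R h x \<partial>lebesgue_on \<Omega>)"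
      proof -
        have m: "\<eta> j \<in> borel_measurable (lebesgue_on \<Omega>)"
          using continuous_measurable_lebesgue_on test_function_gradient(2)[OF t] by blast
        have "integrable (lebesgue_on \<Omega>) (\<lambda>x. \<eta> j x *\<^sub>R k x)" if k: "integrable (lebesgue_on \<Omega>) k" for k :: "real^'n \<Rightarrow> real^'n"
        proof (rule Bochner_Integration.integrable_bound[OF k])
          show "AE x in lebesgue_on \<Omega>. norm (\<eta> j x *\<^sub>R k x) \<le> norm (k x)"
            using \<eta>(2,3) by (intro AE_I2) (simp add: mult_left_le_one_le)
        qed (use m k in auto)
        then show ?thesis using gi hi unfolding scaleR_diff_right by simp
      qed
      also have "\<dots> = 0"
      proof -
        have "(\<integral>x. v x *\<^sub>R gradient (\<eta> j) x \<partial>lebesgue_on \<Omega>) = - (\<integral>x. \<eta> j x *\<^sub>R g x \<partial>lebesgue_on \<Omega>)"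
          "(\<integral>x. v x *\<^sub>R gradient (\<eta> j) x \<partial>lebesgue_on \<Omega>) = - (\<integral>x. \<eta> j x *\<^sub>R h x \<partial>lebesgue_on \<Omega>)"
          using g(2) h(2) t unfolding has_weak_gradient_def by blast+
        then show ?thesis by simp
      qed
      finally show ?thesis .
    qed
    moreover have "indicator U x *\<^sub>R f x = indicator (U \<inter> \<Omega>) x *\<^sub>R f x" for x
      unfolding f_def by (auto simp: indicator_def)
    ultimately show "(\<integral>x. indicator U x *\<^sub>R f x \<partial>lebesgue) = 0"
      by (simp only: LIMSEQ_const_iff)
  qed
  then have "AE x in lebesgue. x \<in> \<Omega> \<longrightarrow> g x = h x"
    by eventually_elim (auto simp: f_def indicator_def)
  then show ?thesis using \<Omega>s by (simp add: AE_restrict_space_iff)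
qed

lemma weak_gradient_props:
  assumes "v \<in> H1 \<Omega>"
  shows "weak_gradient \<Omega> v \<in> L2 \<Omega>" "has_weak_gradient \<Omega> v (weak_gradient \<Omega> v)"
proof -
  have "\<exists>g. g \<in> L2 \<Omega> \<and> has_weak_gradient \<Omega> v g" using assms unfolding H1_def by blast
  from someI_ex[OF this]
  show "weak_gradient \<Omega> v \<in> L2 \<Omega>" "has_weak_gradient \<Omega> v (weak_gradient \<Omega> v)"
    unfolding weak_gradient_def by auto
qed

lemma L2_norm_cong_AE:
  assumes "f \<in> L2 \<Omega>" "g \<in> L2 \<Omega>" "AE x in lebesgue_on \<Omega>. f x = g x"
  shows "L2_norm \<Omega> f = L2_norm \<Omega> g"
proof -
  have "(\<integral>x. (norm (f x))\<^sup>2 \<partial>lebesgue_on \<Omega>) = (\<integral>x. (norm (g x))\<^sup>2 \<partial>lebesgue_on \<Omega>)"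
  proof (rule integral_cong_AE)
    show "AE x in lebesgue_on \<Omega>. (norm (f x))\<^sup>2 = (norm (g x))\<^sup>2"
      using assms(3) by eventually_elim auto
  qed (use assms(1,2) in \<open>auto simp: L2_def\<close>)
  then show ?thesis unfolding L2_norm_def by simp
qed

text \<open>The norm is defined through an arbitrary choice of weak gradient; for explicitly
  constructed functions it can thus be computed with the gradient at hand.\<close>

lemma H1_norm_eq:
  assumes "bounded \<Omega>" "open \<Omega>" "v \<in> L2 \<Omega>" "g \<in> L2 \<Omega>" "has_weak_gradient \<Omega> v g"
  shows "v \<in> H1 \<Omega>" "H1_norm \<Omega> v = sqrt ((L2_norm \<Omega> v)\<^sup>2 + (L2_norm \<Omega> g)\<^sup>2)"
proof -
  show v: "v \<in> H1 \<Omega>" using assms unfolding H1_def by blast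
  note w = weak_gradient_props[OF v]
  show "H1_norm \<Omega> v = sqrt ((L2_norm \<Omega> v)\<^sup>2 + (L2_norm \<Omega> g)\<^sup>2)"
    unfolding H1_norm_def
    using L2_norm_cong_AE[OF w(1) assms(4) weak_gradient_unique[OF assms(1,2) w assms(4,5)]] by simp
qed

subsection \<open>Piecewise smooth functions\<close>

lemma lipschitz_of_compact_support:
  fixes f :: "real^'n \<Rightarrow> real"
  assumes "\<And>x. GDERIV f x :> D x" "\<And>x. norm (D x) \<le> L"
  shows "\<bar>f x - f y\<bar> \<le> L * norm (x - y)"
proof -
  have "norm (f x - f y) \<le> L * norm (x - y)"
  proof (rule differentiable_bound[of UNIV f "\<lambda>x h. h \<bullet> D x"])
    fix x :: "real^'n"
    show "(f has_derivative (\<lambda>h. h \<bullet> D x)) (at x within UNIV)" using assms(1) unfolding gderiv_def by blast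
    show "onorm (\<lambda>h. h \<bullet> D x) \<le> L"
      using assms(2)[of x] onorm_inner_left[OF bounded_linear_ident, of "D x"]
      by (simp add: onorm_id order_trans)
  qed auto
  then show ?thesis by simp
qed

text \<open>The product with a test function, extended by zero, is Lipschitz, because it is so on each of
  finitely many closed pieces covering the line. Hence its difference quotients are bounded, have
  integral zero and converge almost everywhere to the partial derivative.\<close>

lemma piecewise_smooth_weak_gradient:
  fixes v :: "real^'n \<Rightarrow> real" and f :: "'i \<Rightarrow> real^'n \<Rightarrow> real" and D :: "'i \<Rightarrow> real^'n \<Rightarrow> real^'n"
  assumes \<Omega>: "bounded \<Omega>" "open \<Omega>" and fin: "finite I"
    and T: "\<And>i. i \<in> I \<Longrightarrow> open (T i)" and cover: "\<Omega> \<subseteq> (\<Union>i\<in>I. closure (T i))"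
    and null: "\<And>i. i \<in> I \<Longrightarrow> negligible (frontier (T i))"
    and f: "\<And>i x. i \<in> I \<Longrightarrow> GDERIV (f i) x :> D i x"
    and D: "\<And>i. i \<in> I \<Longrightarrow> continuous_on UNIV (D i)"
    and vf: "\<And>i x. i \<in> I \<Longrightarrow> x \<in> closure (T i) \<Longrightarrow> v x = f i x"
    and gD: "\<And>i x. i \<in> I \<Longrightarrow> x \<in> T i \<Longrightarrow> g x = D i x"
    and v: "v \<in> L2 \<Omega>" and g: "g \<in> L2 \<Omega>"
  shows "has_weak_gradient \<Omega> v g"
  unfolding has_weak_gradient_def
proof (intro allI impI)
  fix \<eta> assume \<eta>: "test_function \<Omega> \<eta>"
  let ?M = "lebesgue_on \<Omega>"
  define S where "S = closure {x. \<eta> x \<noteq> 0}"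
  have S: "compact S" "S \<subseteq> \<Omega>" using \<eta> unfolding test_function_def S_def by auto
  have \<eta>S: "\<eta> x = 0" if "x \<notin> S" for x using that closure_subset[of "{x. \<eta> x \<noteq> 0}"] unfolding S_def by auto
  note \<eta>c = test_function_gradient[OF \<eta>]
  have gS: "gradient \<eta> x = 0" if "x \<notin> S" for x using gradient_test_function_outside that unfolding S_def by blast
  have \<Omega>s: "\<Omega> \<in> sets lebesgue" using \<Omega> by auto
  define F where "F x = (if x \<in> \<Omega> then v x * \<eta> x else 0)" for x
  define P where "P i x = f i x * \<eta> x" for i x
  define Q where "Q i x = f i x *\<^sub>R gradient \<eta> x + \<eta> x *\<^sub>R D i x" for i x
  have PQ: "GDERIV (P i) x :> Q i x" if "i \<in> I" for i x
    unfolding P_def[abs_def] Q_def by (rule GDERIV_mult[OF f[OF that] \<eta>c(1)])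
  have fc: "continuous_on UNIV (f i)" if "i \<in> I" for i
    using f[OF that] unfolding gderiv_def
    by (intro continuous_at_imp_continuous_on) (auto intro: has_derivative_continuous)
  have Qc: "continuous_on UNIV (Q i)" if "i \<in> I" for i
    unfolding Q_def[abs_def] by (intro continuous_intros fc D \<eta>c that)
  have "\<exists>L\<ge>0. \<forall>x. norm (Q i x) \<le> L" if i: "i \<in> I" for i
  proof -
    have "bounded (Q i ` S)"
      using S Qc[OF i] by (intro compact_imp_bounded compact_continuous_image) (auto intro: continuous_on_subset)
    then obtain L where "\<And>x. x \<in> S \<Longrightarrow> norm (Q i x) \<le> L" by (auto simp: bounded_iff)
    moreover have "Q i x = 0" if "x \<notin> S" for x using that gS \<eta>S unfolding Q_def by simp
    ultimately have "norm (Q i x) \<le> \<bar>L\<bar>" for x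
      by (cases "x \<in> S") (auto intro: order_trans[OF _ abs_ge_self])
    then show ?thesis by (intro exI[of _ "\<bar>L\<bar>"]) auto
  qed
  then obtain L0 where L0: "\<And>i. i \<in> I \<Longrightarrow> L0 i \<ge> 0" "\<And>i x. i \<in> I \<Longrightarrow> norm (Q i x) \<le> L0 i" by metis
  define L where "L = (\<Sum>i\<in>I. L0 i)"
  have L: "L \<ge> 0" "\<And>i x. i \<in> I \<Longrightarrow> norm (Q i x) \<le> L"
  proof -
    show "L \<ge> 0" unfolding L_def using L0 by (intro sum_nonneg) auto
    fix i x assume i: "i \<in> I"
    have "L0 i \<le> L" unfolding L_def using i fin L0(1) by (intro member_le_sum) auto
    then show "norm (Q i x) \<le> L" using L0(2)[OF i, of x] by linarith
  qed
  have PL: "\<bar>P i x - P i y\<bar> \<le> L * norm (x - y)" if "i \<in> I" for i x y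
    by (rule lipschitz_of_compact_support[OF PQ L(2)]) (use that in auto)
  have FP: "F x = P i x" if "i \<in> I" "x \<in> closure (T i)" for i x
    using vf[OF that] test_function_outside[OF \<eta>] unfolding F_def P_def by auto
  have FL: "\<bar>F x - F y\<bar> \<le> L * norm (x - y)" for x y
  proof -
    define l where "l t = x + t *\<^sub>R (y - x)" for t :: real
    have lc: "continuous_on UNIV l" unfolding l_def[abs_def] by (intro continuous_intros)
    \<comment> \<open>Closed pieces of the parameter line of the segment: \<open>None\<close> stands
      for the exterior of \<Omega>, where \<open>F\<close> vanishes, \<open>Some i\<close> for the
      closed element \<open>i\<close>.\<close>
    define U where "U j = (case j of None \<Rightarrow> l -` (- \<Omega>) | Some i \<Rightarrow> l -` closure (T i))" for j
    have "(L * norm (y - x))-lipschitz_on {0..1} (\<lambda>t. F (l t))"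
    proof (rule lipschitz_on_closed_Union[where I = "insert None (Some ` I)" and U = U])
      fix j assume j: "j \<in> insert None (Some ` I)"
      show "closed (U j)"
        using \<Omega> lc j unfolding U_def by (auto split: option.splits intro!: closed_vimage)
      show "(L * norm (y - x))-lipschitz_on (U j) (\<lambda>t. F (l t))"
      proof (rule lipschitz_onI)
        fix s t assume st: "s \<in> U j" "t \<in> U j"
        show "dist (F (l s)) (F (l t)) \<le> L * norm (y - x) * dist s t"
        proof (cases j)
          case None
          then show ?thesis using st L(1) unfolding U_def F_def by auto
        next
          case (Some i)
          then have i: "i \<in> I" using j by auto
          have "dist (F (l s)) (F (l t)) = \<bar>P i (l s) - P i (l t)\<bar>"
            using st Some FP[OF i] unfolding U_def by (simp add: dist_real_def)
          also have "\<dots> \<le> L * norm (l s - l t)" by (rule PL[OF i])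
          also have "l s - l t = (s - t) *\<^sub>R (y - x)" unfolding l_def by (simp add: algebra_simps)
          finally show ?thesis by (simp add: dist_real_def mult_ac)
        qed
      qed (use L(1) in auto)
    next
      show "{0..1} \<subseteq> (\<Union>j\<in>insert None (Some ` I). U j)" unfolding U_def using cover by fastforce
    qed (use fin L(1) in auto)
    then have "dist (F (l 0)) (F (l 1)) \<le> L * norm (y - x) * dist 0 (1::real)" by (rule lipschitz_onD) auto
    then show ?thesis unfolding l_def by (simp add: dist_real_def norm_minus_commute)
  qed
  have Fc: "continuous_on UNIV F"
  proof -
    have "L-lipschitz_on UNIV F"
      using FL L(1) by (intro lipschitz_onI) (auto simp: dist_real_def dist_norm)
    then show ?thesis by (rule lipschitz_on_continuous_on)
  qed
  have Fm[measurable]: "F \<in> borel_measurable borel" using borel_measurable_continuous_onI[OF Fc] .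
  have F0: "F x = 0" if "x \<notin> S" for x using \<eta>S[OF that] unfolding F_def by simp
  \<comment> \<open>The steps \<open>t j\<close> are at most 1, so every difference quotient
    vanishes outside this neighbourhood of the support.\<close>
  define R where "R = {x. \<exists>z\<in>S. norm (x - z) \<le> 1}"
  have "bounded S" using S by (simp add: compact_imp_bounded)
  then have "bounded R"
  proof -
    obtain b where b: "\<And>z. z \<in> S \<Longrightarrow> norm z \<le> b" using \<open>bounded S\<close> by (auto simp: bounded_iff)
    have "norm x \<le> b + 1" if xR: "x \<in> R" for x
    proof -
      obtain z where "z \<in> S" "norm (x - z) \<le> 1" using xR unfolding R_def by blast
      then show ?thesis using b[of z] norm_triangle_sub[of x z] by linarith
    qed
    then show ?thesis by (auto simp: bounded_iff)
  qed
  then obtain c :: "real^'n" where c: "R \<subseteq> cbox (- c) c" using bounded_subset_cbox_symmetric by blast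
  have SR: "S \<subseteq> R" unfolding R_def by force
  have comp: "(\<integral>x. v x * gradient \<eta> x $ k + \<eta> x * g x $ k \<partial>?M) = 0" for k
  proof -
    define G where "G x = indicator \<Omega> x * (v x * gradient \<eta> x $ k + \<eta> x * g x $ k)" for x
    define t where "t j = inverse (real (Suc j))" for j
    have t: "t j > 0" "t j \<le> 1" for j unfolding t_def by (auto simp: field_simps)
    have tlim: "t \<longlonglongrightarrow> 0" unfolding t_def[abs_def] by (rule LIMSEQ_inverse_real_of_nat)
    define e where "e = (axis k 1 :: real^'n)"
    have e1: "norm e = 1" unfolding e_def by simp
    define q where "q j x = (F (x + t j *\<^sub>R e) - F x) / t j" for j x
    have [measurable]: "q j \<in> borel_measurable borel" for j unfolding q_def by measurable
    have qb: "\<bar>q j x\<bar> \<le> L * indicator (cbox (- c) c) x" for j x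
    proof (cases "x \<in> R")
      case True
      have "\<bar>F (x + t j *\<^sub>R e) - F x\<bar> \<le> L * t j"
        using FL[of "x + t j *\<^sub>R e" x] t[of j] e1 by simp
      then show ?thesis using True c t[of j] unfolding q_def by (auto simp: field_simps)
    next
      case False
      have "x \<notin> S" using False SR by blast
      moreover have "x + t j *\<^sub>R e \<notin> S"
      proof
        assume "x + t j *\<^sub>R e \<in> S"
        moreover have "norm (x - (x + t j *\<^sub>R e)) \<le> 1" using t[of j] e1 by simp
        ultimately show False using False unfolding R_def by blast
      qed
      ultimately show ?thesis using F0 L(1) unfolding q_def by simp
    qed
    have cint: "integrable lebesgue (\<lambda>x. L * indicator (cbox (- c) c) x)"
      by (intro integrable_mult_right integrable_real_indicator) (auto simp: emeasure_lborel_cbox_eq)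
    have "(\<integral>x. q j x \<partial>lebesgue) = 0" for j
    proof -
      have Fi: "integrable lborel F"
      proof -
        have "bounded (F ` S)"
          using S Fc by (intro compact_imp_bounded compact_continuous_image) (auto intro: continuous_on_subset)
        then obtain b where b: "\<And>x. x \<in> S \<Longrightarrow> \<bar>F x\<bar> \<le> b" by (auto simp: bounded_iff)
        show ?thesis
        proof (rule Bochner_Integration.integrable_bound[of _ "\<lambda>x. b * indicator (cbox (- c) c) x"])
          show "integrable lborel (\<lambda>x. b * indicator (cbox (- c) c) x)"
            using emeasure_bounded_finite[of "cbox (- c) c"]
            by (intro integrable_mult_right integrable_real_indicator) auto
          have "\<bar>F x\<bar> \<le> \<bar>b * indicator (cbox (- c) c) x\<bar>" for x
            using b[of x] F0[of x] SR c by (cases "x \<in> S") (auto simp: indicator_def)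
          then show "AE x in lborel. norm (F x) \<le> norm (b * indicator (cbox (- c) c) x)" by simp
        qed simp
      qed
      have "(\<integral>x. F (t j *\<^sub>R e + x) \<partial>lborel) = (\<integral>x. F x \<partial>lborel)"
        using integral_distr[of "(+) (t j *\<^sub>R e)" lborel borel F] lborel_distr_plus[of "t j *\<^sub>R e"] by simp
      moreover have "integrable lborel (\<lambda>x. F (t j *\<^sub>R e + x))"
        using integrable_distr[of "(+) (t j *\<^sub>R e)" lborel borel F] lborel_distr_plus[of "t j *\<^sub>R e"] Fi by simp
      ultimately have "(\<integral>x. q j x \<partial>lborel) = 0" using Fi unfolding q_def by (simp add: add.commute)
      then show ?thesis by (simp add: integral_completion)
    qed
    moreover have "(\<lambda>j. \<integral>x. q j x \<partial>lebesgue) \<longlonglongrightarrow> (\<integral>x. G x \<partial>lebesgue)"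
    proof (rule integral_dominated_convergence[where w = "\<lambda>x. L * indicator (cbox (- c) c) x"])
      have comp: "(\<lambda>x. h x $ k) \<in> borel_measurable ?M" if "h \<in> borel_measurable ?M" for h :: "real^'n \<Rightarrow> real^'n"
      proof -
        have "(\<lambda>x. h x \<bullet> axis k 1) \<in> borel_measurable ?M" using that by simp
        then show ?thesis by (simp add: inner_axis)
      qed
      have m: "(\<lambda>x. v x * gradient \<eta> x $ k + \<eta> x * g x $ k) \<in> borel_measurable ?M"
      proof -
        have [measurable]: "v \<in> borel_measurable ?M" "g \<in> borel_measurable ?M" using v g unfolding L2_def by auto
        have [measurable]: "gradient \<eta> \<in> borel_measurable ?M" "\<eta> \<in> borel_measurable ?M"
          using \<eta>c by (auto intro: continuous_measurable_lebesgue_on)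
        show ?thesis by (intro borel_measurable_add borel_measurable_times comp) auto
      qed
      show "G \<in> borel_measurable lebesgue"
        using m \<Omega>s unfolding G_def[abs_def]
        by (subst (asm) borel_measurable_restrict_space_iff) auto
      show "q j \<in> borel_measurable lebesgue" for j by (intro measurable_completion) simp
      show "AE x in lebesgue. norm (q j x) \<le> L * indicator (cbox (- c) c) x" for j using qb by simp
      have "negligible (\<Union>i\<in>I. frontier (T i))" using fin null by (intro negligible_Union) auto
      then have "AE x in lebesgue. x \<notin> (\<Union>i\<in>I. frontier (T i))"
        unfolding negligible_iff_null_sets by (rule AE_not_in)
      then show "AE x in lebesgue. (\<lambda>j. q j x) \<longlonglongrightarrow> G x"
      proof eventually_elim
        fix x assume x: "x \<notin> (\<Union>i\<in>I. frontier (T i))"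
        have lim: "(\<lambda>j. q j x) \<longlonglongrightarrow> d \<bullet> e"
          if d: "GDERIV p x :> d" and U: "open U" "x \<in> U" "\<And>y. y \<in> U \<Longrightarrow> F y = p y" for p d U
        proof -
          have "(F has_derivative (\<lambda>h. h \<bullet> d)) (at x)"
            using d unfolding gderiv_def
            by (rule has_derivative_transform_within_open[OF _ U(1,2)]) (use U(3) in simp)
          moreover have "((\<lambda>s. x + s *\<^sub>R e) has_derivative (\<lambda>s. s *\<^sub>R e)) (at 0)"
            by (auto intro!: derivative_eq_intros)
          ultimately have "((\<lambda>s. F (x + s *\<^sub>R e)) has_derivative (\<lambda>s. (s *\<^sub>R e) \<bullet> d)) (at 0)"
            using has_derivative_compose[of "\<lambda>s. x + s *\<^sub>R e" "\<lambda>s. s *\<^sub>R e" 0 UNIV F "\<lambda>h. h \<bullet> d"] by simp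
          then have "((\<lambda>s. F (x + s *\<^sub>R e)) has_real_derivative (d \<bullet> e)) (at 0)"
            unfolding has_field_derivative_def by (simp add: inner_commute mult.commute[of _ "_ \<bullet> _"])
          then have "((\<lambda>s. (F (x + s *\<^sub>R e) - F x) / s) \<longlongrightarrow> d \<bullet> e) (at 0)"
            unfolding DERIV_def by simp
          from filterlim_compose[OF this, of t sequentially] show ?thesis
            unfolding q_def using tlim t by (simp add: filterlim_at less_imp_neq[symmetric])
        qed
        show "(\<lambda>j. q j x) \<longlonglongrightarrow> G x"
        proof (cases "x \<in> \<Omega>")
          case True
          then obtain i where i: "i \<in> I" "x \<in> closure (T i)" using cover by blast
          then have xT: "x \<in> T i" using x T by (auto simp: frontier_def interior_open)
          have "(\<lambda>j. q j x) \<longlonglongrightarrow> Q i x \<bullet> e"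
            by (rule lim[OF PQ[OF i(1)] T[OF i(1)] xT]) (use FP[OF i(1)] closure_subset in blast)
          moreover have "Q i x \<bullet> e = G x"
            using True gD[OF i(1) xT] vf[OF i]
            unfolding Q_def G_def e_def by (simp add: inner_axis inner_add_left)
          ultimately show ?thesis by simp
        next
          case False
          then have xS: "x \<in> - S" using S by auto
          have "(\<lambda>j. q j x) \<longlonglongrightarrow> 0 \<bullet> e"
            by (rule lim[of "\<lambda>x. 0" 0 "- S"]) (use xS S F0 in \<open>auto simp: GDERIV_const compact_imp_closed open_Compl\<close>)
          then show ?thesis using False unfolding G_def by simp
        qed
      qed
    qed (rule cint)
    ultimately have "(\<integral>x. G x \<partial>lebesgue) = 0" by (simp add: LIMSEQ_const_iff)
    then show ?thesis unfolding G_def using \<Omega>s by (subst integral_restrict_space) auto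
  qed
  obtain B where B: "\<And>x. \<bar>\<eta> x\<bar> \<le> B" "\<And>x. norm (gradient \<eta> x) \<le> B"
    using test_function_bounded[OF \<eta>] by auto
  have vi: "integrable ?M v" and gi: "integrable ?M g" using L2_integrable[OF \<Omega>] v g by auto
  have i1: "integrable ?M (\<lambda>x. v x *\<^sub>R gradient \<eta> x)"
    by (rule integrable_mult_continuous_bounded[OF vi \<eta>c(3) B(2)])
  have i2: "integrable ?M (\<lambda>x. \<eta> x *\<^sub>R g x)"
  proof (rule Bochner_Integration.integrable_bound[of _ "\<lambda>x. B *\<^sub>R g x"])
    have "\<eta> \<in> borel_measurable ?M" using \<eta>c(2) by (rule continuous_measurable_lebesgue_on)
    then show "(\<lambda>x. \<eta> x *\<^sub>R g x) \<in> borel_measurable ?M" using gi by auto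
    show "AE x in ?M. norm (\<eta> x *\<^sub>R g x) \<le> norm (B *\<^sub>R g x)"
      using B(1) by (intro AE_I2) (auto intro!: mult_right_mono order_trans[OF _ abs_ge_self])
  qed (use gi in auto)
  have "(\<integral>x. v x *\<^sub>R gradient \<eta> x \<partial>?M) + (\<integral>x. \<eta> x *\<^sub>R g x \<partial>?M)
      = (\<integral>x. v x *\<^sub>R gradient \<eta> x + \<eta> x *\<^sub>R g x \<partial>?M)" using i1 i2 by simp
  also have "\<dots> = 0"
  proof (rule vec_eq_iff[THEN iffD2], rule allI)
    fix k
    have "(\<integral>x. v x *\<^sub>R gradient \<eta> x + \<eta> x *\<^sub>R g x \<partial>?M) $ k
       = (\<integral>x. (v x *\<^sub>R gradient \<eta> x + \<eta> x *\<^sub>R g x) $ k \<partial>?M)"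
      by (rule integral_bounded_linear[OF bounded_linear_vec_nth, symmetric]) (use i1 i2 in auto)
    then show "(\<integral>x. v x *\<^sub>R gradient \<eta> x + \<eta> x *\<^sub>R g x \<partial>?M) $ k = 0 $ k" using comp[of k] by simp
  qed
  finally show "(\<integral>x. v x *\<^sub>R gradient \<eta> x \<partial>?M) = - (\<integral>x. \<eta> x *\<^sub>R g x \<partial>?M)"
    by (simp add: eq_neg_iff_add_eq_0)
qed

subsection \<open>Simplices\<close>

text \<open>Mesh elements are bare open sets; the extreme points of the closure recover the
  vertices.\<close>

definition verts :: "(real^'n) set \<Rightarrow> (real^'n) set" where
  "verts T = {p. p extreme_point_of closure T}"

definition full_simplex_vertices :: "(real^'n) set \<Rightarrow> bool" where
  "full_simplex_vertices S \<longleftrightarrow> \<not> affine_dependent S \<and> card S = Suc CARD('n)"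

lemma open_simplex_verts:
  fixes T :: "(real^'n) set"
  assumes "open_simplex T"
  shows "full_simplex_vertices (verts T)" "closure T = convex hull (verts T)"
    "T = interior (convex hull (verts T))" "open T" "convex T" "T \<noteq> {}" "bounded T"
proof -
  obtain C where C: "\<not> affine_dependent C" "int (card C) = int CARD('n) + 1" "T = interior (convex hull C)"
    using assms unfolding open_simplex_def simplex_def by blast
  have card: "card C = Suc DIM(real^'n)" using C(2) by simp
  have fin: "finite C" using C(1) aff_independent_finite by blast
  have hull: "affine hull C = UNIV" by (rule affine_independent_span_eq[OF C(1) card])
  have "C \<noteq> {}" using card by auto
  then have "rel_interior (convex hull C) \<noteq> {}" by (simp add: rel_interior_eq_empty)
  moreover have "rel_interior (convex hull C) = interior (convex hull C)"
    by (rule rel_interior_interior) (simp add: hull)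
  ultimately show ne: "T \<noteq> {}" using C(3) by simp
  have cl: "closure T = convex hull C"
    using C(3) ne fin by (simp add: convex_closure_interior compact_convex_hull finite_imp_compact compact_imp_closed)
  then have "verts T = C"
    unfolding verts_def using extreme_point_of_convex_hull_affine_independent[OF C(1)] by auto
  then show "full_simplex_vertices (verts T)" "closure T = convex hull (verts T)"
    "T = interior (convex hull (verts T))"
    using C cl card unfolding full_simplex_vertices_def by auto
  show "open T" "convex T" using C(3) by auto
  show "bounded T" using C(3) fin
    by (auto intro: bounded_interior bounded_convex_hull finite_imp_bounded)
qed

section \<open>Barycentric coordinates\<close>

text \<open>Slope and offset of the affine function equal to 1 at \<open>s\<close> and 0 at the
  other vertices. It lives on the whole space, so it can also be evaluated on a neighbouring
  simplex.\<close>

definition bary_coeffs :: "(real^'n) set \<Rightarrow> real^'n \<Rightarrow> (real^'n) \<times> real" where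
  "bary_coeffs S s = (SOME (a, b). a \<bullet> s + b = 1 \<and> (\<forall>t\<in>S - {s}. a \<bullet> t + b = 0))"

definition bary_grad :: "(real^'n) set \<Rightarrow> real^'n \<Rightarrow> real^'n" where
  "bary_grad S s = fst (bary_coeffs S s)"

definition bary :: "(real^'n) set \<Rightarrow> real^'n \<Rightarrow> real^'n \<Rightarrow> real" where
  "bary S s x = bary_grad S s \<bullet> x + snd (bary_coeffs S s)"

context
  fixes S :: "(real^'n) set"
  assumes S: "full_simplex_vertices S"
begin

lemma full_finite: "finite S" and full_nonempty: "S \<noteq> {}"
  and full_affine_hull: "affine hull S = UNIV"
proof -
  show "finite S" using S aff_independent_finite unfolding full_simplex_vertices_def by blast
  show "S \<noteq> {}" using S unfolding full_simplex_vertices_def by auto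
  show "affine hull S = UNIV"
    using S unfolding full_simplex_vertices_def by (intro affine_independent_span_eq) auto
qed

text \<open>The vertices other than \<open>s\<close> are too few to span, so they lie in a
  hyperplane; \<open>s\<close> is off it because all vertices together span the space. Rescaling the
  equation of the hyperplane gives the required affine function.\<close>

lemma bary_vertex:
  assumes s: "s \<in> S" and t: "t \<in> S"
  shows "bary S s t = (if t = s then 1 else 0)"
proof -
  have ind: "\<not> affine_dependent (S - {s})"
    using S affine_independent_Diff unfolding full_simplex_vertices_def by blast
  have "of_nat (card (S - {s})) = aff_dim (S - {s}) + 1" by (rule aff_dim_affine_independent[OF ind])
  moreover have "card (S - {s}) = CARD('n)" using S s full_finite unfolding full_simplex_vertices_def by simp
  ultimately have "aff_dim (S - {s}) < DIM(real^'n)" by simp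
  then obtain a b where ab: "a \<noteq> 0" "S - {s} \<subseteq> {x. a \<bullet> x = b}"
    by (rule aff_lowdim_subset_hyperplane)
  have ne: "a \<bullet> s \<noteq> b"
  proof
    assume "a \<bullet> s = b"
    then have "S \<subseteq> {x. a \<bullet> x = b}" using ab by blast
    then have "affine hull S \<subseteq> {x. a \<bullet> x = b}" by (intro hull_minimal affine_hyperplane)
    then have "a \<bullet> x = b" for x using full_affine_hull by auto
    from this[of 0] this[of a] ab(1) show False by simp
  qed
  define c where "c = a \<bullet> s - b"
  have "c \<noteq> 0" using ne unfolding c_def by simp
  define a' where "a' = (1 / c) *\<^sub>R a"
  define b' where "b' = - b / c"
  have "a' \<bullet> s + b' = 1"
    using \<open>c \<noteq> 0\<close> unfolding a'_def b'_def c_def by (simp add: diff_divide_distrib[symmetric])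
  moreover have "a' \<bullet> t + b' = 0" if "t \<in> S - {s}" for t using that ab(2) unfolding a'_def b'_def by auto
  ultimately have "\<exists>p. (case p of (a, b) \<Rightarrow> a \<bullet> s + b = 1 \<and> (\<forall>t\<in>S - {s}. a \<bullet> t + b = 0))"
    by (intro exI[of _ "(a', b')"]) simp
  then have "case bary_coeffs S s of (a, b) \<Rightarrow> a \<bullet> s + b = 1 \<and> (\<forall>t\<in>S - {s}. a \<bullet> t + b = 0)"
    unfolding bary_coeffs_def by (rule someI_ex)
  then show ?thesis using t unfolding bary_def bary_grad_def by (auto split: prod.splits)
qed

lemma affine_combination:
  assumes "sum u V = 1"
  shows "a \<bullet> (\<Sum>t\<in>V. u t *\<^sub>R t) + b = (\<Sum>t\<in>V. u t * (a \<bullet> t + b))"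
proof -
  have "(\<Sum>t\<in>V. u t * (a \<bullet> t + b)) = (\<Sum>t\<in>V. u t * (a \<bullet> t)) + (\<Sum>t\<in>V. u t) * b"
    by (simp add: distrib_left sum.distrib sum_distrib_right)
  then show ?thesis using assms by (simp add: inner_sum_right)
qed

text \<open>Admitting a subset \<open>V\<close> of the vertices covers points of faces, where the
  remaining coordinates vanish.\<close>

lemma bary_combination:
  assumes "sum u V = 1" "V \<subseteq> S" "s \<in> S"
  shows "bary S s (\<Sum>t\<in>V. u t *\<^sub>R t) = (if s \<in> V then u s else 0)"
proof -
  have fin: "finite V" using assms(2) full_finite finite_subset by blast
  have "bary S s (\<Sum>t\<in>V. u t *\<^sub>R t) = (\<Sum>t\<in>V. u t * bary S s t)"
    unfolding bary_def by (rule affine_combination[OF assms(1)])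
  also have "\<dots> = (\<Sum>t\<in>V. if t = s then u s else 0)"
    using assms bary_vertex by (intro sum.cong) auto
  finally show ?thesis using fin by simp
qed

lemma bary_sum: "(\<Sum>s\<in>S. bary S s x) = 1"
  and bary_representation: "(\<Sum>s\<in>S. bary S s x *\<^sub>R s) = x"
proof -
  have "x \<in> affine hull S" using full_affine_hull by simp
  then obtain u where u: "sum u S = 1" "(\<Sum>t\<in>S. u t *\<^sub>R t) = x"
    using full_finite by (auto simp: affine_hull_finite)
  then have "bary S s x = u s" if "s \<in> S" for s using bary_combination[OF u(1) order_refl that] that by simp
  then show "(\<Sum>s\<in>S. bary S s x) = 1" "(\<Sum>s\<in>S. bary S s x *\<^sub>R s) = x"
    using u by (simp_all cong: sum.cong)
qed

lemma bary_nonneg_iff: "x \<in> convex hull S \<longleftrightarrow> (\<forall>s\<in>S. bary S s x \<ge> 0)"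
proof
  assume "x \<in> convex hull S"
  then obtain u where u: "\<forall>t\<in>S. 0 \<le> u t" "sum u S = 1" "(\<Sum>t\<in>S. u t *\<^sub>R t) = x"
    using full_finite by (auto simp: convex_hull_finite)
  then show "\<forall>s\<in>S. bary S s x \<ge> 0" using bary_combination[OF u(2) order_refl] by auto
next
  assume "\<forall>s\<in>S. bary S s x \<ge> 0"
  then show "x \<in> convex hull S"
    using bary_sum[of x] bary_representation[of x] full_finite
    unfolding convex_hull_finite[OF full_finite] by (auto intro!: exI[of _ "\<lambda>s. bary S s x"])
qed

lemma bary_le_1: "x \<in> convex hull S \<Longrightarrow> s \<in> S \<Longrightarrow> bary S s x \<le> 1"
  using member_le_sum[of s S "\<lambda>s. bary S s x"] bary_nonneg_iff[of x] bary_sum[of x] full_finite by auto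

lemma bary_pos_iff: "x \<in> interior (convex hull S) \<longleftrightarrow> (\<forall>s\<in>S. bary S s x > 0)"
proof -
  have aff: "\<not> affine_dependent S" and "\<not> card S \<le> DIM(real^'n)"
    using S unfolding full_simplex_vertices_def by auto
  then have eq: "interior (convex hull S) =
      {y. \<exists>u. (\<forall>x\<in>S. 0 < u x) \<and> sum u S = 1 \<and> (\<Sum>x\<in>S. u x *\<^sub>R x) = y}"
    using interior_convex_hull_explicit_minimal[OF aff] by simp
  show ?thesis
  proof
    assume "x \<in> interior (convex hull S)"
    then obtain u where u: "\<forall>t\<in>S. 0 < u t" "sum u S = 1" "(\<Sum>t\<in>S. u t *\<^sub>R t) = x" unfolding eq by blast
    then show "\<forall>s\<in>S. bary S s x > 0" using bary_combination[OF u(2) order_refl] by auto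
  next
    assume "\<forall>s\<in>S. bary S s x > 0"
    then show "x \<in> interior (convex hull S)"
      unfolding eq using bary_sum[of x] bary_representation[of x] by (auto intro!: exI[of _ "\<lambda>s. bary S s x"])
  qed
qed

end

lemma bary_diff: "bary S s x - bary S s y = bary_grad S s \<bullet> (x - y)"
  unfolding bary_def by (simp add: inner_diff_right)

lemma GDERIV_bary: "GDERIV (bary S s) x :> bary_grad S s"
  unfolding gderiv_def bary_def by (auto intro!: derivative_eq_intros simp: inner_commute)

lemma continuous_on_bary [continuous_intros]: "continuous_on A (bary S s)"
  unfolding bary_def by (intro continuous_intros)

section \<open>Volume estimates\<close>

text \<open>A cube of side \<open>2 * h\<close> about any point of the set contains it.\<close>

lemma measure_le_diameter:
  fixes T :: "(real^'n) set"
  assumes T: "T \<in> lmeasurable" and h: "\<And>x y. x \<in> T \<Longrightarrow> y \<in> T \<Longrightarrow> norm (x - y) \<le> h" and "h \<ge> 0"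
  shows "measure lebesgue T \<le> (2 * h) ^ CARD('n)"
proof (cases "T = {}")
  case True then show ?thesis using \<open>h \<ge> 0\<close> by simp
next
  case False
  then obtain p where p: "p \<in> T" by auto
  define lo :: "real^'n" where "lo = (\<chi> i. p $ i - h)"
  define hi :: "real^'n" where "hi = (\<chi> i. p $ i + h)"
  have sub: "T \<subseteq> cbox lo hi"
  proof
    fix x assume x: "x \<in> T"
    have "\<bar>x $ i - p $ i\<bar> \<le> h" for i
      using component_le_norm_cart[of "x - p" i] h[OF x p] by simp
    then show "x \<in> cbox lo hi" unfolding mem_box_cart lo_def hi_def by (simp add: abs_le_iff algebra_simps)
  qed
  have "measure lebesgue T \<le> measure lebesgue (cbox lo hi)"
    by (rule measure_mono_fmeasurable[OF sub]) (use T in auto)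
  also have "\<dots> = (\<Prod>i\<in>UNIV. hi $ i - lo $ i)"
    using content_cbox_cart[of lo hi] sub p by auto
  also have "\<dots> = (2 * h) ^ CARD('n)" unfolding hi_def lo_def by simp
  finally show ?thesis .
qed

text \<open>The translates of \<open>T\<close> by multiples of \<open>2 a / (norm a)\<^sup>2\<close> are disjoint. As many as \<open>norm a * h\<close>
  of them fit into a set of diameter \<open>5 h\<close>.\<close>

lemma measure_slab:
  fixes T :: "(real^'n) set"
  assumes T: "T \<in> lmeasurable" "T \<noteq> {}" and h: "\<And>x y. x \<in> T \<Longrightarrow> y \<in> T \<Longrightarrow> norm (x - y) \<le> h"
    and ab: "\<And>x. x \<in> T \<Longrightarrow> 0 \<le> a \<bullet> x + b" "\<And>x. x \<in> T \<Longrightarrow> a \<bullet> x + b \<le> 1"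
    and ah: "norm a * h \<ge> 1"
  shows "norm a * h * measure lebesgue T \<le> (10 * h) ^ CARD('n)"
proof -
  have a0: "a \<noteq> 0" using ah by auto
  obtain p where p: "p \<in> T" using T(2) by auto
  have h0: "h \<ge> 0" using h[OF p p] by simp
  define m where "m = nat \<lceil>norm a * h\<rceil>"
  have m: "norm a * h \<le> real m" "real m \<le> 2 * (norm a * h)"
  proof -
    show "norm a * h \<le> real m" unfolding m_def by (rule real_nat_ceiling_ge)
    have "real m = of_int \<lceil>norm a * h\<rceil>" unfolding m_def using ah by simp
    then show "real m \<le> 2 * (norm a * h)" using ah by linarith
  qed
  \<comment> \<open>Translation by \<open>w\<close> raises the affine function by 2, which exceeds
    the length of its range on \<open>T\<close>.\<close>
  define w where "w = (2 / (norm a)\<^sup>2) *\<^sub>R a"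
  have aw: "a \<bullet> w = 2" "norm w = 2 / norm a"
    unfolding w_def using a0 by (simp_all add: power2_norm_eq_inner[symmetric] power2_eq_square)
  define X where "X j = (\<lambda>x. real j *\<^sub>R w + x) ` T" for j
  have Xm: "X j \<in> lmeasurable" "measure lebesgue (X j) = measure lebesgue T" for j
    unfolding X_def using T(1) by (auto intro: measurable_translation simp: measure_translation)
  have disj: "X i \<inter> X j = {}" if "i < j" for i j
  proof (rule ccontr)
    assume "X i \<inter> X j \<noteq> {}"
    then obtain x y where xy: "x \<in> T" "y \<in> T" "real i *\<^sub>R w + x = real j *\<^sub>R w + y" unfolding X_def by auto
    from arg_cong[OF xy(3), of "\<lambda>z. a \<bullet> z"] have "2 * real i + a \<bullet> x = 2 * real j + a \<bullet> y"
      using aw(1) by (simp add: inner_add_right mult.commute)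
    moreover have "real i + 1 \<le> real j" using that by simp
    ultimately show False using ab[OF xy(1)] ab[OF xy(2)] by linarith
  qed
  have "real m * measure lebesgue T = (\<Sum>j<m. measure lebesgue (X j))" using Xm(2) by simp
  also have "\<dots> = measure lebesgue (\<Union>j<m. X j)"
  proof (rule measure_UNION'[symmetric])
    show "pairwise (\<lambda>i j. disjnt (X i) (X j)) {..<m}"
      unfolding pairwise_def disjnt_def using disj by (metis inf_commute linorder_neqE_nat)
  qed (use Xm in auto)
  also have "\<dots> \<le> (2 * (5 * h)) ^ CARD('n)"
  proof (rule measure_le_diameter)
    show "(\<Union>j<m. X j) \<in> lmeasurable" using Xm by (intro fmeasurable.finite_UN) auto
    fix u v assume "u \<in> (\<Union>j<m. X j)" "v \<in> (\<Union>j<m. X j)"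
    then obtain i j x y where ij: "i < m" "j < m" "x \<in> T" "y \<in> T" "u = real i *\<^sub>R w + x" "v = real j *\<^sub>R w + y"
      unfolding X_def by auto
    have "u - v = (real i - real j) *\<^sub>R w + (x - y)" unfolding ij by (simp add: algebra_simps)
    then have "norm (u - v) \<le> \<bar>real i - real j\<bar> * norm w + norm (x - y)"
      using norm_triangle_ineq[of "(real i - real j) *\<^sub>R w" "x - y"] by simp
    also have "\<dots> \<le> real m * norm w + h" using ij by (intro add_mono mult_right_mono h) auto
    also have "real m * norm w \<le> 2 * (norm a * h) * (2 / norm a)" unfolding aw(2) using m(2) by (intro mult_right_mono) auto
    also have "\<dots> = 4 * h" using a0 by simp
    finally show "norm (u - v) \<le> 5 * h" by simp
  qed (use h0 in auto)
  finally have "real m * measure lebesgue T \<le> (10 * h) ^ CARD('n)" by simp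
  moreover have "norm a * h * measure lebesgue T \<le> real m * measure lebesgue T"
    using m(1) by (intro mult_right_mono) auto
  ultimately show ?thesis by linarith
qed

text \<open>Contraction towards a point of the closure keeps a convex open set inside itself and
  scales its volume by \<open>e ^ n\<close>. This yields parts of an element with a definite share
  of its volume.\<close>

lemma measure_homothety:
  fixes T :: "(real^'n) set"
  assumes T: "open T" "convex T" "bounded T" and z: "z \<in> closure T" and e: "0 < e" "e \<le> 1"
    and sub: "\<And>x. x \<in> T \<Longrightarrow> z + e *\<^sub>R (x - z) \<in> A" and A: "A \<in> lmeasurable"
  shows "e ^ CARD('n) * measure lebesgue T \<le> measure lebesgue (T \<inter> A)"
proof -
  let ?f = "\<lambda>x. e *\<^sub>R x + (1 - e) *\<^sub>R z"
  have eq: "?f x = z + e *\<^sub>R (x - z)" for x by (simp add: algebra_simps)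
  have "?f ` T \<subseteq> T \<inter> A"
  proof safe
    fix x assume x: "x \<in> T"
    show "?f x \<in> A" unfolding eq by (rule sub[OF x])
    have "z - e *\<^sub>R (z - x) \<in> interior T"
      using mem_interior_closure_convex_shrink[OF T(2) _ z e, of x] x T(1) by (simp add: interior_open)
    then show "?f x \<in> T" unfolding eq using T(1) by (simp add: interior_open algebra_simps)
  qed
  moreover have "measure lebesgue (?f ` T) = e ^ CARD('n) * measure lebesgue T"
    using measure_lebesgue_affine[of e "(1 - e) *\<^sub>R z" T] e by simp
  moreover have "T \<in> lmeasurable" using T by (intro lmeasurable_open) auto
  moreover have "?f ` T \<in> sets lebesgue"
  proof -
    have "open (?f ` T)"
    proof -
      have "open ((\<lambda>x. (1 - e) *\<^sub>R z + e *\<^sub>R x) ` T)" by (rule open_affinity[OF T(1)]) (use e in auto)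
      then show ?thesis by (simp add: add.commute)
    qed
    then show ?thesis by auto
  qed
  ultimately show ?thesis
    using measure_mono_fmeasurable[of "?f ` T" "T \<inter> A" lebesgue] A by (metis fmeasurable.Int)
qed

subsection \<open>Lipschitz domains\<close>

lemma lipschitz_boundary_chart:
  assumes "lipschitz_boundary \<Omega>" "z \<in> frontier \<Omega>"
  shows "\<exists>U e g L. open U \<and> z \<in> U \<and> norm e = 1 \<and> L-lipschitz_on {y. y \<bullet> e = 0} g \<and>
    \<Omega> \<inter> U = {x \<in> U. (g (x - (x \<bullet> e) *\<^sub>R e) :: real) < x \<bullet> e}"
  by (rule bspec[OF assms(1)[unfolded lipschitz_boundary_def] assms(2)])

text \<open>Just below a boundary point, in the direction of the chart, there is an open set that
  misses \<Omega>. A mesh covers only the closure, and this fact places its open elements inside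
  \<Omega>.\<close>

lemma lipschitz_interior_closure:
  fixes \<Omega> :: "(real^'n) set"
  assumes "open \<Omega>" "lipschitz_boundary \<Omega>"
  shows "interior (closure \<Omega>) = \<Omega>"
proof
  show "\<Omega> \<subseteq> interior (closure \<Omega>)" using assms(1) closure_subset by (rule interior_maximal[rotated])
  show "interior (closure \<Omega>) \<subseteq> \<Omega>"
  proof (rule subsetI, rule ccontr)
    fix x assume x: "x \<in> interior (closure \<Omega>)" and "x \<notin> \<Omega>"
    then have "x \<in> frontier \<Omega>" using assms(1) interior_subset unfolding frontier_def by (auto simp: interior_open)
    from lipschitz_boundary_chart[OF assms(2) this] obtain U e g L
      where loc: "open U \<and> x \<in> U \<and> norm e = 1 \<and> L-lipschitz_on {y. y \<bullet> e = 0} g \<and>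
        \<Omega> \<inter> U = {x \<in> U. (g (x - (x \<bullet> e) *\<^sub>R e) :: real) < x \<bullet> e}"
      by (elim exE) (rule that)
    note U = conjunct1[OF loc] conjunct1[OF conjunct2[OF loc]] and chart = conjunct2[OF conjunct2[OF loc]]
    note e = conjunct1[OF chart] and g = conjunct1[OF conjunct2[OF chart]] and eq = conjunct2[OF conjunct2[OF chart]]
    define pr where "pr y = y - (y \<bullet> e) *\<^sub>R e" for y
    have ee: "e \<bullet> e = 1" using e by (simp add: dot_square_norm)
    have pre: "pr y \<bullet> e = 0" for y unfolding pr_def using ee by (simp add: inner_diff_left)
    have contg: "continuous_on UNIV (\<lambda>y. g (pr y))"
    proof (rule continuous_on_compose2[OF lipschitz_on_continuous_on[OF g]])
      show "continuous_on UNIV pr" unfolding pr_def by (intro continuous_intros)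
    qed (use pre in auto)
    have "open (U \<inter> interior (closure \<Omega>))" using U by auto
    then obtain t where t: "t > 0" "ball x t \<subseteq> U \<inter> interior (closure \<Omega>)"
      using x U(2) open_contains_ball by blast
    define y where "y = x - (t / 2) *\<^sub>R e"
    have y: "y \<in> ball x t" unfolding y_def using t e by (simp add: dist_norm)
    have "x \<bullet> e \<le> g (pr x)" using eq U(2) \<open>x \<notin> \<Omega>\<close> unfolding pr_def by force
    moreover have pyx: "pr y = pr x" unfolding pr_def y_def using ee by (simp add: algebra_simps inner_diff_left)
    moreover have "y \<bullet> e = x \<bullet> e - t / 2" unfolding y_def using ee by (simp add: inner_diff_left)
    ultimately have lt: "y \<bullet> e < g (pr y)" unfolding pyx using t(1) by linarith
    define W where "W = {w. w \<bullet> e < g (pr w)} \<inter> U"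
    have "open W" unfolding W_def
      by (intro open_Int U open_Collect_less contg continuous_intros)
    moreover have "y \<in> W" unfolding W_def using lt y t by blast
    moreover have "W \<inter> \<Omega> = {}" using eq unfolding W_def pr_def by force
    ultimately have "y \<notin> closure \<Omega>" using open_Int_closure_eq_empty by blast
    then show False using y t interior_subset by blast
  qed
qed

text \<open>At a boundary point \<open>U\<close> is a cylinder cut off below by the graph and above
  by a flat lid. Every point climbs vertically, without leaving \<open>U\<close>, into the convex
  slab \<open>Q\<close> under the lid.\<close>

lemma lipschitz_locally_connected:
  fixes \<Omega> :: "(real^'n) set"
  assumes "open \<Omega>" "lipschitz_boundary \<Omega>" "z \<in> closure \<Omega>" "\<rho> > 0"
  obtains U \<delta> where "open U" "connected U" "U \<subseteq> \<Omega> \<inter> ball z \<rho>" "\<delta> > 0" "\<Omega> \<inter> ball z \<delta> \<subseteq> U"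
proof (cases "z \<in> \<Omega>")
  case True
  then obtain \<delta> where d: "\<delta> > 0" "ball z \<delta> \<subseteq> \<Omega>" using assms(1) open_contains_ball by blast
  show ?thesis
    by (rule that[of "ball z (min \<delta> \<rho>)" "min \<delta> \<rho>"]) (use d assms(4) in \<open>auto simp: subset_iff\<close>)
next
  case False
  then have "z \<in> frontier \<Omega>" using assms unfolding frontier_def by (auto simp: interior_open)
  from lipschitz_boundary_chart[OF assms(2) this] obtain W e g L
    where loc: "open W \<and> z \<in> W \<and> norm e = 1 \<and> L-lipschitz_on {y. y \<bullet> e = 0} g \<and>
      \<Omega> \<inter> W = {x \<in> W. (g (x - (x \<bullet> e) *\<^sub>R e) :: real) < x \<bullet> e}"
    by (elim exE) (rule that)
  note W = conjunct1[OF loc] conjunct1[OF conjunct2[OF loc]] and chart = conjunct2[OF conjunct2[OF loc]]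
  note e = conjunct1[OF chart] and g = conjunct1[OF conjunct2[OF chart]] and eq = conjunct2[OF conjunct2[OF chart]]
  have L0: "L \<ge> 0" using g by (rule lipschitz_on_nonneg)
  define pr where "pr y = y - (y \<bullet> e) *\<^sub>R e" for y
  have ee: "e \<bullet> e = 1" using e by (simp add: dot_square_norm)
  have pre: "pr y \<bullet> e = 0" for y unfolding pr_def using ee by (simp add: inner_diff_left)
  have prl: "pr (x + c *\<^sub>R y) = pr x + c *\<^sub>R pr y" for x y c
    unfolding pr_def by (simp add: algebra_simps inner_add_left)
  have pre0: "pr e = 0" unfolding pr_def using ee by simp
  have prn: "norm (pr x - pr y) \<le> 2 * norm (x - y)" for x y
  proof -
    have "pr x - pr y = (x - y) - ((x - y) \<bullet> e) *\<^sub>R e" unfolding pr_def by (simp add: algebra_simps inner_diff_left)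
    also have "norm \<dots> \<le> norm (x - y) + \<bar>(x - y) \<bullet> e\<bar>" using norm_triangle_ineq4[of "x - y" "((x - y) \<bullet> e) *\<^sub>R e"] e by simp
    also have "\<bar>(x - y) \<bullet> e\<bar> \<le> norm (x - y)" using Cauchy_Schwarz_ineq2[of "x - y" e] e by simp
    finally show ?thesis by simp
  qed
  have contpr: "continuous_on UNIV pr" unfolding pr_def by (intro continuous_intros)
  have contg: "continuous_on UNIV (\<lambda>y. g (pr y))"
    by (rule continuous_on_compose2[OF lipschitz_on_continuous_on[OF g] contpr]) (use pre in auto)
  have gl: "\<bar>g (pr x) - g (pr y)\<bar> \<le> L * norm (pr x - pr y)" for x y
    using lipschitz_onD[OF g, of "pr x" "pr y"] pre by (simp add: dist_norm dist_real_def)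
  have gz: "g (pr z) = z \<bullet> e"
  proof (rule antisym)
    show "z \<bullet> e \<le> g (pr z)" using eq W(2) False unfolding pr_def by force
    show "g (pr z) \<le> z \<bullet> e"
    proof (rule ccontr)
      assume "\<not> g (pr z) \<le> z \<bullet> e"
      then have "z \<in> {w. w \<bullet> e < g (pr w)} \<inter> W" using W by auto
      moreover have "open ({w. w \<bullet> e < g (pr w)} \<inter> W)"
        by (intro open_Int W open_Collect_less contg continuous_intros)
      moreover have "({w. w \<bullet> e < g (pr w)} \<inter> W) \<inter> \<Omega> = {}" using eq unfolding pr_def by force
      ultimately show False using assms(3) open_Int_closure_eq_empty by blast
    qed
  qed
  obtain \<rho>' where \<rho>': "\<rho>' > 0" "ball z \<rho>' \<subseteq> W" using W open_contains_ball by blast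
  define \<sigma> where "\<sigma> = min \<rho> \<rho>' / 2"
  have \<sigma>: "\<sigma> > 0" "2 * \<sigma> \<le> \<rho>" "2 * \<sigma> \<le> \<rho>'" unfolding \<sigma>_def using assms(4) \<rho>' by auto
  \<comment> \<open>Over a base of this radius the graph varies by less than
    \<open>\<sigma> / 2\<close>, so it stays below the slab.\<close>
  define r where "r = \<sigma> / (2 * (L + 1))"
  have r: "r > 0" "L * r < \<sigma> / 2" "r \<le> \<sigma>" "L * r + r \<le> \<sigma>"
  proof -
    show "r > 0" unfolding r_def using \<sigma> L0 by simp
    have "(L + 1) * r = \<sigma> / 2" unfolding r_def using L0 by (simp add: field_simps)
    then have "L * r + r = \<sigma> / 2" by (simp add: algebra_simps)
    moreover have "L * r \<ge> 0" using L0 \<open>r > 0\<close> by simp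
    ultimately show "L * r < \<sigma> / 2" "r \<le> \<sigma>" "L * r + r \<le> \<sigma>" using \<open>r > 0\<close> \<sigma>(1) by linarith+
  qed
  define top where "top = z \<bullet> e + \<sigma>"
  define U where "U = {x. norm (pr x - pr z) < r \<and> g (pr x) < x \<bullet> e \<and> x \<bullet> e < top}"
  define Q where "Q = {x. norm (pr x - pr z) < r \<and> z \<bullet> e + \<sigma> / 2 < x \<bullet> e \<and> x \<bullet> e < top}"
  have gU: "g (pr x) < z \<bullet> e + \<sigma> / 2" "g (pr x) > z \<bullet> e - \<sigma> / 2" if "norm (pr x - pr z) < r" for x
  proof -
    have "\<bar>g (pr x) - g (pr z)\<bar> \<le> L * norm (pr x - pr z)" by (rule gl)
    also have "\<dots> \<le> L * r" using that L0 by (intro mult_left_mono) auto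
    finally show "g (pr x) < z \<bullet> e + \<sigma> / 2" "g (pr x) > z \<bullet> e - \<sigma> / 2" using gz r(2) by auto
  qed
  have QU: "Q \<subseteq> U" unfolding Q_def U_def using gU by force
  have "convex Q"
  proof -
    have "convex (pr -` ball (pr z) r)"
      by (rule convex_linear_vimage) (auto simp: linear_iff pr_def algebra_simps inner_add_left)
    moreover have "convex {x. z \<bullet> e + \<sigma> / 2 < x \<bullet> e}" "convex {x. x \<bullet> e < top}"
      using convex_halfspace_gt[of "z \<bullet> e + \<sigma> / 2" e] convex_halfspace_lt[of e top] by (simp_all add: inner_commute)
    moreover have "Q = pr -` ball (pr z) r \<inter> {x. z \<bullet> e + \<sigma> / 2 < x \<bullet> e} \<inter> {x. x \<bullet> e < top}"
      unfolding Q_def by (auto simp: dist_norm norm_minus_commute)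
    ultimately show ?thesis by (simp add: convex_Int)
  qed
  have vert: "\<exists>q\<in>Q. closed_segment x q \<subseteq> U" if x: "x \<in> U" for x
  proof -
    define m where "m = (max (x \<bullet> e) (z \<bullet> e + \<sigma> / 2) + top) / 2"
    have m: "x \<bullet> e < m" "z \<bullet> e + \<sigma> / 2 < m" "m < top"
      using x \<sigma>(1) unfolding m_def top_def U_def by (auto simp: max_def)
    define q where "q = x + (m - x \<bullet> e) *\<^sub>R e"
    have qe: "q \<bullet> e = m" "pr q = pr x" unfolding q_def using ee by (simp_all add: prl pre0 inner_add_left)
    have "q \<in> Q" using x m qe unfolding Q_def U_def by simp
    moreover have "closed_segment x q \<subseteq> U"
    proof
      fix y assume "y \<in> closed_segment x q"
      then obtain u where u: "0 \<le> u" "u \<le> 1" "y = (1 - u) *\<^sub>R x + u *\<^sub>R q" by (auto simp: in_segment)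
      then have y: "y = x + (u * (m - x \<bullet> e)) *\<^sub>R e" unfolding q_def by (simp add: algebra_simps)
      have py: "pr y = pr x" unfolding y by (simp add: prl pre0)
      have ye: "y \<bullet> e = x \<bullet> e + u * (m - x \<bullet> e)" unfolding y using ee by (simp add: inner_add_left)
      have "0 \<le> u * (m - x \<bullet> e)" "u * (m - x \<bullet> e) \<le> m - x \<bullet> e"
        using u m mult_right_mono[of u 1 "m - x \<bullet> e"] by auto
      then have "x \<bullet> e \<le> y \<bullet> e" "y \<bullet> e \<le> m" using ye by linarith+
      then show "y \<in> U" using x m py unfolding U_def by simp
    qed
    ultimately show ?thesis by blast
  qed
  show ?thesis
  \<comment> \<open>Half of \<open>r\<close>, because the bound for the projection \<open>pr\<close>
    has the Lipschitz constant 2.\<close>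
  proof (rule that[of U "r / 2"])
    have "U = {x. norm (pr x - pr z) < r} \<inter> {x. g (pr x) < x \<bullet> e} \<inter> {x. x \<bullet> e < top}" unfolding U_def by auto
    then show "open U" by (auto intro!: open_Int open_Collect_less continuous_intros contg contpr)
    show "connected U"
    proof (cases "U = {}")
      case False
      then obtain q0 where q0: "q0 \<in> Q" using vert by blast
      show ?thesis
      proof (rule path_connected_imp_connected, unfold path_connected_component, intro ballI)
        have comp: "path_component U x q0" if x: "x \<in> U" for x
        proof -
          obtain q where q: "q \<in> Q" "closed_segment x q \<subseteq> U" using vert[OF x] by blast
          have "closed_segment q q0 \<subseteq> U" using closed_segment_subset[OF q(1) q0 \<open>convex Q\<close>] QU by blast
          moreover have seg: "path_component U a b" if "closed_segment a b \<subseteq> U" for a b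
            unfolding path_component_def using that
            by (intro exI[of _ "linepath a b"]) auto
          ultimately show ?thesis using q(2) path_component_trans by blast
        qed
        fix x y assume "x \<in> U" "y \<in> U"
        then show "path_component U x y" using comp path_component_sym path_component_trans by metis
      qed
    qed simp
    have Ub: "x \<in> ball z (2 * \<sigma>)" if "x \<in> U" for x
    proof -
      have "x - z = (pr x - pr z) + ((x \<bullet> e) - (z \<bullet> e)) *\<^sub>R e" unfolding pr_def by (simp add: algebra_simps)
      then have "norm (x - z) \<le> norm (pr x - pr z) + \<bar>x \<bullet> e - z \<bullet> e\<bar>"
        using norm_triangle_ineq[of "pr x - pr z" "((x \<bullet> e) - (z \<bullet> e)) *\<^sub>R e"] e by simp
      moreover have "\<bar>x \<bullet> e - z \<bullet> e\<bar> < \<sigma>" using that gU[of x] \<sigma>(1) unfolding U_def top_def by auto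
      ultimately show ?thesis using that r(3) unfolding U_def by (simp add: dist_norm norm_minus_commute)
    qed
    show "U \<subseteq> \<Omega> \<inter> ball z \<rho>"
    proof
      fix x assume x: "x \<in> U"
      then have b: "x \<in> ball z \<rho>" "x \<in> W" using Ub[OF x] \<sigma> \<rho>' by auto
      have "x \<in> \<Omega> \<inter> W" unfolding eq using b x unfolding U_def pr_def by auto
      with b show "x \<in> \<Omega> \<inter> ball z \<rho>" by blast
    qed
    show "r / 2 > 0" using r by simp
    show "\<Omega> \<inter> ball z (r / 2) \<subseteq> U"
    proof
      fix x assume x: "x \<in> \<Omega> \<inter> ball z (r / 2)"
      then have n: "norm (x - z) < r / 2" by (simp add: dist_norm norm_minus_commute)
      then have "x \<in> W" using r \<sigma> \<rho>' by (auto simp: dist_norm norm_minus_commute subset_iff)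
      then have "g (pr x) < x \<bullet> e" using x eq unfolding pr_def by blast
      moreover have "norm (pr x - pr z) < r" using prn[of x z] n by linarith
      moreover have "x \<bullet> e < top"
      proof -
        have "\<bar>(x - z) \<bullet> e\<bar> \<le> norm (x - z)" using Cauchy_Schwarz_ineq2[of "x - z" e] e by simp
        then show ?thesis unfolding top_def using n r(1,3) by (simp add: inner_diff_left)
      qed
      ultimately show "x \<in> U" unfolding U_def by simp
    qed
  qed
qed

text \<open>Sets of codimension two do not disconnect: two points are joined by a path with two segments
  whose common end point avoids the null set of bad directions.\<close>

lemma negligible_lowdim_aff:
  fixes S :: "'a::euclidean_space set"
  assumes "aff_dim S < DIM('a)"
  shows "negligible S"
proof -
  obtain a b where "a \<noteq> 0" "S \<subseteq> {x. a \<bullet> x = b}" using assms by (rule aff_lowdim_subset_hyperplane)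
  then show ?thesis using negligible_hyperplane negligible_subset by blast
qed

lemma connected_convex_minus_affine:
  fixes C :: "(real^'n) set"
  assumes C: "convex C" "open C" and fin: "finite \<A>"
    and \<A>: "\<And>A. A \<in> \<A> \<Longrightarrow> affine A \<and> aff_dim A \<le> int CARD('n) - 2"
  shows "connected (C - \<Union>\<A>)"
proof (rule path_connected_imp_connected, unfold path_connected_component, intro ballI)
  fix x y assume x: "x \<in> C - \<Union>\<A>" and y: "y \<in> C - \<Union>\<A>"
  \<comment> \<open>Adding one point to an affine set of codimension at least two spans a proper
    affine subspace, hence a null set.\<close>
  define N where "N = (\<Union>A\<in>\<A>. affine hull (insert x A) \<union> affine hull (insert y A))"
  have neg: "negligible (affine hull (insert w A))" if "A \<in> \<A>" for w A
  proof (rule negligible_lowdim_aff)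
    show "aff_dim (affine hull (insert w A)) < DIM(real^'n)"
      using \<A>[OF that] by (simp add: aff_dim_insert)
  qed
  have "negligible N" unfolding N_def using fin neg by (intro negligible_Union) (auto intro: negligible_Un)
  moreover have "\<not> negligible C" using C x open_not_negligible by blast
  ultimately have "\<not> C \<subseteq> N" using negligible_subset by blast
  then obtain c where c: "c \<in> C" "c \<notin> N" by blast
  have seg: "closed_segment w c \<subseteq> C - \<Union>\<A>" if w: "w \<in> C - \<Union>\<A>" and cw: "\<And>A. A \<in> \<A> \<Longrightarrow> c \<notin> affine hull (insert w A)" for w
  proof
    fix q assume q: "q \<in> closed_segment w c"
    have "q \<in> C" using closed_segment_subset[OF _ c(1) C(1), of w] w q by blast
    moreover have "q \<notin> A" if A: "A \<in> \<A>" for A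
    proof
      assume qA: "q \<in> A"
      obtain u where u: "0 \<le> u" "u \<le> 1" "q = (1 - u) *\<^sub>R w + u *\<^sub>R c" using q by (auto simp: in_segment)
      have "u \<noteq> 0" using u qA w A by auto
      then have "(1 / u) *\<^sub>R q = ((1 - u) / u) *\<^sub>R w + c" unfolding u(3) by (simp add: scaleR_add_right)
      then have "(1 - 1 / u) *\<^sub>R w + (1 / u) *\<^sub>R q = ((1 - 1 / u) + (1 - u) / u) *\<^sub>R w + c"
        by (simp only: scaleR_add_left add.assoc)
      also have "(1 - 1 / u) + (1 - u) / u = 0" using \<open>u \<noteq> 0\<close> by (simp add: field_simps)
      finally have "c = (1 - 1 / u) *\<^sub>R w + (1 / u) *\<^sub>R q" by simp
      moreover have "w \<in> affine hull (insert w A)" "q \<in> affine hull (insert w A)" using qA by (auto intro: hull_inc)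
      ultimately have "c \<in> affine hull (insert w A)"
        using mem_affine[OF affine_affine_hull, of w "insert w A" q "1 - 1 / u" "1 / u"] by simp
      then show False using cw[OF A] by blast
    qed
    ultimately show "q \<in> C - \<Union>\<A>" by blast
  qed
  have path: "path_component (C - \<Union>\<A>) a b" if "closed_segment a b \<subseteq> C - \<Union>\<A>" for a b
    unfolding path_component_def using that by (intro exI[of _ "linepath a b"]) auto
  have "path_component (C - \<Union>\<A>) x c" "path_component (C - \<Union>\<A>) y c"
    using c(2) unfolding N_def by (blast intro: path[OF seg[OF x]] path[OF seg[OF y]])+
  then show "path_component (C - \<Union>\<A>) x y" using path_component_sym path_component_trans by metis
qed

text \<open>Every small ball remains connected after the removal, so it lies on one side of a
  supposed separation. The sides label the points of \<open>U\<close> by two open sets; these are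
  disjoint, as no ball is exhausted by a null set, and contradict the connectedness of
  \<open>U\<close>.\<close>

lemma connected_minus_affine:
  fixes U :: "(real^'n) set"
  assumes U: "connected U" "open U" and fin: "finite \<A>"
    and \<A>: "\<And>A. A \<in> \<A> \<Longrightarrow> affine A \<and> aff_dim A \<le> int CARD('n) - 2"
  shows "connected (U - \<Union>\<A>)"
proof (rule connectedI)
  fix P Q assume PQ: "open P" "open Q" "P \<inter> (U - \<Union>\<A>) \<noteq> {}" "Q \<inter> (U - \<Union>\<A>) \<noteq> {}"
    "P \<inter> Q \<inter> (U - \<Union>\<A>) = {}" "U - \<Union>\<A> \<subseteq> P \<union> Q"
  define X where "X P = {x \<in> U. \<exists>r>0. ball x r \<subseteq> U \<and> ball x r - \<Union>\<A> \<subseteq> P}" for P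
  have nonempty: "V - \<Union>\<A> \<noteq> {}" if "open V" "V \<noteq> {}" for V
  proof -
    have "negligible (\<Union>\<A>)"
    proof (rule negligible_Union[OF fin])
      fix A assume "A \<in> \<A>"
      then show "negligible A" using \<A>[of A] by (intro negligible_lowdim_aff) auto
    qed
    moreover have "\<not> negligible V" using that open_not_negligible by blast
    ultimately show ?thesis using negligible_subset by blast
  qed
  have oX: "open (X P)" for P
    unfolding open_contains_ball
  proof
    fix x assume "x \<in> X P"
    then obtain r where r: "x \<in> U" "r > 0" "ball x r \<subseteq> U" "ball x r - \<Union>\<A> \<subseteq> P" unfolding X_def by blast
    have "ball x r \<subseteq> X P"
    proof
      fix y assume y: "y \<in> ball x r"
      obtain s where s: "s > 0" "ball y s \<subseteq> ball x r" using openE[OF open_ball y] by blast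
      then show "y \<in> X P" unfolding X_def using r y by (intro CollectI conjI exI[of _ s]) auto
    qed
    then show "\<exists>e>0. ball x e \<subseteq> X P" using r by blast
  qed
  have cover: "U \<subseteq> X P \<union> X Q"
  proof
    fix x assume x: "x \<in> U"
    then obtain r where r: "r > 0" "ball x r \<subseteq> U" using U open_contains_ball by blast
    have "connected (ball x r - \<Union>\<A>)"
      by (rule connected_convex_minus_affine[OF convex_ball open_ball fin \<A>])
    then have "P \<inter> (ball x r - \<Union>\<A>) = {} \<or> Q \<inter> (ball x r - \<Union>\<A>) = {}"
      using connectedD[of "ball x r - \<Union>\<A>" P Q] PQ r by blast
    then show "x \<in> X P \<union> X Q" unfolding X_def using x r PQ(6) by blast
  qed
  have disj: "X P \<inter> X Q \<inter> U = {}"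
  proof (rule ccontr)
    assume "X P \<inter> X Q \<inter> U \<noteq> {}"
    then obtain x r s where xrs: "x \<in> U" "r > 0" "s > 0" "ball x r \<subseteq> U" "ball x r - \<Union>\<A> \<subseteq> P" "ball x s - \<Union>\<A> \<subseteq> Q"
      unfolding X_def by blast
    have "ball x (min r s) - \<Union>\<A> \<noteq> {}" by (rule nonempty) (use xrs in auto)
    then obtain w where "w \<in> ball x (min r s) - \<Union>\<A>" by blast
    then have "w \<in> P" "w \<in> Q" "w \<in> U - \<Union>\<A>" using xrs by auto
    then show False using PQ(5) by blast
  qed
  have ne: "X P \<inter> U \<noteq> {}" if P: "open P" "P \<inter> (U - \<Union>\<A>) \<noteq> {}" for P
  proof -
    obtain x where x: "x \<in> P" "x \<in> U" using P by blast
    then obtain r where "r > 0" "ball x r \<subseteq> P \<inter> U" using open_contains_ball[of "P \<inter> U"] P U by blast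
    then show ?thesis unfolding X_def using x by blast
  qed
  show False
    using connectedD[OF U(1) oX oX disj cover] ne PQ by blast
qed

subsection \<open>Meshes\<close>

text \<open>In a finite relation every chain can be shortened to at most as many links as the
  relation has pairs.\<close>

lemma rtrancl_increment_bound:
  fixes f :: "'a \<Rightarrow> real"
  assumes "finite R" "card R \<le> P" "(a, b) \<in> R\<^sup>*" "0 \<le> m"
    and "\<And>x y. (x, y) \<in> R \<Longrightarrow> \<bar>f x - f y\<bar> \<le> m"
  shows "\<bar>f a - f b\<bar> \<le> real P * m"
proof -
  obtain k where k: "k \<le> card R" "(a, b) \<in> R ^^ k"
    using assms(3) rtrancl_finite_eq_relpow[OF assms(1)] by auto
  have "(a, b) \<in> R ^^ k \<Longrightarrow> \<bar>f a - f b\<bar> \<le> real k * m" for a b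
  proof (induction k arbitrary: b)
    case (Suc k)
    then obtain c where "(a, c) \<in> R ^^ k" "(c, b) \<in> R" by auto
    then show ?case using Suc.IH[of c] assms(5)[of c b] by (simp add: algebra_simps)
  qed simp
  from this[OF k(2)] have "\<bar>f a - f b\<bar> \<le> real k * m" .
  also have "\<dots> \<le> real P * m" using k(1) assms(2,4) by (intro mult_right_mono) auto
  finally show ?thesis .
qed

lemma card_ge_2_obtain:
  assumes "card A \<ge> 2"
  obtains s t where "s \<in> A" "t \<in> A" "s \<noteq> t"
proof -
  have "finite A" using assms by (intro card_ge_0_finite) auto
  moreover have "\<not> card A \<le> Suc 0" using assms by auto
  ultimately show ?thesis using that card_le_Suc0_iff_eq[of A] by auto
qed

text \<open>\<open>\<kappa>\<close> bounds the gradients of barycentric coordinates in units of the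
  inverse diameter, and \<open>P\<close> bounds the number of ordered pairs of elements at a vertex.
  As parameters fixed by \<gamma> and the dimension they give constants that do not mention the
  mesh.\<close>

locale mesh =
  fixes \<Omega> :: "(real^'n) set" and \<T> :: "(real^'n) set set"
    and Tp Tm :: "(real^'n) set \<Rightarrow> (real^'n) set" and \<gamma> \<kappa> :: real and P :: nat
  assumes dim2: "CARD('n) \<ge> 2" and domain: "polyhedral_lipschitz_domain \<Omega>"
    and regular: "regular_mesh \<Omega> \<T>" and shape: "shape_regular \<gamma> \<T>"
    and labels: "facet_labelling \<Omega> \<T> Tp Tm"
    and kappa: "\<kappa> = 10 ^ CARD('n) * \<gamma>" and P: "P = (nat \<lceil>8 ^ CARD('n) * \<gamma>\<rceil>)\<^sup>2"
begin

abbreviation \<E> where "\<E> \<equiv> interior_facets \<Omega> \<T>"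
abbreviation h where "h \<equiv> diameter"
abbreviation vol where "vol \<equiv> measure lebesgue"

lemma \<Omega>_open: "open \<Omega>" and \<Omega>_bounded: "bounded \<Omega>" and \<Omega>_connected: "connected \<Omega>"
  and \<Omega>_nonempty: "\<Omega> \<noteq> {}" and \<Omega>_lipschitz: "lipschitz_boundary \<Omega>"
  using domain unfolding polyhedral_lipschitz_domain_def by auto

lemma interior_closure_\<Omega>: "interior (closure \<Omega>) = \<Omega>"
  by (rule lipschitz_interior_closure[OF \<Omega>_open \<Omega>_lipschitz])

lemma finite_mesh: "finite \<T>" and cover: "closure \<Omega> = (\<Union>T\<in>\<T>. closure T)"
  and triang: "triangulation (closure ` \<T>)"
  using regular unfolding regular_mesh_def by auto

lemma mesh_nonempty: "\<T> \<noteq> {}"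
  using cover \<Omega>_nonempty by auto

lemma elements_disjoint: "T \<in> \<T> \<Longrightarrow> T' \<in> \<T> \<Longrightarrow> T \<noteq> T' \<Longrightarrow> T \<inter> T' = {}"
  using regular unfolding regular_mesh_def pairwise_def disjnt_def by auto

lemma
  assumes "T \<in> \<T>"
  shows verts_full: "full_simplex_vertices (verts T)" and closure_hull: "closure T = convex hull (verts T)"
    and interior_hull: "T = interior (convex hull (verts T))" and open_T: "open T" and convex_T: "convex T"
    and nonempty_T: "T \<noteq> {}" and bounded_T: "bounded T"
  using open_simplex_verts[of T] assms regular unfolding regular_mesh_def by auto

lemmas finite_verts = full_finite[OF verts_full]

lemma card_verts: "T \<in> \<T> \<Longrightarrow> card (verts T) = Suc CARD('n)"
  using verts_full unfolding full_simplex_vertices_def by auto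

lemma mem_element_iff: "T \<in> \<T> \<Longrightarrow> x \<in> T \<longleftrightarrow> (\<forall>s\<in>verts T. bary (verts T) s x > 0)"
  using bary_pos_iff[OF verts_full] interior_hull by metis

lemma mem_closure_iff: "T \<in> \<T> \<Longrightarrow> x \<in> closure T \<longleftrightarrow> (\<forall>s\<in>verts T. bary (verts T) s x \<ge> 0)"
  using bary_nonneg_iff[OF verts_full] closure_hull by metis

lemma verts_in_closure: "s \<in> verts T \<Longrightarrow> s \<in> closure T"
  unfolding verts_def extreme_point_of_def by auto

lemma element_subset: "T \<in> \<T> \<Longrightarrow> T \<subseteq> \<Omega>"
proof -
  assume T: "T \<in> \<T>"
  have "T \<subseteq> closure T" by (rule closure_subset)
  also have "\<dots> \<subseteq> closure \<Omega>" using T cover by auto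
  finally have "T \<subseteq> interior (closure \<Omega>)" using open_T[OF T] by (rule interior_maximal)
  then show "T \<subseteq> \<Omega>" unfolding interior_closure_\<Omega> .
qed

lemma element_lmeasurable: "T \<in> \<T> \<Longrightarrow> T \<in> lmeasurable"
  using open_T bounded_T by (intro lmeasurable_open) auto

lemma vol_pos: "T \<in> \<T> \<Longrightarrow> vol T > 0"
proof -
  assume T: "T \<in> \<T>"
  have "\<not> negligible T" using open_not_negligible[OF open_T[OF T] nonempty_T[OF T]] .
  then have "vol T \<noteq> 0" using negligible_iff_measure0 element_lmeasurable[OF T] by blast
  then show "vol T > 0" using measure_nonneg[of lebesgue T] by linarith
qed

lemma norm_le_h: "T \<in> \<T> \<Longrightarrow> x \<in> closure T \<Longrightarrow> y \<in> closure T \<Longrightarrow> norm (x - y) \<le> h T"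
  using diameter_bounded_bound[OF bounded_closure[OF bounded_T], of T x y] bounded_T[of T]
  by (simp add: diameter_closure dist_norm)

lemma h_pos: "T \<in> \<T> \<Longrightarrow> h T > 0"
proof -
  assume T: "T \<in> \<T>"
  have "card (verts T) \<ge> 2" using card_verts[OF T] by simp
  then obtain s t where st: "s \<in> verts T" "t \<in> verts T" "s \<noteq> t"
    by (rule card_ge_2_obtain)
  then have "norm (s - t) \<le> h T" using norm_le_h[OF T] verts_in_closure by blast
  moreover have "norm (s - t) > 0" using st by simp
  ultimately show "h T > 0" by linarith
qed

lemma h_le_vol: "T \<in> \<T> \<Longrightarrow> h T ^ CARD('n) \<le> \<gamma> * vol T"
  using shape vol_pos[of T] unfolding shape_regular_def by (auto simp: pos_divide_le_eq)

lemma vol_le_h: "T \<in> \<T> \<Longrightarrow> vol T \<le> (2 * h T) ^ CARD('n)"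
  using norm_le_h closure_subset h_pos less_imp_le
  by (intro measure_le_diameter element_lmeasurable) blast+

text \<open>The upper bound of the volume by the diameter and the lower bound by shape regularity
  are compatible only for \<gamma> that is not too small; this later gives
  \<open>\<kappa> \<ge> 1\<close>.\<close>

lemma gamma: "\<gamma> > 0" "1 \<le> 2 ^ CARD('n) * \<gamma>"
proof -
  obtain T where T: "T \<in> \<T>" using mesh_nonempty by blast
  have hp: "h T ^ CARD('n) > 0" using h_pos[OF T] by simp
  then have "0 < \<gamma> * vol T" using h_le_vol[OF T] by linarith
  then show g: "\<gamma> > 0" using vol_pos[OF T] by (simp add: zero_less_mult_iff)
  have "h T ^ CARD('n) \<le> \<gamma> * (2 * h T) ^ CARD('n)"
    using h_le_vol[OF T] mult_left_mono[OF vol_le_h[OF T], of \<gamma>] g by linarith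
  then have "1 * h T ^ CARD('n) \<le> (2 ^ CARD('n) * \<gamma>) * h T ^ CARD('n)"
    by (simp add: power_mult_distrib mult_ac)
  then show "1 \<le> 2 ^ CARD('n) * \<gamma>" using hp mult_le_cancel_right_pos by blast
qed

lemma kappa_ge_1: "\<kappa> \<ge> 1"
proof -
  have "(2::real) ^ CARD('n) \<le> 10 ^ CARD('n)" by (intro power_mono) auto
  then have "2 ^ CARD('n) * \<gamma> \<le> \<kappa>" unfolding kappa using gamma by (intro mult_right_mono) auto
  then show ?thesis using gamma by linarith
qed

text \<open>A steep coordinate confines the element to a thin slab, which shape regularity excludes.
  The factor \<open>10 ^ n\<close> in \<open>\<kappa>\<close> is that of the slab estimate.\<close>

lemma bary_grad_bound:
  assumes T: "T \<in> \<T>" and s: "s \<in> verts T"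
  shows "norm (bary_grad (verts T) s) * h T \<le> \<kappa>"
proof (cases "norm (bary_grad (verts T) s) * h T \<ge> 1")
  case True
  have "norm (bary_grad (verts T) s) * h T * vol T \<le> (10 * h T) ^ CARD('n)"
  proof (rule measure_slab[OF element_lmeasurable[OF T] nonempty_T[OF T], where b = "snd (bary_coeffs (verts T) s)"])
    fix x assume x: "x \<in> T"
    then have xh: "x \<in> convex hull (verts T)" using closure_hull[OF T] closure_subset by blast
    show "0 \<le> bary_grad (verts T) s \<bullet> x + snd (bary_coeffs (verts T) s)"
      using bary_nonneg_iff[OF verts_full[OF T], of x] xh s unfolding bary_def by auto
    show "bary_grad (verts T) s \<bullet> x + snd (bary_coeffs (verts T) s) \<le> 1"
      using bary_le_1[OF verts_full[OF T] xh s] unfolding bary_def .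
  next
    fix x y assume "x \<in> T" "y \<in> T"
    then show "norm (x - y) \<le> h T" using norm_le_h[OF T] closure_subset by blast
  qed (rule True)
  also have "\<dots> = 10 ^ CARD('n) * h T ^ CARD('n)" by (simp add: power_mult_distrib)
  also have "\<dots> \<le> 10 ^ CARD('n) * (\<gamma> * vol T)" using h_le_vol[OF T] by (intro mult_left_mono) auto
  finally have "(norm (bary_grad (verts T) s) * h T) * vol T \<le> \<kappa> * vol T" unfolding kappa by (simp add: mult_ac)
  then show ?thesis using vol_pos[OF T] mult_le_cancel_right_pos by blast
next
  case False
  then show ?thesis using kappa_ge_1 by linarith
qed

text \<open>The coordinate of \<open>s\<close> drops from 1 to 0 between the two vertices, with a
  slope of at most \<open>\<kappa> / h T\<close>.\<close>

lemma vertex_distance: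
  assumes T: "T \<in> \<T>" and st: "s \<in> verts T" "t \<in> verts T" "s \<noteq> t"
  shows "h T \<le> \<kappa> * norm (s - t)"
proof -
  have "1 = bary (verts T) s s - bary (verts T) s t"
    using bary_vertex[OF verts_full[OF T]] st by simp
  also have "\<dots> \<le> norm (bary_grad (verts T) s) * norm (s - t)"
    unfolding bary_diff by (rule norm_cauchy_schwarz)
  finally have "h T * 1 \<le> h T * (norm (bary_grad (verts T) s) * norm (s - t))"
    using h_pos[OF T] by (intro mult_left_mono) auto
  also have "\<dots> = (norm (bary_grad (verts T) s) * h T) * norm (s - t)" by simp
  also have "\<dots> \<le> \<kappa> * norm (s - t)" by (intro mult_right_mono bary_grad_bound T st) auto
  finally show ?thesis by simp
qed

lemma h_comparable:
  assumes "T \<in> \<T>" "T' \<in> \<T>" "s \<in> verts T" "t \<in> verts T" "s \<noteq> t" "s \<in> verts T'" "t \<in> verts T'"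
  shows "h T \<le> \<kappa> * h T'"
proof -
  have "h T \<le> \<kappa> * norm (s - t)" using vertex_distance assms by blast
  also have "\<dots> \<le> \<kappa> * h T'"
    using kappa_ge_1 norm_le_h[OF assms(2)] verts_in_closure assms by (intro mult_left_mono) auto
  finally show ?thesis .
qed

lemma vol_element_Int_ball:
  assumes T: "T \<in> \<T>" and z: "z \<in> closure T" and r: "0 < r" "r \<le> h T"
  shows "(r / 2) ^ CARD('n) / \<gamma> \<le> vol (T \<inter> ball z r)"
proof -
  \<comment> \<open>The additional factor 2 keeps the contracted copy strictly inside the open
    ball.\<close>
  define e where "e = r / (2 * h T)"
  have e: "0 < e" "e \<le> 1" "e * h T = r / 2" unfolding e_def using r by (auto simp: field_simps)
  have "e ^ CARD('n) * vol T \<le> vol (T \<inter> ball z r)"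
  proof (rule measure_homothety[OF open_T[OF T] convex_T[OF T] bounded_T[OF T] z e(1,2)])
    fix x assume "x \<in> T"
    then have "norm (x - z) \<le> h T" using norm_le_h[OF T _ z] closure_subset by blast
    then have "e * norm (x - z) \<le> e * h T" using e by (intro mult_left_mono) auto
    then have "e * norm (x - z) \<le> r / 2" unfolding e(3) .
    then show "z + e *\<^sub>R (x - z) \<in> ball z r" using e r by (simp add: dist_norm)
  qed auto
  moreover have "(r / 2) ^ CARD('n) / \<gamma> \<le> e ^ CARD('n) * vol T"
  proof -
    have "(r / 2) ^ CARD('n) = e ^ CARD('n) * h T ^ CARD('n)" unfolding e(3)[symmetric] by (rule power_mult_distrib)
    also have "\<dots> \<le> e ^ CARD('n) * (\<gamma> * vol T)" using h_le_vol[OF T] e by (intro mult_left_mono) auto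
    finally show ?thesis using gamma by (simp add: field_simps)
  qed
  ultimately show ?thesis by linarith
qed

lemma closure_Int_face: "T \<in> \<T> \<Longrightarrow> T' \<in> \<T> \<Longrightarrow> closure T \<inter> closure T' face_of closure T"
  using triang unfolding triangulation_def by auto

text \<open>By conformity the common part is a face of both closed elements, and extreme points of a
  face are those of the element that lie in it.\<close>

lemma shared_vertex:
  assumes "T \<in> \<T>" "T' \<in> \<T>" "s \<in> verts T" "s \<in> closure T'"
  shows "s \<in> verts T'"
proof -
  have f: "closure T \<inter> closure T' face_of closure T" "closure T \<inter> closure T' face_of closure T'"
    using closure_Int_face[OF assms(1,2)] closure_Int_face[OF assms(2,1)] by (simp_all add: Int_commute)
  have "s extreme_point_of (closure T \<inter> closure T')"
    using extreme_point_of_face[OF f(1)] assms verts_in_closure unfolding verts_def by auto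
  then show ?thesis using extreme_point_of_face[OF f(2)] unfolding verts_def by auto
qed

text \<open>A face of a simplex is the hull of some of its vertices, and these belong to the other
  element as well.\<close>

lemma closure_Int:
  assumes T: "T \<in> \<T>" "T' \<in> \<T>"
  shows "closure T \<inter> closure T' = convex hull (verts T \<inter> verts T')"
proof
  have "closure T \<inter> closure T' face_of convex hull (verts T)"
    using closure_Int_face[OF T] closure_hull[OF T(1)] by simp
  then obtain c where c: "c \<subseteq> verts T" "closure T \<inter> closure T' = convex hull c"
    using face_of_convex_hull_subset[OF finite_imp_compact[OF finite_verts[OF T(1)]]] by metis
  have "c \<subseteq> verts T'"
  proof
    fix s assume s: "s \<in> c"
    then have "s \<in> closure T'" using c(2) hull_inc[of s c convex] by auto
    then show "s \<in> verts T'" using shared_vertex[OF T] s c(1) by blast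
  qed
  then show "closure T \<inter> closure T' \<subseteq> convex hull (verts T \<inter> verts T')"
    unfolding c(2) using c(1) by (intro hull_mono) auto
  show "convex hull (verts T \<inter> verts T') \<subseteq> closure T \<inter> closure T'"
    using T closure_hull hull_mono[of "verts T \<inter> verts T'" "verts T" convex]
      hull_mono[of "verts T \<inter> verts T'" "verts T'" convex] by auto
qed

text \<open>On the common face both sums involve only the shared vertices, with the same weights.
  This is the continuity of piecewise affine functions across elements.\<close>

lemma nodal_consistent:
  assumes T: "T \<in> \<T>" "T' \<in> \<T>" and x: "x \<in> closure T" "x \<in> closure T'"
  shows "(\<Sum>s\<in>verts T. U s * bary (verts T) s x) = (\<Sum>s\<in>verts T'. U s * bary (verts T') s x)"
proof -
  let ?V = "verts T \<inter> verts T'"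
  have fin: "finite ?V" using finite_verts T by auto
  have "x \<in> convex hull ?V" using closure_Int[OF T] x by blast
  then obtain u where u: "sum u ?V = 1" "(\<Sum>s\<in>?V. u s *\<^sub>R s) = x"
    using fin by (auto simp: convex_hull_finite)
  have "(\<Sum>s\<in>verts R. U s * bary (verts R) s x) = (\<Sum>s\<in>?V. U s * u s)" if R: "R \<in> \<T>" "?V \<subseteq> verts R" for R
  proof -
    have "bary (verts R) s x = (if s \<in> ?V then u s else 0)" if "s \<in> verts R" for s
      using bary_combination[OF verts_full[OF R(1)] u(1) R(2) that] unfolding u(2) .
    then have "(\<Sum>s\<in>verts R. U s * bary (verts R) s x) = (\<Sum>s\<in>verts R. if s \<in> ?V then U s * u s else 0)"
      by (intro sum.cong) auto
    also have "\<dots> = (\<Sum>s\<in>verts R \<inter> ?V. U s * u s)"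
      using finite_verts[OF R(1)] by (subst sum.inter_restrict) auto
    also have "verts R \<inter> ?V = ?V" using R(2) by blast
    finally show ?thesis .
  qed
  from this[OF T(1)] this[OF T(2)] show ?thesis by simp
qed

lemma element_eqI: "T \<in> \<T> \<Longrightarrow> T' \<in> \<T> \<Longrightarrow> verts T = verts T' \<Longrightarrow> T = T'"
  using interior_hull by metis

section \<open>Adjacent elements\<close>

definition adj where
  "adj T T' \<longleftrightarrow> T \<in> \<T> \<and> T' \<in> \<T> \<and> T \<noteq> T' \<and> card (verts T \<inter> verts T') = CARD('n)"

lemma card_Int_verts:
  assumes "T \<in> \<T>" "T' \<in> \<T>" "T \<noteq> T'"
  shows "card (verts T \<inter> verts T') \<le> CARD('n)"
proof (rule ccontr)
  assume "\<not> card (verts T \<inter> verts T') \<le> CARD('n)"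
  then have ge: "card (verts T) \<le> card (verts T \<inter> verts T')" "card (verts T') \<le> card (verts T \<inter> verts T')"
    using card_verts assms by auto
  have "verts T \<inter> verts T' = verts T" "verts T \<inter> verts T' = verts T'"
    using card_seteq[OF finite_verts[OF assms(1)] Int_lower1 ge(1)]
      card_seteq[OF finite_verts[OF assms(2)] Int_lower2 ge(2)] by auto
  then show False using element_eqI assms by metis
qed

text \<open>The coordinates of the two opposite vertices both vanish on the shared ones, hence are
  proportional. A positive factor would put both elements on the same side, and they would overlap
  near the barycentre \<open>z\<close> of the facet.\<close>

lemma adj_opposite:
  assumes "adj T T'"
  obtains p p' c where "verts T = insert p (verts T \<inter> verts T')" "verts T' = insert p' (verts T \<inter> verts T')"
    "p \<notin> verts T'" "p' \<notin> verts T" "c < 0" "\<And>x. bary (verts T') p' x = c * bary (verts T) p x"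
proof -
  let ?V = "verts T \<inter> verts T'" and ?S = "verts T" and ?S' = "verts T'"
  have T: "T \<in> \<T>" "T' \<in> \<T>" "T \<noteq> T'" and V: "card ?V = CARD('n)" using assms unfolding adj_def by auto
  note S = verts_full[OF T(1)] and S' = verts_full[OF T(2)]
  have finV: "finite ?V" using finite_verts T by auto
  have "card (?S - ?V) = 1" "card (?S' - ?V) = 1"
    using card_Diff_subset[OF finV, of ?S] card_Diff_subset[OF finV, of ?S'] V card_verts T by auto
  then obtain p p' where pp: "?S - ?V = {p}" "?S' - ?V = {p'}" by (auto simp: card_1_singleton_iff)
  have p: "?S = insert p ?V" "?S' = insert p' ?V" "p \<notin> ?S'" "p' \<notin> ?S" "p \<in> ?S" "p' \<in> ?S'" using pp by auto
  define c where "c = bary ?S' p' p"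
  have eq: "bary ?S' p' x = c * bary ?S p x" for x
  proof -
    have "bary ?S' p' x = bary ?S' p' (\<Sum>s\<in>?S. bary ?S s x *\<^sub>R s)" using bary_representation[OF S] by simp
    also have "\<dots> = (\<Sum>s\<in>?S. bary ?S s x * bary ?S' p' s)"
      unfolding bary_def[of ?S'] by (rule affine_combination[OF S bary_sum[OF S]])
    also have "\<dots> = (\<Sum>s\<in>?S. if s = p then bary ?S p x * c else 0)"
    proof (rule sum.cong[OF refl])
      fix s assume s: "s \<in> ?S"
      show "bary ?S s x * bary ?S' p' s = (if s = p then bary ?S p x * c else 0)"
      proof (cases "s = p")
        case False
        then have "s \<in> ?S'" "s \<noteq> p'" using s p by auto
        then show ?thesis using bary_vertex[OF S' p(6)] False by simp
      qed (simp add: c_def)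
    qed
    also have "\<dots> = c * bary ?S p x" using p(5) finite_verts[OF T(1)] by (simp add: mult.commute)
    finally show ?thesis .
  qed
  have n: "real CARD('n) > 0" by simp
  define z where "z = (\<Sum>s\<in>?V. (1 / real CARD('n)) *\<^sub>R s)"
  have u1: "(\<Sum>s\<in>?V. 1 / real CARD('n)) = 1" using V by simp
  have zS: "bary ?S k z = (if k \<in> ?V then 1 / real CARD('n) else 0)" if "k \<in> ?S" for k
    unfolding z_def by (rule bary_combination[OF S u1 _ that]) auto
  have zS': "bary ?S' k z = (if k \<in> ?V then 1 / real CARD('n) else 0)" if "k \<in> ?S'" for k
    unfolding z_def by (rule bary_combination[OF S' u1 _ that]) auto
  have line: "bary A k (z + e *\<^sub>R (p - z)) = bary A k z + e * (bary A k p - bary A k z)" for A k e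
    using bary_diff[of A k "z + e *\<^sub>R (p - z)" z] bary_diff[of A k p z] by simp
  have "c < 0"
  proof (rule ccontr)
    assume "\<not> c < 0"
    moreover have "c \<noteq> 0" using eq[of p'] bary_vertex[OF S' p(6) p(6)] by auto
    ultimately have "c > 0" by simp
    define D where "D = 1 + (\<Sum>k\<in>?V. \<bar>bary ?S' k p - 1 / real CARD('n)\<bar>)"
    have D: "D \<ge> 1" "\<And>k. k \<in> ?V \<Longrightarrow> \<bar>bary ?S' k p - 1 / real CARD('n)\<bar> \<le> D"
    proof -
      show "D \<ge> 1" unfolding D_def by (simp add: sum_nonneg)
      fix k assume "k \<in> ?V"
      then have "\<bar>bary ?S' k p - 1 / real CARD('n)\<bar> \<le> (\<Sum>k\<in>?V. \<bar>bary ?S' k p - 1 / real CARD('n)\<bar>)"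
        using finV by (intro member_le_sum) auto
      then show "\<bar>bary ?S' k p - 1 / real CARD('n)\<bar> \<le> D" unfolding D_def by linarith
    qed
    \<comment> \<open>\<open>D\<close> bounds how fast the coordinates of the shared vertices change
      on the way from \<open>z\<close> to \<open>p\<close>; with this step they stay at least half
      of their initial value \<open>1 / n\<close>.\<close>
    define e where "e = 1 / (2 * real CARD('n) * D)"
    have e: "0 < e" "e < 1" "e * D = 1 / (2 * real CARD('n))"
    proof -
      show "0 < e" "e * D = 1 / (2 * real CARD('n))" unfolding e_def using D(1) n by (auto simp: field_simps)
      have "1 * 1 \<le> real CARD('n) * D" by (intro mult_mono) (use D(1) n in \<open>auto simp: Suc_leI\<close>)
      then show "e < 1" unfolding e_def by (simp add: field_simps)
    qed
    define x where "x = z + e *\<^sub>R (p - z)"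
    have px: "bary ?S p x = e" unfolding x_def line using zS[OF p(5)] p bary_vertex[OF S p(5) p(5)] by simp
    have "x \<in> T"
      unfolding mem_element_iff[OF T(1)]
    proof
      fix k assume k: "k \<in> ?S"
      show "0 < bary ?S k x"
      proof (cases "k = p")
        case True then show ?thesis using px e by simp
      next
        case False
        then have kV: "k \<in> ?V" using k p by auto
        have "bary ?S k p = 0" using bary_vertex[OF S k p(5)] False by auto
        then have "bary ?S k x = (1 - e) / real CARD('n)"
          unfolding x_def line using zS[OF k] kV by (simp add: diff_divide_distrib)
        then show ?thesis using e n by simp
      qed
    qed
    moreover have "x \<in> T'"
      unfolding mem_element_iff[OF T(2)]
    proof
      fix k assume k: "k \<in> ?S'"
      show "0 < bary ?S' k x"
      proof (cases "k = p'")
        case True then show ?thesis using eq px e \<open>c > 0\<close> by simp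
      next
        case False
        then have kV: "k \<in> ?V" using k p by auto
        have "\<bar>e * (bary ?S' k p - 1 / real CARD('n))\<bar> \<le> e * D"
          unfolding abs_mult using mult_left_mono[OF D(2)[OF kV], of e] e(1) by simp
        moreover have "1 / (2 * real CARD('n)) < 1 / real CARD('n)" using n by (simp add: field_simps)
        ultimately show ?thesis unfolding x_def line using zS'[OF k] kV e(3) by auto
      qed
    qed
    ultimately show False using elements_disjoint T by blast
  qed
  with p eq show ?thesis by (intro that) auto
qed

lemma adj_sym: "adj T T' \<Longrightarrow> adj T' T"
  unfolding adj_def by (auto simp: Int_commute)

text \<open>Of three elements on one facet, two would have to lie on the same side of its
  hyperplane, against the sign in \<open>adj_opposite\<close>.\<close>

lemma shared_facet_two:
  assumes "V \<subseteq> verts T" "V \<subseteq> verts T1" "V \<subseteq> verts T2" "card V = CARD('n)"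
    and "T \<in> \<T>" "T1 \<in> \<T>" "T2 \<in> \<T>" "T \<noteq> T1" "T \<noteq> T2"
  shows "T1 = T2"
proof (rule ccontr)
  assume "T1 \<noteq> T2"
  have int: "verts A \<inter> verts B = V" "adj A B"
    if "A \<in> \<T>" "B \<in> \<T>" "A \<noteq> B" "V \<subseteq> verts A" "V \<subseteq> verts B" for A B
  proof -
    have "card (verts A \<inter> verts B) \<le> card V" using card_Int_verts[OF that(1-3)] assms(4) by simp
    then show "verts A \<inter> verts B = V"
      using card_seteq[of "verts A \<inter> verts B" V] finite_verts[OF that(1)] that by auto
    then show "adj A B" using that assms(4) unfolding adj_def by simp
  qed
  note i1 = int[OF assms(5,6,8,1,2)] and i2 = int[OF assms(5,7,9,1,3)] and i3 = int[OF assms(6,7) \<open>T1 \<noteq> T2\<close> assms(2,3)]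
  obtain p p1 c1 where 1: "verts T = insert p V" "verts T1 = insert p1 V" "p \<notin> verts T1" "p1 \<notin> verts T" "c1 < 0"
    "\<And>x. bary (verts T1) p1 x = c1 * bary (verts T) p x" using adj_opposite[OF i1(2)] i1(1) by metis
  obtain q p2 c2 where 2: "verts T = insert q V" "verts T2 = insert p2 V" "q \<notin> verts T2" "p2 \<notin> verts T" "c2 < 0"
    "\<And>x. bary (verts T2) p2 x = c2 * bary (verts T) q x" using adj_opposite[OF i2(2)] i2(1) by metis
  obtain q1 q2 c3 where 3: "verts T1 = insert q1 V" "verts T2 = insert q2 V" "q1 \<notin> verts T2" "q2 \<notin> verts T1" "c3 < 0"
    "\<And>x. bary (verts T2) q2 x = c3 * bary (verts T1) q1 x" using adj_opposite[OF i3(2)] i3(1) by metis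
  have q: "q = p" "q1 = p1" "q2 = p2" using 1 2 3 by auto
  have b1: "bary (verts T1) p1 p1 = 1" using bary_vertex[OF verts_full[OF assms(6)], of p1 p1] 1(2) by simp
  then have "bary (verts T) p p1 < 0" using 1(5) 1(6)[of p1] by (smt (verit) mult_nonpos_nonneg)
  then have "bary (verts T2) p2 p1 > 0" using 2(5) 2(6)[of p1] q mult_neg_neg by simp
  moreover have "bary (verts T2) p2 p1 = c3" using 3(6)[of p1] q b1 by simp
  ultimately show False using 3(5) by simp
qed

text \<open>From dimension two on a facet has two vertices, so the elements have an edge in common,
  and its length is comparable to both diameters.\<close>

lemma adj_h:
  assumes "adj T T'" shows "h T \<le> \<kappa> * h T'"
proof -
  have T: "T \<in> \<T>" "T' \<in> \<T>" and "card (verts T \<inter> verts T') \<ge> 2" using assms dim2 unfolding adj_def by auto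
  from this(3) obtain s t where "s \<in> verts T \<inter> verts T'" "t \<in> verts T \<inter> verts T'" "s \<noteq> t"
    by (rule card_ge_2_obtain)
  then show ?thesis using h_comparable[OF T] by blast
qed

text \<open>At the barycentre of the facet the coordinates of the shared vertices equal
  \<open>1 / n\<close>, and they remain positive nearby. The sign of the one remaining coordinate
  then decides which closed element contains a point. Of the two factors \<open>\<kappa>\<close> in
  the radius, one bounds the gradients, the other compares the diameters.\<close>

lemma adj_ball:
  assumes "adj T T'"
  obtains z where "z \<in> closure T" "z \<in> closure T'"
    "ball z (h T / (2 * real CARD('n) * \<kappa>\<^sup>2)) \<subseteq> closure T \<union> closure T'"
proof -
  obtain p p' c where p: "verts T = insert p (verts T \<inter> verts T')" "verts T' = insert p' (verts T \<inter> verts T')"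
    "p \<notin> verts T'" "p' \<notin> verts T" "c < 0" "\<And>x. bary (verts T') p' x = c * bary (verts T) p x"
    using adj_opposite[OF assms] by metis
  let ?V = "verts T \<inter> verts T'" and ?n = "real CARD('n)"
  define r where "r = h T / (2 * ?n * \<kappa>\<^sup>2)"
  have T: "T \<in> \<T>" "T' \<in> \<T>" and V: "card ?V = CARD('n)" using assms unfolding adj_def by auto
  note S = verts_full[OF T(1)] and S' = verts_full[OF T(2)]
  have n: "?n > 0" by simp
  define z where "z = (\<Sum>s\<in>?V. (1 / ?n) *\<^sub>R s)"
  have u1: "(\<Sum>s\<in>?V. 1 / ?n) = 1" using V by simp
  have zS: "bary (verts T) k z = (if k \<in> ?V then 1 / ?n else 0)" if "k \<in> verts T" for k
    unfolding z_def by (rule bary_combination[OF S u1 _ that]) auto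
  have zS': "bary (verts T') k z = (if k \<in> ?V then 1 / ?n else 0)" if "k \<in> verts T'" for k
    unfolding z_def by (rule bary_combination[OF S' u1 _ that]) auto
  have z: "z \<in> closure T" "z \<in> closure T'"
    unfolding mem_closure_iff[OF T(1)] mem_closure_iff[OF T(2)] using zS zS' n by auto
  have near: "bary (verts R) k x > 0"
    if R: "R \<in> \<T>" "h T \<le> \<kappa> * h R" "k \<in> verts R" and zk: "bary (verts R) k z = 1 / ?n" and x: "x \<in> ball z r" for R k x
  proof -
    have "\<bar>bary (verts R) k x - bary (verts R) k z\<bar> \<le> norm (bary_grad (verts R) k) * norm (x - z)"
      unfolding bary_diff by (rule Cauchy_Schwarz_ineq2)
    also have "\<dots> \<le> norm (bary_grad (verts R) k) * r"
      using x by (intro mult_left_mono) (auto simp: dist_norm norm_minus_commute)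
    also have "\<dots> = norm (bary_grad (verts R) k) * h T / (2 * ?n * \<kappa>\<^sup>2)" unfolding r_def by simp
    also have "\<dots> \<le> norm (bary_grad (verts R) k) * (\<kappa> * h R) / (2 * ?n * \<kappa>\<^sup>2)"
      using R(2) n by (intro divide_right_mono mult_left_mono) auto
    also have "\<dots> = \<kappa> * (norm (bary_grad (verts R) k) * h R) / (2 * ?n * \<kappa>\<^sup>2)" by simp
    also have "\<dots> \<le> \<kappa> * \<kappa> / (2 * ?n * \<kappa>\<^sup>2)"
      using bary_grad_bound[OF R(1,3)] kappa_ge_1 n by (intro divide_right_mono mult_left_mono) auto
    also have "\<dots> = 1 / (2 * ?n)" using kappa_ge_1 by (simp add: power2_eq_square)
    also have "\<dots> < 1 / ?n" using n by (simp add: field_simps)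
    finally show ?thesis unfolding zk by linarith
  qed
  have "h T \<le> \<kappa> * h T" using kappa_ge_1 h_pos[OF T(1)] by simp
  note nT = near[OF T(1) this] and nT' = near[OF T(2) adj_h[OF assms]]
  have "ball z r \<subseteq> closure T \<union> closure T'"
  proof
    fix x assume x: "x \<in> ball z r"
    show "x \<in> closure T \<union> closure T'"
    proof (cases "bary (verts T) p x \<ge> 0")
      case True
      have "bary (verts T) k x \<ge> 0" if k: "k \<in> verts T" for k
      proof (cases "k = p")
        case False
        then have "k \<in> ?V" using k p(1) by blast
        then show ?thesis using nT[OF k _ x] zS[OF k] by simp
      qed (simp add: True)
      then show ?thesis using mem_closure_iff[OF T(1)] by blast
    next
      case False
      then have pos: "bary (verts T') p' x \<ge> 0" using p(5,6) by (simp add: mult_nonpos_nonpos)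
      have "bary (verts T') k x \<ge> 0" if k: "k \<in> verts T'" for k
      proof (cases "k = p'")
        case False
        then have "k \<in> ?V" using k p(2) by blast
        then show ?thesis using nT'[OF k _ x] zS'[OF k] by simp
      qed (simp add: pos)
      then show ?thesis using mem_closure_iff[OF T(2)] by blast
    qed
  qed
  then show ?thesis using that z unfolding r_def by blast
qed

section \<open>Facets and connectedness through facets\<close>

lemma aff_dim_closure: "T \<in> \<T> \<Longrightarrow> aff_dim (closure T) = int CARD('n)"
  using full_affine_hull[OF verts_full] closure_hull
  by (metis aff_dim_affine_hull aff_dim_convex_hull aff_dim_UNIV DIM_cart DIM_real mult_1_right)

lemma aff_dim_shared:
  assumes "T \<in> \<T>" "V \<subseteq> verts T"
  shows "aff_dim (convex hull V) = int (card V) - 1"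
proof -
  have "\<not> affine_dependent V"
    using affine_independent_subset[OF _ assms(2)] verts_full[OF assms(1)] unfolding full_simplex_vertices_def by blast
  from aff_dim_affine_independent[OF this] show ?thesis by (simp add: aff_dim_convex_hull)
qed

text \<open>The labelling speaks only about closures. Since the intersection is the hull of the
  shared vertices and has dimension \<open>n - 1\<close>, there must be \<open>n\<close> of
  them.\<close>

lemma facet_props:
  assumes E: "E \<in> \<E>"
  shows "adj (Tp E) (Tm E)" "closure E = closure (Tp E) \<inter> closure (Tm E)" "E \<noteq> {}"
    "E = rel_interior (closure E)"
proof -
  obtain T F where TF: "T \<in> \<T>" "F facet_of closure T" "E = rel_interior F"
    using E unfolding interior_facets_def by blast
  have lab: "Tp E \<in> \<T>" "Tm E \<in> \<T>" "Tp E \<noteq> Tm E" "closure (Tp E) \<inter> closure (Tm E) = closure E"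
    using labels E unfolding facet_labelling_def by auto
  have face: "F face_of closure T" "F \<noteq> {}" "aff_dim F = int CARD('n) - 1"
    using TF(2) aff_dim_closure[OF TF(1)] unfolding facet_of_def by auto
  have "convex F" using face face_of_imp_convex by blast
  moreover have "closed F" using face_of_imp_closed[OF _ _ face(1)] convex_T[OF TF(1)] by (simp add: convex_closure)
  ultimately have cl: "closure E = F" using TF(3) by (simp add: convex_closure_rel_interior closure_closed)
  show "closure E = closure (Tp E) \<inter> closure (Tm E)" using lab by simp
  have "F = convex hull (verts (Tp E) \<inter> verts (Tm E))" using lab cl closure_Int by metis
  then have "card (verts (Tp E) \<inter> verts (Tm E)) = CARD('n)"
    using face(3) aff_dim_shared[OF lab(1), of "verts (Tp E) \<inter> verts (Tm E)"] by simp
  then show "adj (Tp E) (Tm E)" using lab unfolding adj_def by simp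
  show "E \<noteq> {}" using cl face(2) by auto
  show "E = rel_interior (closure E)" using TF(3) cl by simp
qed

lemma finite_facets: "finite \<E>"
proof -
  have "\<E> \<subseteq> rel_interior ` (\<Union>T\<in>\<T>. {F. F facet_of closure T})"
    unfolding interior_facets_def by blast
  moreover have "finite {F. F facet_of closure T}" if "T \<in> \<T>" for T
    unfolding closure_hull[OF that]
    by (intro finite_polytope_facets polytope_convex_hull finite_verts[OF that])
  then have "finite (rel_interior ` (\<Union>T\<in>\<T>. {F. F facet_of closure T}))" using finite_mesh by blast
  ultimately show ?thesis by (rule finite_subset)
qed

text \<open>A common facet meeting \<open>U\<close> does so in its relative interior, so it is not
  contained in the boundary of \<Omega>. Its labels can only be \<open>T\<close> and
  \<open>T'\<close>, since no third element contains it.\<close>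

lemma adj_facet:
  assumes adj: "adj T T'" and U: "open U" "U \<subseteq> \<Omega>" and x: "x \<in> closure T \<inter> closure T' \<inter> U"
  obtains E where "E \<in> \<E>" "E \<inter> U \<noteq> {}" "{Tp E, Tm E} = {T, T'}"
proof -
  have T: "T \<in> \<T>" "T' \<in> \<T>" "T \<noteq> T'" and V: "card (verts T \<inter> verts T') = CARD('n)" using adj unfolding adj_def by auto
  define F where "F = closure T \<inter> closure T'"
  have face: "F face_of closure T" unfolding F_def by (rule closure_Int_face[OF T(1,2)])
  have "aff_dim F = int CARD('n) - 1"
    unfolding F_def closure_Int[OF T(1,2)] using aff_dim_shared[OF T(1), of "verts T \<inter> verts T'"] V by simp
  then have facet: "F facet_of closure T"
    using face x aff_dim_closure[OF T(1)] unfolding facet_of_def F_def by auto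
  define E where "E = rel_interior F"
  have "convex F" using face face_of_imp_convex by blast
  moreover have "closed F" unfolding F_def by auto
  ultimately have cl: "closure E = F" unfolding E_def by (simp add: convex_closure_rel_interior closure_closed)
  have "x \<in> closure E" using cl x unfolding F_def by blast
  then have EU: "E \<inter> U \<noteq> {}" using open_Int_closure_eq_empty[OF U(1), of E] x by blast
  moreover have "\<Omega> \<inter> frontier \<Omega> = {}" using \<Omega>_open by (auto simp: frontier_def interior_open)
  ultimately have "\<not> E \<subseteq> frontier \<Omega>" using U(2) by blast
  then have E: "E \<in> \<E>" unfolding interior_facets_def E_def using T(1) facet by blast
  note fp = facet_props[OF E]
  have vs: "verts T \<inter> verts T' \<subseteq> verts R" if R: "R \<in> \<T>" "closure E \<subseteq> closure R" for R
  proof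
    fix s assume s: "s \<in> verts T \<inter> verts T'"
    then have "s \<in> F" unfolding F_def using verts_in_closure by blast
    then show "s \<in> verts R" using shared_vertex[OF T(1) R(1), of s] s R cl by blast
  qed
  have R: "Tp E \<in> \<T>" "Tm E \<in> \<T>" "Tp E \<noteq> Tm E" using fp(1) unfolding adj_def by auto
  have vp: "verts T \<inter> verts T' \<subseteq> verts (Tp E)" "verts T \<inter> verts T' \<subseteq> verts (Tm E)"
    using vs R fp(2) by auto
  have "A \<in> {Tp E, Tm E}" if A: "A \<in> \<T>" "verts T \<inter> verts T' \<subseteq> verts A" for A
    using shared_facet_two[OF A(2) vp V A(1) R(1,2)] R(3) by blast
  then have "T \<in> {Tp E, Tm E}" "T' \<in> {Tp E, Tm E}" using T by auto
  then have "{Tp E, Tm E} = {T, T'}" using T(3) by auto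
  with E EU show ?thesis by (intro that) auto
qed

text \<open>Comparing unordered pairs makes the relation symmetric, whichever element carries the
  plus sign.\<close>

definition links where
  "links \<F> = {(T, T'). \<exists>E\<in>\<F>. {Tp E, Tm E} = {T, T'}}"

lemma links_mono: "\<F> \<subseteq> \<F>' \<Longrightarrow> links \<F> \<subseteq> links \<F>'"
  unfolding links_def by auto

text \<open>Divide the elements meeting \<open>U\<close> into those reachable from \<open>T0\<close>
  and the others. The closures of the two classes can meet in \<open>U\<close> only in faces of
  codimension at least two, because a common facet would be a link. Without the finitely many affine
  hulls of such faces \<open>U\<close> is still connected, so one class would be empty.\<close>

lemma links_connected:
  assumes U: "open U" "connected U" "U \<subseteq> \<Omega>"
    and T0: "T0 \<in> \<T>" "T0 \<inter> U \<noteq> {}" and T1: "T1 \<in> \<T>" "T1 \<inter> U \<noteq> {}"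
  shows "(T0, T1) \<in> (links {E\<in>\<E>. E \<inter> U \<noteq> {}})\<^sup>*"
proof (rule ccontr)
  let ?R = "links {E\<in>\<E>. E \<inter> U \<noteq> {}}"
  assume not: "(T0, T1) \<notin> ?R\<^sup>*"
  define \<A> where "\<A> = {T\<in>\<T>. T \<inter> U \<noteq> {} \<and> (T0, T) \<in> ?R\<^sup>*}"
  define \<B> where "\<B> = {T\<in>\<T>. T \<inter> U \<noteq> {} \<and> (T0, T) \<notin> ?R\<^sup>*}"
  have AB: "\<A> \<subseteq> \<T>" "\<B> \<subseteq> \<T>" "T0 \<in> \<A>" "T1 \<in> \<B>" unfolding \<A>_def \<B>_def using T0 T1 not by auto
  have finAB: "finite \<A>" "finite \<B>" using AB finite_mesh finite_subset by blast+
  define L where "L = {affine hull (verts T \<inter> verts T') | T T'. T \<in> \<A> \<and> T' \<in> \<B> \<and> card (verts T \<inter> verts T') < CARD('n)}"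
  have L: "finite L"
  proof (rule finite_subset)
    show "L \<subseteq> (\<lambda>(T, T'). affine hull (verts T \<inter> verts T')) ` (\<A> \<times> \<B>)" unfolding L_def by auto
  qed (use finAB in auto)
  have Ldim: "affine A \<and> aff_dim A \<le> int CARD('n) - 2" if A: "A \<in> L" for A
  proof -
    obtain T T' where T: "A = affine hull (verts T \<inter> verts T')" "T \<in> \<T>" "card (verts T \<inter> verts T') < CARD('n)"
      using A AB unfolding L_def by blast
    have "aff_dim A = int (card (verts T \<inter> verts T')) - 1"
      using aff_dim_shared[OF T(2), of "verts T \<inter> verts T'"] T(1) by (simp add: aff_dim_convex_hull)
    then show ?thesis using T by auto
  qed
  have conn: "connected (U - \<Union>L)" by (rule connected_minus_affine[OF U(2,1) L Ldim])
  define X where "X = (\<Union>T\<in>\<A>. closure T)"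
  define Y where "Y = (\<Union>T\<in>\<B>. closure T)"
  have cl: "closed X" "closed Y" unfolding X_def Y_def using finAB by auto
  have XY: "U - \<Union>L \<subseteq> X \<union> Y"
  proof
    fix x assume "x \<in> U - \<Union>L"
    then have xU: "x \<in> U" by blast
    then have "x \<in> closure \<Omega>" using U(3) closure_subset by blast
    then obtain T where T: "T \<in> \<T>" "x \<in> closure T" using cover by blast
    then have "T \<inter> U \<noteq> {}" using open_Int_closure_eq_empty[OF U(1), of T] xU by blast
    then show "x \<in> X \<union> Y" using T unfolding X_def Y_def \<A>_def \<B>_def by blast
  qed
  have dXY: "X \<inter> Y \<inter> (U - \<Union>L) = {}"
  proof (rule ccontr)
    assume "X \<inter> Y \<inter> (U - \<Union>L) \<noteq> {}"
    then obtain x T T' where x: "x \<in> U" "x \<notin> \<Union>L" "T \<in> \<A>" "T' \<in> \<B>" "x \<in> closure T" "x \<in> closure T'"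
      unfolding X_def Y_def by blast
    then have T: "T \<in> \<T>" "T' \<in> \<T>" "T \<noteq> T'" using AB unfolding \<A>_def \<B>_def by auto
    have "x \<in> affine hull (verts T \<inter> verts T')"
      using closure_Int[OF T(1,2)] x convex_hull_subset_affine_hull by blast
    then have "\<not> card (verts T \<inter> verts T') < CARD('n)" using x(2,3,4) unfolding L_def by blast
    then have "adj T T'" using card_Int_verts[OF T] T unfolding adj_def by simp
    then obtain E where E: "E \<in> \<E>" "E \<inter> U \<noteq> {}" "{Tp E, Tm E} = {T, T'}"
      using adj_facet[OF _ U(1,3), of T T' x] x by blast
    then have "(T, T') \<in> ?R" unfolding links_def by blast
    moreover have "(T0, T) \<in> ?R\<^sup>*" "(T0, T') \<notin> ?R\<^sup>*" using x(3,4) unfolding \<A>_def \<B>_def by auto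
    ultimately show False by (meson rtrancl.rtrancl_into_rtrancl)
  qed
  have "X \<inter> (U - \<Union>L) = {} \<or> Y \<inter> (U - \<Union>L) = {}"
    by (rule connected_closedD[OF conn dXY XY cl])
  moreover have "T \<inter> U - \<Union>L \<noteq> {}" if "T \<in> \<T>" "T \<inter> U \<noteq> {}" for T
  proof -
    have "negligible (\<Union>L)"
    proof (rule negligible_Union[OF L])
      fix A assume "A \<in> L"
      then show "negligible A" using Ldim[of A] by (intro negligible_lowdim_aff) auto
    qed
    moreover have "\<not> negligible (T \<inter> U)"
      by (rule open_not_negligible[OF open_Int[OF open_T[OF that(1)] U(1)] that(2)])
    ultimately show ?thesis using negligible_subset by blast
  qed
  then have "T0 \<inter> U - \<Union>L \<noteq> {}" "T1 \<inter> U - \<Union>L \<noteq> {}" using T0 T1 by auto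
  moreover have "T0 \<subseteq> X" "T1 \<subseteq> Y" unfolding X_def Y_def using AB closure_subset by blast+
  ultimately show False by blast
qed

lemma mesh_linked: "T \<in> \<T> \<Longrightarrow> T' \<in> \<T> \<Longrightarrow> (T, T') \<in> (links \<E>)\<^sup>*"
proof -
  assume T: "T \<in> \<T>" "T' \<in> \<T>"
  have "(T, T') \<in> (links {E\<in>\<E>. E \<inter> \<Omega> \<noteq> {}})\<^sup>*"
    using T element_subset nonempty_T
    by (intro links_connected \<Omega>_open \<Omega>_connected order_refl) (metis inf.absorb1)+
  moreover have "(links {E\<in>\<E>. E \<inter> \<Omega> \<noteq> {}})\<^sup>* \<subseteq> (links \<E>)\<^sup>*"
    by (intro rtrancl_mono links_mono) auto
  ultimately show "(T, T') \<in> (links \<E>)\<^sup>*" by (rule rev_subsetD)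
qed

definition patch where "patch z = {T\<in>\<T>. z \<in> verts T}"

definition facets_at where "facets_at z = {E\<in>\<E>. z \<in> closure E}"

text \<open>The chain is confined to a connected piece \<open>U\<close> of \<Omega> so close to
  \<open>z\<close> that it avoids all closed elements not containing \<open>z\<close>. Hence every
  facet met on the way passes through \<open>z\<close>.\<close>

lemma patch_linked:
  assumes T: "T \<in> patch z" "T' \<in> patch z"
  shows "(T, T') \<in> (links (facets_at z))\<^sup>*"
proof -
  have TT: "T \<in> \<T>" "T' \<in> \<T>" "z \<in> verts T" "z \<in> verts T'" using T unfolding patch_def by auto
  have z: "z \<in> closure \<Omega>" using TT verts_in_closure cover by blast
  define Z where "Z = (\<Union>T\<in>{T\<in>\<T>. z \<notin> closure T}. closure T)"
  have "closed Z" unfolding Z_def using finite_mesh by auto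
  moreover have "z \<notin> Z" unfolding Z_def by auto
  ultimately obtain \<rho> where \<rho>: "\<rho> > 0" "ball z \<rho> \<subseteq> - Z"
    using open_contains_ball[of "- Z"] by (auto simp: open_Compl)
  obtain U \<delta> where U: "open U" "connected U" "U \<subseteq> \<Omega> \<inter> ball z \<rho>" "\<delta> > 0" "\<Omega> \<inter> ball z \<delta> \<subseteq> U"
    using lipschitz_locally_connected[OF \<Omega>_open \<Omega>_lipschitz z \<rho>(1)] by metis
  have meets: "R \<inter> U \<noteq> {}" if R: "R \<in> \<T>" "z \<in> verts R" for R
  proof -
    have "z \<in> closure R" using R verts_in_closure by blast
    then have "ball z \<delta> \<inter> closure R \<noteq> {}" using centre_in_ball[of z \<delta>] U(4) by blast
    then have "ball z \<delta> \<inter> R \<noteq> {}" using open_Int_closure_eq_empty[OF open_ball, of z \<delta> R] by blast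
    then show ?thesis using U(5) element_subset[OF R(1)] by blast
  qed
  have "(T, T') \<in> (links {E\<in>\<E>. E \<inter> U \<noteq> {}})\<^sup>*"
    using U by (intro links_connected meets TT) auto
  moreover have "{E\<in>\<E>. E \<inter> U \<noteq> {}} \<subseteq> facets_at z"
  proof
    fix E assume "E \<in> {E\<in>\<E>. E \<inter> U \<noteq> {}}"
    then obtain x where E: "E \<in> \<E>" "x \<in> E" "x \<in> U" by blast
    note fp = facet_props[OF E(1)]
    have x: "x \<in> closure (Tp E)" "x \<in> closure (Tm E)" using fp(2) E(2) closure_subset by blast+
    have "x \<notin> Z" using U(3) \<rho>(2) E(3) by blast
    then have "z \<in> closure (Tp E)" "z \<in> closure (Tm E)"
      using x fp(1) unfolding Z_def adj_def by auto
    then show "E \<in> facets_at z" using E(1) fp(2) unfolding facets_at_def by blast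
  qed
  from rtrancl_mono[OF links_mono[OF this]]
  have "(links {E\<in>\<E>. E \<inter> U \<noteq> {}})\<^sup>* \<subseteq> (links (facets_at z))\<^sup>*" .
  ultimately show ?thesis by (rule rev_subsetD)
qed

text \<open>A packing argument: in the ball about \<open>z\<close> whose radius is the smallest
  diameter occurring, each element of the patch fills at least a fixed share of the volume.\<close>

lemma card_patch: "card (patch z) \<le> nat \<lceil>8 ^ CARD('n) * \<gamma>\<rceil>"
proof (cases "patch z = {}")
  case False
  have fin: "finite (patch z)" unfolding patch_def using finite_mesh by auto
  define r where "r = Min (h ` patch z)"
  have pT: "T \<in> \<T>" "z \<in> closure T" if "T \<in> patch z" for T using that verts_in_closure unfolding patch_def by auto
  have r: "r > 0" "\<And>T. T \<in> patch z \<Longrightarrow> r \<le> h T"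
    unfolding r_def using fin False h_pos pT by auto
  have lm: "T \<inter> ball z r \<in> lmeasurable" if "T \<in> patch z" for T
    using element_lmeasurable[OF pT(1)[OF that]] by (intro fmeasurable.Int) auto
  have "real (card (patch z)) * ((r / 2) ^ CARD('n) / \<gamma>) \<le> (\<Sum>T\<in>patch z. vol (T \<inter> ball z r))"
    using sum_bounded_below[of "patch z" "(r / 2) ^ CARD('n) / \<gamma>" "\<lambda>T. vol (T \<inter> ball z r)"]
      vol_element_Int_ball pT r by auto
  also have "\<dots> = vol (\<Union>T\<in>patch z. T \<inter> ball z r)"
  proof (rule measure_UNION'[symmetric, OF fin lm])
    show "pairwise (\<lambda>T T'. disjnt (T \<inter> ball z r) (T' \<inter> ball z r)) (patch z)"
      unfolding pairwise_def disjnt_def using elements_disjoint pT by blast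
  qed
  also have "\<dots> \<le> vol (ball z r)"
  proof (rule measure_mono_fmeasurable)
    show "(\<Union>T\<in>patch z. T \<inter> ball z r) \<in> sets lebesgue"
      using fin fmeasurableD[OF lm] by (intro sets.finite_UN) auto
  qed auto
  also have "\<dots> \<le> (2 * (2 * r)) ^ CARD('n)"
  proof (rule measure_le_diameter)
    fix x y assume "x \<in> ball z r" "y \<in> ball z r"
    then show "norm (x - y) \<le> 2 * r"
      using norm_triangle_ineq[of "x - z" "z - y"] by (simp add: dist_norm norm_minus_commute)
  qed (use r in auto)
  also have "\<dots> = 8 ^ CARD('n) * (r / 2) ^ CARD('n)"
    unfolding power_mult_distrib[symmetric] by simp
  finally have "real (card (patch z)) * ((r / 2) ^ CARD('n) / \<gamma>) \<le> 8 ^ CARD('n) * (r / 2) ^ CARD('n)" .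
  moreover have "(r / 2) ^ CARD('n) > 0" using r by simp
  moreover from calculation(1)
  have "real (card (patch z)) * (r / 2) ^ CARD('n) \<le> (8 ^ CARD('n) * \<gamma>) * (r / 2) ^ CARD('n)"
    using gamma(1) unfolding times_divide_eq_right by (simp add: pos_divide_le_eq mult_ac)
  ultimately have "real (card (patch z)) \<le> 8 ^ CARD('n) * \<gamma>" using mult_le_cancel_right_pos by blast
  then show ?thesis by linarith
qed simp

lemma links_at:
  assumes z: "T0 \<in> \<T>" "z \<in> verts T0"
  shows "finite (links (facets_at z))" "card (links (facets_at z)) \<le> P"
  "(T, T') \<in> links (facets_at z) \<Longrightarrow> adj T T' \<and> T \<in> patch z \<and> T' \<in> patch z"
proof -
  have sub: "adj T T' \<and> T \<in> patch z \<and> T' \<in> patch z" if TT: "(T, T') \<in> links (facets_at z)" for T T'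
  proof -
    obtain E where E: "E \<in> \<E>" "z \<in> closure E" "{Tp E, Tm E} = {T, T'}"
      using TT unfolding links_def facets_at_def by blast
    note fp = facet_props[OF E(1)]
    have tt: "Tp E \<in> \<T>" "Tm E \<in> \<T>" "z \<in> closure (Tp E)" "z \<in> closure (Tm E)" using fp E(2) unfolding adj_def by auto
    have "z \<in> verts (Tp E) \<and> z \<in> verts (Tm E)"
      using shared_vertex[OF z(1) _ z(2)] tt by blast
    then have "Tp E \<in> patch z" "Tm E \<in> patch z" using tt unfolding patch_def by auto
    then show ?thesis using E(3) fp(1) adj_sym by (auto simp: doubleton_eq_iff)
  qed
  then show "(T, T') \<in> links (facets_at z) \<Longrightarrow> adj T T' \<and> T \<in> patch z \<and> T' \<in> patch z" by blast
  have fin: "finite (patch z)" unfolding patch_def using finite_mesh by auto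
  have lsub: "links (facets_at z) \<subseteq> patch z \<times> patch z" using sub by auto
  show "finite (links (facets_at z))" by (rule finite_subset[OF lsub]) (use fin in auto)
  have "card (links (facets_at z)) \<le> card (patch z) * card (patch z)"
    using card_mono[OF _ lsub] fin by (simp add: card_cartesian_product)
  also have "\<dots> \<le> P" unfolding P power2_eq_square by (intro mult_le_mono card_patch)
  finally show "card (links (facets_at z)) \<le> P" .
qed

end

subsection \<open>Functions on a mesh\<close>

text \<open>Members of \<open>P0\<close> take arbitrary values on the element boundaries; they are
  measurable because Lebesgue measure is complete.\<close>

lemma measurable_lebesgue_on_modify:
  fixes f g :: "'a::euclidean_space \<Rightarrow> 'b::euclidean_space"
  assumes \<Omega>: "\<Omega> \<in> sets lebesgue" and f: "f \<in> borel_measurable (lebesgue_on \<Omega>)"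
    and N: "negligible N" and eq: "\<And>x. x \<in> \<Omega> \<Longrightarrow> x \<notin> N \<Longrightarrow> f x = g x"
  shows "g \<in> borel_measurable (lebesgue_on \<Omega>)"
proof (rule borel_measurableI)
  fix A :: "'b set" assume "open A"
  then have "f -` A \<inter> space (lebesgue_on \<Omega>) \<in> sets (lebesgue_on \<Omega>)" using f by (intro measurable_sets) auto
  then have fA: "f -` A \<inter> \<Omega> \<in> sets lebesgue" using \<Omega> by (simp add: sets_restrict_space_iff)
  have Ns: "B \<in> sets lebesgue" if "B \<subseteq> N" for B
    using negligible_subset[OF N that] by (simp add: negligible_iff_null_sets null_setsD2)
  have "g -` A \<inter> \<Omega> = (f -` A \<inter> \<Omega> - N) \<union> (g -` A \<inter> \<Omega> \<inter> N)" using eq by auto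
  also have "\<dots> \<in> sets lebesgue" using fA Ns by (intro sets.Un sets.Diff) auto
  finally show "g -` A \<inter> space (lebesgue_on \<Omega>) \<in> sets (lebesgue_on \<Omega>)"
    using \<Omega> by (simp add: sets_restrict_space_iff)
qed

context mesh
begin

abbreviation skel where "skel \<equiv> (\<Union>T\<in>\<T>. frontier T)"

lemma negligible_skel: "negligible skel"
  using finite_mesh convex_T by (intro negligible_Union) (auto intro: negligible_convex_frontier)

lemma \<Omega>_sets: "\<Omega> \<in> sets lebesgue"
  using \<Omega>_open by auto

lemma AE_\<Omega>I:
  assumes "\<And>T x. T \<in> \<T> \<Longrightarrow> x \<in> T \<Longrightarrow> Q x"
  shows "AE x in lebesgue_on \<Omega>. Q x"
proof -
  have "AE x in lebesgue. x \<notin> skel"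
    using negligible_skel unfolding negligible_iff_null_sets by (rule AE_not_in)
  then have "AE x in lebesgue. x \<in> \<Omega> \<longrightarrow> Q x"
  proof eventually_elim
    fix x assume x: "x \<notin> skel"
    show "x \<in> \<Omega> \<longrightarrow> Q x"
    proof
      assume "x \<in> \<Omega>"
      then have "x \<in> closure \<Omega>" using closure_subset by blast
      then obtain T where T: "T \<in> \<T>" "x \<in> closure T" using cover by blast
      then have "x \<in> T" using x open_T[OF T(1)] by (auto simp: frontier_def interior_open)
      then show "Q x" using assms T by blast
    qed
  qed
  then show ?thesis using \<Omega>_sets by (simp add: AE_restrict_space_iff)
qed

lemma element_sets: "T \<in> \<T> \<Longrightarrow> T \<in> sets (lebesgue_on \<Omega>)"
  using element_subset[of T] open_T[of T] \<Omega>_sets by (subst sets_restrict_space_iff) auto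

lemma indicator_other: "T \<in> \<T> \<Longrightarrow> T' \<in> \<T> \<Longrightarrow> x \<in> T \<Longrightarrow> indicator T' x = (if T' = T then 1 else 0 :: real)"
  using elements_disjoint[of T T'] by (auto simp: indicator_def)

lemma sum_indicator_elements:
  fixes c :: "(real^'n) set \<Rightarrow> 'a::real_vector"
  shows "T \<in> \<T> \<Longrightarrow> x \<in> T \<Longrightarrow> (\<Sum>T'\<in>\<T>. indicator T' x *\<^sub>R c T') = c T"
proof -
  assume T: "T \<in> \<T>" "x \<in> T"
  have "(\<Sum>T'\<in>\<T>. indicator T' x *\<^sub>R c T') = (\<Sum>T'\<in>\<T>. if T' = T then c T else 0)"
    using indicator_other[OF T(1) _ T(2)] by (intro sum.cong) auto
  then show ?thesis using finite_mesh T by simp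
qed

lemma integrable_element:
  fixes f :: "real^'n \<Rightarrow> real"
  shows "T \<in> \<T> \<Longrightarrow> integrable (lebesgue_on \<Omega>) f \<Longrightarrow> integrable (lebesgue_on \<Omega>) (\<lambda>z. indicator T z * f z)"
  using integrable_mult_indicator[OF element_sets, of T f] by simp

lemma integral_elements:
  fixes f :: "real^'n \<Rightarrow> real"
  assumes f: "integrable (lebesgue_on \<Omega>) f"
  shows "(\<integral>z. f z \<partial>lebesgue_on \<Omega>) = (\<Sum>T\<in>\<T>. \<integral>z. indicator T z * f z \<partial>lebesgue_on \<Omega>)"
proof -
  note int = integrable_element[OF _ f]
  have "(\<integral>z. f z \<partial>lebesgue_on \<Omega>) = (\<integral>z. (\<Sum>T\<in>\<T>. indicator T z * f z) \<partial>lebesgue_on \<Omega>)"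
  proof (rule integral_cong_AE)
    show "AE z in lebesgue_on \<Omega>. f z = (\<Sum>T\<in>\<T>. indicator T z * f z)"
    proof (rule AE_\<Omega>I)
      fix T x assume "T \<in> \<T>" "x \<in> T"
      from sum_indicator_elements[OF this, of "\<lambda>_. f x"] show "f x = (\<Sum>T\<in>\<T>. indicator T x * f x)" by simp
    qed
    show "(\<lambda>z. \<Sum>T\<in>\<T>. indicator T z * f z) \<in> borel_measurable (lebesgue_on \<Omega>)"
      using int by (intro borel_measurable_sum) auto
  qed (use f in auto)
  also have "\<dots> = (\<Sum>T\<in>\<T>. \<integral>z. indicator T z * f z \<partial>lebesgue_on \<Omega>)"
    using int by (intro Bochner_Integration.integral_sum) auto
  finally show ?thesis .
qed

section \<open>Local energies and the jump estimate\<close>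

definition energy :: "(real^'n \<Rightarrow> real^'n) \<Rightarrow> (real^'n) set \<Rightarrow> real" where
  "energy g A = (\<integral>z. indicator A z * (norm (g z))\<^sup>2 \<partial>lebesgue_on \<Omega>)"

lemma energy_nonneg: "energy g A \<ge> 0"
  unfolding energy_def by (auto intro!: Bochner_Integration.integral_nonneg)

lemma energy_sum:
  assumes "g \<in> L2 \<Omega>"
  shows "(\<Sum>T\<in>\<T>. energy g T) = (L2_norm \<Omega> g)\<^sup>2"
proof -
  have "integrable (lebesgue_on \<Omega>) (\<lambda>x. (norm (g x))\<^sup>2)" using assms unfolding L2_def by simp
  from integral_elements[OF this]
  have "(\<Sum>T\<in>\<T>. energy g T) = (\<integral>x. (norm (g x))\<^sup>2 \<partial>lebesgue_on \<Omega>)" unfolding energy_def by simp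
  also have "\<dots> = (L2_norm \<Omega> g)\<^sup>2" unfolding L2_norm_def by (simp add: Bochner_Integration.integral_nonneg)
  finally show ?thesis .
qed

text \<open>An open element that meets the closure of another one coincides with it, so up to
  element boundaries \<open>A\<close> lies in the two open elements.\<close>

lemma energy_le:
  assumes g: "g \<in> L2 \<Omega>" and T: "T \<in> \<T>" "T' \<in> \<T>" and A: "A \<in> sets lebesgue" "A \<subseteq> closure T \<union> closure T'"
  shows "energy g A \<le> energy g T + energy g T'"
proof -
  have sT: "T \<in> sets lebesgue" "T' \<in> sets lebesgue" using open_T T by auto
  note i = integrable_indicator_L2[OF g]
  have "energy g A \<le> (\<integral>z. indicator T z * (norm (g z))\<^sup>2 + indicator T' z * (norm (g z))\<^sup>2 \<partial>lebesgue_on \<Omega>)"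
    unfolding energy_def
  proof (rule integral_mono_AE)
    show "AE z in lebesgue_on \<Omega>. indicator A z * (norm (g z))\<^sup>2
        \<le> indicator T z * (norm (g z))\<^sup>2 + indicator T' z * (norm (g z))\<^sup>2"
    proof (rule AE_\<Omega>I)
      fix R x assume R: "R \<in> \<T>" "x \<in> R"
      have "x \<in> T \<or> x \<in> T'" if "x \<in> A"
      proof -
        have "x \<in> closure T \<or> x \<in> closure T'" using that A by blast
        then have "R \<inter> T \<noteq> {} \<or> R \<inter> T' \<noteq> {}"
          using open_Int_closure_eq_empty[OF open_T[OF R(1)]] R(2) by blast
        then show ?thesis using elements_disjoint R T by blast
      qed
      then show "indicator A x * (norm (g x))\<^sup>2 \<le> indicator T x * (norm (g x))\<^sup>2 + indicator T' x * (norm (g x))\<^sup>2"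
        by (auto simp: indicator_def)
    qed
  qed (use i sT A in auto)
  also have "\<dots> = energy g T + energy g T'" unfolding energy_def using i sT by simp
  finally show ?thesis .
qed

definition jump_const :: real where
  "jump_const = 96 * 4 ^ CARD('n) * \<kappa>\<^sup>2 * \<gamma> * (4 * real CARD('n) * \<kappa>\<^sup>2) ^ CARD('n)"

lemma jump_const_nonneg: "jump_const \<ge> 0"
  unfolding jump_const_def using gamma kappa_ge_1 by (intro mult_nonneg_nonneg zero_le_power) auto

text \<open>The passage from \<open>T\<close> to \<open>T'\<close> goes through the pieces
  \<open>A\<close> and \<open>A'\<close> that the two elements cut out of a ball across the facet.
  Each of the three steps takes place in a convex set of size comparable to \<open>h T\<close>,
  between sets of volume at least \<open>m\<close>.\<close>

lemma jump_bound:
  assumes v: "v \<in> L2 \<Omega>" and g: "g \<in> L2 \<Omega>" and wg: "has_weak_gradient \<Omega> v g" and adj: "adj T T'"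
  shows "h T ^ (CARD('n) - 2) * (avg \<Omega> T v - avg \<Omega> T' v)\<^sup>2 \<le> jump_const * (energy g T + energy g T')"
proof -
  let ?n = "CARD('n)"
  have T: "T \<in> \<T>" "T' \<in> \<T>" using adj unfolding adj_def by auto
  have hp: "h T > 0" "h T' > 0" using h_pos T by auto
  define r where "r = h T / (2 * real ?n * \<kappa>\<^sup>2)"
  obtain z where z: "z \<in> closure T" "z \<in> closure T'" "ball z r \<subseteq> closure T \<union> closure T'"
    using adj_ball[OF adj] unfolding r_def by metis
  have k1: "\<kappa> \<ge> 1" by (rule kappa_ge_1)
  have n1: "real ?n \<ge> 1" using dim2 by simp
  have r0: "r > 0" unfolding r_def using hp k1 n1 by (intro divide_pos_pos mult_pos_pos) auto
  have rk: "r * \<kappa> \<le> h T / 2"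
  proof -
    have "1 * \<kappa> \<le> real ?n * \<kappa>\<^sup>2" using n1 k1 by (intro mult_mono) (auto simp: power2_eq_square)
    moreover have "real ?n * \<kappa>\<^sup>2 > 0" using n1 k1 by (intro mult_pos_pos) auto
    ultimately have "\<kappa> / (real ?n * \<kappa>\<^sup>2) \<le> 1" by (simp add: divide_le_eq)
    then have "(h T / 2) * (\<kappa> / (real ?n * \<kappa>\<^sup>2)) \<le> (h T / 2) * 1" using hp by (intro mult_left_mono) auto
    then show ?thesis unfolding r_def by simp
  qed
  have "r * 1 \<le> r * \<kappa>" using r0 k1 by (intro mult_left_mono) auto
  then have rT: "2 * r \<le> h T" using rk by linarith
  have rT': "r \<le> h T'"
  proof -
    have "r * \<kappa> \<le> h T' * \<kappa>" using rk adj_h[OF adj] hp by (simp add: mult.commute)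
    then show ?thesis using k1 by (simp add: mult_le_cancel_right)
  qed
  define m where "m = (r / 2) ^ ?n / \<gamma>"
  have m0: "m > 0" unfolding m_def using r0 gamma by simp
  define A where "A = T \<inter> ball z r"
  define A' where "A' = T' \<inter> ball z r"
  have volA: "m \<le> vol A" "m \<le> vol A'"
    unfolding m_def A_def A'_def using vol_element_Int_ball T z r0 rT rT' by auto
  have volT: "m \<le> vol T" "m \<le> vol T'"
  proof -
    have le: "vol (R \<inter> ball z r) \<le> vol R" if "R \<in> \<T>" for R
      using element_lmeasurable[OF that] by (intro measure_mono_fmeasurable) auto
    show "m \<le> vol T" "m \<le> vol T'" using volA le T unfolding A_def A'_def by (auto intro: order_trans)
  qed
  have oA: "open A" "open A'" unfolding A_def A'_def using open_T T by auto
  have ball_\<Omega>: "ball z r \<subseteq> \<Omega>"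
  proof -
    have "closure T \<union> closure T' \<subseteq> closure \<Omega>" using T cover by auto
    then have "ball z r \<subseteq> interior (closure \<Omega>)" using z(3) by (intro interior_maximal) auto
    then show ?thesis unfolding interior_closure_\<Omega> .
  qed
  define H where "H = energy g T + energy g T'"
  have H: "energy g T \<le> H" "energy g T' \<le> H" "energy g (ball z r) \<le> H" "H \<ge> 0"
    unfolding H_def using energy_nonneg[of g] energy_le[OF g T _ z(3)] by auto
  define M where "M = 2 * 4 ^ ?n * (\<kappa> * h T)\<^sup>2 * (2 / m) * H"
  have step: "(avg \<Omega> X v - avg \<Omega> Y v)\<^sup>2 \<le> M"
    if K: "convex K" "open K" "K \<subseteq> \<Omega>" "\<And>x y. x \<in> K \<Longrightarrow> y \<in> K \<Longrightarrow> norm (x - y) \<le> d" "0 \<le> d" "d \<le> \<kappa> * h T"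
      "energy g K \<le> H"
      and XY: "open X" "X \<subseteq> K" "m \<le> vol X" "open Y" "Y \<subseteq> K" "m \<le> vol Y" for K X Y d
  proof -
    have "(avg \<Omega> X v - avg \<Omega> Y v)\<^sup>2 \<le> 2 * 4 ^ ?n * d\<^sup>2 * (1 / vol X + 1 / vol Y) * energy g K"
      unfolding energy_def
      using avg_difference[OF \<Omega>_bounded \<Omega>_open v g wg K(1-4) XY(1,2) _ XY(4,5)] m0 XY(3,6) by linarith
    also have "\<dots> \<le> 2 * 4 ^ ?n * (\<kappa> * h T)\<^sup>2 * (2 / m) * H"
    proof (intro mult_mono)
      show "d\<^sup>2 \<le> (\<kappa> * h T)\<^sup>2" using K(5,6) by (rule power_mono[rotated])
      have "1 / vol X \<le> 1 / m" "1 / vol Y \<le> 1 / m" using XY m0 by (auto intro!: divide_left_mono mult_pos_pos)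
      then show "1 / vol X + 1 / vol Y \<le> 2 / m" by simp
    qed (use K energy_nonneg m0 XY in \<open>auto intro!: add_nonneg_nonneg mult_nonneg_nonneg\<close>)
    finally show ?thesis unfolding M_def .
  qed
  have hk: "h T \<le> \<kappa> * h T" using k1 hp by simp
  have nT: "norm (x - y) \<le> h R" if "R \<in> \<T>" "x \<in> R" "y \<in> R" for R x y
    using norm_le_h[OF that(1)] that(2,3) closure_subset[of R] by blast
  have r2: "2 * r \<le> \<kappa> * h T" using rT hk by linarith
  have s1: "(avg \<Omega> T v - avg \<Omega> A v)\<^sup>2 \<le> M"
    by (rule step[of T "h T"])
      (use convex_T open_T element_subset T nT hp hk H volT volA oA in \<open>auto simp: A_def\<close>)
  have s3: "(avg \<Omega> A' v - avg \<Omega> T' v)\<^sup>2 \<le> M"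
    by (rule step[of T' "h T'"])
      (use convex_T open_T element_subset T nT hp adj_h[OF adj_sym[OF adj]] H volT volA oA in \<open>auto simp: A'_def\<close>)
  have s2: "(avg \<Omega> A v - avg \<Omega> A' v)\<^sup>2 \<le> M"
  proof (rule step[of "ball z r" "2 * r"])
    fix x y assume "x \<in> ball z r" "y \<in> ball z r"
    then show "norm (x - y) \<le> 2 * r"
      using norm_triangle_ineq[of "x - z" "z - y"] by (simp add: dist_norm norm_minus_commute)
  qed (use ball_\<Omega> H volA oA r2 r0 in \<open>auto simp: A_def A'_def\<close>)
  have three: "(a + b + c)\<^sup>2 \<le> 3 * (a\<^sup>2 + b\<^sup>2 + c\<^sup>2)" for a b c :: real
    using zero_le_power2[of "a - b"] zero_le_power2[of "b - c"] zero_le_power2[of "a - c"]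
    by (simp add: power2_eq_square algebra_simps)
  have "(avg \<Omega> T v - avg \<Omega> T' v)\<^sup>2 \<le> 9 * M"
    using three[of "avg \<Omega> T v - avg \<Omega> A v" "avg \<Omega> A v - avg \<Omega> A' v" "avg \<Omega> A' v - avg \<Omega> T' v"] s1 s2 s3 by simp
  then have "h T ^ (?n - 2) * (avg \<Omega> T v - avg \<Omega> T' v)\<^sup>2 \<le> h T ^ (?n - 2) * (9 * M)"
    using hp by (intro mult_left_mono) auto
  \<comment> \<open>The factor 9 stems from the square of a sum of three differences, 2 from
    \<open>avg_difference\<close> and another 2 from the two inverse volumes.\<close>
  also have "\<dots> = 36 * 4 ^ ?n * \<kappa>\<^sup>2 * (h T ^ ?n / m) * H"
  proof -
    have "h T ^ (?n - 2) * (h T)\<^sup>2 = h T ^ ?n" using dim2 by (simp only: power_add[symmetric] le_add_diff_inverse2)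
    then have "h T ^ (?n - 2) * (9 * M) = 36 * 4 ^ ?n * \<kappa>\<^sup>2 * (h T ^ (?n - 2) * (h T)\<^sup>2 / m) * H"
      unfolding M_def by (simp add: power_mult_distrib)
    then show ?thesis using \<open>h T ^ (?n - 2) * (h T)\<^sup>2 = h T ^ ?n\<close> by simp
  qed
  also have "h T ^ ?n / m = \<gamma> * (4 * real ?n * \<kappa>\<^sup>2) ^ ?n"
  proof -
    have "h T = (r / 2) * (4 * real ?n * \<kappa>\<^sup>2)" unfolding r_def using k1 n1 by simp
    then have "h T ^ ?n = (r / 2) ^ ?n * (4 * real ?n * \<kappa>\<^sup>2) ^ ?n" by (metis power_mult_distrib)
    then show ?thesis unfolding m_def using r0 gamma by simp
  qed
  also have "36 * 4 ^ ?n * \<kappa>\<^sup>2 * (\<gamma> * (4 * real ?n * \<kappa>\<^sup>2) ^ ?n) * H \<le> jump_const * H"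
    unfolding jump_const_def using gamma(1) H by (intro mult_right_mono) (auto simp: mult_ac)
  finally show ?thesis unfolding H_def .
qed

text \<open>Conforming functions: continuous piecewise affine functions with nodal values \<open>U\<close>, plus
  multiples \<open>\<beta>\<close> of the element bubbles.\<close>

definition bubble :: "(real^'n) set \<Rightarrow> real^'n \<Rightarrow> real" where
  "bubble T x = (\<Prod>s\<in>verts T. bary (verts T) s x)"

definition conf_piece :: "(real^'n \<Rightarrow> real) \<Rightarrow> ((real^'n) set \<Rightarrow> real) \<Rightarrow> (real^'n) set \<Rightarrow> real^'n \<Rightarrow> real" where
  "conf_piece U \<beta> T x = (\<Sum>s\<in>verts T. U s * bary (verts T) s x) + \<beta> T * bubble T x"

definition conf_grad_piece :: "(real^'n \<Rightarrow> real) \<Rightarrow> ((real^'n) set \<Rightarrow> real) \<Rightarrow> (real^'n) set \<Rightarrow> real^'n \<Rightarrow> real^'n" where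
  "conf_grad_piece U \<beta> T x = (\<Sum>s\<in>verts T. U s *\<^sub>R bary_grad (verts T) s)
    + \<beta> T *\<^sub>R (\<Sum>s\<in>verts T. (\<Prod>t\<in>verts T - {s}. bary (verts T) t x) *\<^sub>R bary_grad (verts T) s)"

definition conf :: "(real^'n \<Rightarrow> real) \<Rightarrow> ((real^'n) set \<Rightarrow> real) \<Rightarrow> real^'n \<Rightarrow> real" where
  "conf U \<beta> x = conf_piece U \<beta> (SOME T. T \<in> \<T> \<and> x \<in> closure T) x"

text \<open>The sum of indicators makes measurability evident; on element boundaries the value is
  0.\<close>

definition conf_grad :: "(real^'n \<Rightarrow> real) \<Rightarrow> ((real^'n) set \<Rightarrow> real) \<Rightarrow> real^'n \<Rightarrow> real^'n" where
  "conf_grad U \<beta> x = (\<Sum>T\<in>\<T>. indicator T x *\<^sub>R conf_grad_piece U \<beta> T x)"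

lemma bubble_outside:
  assumes "T \<in> \<T>" "T' \<in> \<T>" "T \<noteq> T'" "x \<in> closure T" "x \<in> closure T'"
  shows "bubble T x = 0"
proof -
  have "x \<notin> T"
    using open_Int_closure_eq_empty[OF open_T[OF assms(1)], of T'] elements_disjoint[OF assms(1-3)] assms(5) by blast
  then have "\<exists>s\<in>verts T. \<not> bary (verts T) s x > 0" using mem_element_iff[OF assms(1)] by blast
  moreover have "\<forall>s\<in>verts T. bary (verts T) s x \<ge> 0" using mem_closure_iff[OF assms(1)] assms(4) by blast
  ultimately have "\<exists>s\<in>verts T. bary (verts T) s x = 0" by force
  then show ?thesis unfolding bubble_def using finite_verts[OF assms(1)] by (auto intro: prod_zero)
qed

text \<open>The element chosen in \<open>conf\<close> is immaterial: on a common face the nodal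
  parts agree and both bubbles vanish.\<close>

lemma conf_eq:
  assumes "T \<in> \<T>" "x \<in> closure T"
  shows "conf U \<beta> x = conf_piece U \<beta> T x"
proof -
  define R where "R = (SOME T. T \<in> \<T> \<and> x \<in> closure T)"
  have R: "R \<in> \<T>" "x \<in> closure R" unfolding R_def using someI[of "\<lambda>T. T \<in> \<T> \<and> x \<in> closure T" T] assms by auto
  show ?thesis
  proof (cases "R = T")
    case False
    then show ?thesis
      unfolding conf_def R_def[symmetric] conf_piece_def
      using nodal_consistent[OF R(1) assms(1) R(2) assms(2)] bubble_outside[OF R(1) assms(1) False R(2) assms(2)]
        bubble_outside[OF assms(1) R(1) _ assms(2) R(2)] by simp
  qed (simp add: conf_def R_def)
qed

lemma conf_grad_eq: "T \<in> \<T> \<Longrightarrow> x \<in> T \<Longrightarrow> conf_grad U \<beta> x = conf_grad_piece U \<beta> T x"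
  unfolding conf_grad_def by (rule sum_indicator_elements)

lemma GDERIV_conf_piece: "GDERIV (conf_piece U \<beta> T) x :> conf_grad_piece U \<beta> T x"
proof -
  note b = GDERIV_bary[unfolded gderiv_def]
  have "((\<lambda>x. \<Prod>s\<in>verts T. bary (verts T) s x) has_derivative
      (\<lambda>y. \<Sum>s\<in>verts T. (y \<bullet> bary_grad (verts T) s) * (\<Prod>t\<in>verts T - {s}. bary (verts T) t x))) (at x)"
    by (rule has_derivative_prod) (rule b)
  moreover have "((\<lambda>x. \<Sum>s\<in>verts T. U s * bary (verts T) s x) has_derivative
      (\<lambda>y. \<Sum>s\<in>verts T. U s * (y \<bullet> bary_grad (verts T) s))) (at x)"
    by (intro has_derivative_sum has_derivative_mult_right b)
  ultimately have "((\<lambda>x. (\<Sum>s\<in>verts T. U s * bary (verts T) s x) + \<beta> T * (\<Prod>s\<in>verts T. bary (verts T) s x)) has_derivative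
      (\<lambda>y. (\<Sum>s\<in>verts T. U s * (y \<bullet> bary_grad (verts T) s)) +
        \<beta> T * (\<Sum>s\<in>verts T. (y \<bullet> bary_grad (verts T) s) * (\<Prod>t\<in>verts T - {s}. bary (verts T) t x)))) (at x)"
    by (intro has_derivative_add has_derivative_mult_right)
  then show ?thesis
    unfolding gderiv_def conf_piece_def[abs_def] bubble_def conf_grad_piece_def
    by (simp add: inner_add_right inner_sum_right sum_distrib_left mult_ac)
qed

lemma continuous_conf_piece: "continuous_on A (conf_piece U \<beta> T)" "continuous_on A (conf_grad_piece U \<beta> T)"
  unfolding conf_piece_def[abs_def] conf_grad_piece_def[abs_def] bubble_def
  by (intro continuous_intros)+

lemma continuous_conf: "continuous_on (closure \<Omega>) (conf U \<beta>)"
  unfolding cover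
proof (rule continuous_on_closed_Union[OF finite_mesh])
  fix T assume "T \<in> \<T>"
  then show "continuous_on (closure T) (conf U \<beta>)"
    using continuous_on_cong[of "closure T" "closure T" "conf U \<beta>" "conf_piece U \<beta> T"] conf_eq continuous_conf_piece(1) by blast
qed auto

lemma bounded_L2:
  fixes f :: "real^'n \<Rightarrow> 'b::euclidean_space"
  assumes f: "f \<in> borel_measurable (lebesgue_on \<Omega>)" and b: "AE x in lebesgue_on \<Omega>. norm (f x) \<le> b"
  shows "f \<in> L2 \<Omega>"
proof -
  interpret finite_measure "lebesgue_on \<Omega>" by (rule finite_measure_lebesgue_on_open[OF \<Omega>_bounded \<Omega>_open])
  have "integrable (lebesgue_on \<Omega>) (\<lambda>x. (norm (f x))\<^sup>2)"
  proof (rule integrable_const_bound[of _ "b\<^sup>2"])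
    show "AE x in lebesgue_on \<Omega>. norm ((norm (f x))\<^sup>2) \<le> b\<^sup>2"
      using b by eventually_elim (auto intro: power_mono)
  qed (use f in measurable)
  then show ?thesis unfolding L2_def using f by simp
qed

lemma conf_L2: "conf U \<beta> \<in> L2 \<Omega>"
proof -
  have "bounded (conf U \<beta> ` closure \<Omega>)"
    using continuous_conf \<Omega>_bounded by (intro compact_imp_bounded compact_continuous_image) auto
  then obtain b where b: "\<And>x. x \<in> closure \<Omega> \<Longrightarrow> norm (conf U \<beta> x) \<le> b" by (auto simp: bounded_iff)
  show ?thesis
  proof (rule bounded_L2)
    show "conf U \<beta> \<in> borel_measurable (lebesgue_on \<Omega>)"
      using continuous_on_subset[OF continuous_conf closure_subset] \<Omega>_sets
      by (rule continuous_imp_measurable_on_sets_lebesgue)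
    show "AE x in lebesgue_on \<Omega>. norm (conf U \<beta> x) \<le> b"
      using b closure_subset[of \<Omega>] by (intro AE_I2) auto
  qed
qed

lemma conf_grad_L2: "conf_grad U \<beta> \<in> L2 \<Omega>"
proof -
  have "\<exists>b\<ge>0. \<forall>x\<in>T. norm (conf_grad_piece U \<beta> T x) \<le> b" if "T \<in> \<T>" for T
  proof -
    have "bounded (conf_grad_piece U \<beta> T ` closure T)"
      using continuous_conf_piece(2) bounded_T[OF that] by (intro compact_imp_bounded compact_continuous_image) auto
    then obtain b where "\<And>x. x \<in> closure T \<Longrightarrow> norm (conf_grad_piece U \<beta> T x) \<le> b" by (auto simp: bounded_iff)
    then show ?thesis using closure_subset[of T] by (intro exI[of _ "\<bar>b\<bar>"]) (auto intro: order_trans[OF _ abs_ge_self])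
  qed
  then obtain b where b: "\<And>T. T \<in> \<T> \<Longrightarrow> b T \<ge> 0" "\<And>T x. T \<in> \<T> \<Longrightarrow> x \<in> T \<Longrightarrow> norm (conf_grad_piece U \<beta> T x) \<le> b T"
    by metis
  show ?thesis
  proof (rule bounded_L2)
    have "conf_grad_piece U \<beta> T \<in> borel_measurable (lebesgue_on \<Omega>)" for T
      using continuous_conf_piece(2) by (rule continuous_measurable_lebesgue_on)
    then show "conf_grad U \<beta> \<in> borel_measurable (lebesgue_on \<Omega>)"
      unfolding conf_grad_def[abs_def] using element_sets
      by (intro borel_measurable_sum borel_measurable_scaleR borel_measurable_indicator) auto
    show "AE x in lebesgue_on \<Omega>. norm (conf_grad U \<beta> x) \<le> (\<Sum>T\<in>\<T>. b T)"
    proof (intro AE_I2)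
    fix x
    have "norm (conf_grad U \<beta> x) \<le> (\<Sum>T\<in>\<T>. norm (indicator T x *\<^sub>R conf_grad_piece U \<beta> T x))"
      unfolding conf_grad_def by (rule norm_sum)
    also have "\<dots> \<le> (\<Sum>T\<in>\<T>. b T)" using b by (intro sum_mono) (auto simp: indicator_def)
    finally show "norm (conf_grad U \<beta> x) \<le> (\<Sum>T\<in>\<T>. b T)" .
    qed
  qed
qed

lemma conf_weak_gradient: "has_weak_gradient \<Omega> (conf U \<beta>) (conf_grad U \<beta>)"
proof (rule piecewise_smooth_weak_gradient[where I = \<T> and T = "\<lambda>T. T" and f = "conf_piece U \<beta>" and D = "conf_grad_piece U \<beta>"])
  show "\<Omega> \<subseteq> (\<Union>T\<in>\<T>. closure T)" using cover closure_subset by blast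
  show "negligible (frontier T)" if "T \<in> \<T>" for T using convex_T[OF that] by (rule negligible_convex_frontier)
qed (use \<Omega>_bounded \<Omega>_open finite_mesh open_T GDERIV_conf_piece continuous_conf_piece conf_eq conf_grad_eq conf_L2 conf_grad_L2 in auto)

lemma bubble_range: "T \<in> \<T> \<Longrightarrow> x \<in> closure T \<Longrightarrow> 0 \<le> bubble T x \<and> bubble T x \<le> 1"
  unfolding bubble_def
  using mem_closure_iff[of T x] bary_le_1[OF verts_full, of T x] closure_hull[of T]
  by (auto intro!: prod_nonneg prod_le_1)

text \<open>On the half-size copy of an element about its barycentre all \<open>n + 1\<close>
  coordinates are at least \<open>1 / (2 * (n + 1))\<close>, and this copy has the share
  \<open>1 / 2 ^ n\<close> of the volume.\<close>

definition bubble_const :: real where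
  "bubble_const = (1 / (2 * (real CARD('n) + 1))) ^ Suc CARD('n) / 2 ^ CARD('n)"

lemma bubble_const_pos: "bubble_const > 0"
  unfolding bubble_const_def by simp

lemma integrable_continuous_element:
  assumes "T \<in> \<T>" "continuous_on UNIV f"
  shows "integrable (lebesgue_on \<Omega>) (\<lambda>x. indicator T x * (f x :: real))"
proof -
  interpret finite_measure "lebesgue_on \<Omega>" by (rule finite_measure_lebesgue_on_open[OF \<Omega>_bounded \<Omega>_open])
  have "bounded (f ` closure T)"
    using assms bounded_T[OF assms(1)]
    by (intro compact_imp_bounded compact_continuous_image) (auto intro: continuous_on_subset)
  then obtain b where b: "\<And>x. x \<in> closure T \<Longrightarrow> \<bar>f x\<bar> \<le> b" by (auto simp: bounded_iff)
  show ?thesis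
  proof (rule integrable_const_bound[of _ "\<bar>b\<bar>"])
    show "AE x in lebesgue_on \<Omega>. norm (indicator T x * f x) \<le> \<bar>b\<bar>"
      using b closure_subset[of T] by (intro AE_I2) (auto simp: indicator_def intro: order_trans[OF _ abs_ge_self])
    show "(\<lambda>x. indicator T x * f x) \<in> borel_measurable (lebesgue_on \<Omega>)"
      using element_sets[OF assms(1)] continuous_measurable_lebesgue_on[OF assms(2)]
      by (intro borel_measurable_times borel_measurable_indicator)
  qed
qed

lemma continuous_bubble: "continuous_on A (bubble T)"
  unfolding bubble_def[abs_def] by (intro continuous_intros)

lemma integral_indicator_\<Omega>:
  assumes "A \<in> sets lebesgue" "A \<subseteq> \<Omega>"
  shows "(\<integral>x. indicator A x \<partial>lebesgue_on \<Omega>) = vol A"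
proof -
  have "measure (lebesgue_on \<Omega>) A = vol A"
    using assms \<Omega>_sets by (subst measure_restrict_space) auto
  moreover have "A \<in> sets (lebesgue_on \<Omega>)" using assms \<Omega>_sets by (subst sets_restrict_space_iff) auto
  ultimately show ?thesis using assms by (simp add: Int_absorb2)
qed

lemma bubble_integral:
  assumes T: "T \<in> \<T>"
  shows "bubble_const * vol T \<le> (\<integral>x. indicator T x * bubble T x \<partial>lebesgue_on \<Omega>)"
proof -
  let ?S = "verts T" and ?n = "CARD('n)"
  define \<delta> where "\<delta> = 1 / (2 * (real ?n + 1))"
  have d0: "\<delta> > 0" unfolding \<delta>_def by simp
  note S = verts_full[OF T]
  define c where "c = (\<Sum>s\<in>?S. (1 / (real ?n + 1)) *\<^sub>R s)"
  have u1: "(\<Sum>s\<in>?S. 1 / (real ?n + 1)) = 1" using card_verts[OF T] by simp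
  have bc: "bary ?S s c = 1 / (real ?n + 1)" if "s \<in> ?S" for s
    unfolding c_def using bary_combination[OF S u1 order_refl that] that by simp
  define A where "A = closure T \<inter> {x. \<forall>s\<in>?S. bary ?S s x \<ge> \<delta>}"
  have "closed (\<Inter>s\<in>?S. {x. bary ?S s x \<ge> \<delta>})"
    by (intro closed_INT ballI closed_Collect_le continuous_intros)
  moreover have "(\<Inter>s\<in>?S. {x. bary ?S s x \<ge> \<delta>}) = {x. \<forall>s\<in>?S. bary ?S s x \<ge> \<delta>}" by auto
  ultimately have "closed {x. \<forall>s\<in>?S. bary ?S s x \<ge> \<delta>}" by simp
  then have "compact A" unfolding A_def using bounded_T[OF T] by (intro compact_Int_closed) auto
  then have A: "A \<in> lmeasurable" by (rule lmeasurable_compact)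
  have "(1 / 2) ^ ?n * vol T \<le> vol (T \<inter> A)"
  proof (rule measure_homothety[OF open_T[OF T] convex_T[OF T] bounded_T[OF T], of c])
    show "c \<in> closure T" unfolding mem_closure_iff[OF T] using bc by simp
    fix x assume x: "x \<in> T"
    have "bary ?S s (c + (1 / 2) *\<^sub>R (x - c)) \<ge> \<delta>" if s: "s \<in> ?S" for s
    proof -
      have "bary ?S s (c + (1 / 2) *\<^sub>R (x - c)) = (bary ?S s c + bary ?S s x) / 2"
        using bary_diff[of ?S s "c + (1 / 2) *\<^sub>R (x - c)" c] bary_diff[of ?S s x c] by simp
      moreover have "bary ?S s x > 0" using x mem_element_iff[OF T] s by blast
      ultimately show ?thesis using bc[OF s] unfolding \<delta>_def by (simp add: field_simps)
    qed
    moreover from this have "c + (1 / 2) *\<^sub>R (x - c) \<in> closure T"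
      unfolding mem_closure_iff[OF T] using d0 by (meson less_imp_le order_trans)
    ultimately show "c + (1 / 2) *\<^sub>R (x - c) \<in> A" unfolding A_def by blast
  qed (use A in auto)
  then have "bubble_const * vol T \<le> \<delta> ^ Suc ?n * vol (T \<inter> A)"
    unfolding bubble_const_def \<delta>_def[symmetric] using d0
    mult_left_mono[of "(1 / 2) ^ ?n * vol T" "vol (T \<inter> A)" "\<delta> ^ Suc ?n"] by (simp add: power_divide)
  also have "\<dots> = (\<integral>x. \<delta> ^ Suc ?n * indicator (T \<inter> A) x \<partial>lebesgue_on \<Omega>)"
  proof -
    have "T \<in> sets lebesgue" "A \<in> sets lebesgue" using open_T[OF T] A by auto
    then have "(\<integral>x. indicator (T \<inter> A) x \<partial>lebesgue_on \<Omega>) = vol (T \<inter> A)"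
      by (intro integral_indicator_\<Omega> sets.Int) (use element_subset[OF T] in auto)
    then show ?thesis by (simp only: integral_mult_right_zero)
  qed
  also have "\<dots> \<le> (\<integral>x. indicator T x * bubble T x \<partial>lebesgue_on \<Omega>)"
  proof (rule integral_mono)
    interpret finite_measure "lebesgue_on \<Omega>" by (rule finite_measure_lebesgue_on_open[OF \<Omega>_bounded \<Omega>_open])
    have "T \<inter> A \<in> sets (lebesgue_on \<Omega>)"
      using A open_T[OF T] element_subset[OF T] \<Omega>_sets by (subst sets_restrict_space_iff) auto
    then show "integrable (lebesgue_on \<Omega>) (\<lambda>x. \<delta> ^ Suc ?n * indicator (T \<inter> A) x)"
      by (intro integrable_mult_right integrable_real_indicator) (auto simp: less_top[symmetric])
    show "integrable (lebesgue_on \<Omega>) (\<lambda>x. indicator T x * bubble T x)"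
      by (rule integrable_continuous_element[OF T continuous_bubble])
    fix x
    show "\<delta> ^ Suc ?n * indicator (T \<inter> A) x \<le> indicator T x * bubble T x"
    proof (cases "x \<in> T \<inter> A")
      case True
      then have "(\<Prod>s\<in>?S. \<delta>) \<le> bubble T x" unfolding bubble_def A_def using d0 by (intro prod_mono) auto
      then show ?thesis using True card_verts[OF T] by simp
    next
      case False
      then show ?thesis using bubble_range[OF T, of x] closure_subset[of T] by (auto simp: indicator_def)
    qed
  qed
  finally show ?thesis .
qed

end

context mesh
begin

section \<open>Energy of conforming functions and the companion\<close>

lemma sum_bary_grad: "T \<in> \<T> \<Longrightarrow> (\<Sum>s\<in>verts T. bary_grad (verts T) s) = 0"
proof -
  assume T: "T \<in> \<T>"
  have "(\<Sum>s\<in>verts T. bary_grad (verts T) s) \<bullet> x = 0" for x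
  proof -
    have "(\<Sum>s\<in>verts T. bary_grad (verts T) s) \<bullet> x = (\<Sum>s\<in>verts T. bary (verts T) s x - bary (verts T) s 0)"
      unfolding bary_diff by (simp add: inner_sum_left)
    also have "\<dots> = 0" unfolding sum_subtractf using bary_sum[OF verts_full[OF T]] by simp
    finally show ?thesis .
  qed
  then show ?thesis by (metis inner_eq_zero_iff)
qed

text \<open>The gradients of the coordinates add up to zero, so the nodal values count only relative
  to an arbitrary constant \<open>a\<close>.\<close>

lemma conf_grad_piece_bound:
  assumes T: "T \<in> \<T>" and x: "x \<in> closure T"
  shows "norm (conf_grad_piece U \<beta> T x) \<le> ((\<Sum>s\<in>verts T. \<bar>U s - a\<bar>) + \<bar>\<beta> T\<bar> * (real CARD('n) + 1)) * (\<kappa> / h T)"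
proof -
  let ?S = "verts T" and ?g = "bary_grad (verts T)"
  have hp: "h T > 0" by (rule h_pos[OF T])
  define q where "q = \<kappa> / h T"
  have gb: "norm (?g s) \<le> q" if "s \<in> ?S" for s
    using bary_grad_bound[OF T that] hp unfolding q_def by (simp add: pos_le_divide_eq)
  have "(\<Sum>s\<in>?S. U s *\<^sub>R ?g s) = (\<Sum>s\<in>?S. (U s - a) *\<^sub>R ?g s)"
    using sum_bary_grad[OF T] by (simp add: scaleR_diff_left sum_subtractf scaleR_sum_right[symmetric])
  also have "norm \<dots> \<le> (\<Sum>s\<in>?S. \<bar>U s - a\<bar> * q)"
    by (rule sum_norm_le) (use gb in \<open>auto intro: mult_left_mono\<close>)
  finally have 1: "norm (\<Sum>s\<in>?S. U s *\<^sub>R ?g s) \<le> (\<Sum>s\<in>?S. \<bar>U s - a\<bar>) * q"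
    by (simp add: sum_distrib_right)
  have xh: "x \<in> convex hull ?S" using x closure_hull[OF T] by simp
  have b01: "0 \<le> bary ?S s x" "bary ?S s x \<le> 1" if "s \<in> ?S" for s
    using bary_nonneg_iff[OF verts_full[OF T]] xh bary_le_1[OF verts_full[OF T] xh] that by auto
  have "norm (\<Sum>s\<in>?S. (\<Prod>t\<in>?S - {s}. bary ?S t x) *\<^sub>R ?g s) \<le> (\<Sum>s\<in>?S. q)"
  proof (rule sum_norm_le)
    fix s assume s: "s \<in> ?S"
    have "\<bar>\<Prod>t\<in>?S - {s}. bary ?S t x\<bar> \<le> 1"
      using b01 by (auto simp: abs_prod intro!: prod_le_1)
    then have "\<bar>\<Prod>t\<in>?S - {s}. bary ?S t x\<bar> * norm (?g s) \<le> 1 * q"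
      by (intro mult_mono gb s) auto
    then show "norm ((\<Prod>t\<in>?S - {s}. bary ?S t x) *\<^sub>R ?g s) \<le> q" by simp
  qed
  also have "\<dots> = (real CARD('n) + 1) * q" using card_verts[OF T] by simp
  finally have "\<bar>\<beta> T\<bar> * norm (\<Sum>s\<in>?S. (\<Prod>t\<in>?S - {s}. bary ?S t x) *\<^sub>R ?g s) \<le> \<bar>\<beta> T\<bar> * ((real CARD('n) + 1) * q)"
    by (rule mult_left_mono) simp
  then have 2: "norm (\<beta> T *\<^sub>R (\<Sum>s\<in>?S. (\<Prod>t\<in>?S - {s}. bary ?S t x) *\<^sub>R ?g s)) \<le> \<bar>\<beta> T\<bar> * (real CARD('n) + 1) * q"
    by (simp add: mult.assoc)
  have "norm (conf_grad_piece U \<beta> T x) \<le> (\<Sum>s\<in>?S. \<bar>U s - a\<bar>) * q + \<bar>\<beta> T\<bar> * (real CARD('n) + 1) * q"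
    unfolding conf_grad_piece_def by (rule order_trans[OF norm_triangle_ineq add_mono[OF 1 2]])
  then show ?thesis unfolding q_def[symmetric] by (simp add: distrib_right)
qed

lemma energy_bound:
  assumes T: "T \<in> \<T>" and b: "\<And>x. x \<in> T \<Longrightarrow> norm (g x) \<le> b" and g: "g \<in> L2 \<Omega>"
  shows "energy g T \<le> vol T * b\<^sup>2"
proof -
  interpret finite_measure "lebesgue_on \<Omega>" by (rule finite_measure_lebesgue_on_open[OF \<Omega>_bounded \<Omega>_open])
  have sT: "T \<in> sets lebesgue" using open_T[OF T] by auto
  have "energy g T \<le> (\<integral>z. b\<^sup>2 * indicator T z \<partial>lebesgue_on \<Omega>)"
    unfolding energy_def
  proof (rule integral_mono)
    show "integrable (lebesgue_on \<Omega>) (\<lambda>z. indicator T z * (norm (g z))\<^sup>2)"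
      by (rule integrable_indicator_L2[OF g sT])
    show "integrable (lebesgue_on \<Omega>) (\<lambda>z. b\<^sup>2 * indicator T z)"
      using element_sets[OF T] by (intro integrable_mult_right integrable_real_indicator) (auto simp: less_top[symmetric])
    show "indicator T z * (norm (g z))\<^sup>2 \<le> b\<^sup>2 * indicator T z" for z
      using b[of z] by (auto simp: indicator_def intro: power_mono)
  qed
  also have "\<dots> = b\<^sup>2 * vol T" using integral_indicator_\<Omega>[OF sT element_subset[OF T]] by simp
  finally show ?thesis by (simp add: mult.commute)
qed

text \<open>The squared gradient scales like the inverse square of the diameter and the volume like
  its \<open>n\<close>-th power, which produces the weight of the jump energy.\<close>

lemma conf_energy:
  assumes T: "T \<in> \<T>"
  shows "energy (conf_grad U \<beta>) T \<le> 2 ^ CARD('n) * \<kappa>\<^sup>2 * h T ^ (CARD('n) - 2) *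
    ((\<Sum>s\<in>verts T. \<bar>U s - a\<bar>) + \<bar>\<beta> T\<bar> * (real CARD('n) + 1))\<^sup>2"
proof -
  define q where "q = (\<Sum>s\<in>verts T. \<bar>U s - a\<bar>) + \<bar>\<beta> T\<bar> * (real CARD('n) + 1)"
  have hp: "h T > 0" by (rule h_pos[OF T])
  have "energy (conf_grad U \<beta>) T \<le> vol T * (q * (\<kappa> / h T))\<^sup>2"
  proof (rule energy_bound[OF T _ conf_grad_L2])
    fix x assume x: "x \<in> T"
    then show "norm (conf_grad U \<beta> x) \<le> q * (\<kappa> / h T)"
      unfolding conf_grad_eq[OF T x] q_def using closure_subset[of T] by (intro conf_grad_piece_bound T) auto
  qed
  also have "\<dots> \<le> (2 * h T) ^ CARD('n) * (q * (\<kappa> / h T))\<^sup>2"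
    by (intro mult_right_mono vol_le_h T) auto
  also have "\<dots> = 2 ^ CARD('n) * \<kappa>\<^sup>2 * h T ^ (CARD('n) - 2) * q\<^sup>2"
  proof -
    have "h T ^ CARD('n) = h T ^ (CARD('n) - 2) * (h T)\<^sup>2"
      using dim2 by (simp only: power_add[symmetric] le_add_diff_inverse2)
    then show ?thesis using hp by (simp add: power_mult_distrib power_divide)
  qed
  finally show ?thesis unfolding q_def .
qed

text \<open>Both bounds follow a chain of at most \<open>P\<close> links around the vertex.
  Diameters change by a factor at each link, hence their logarithms are compared.\<close>

lemma patch_estimates:
  assumes "T \<in> patch z" "T' \<in> patch z"
  shows "h T \<le> \<kappa> ^ P * h T'"
    and "\<And>u. (u T - u T')\<^sup>2 \<le> (real P)\<^sup>2 * (\<Sum>E\<in>facets_at z. (u (Tp E) - u (Tm E))\<^sup>2)"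
proof -
  have z: "T \<in> \<T>" "z \<in> verts T" "T' \<in> \<T>" using assms unfolding patch_def by auto
  note l = links_at[OF z(1,2)] and con = patch_linked[OF assms]
  have hp: "h T > 0" "h T' > 0" using h_pos z by auto
  have "\<bar>ln (h T) - ln (h T')\<bar> \<le> real P * ln \<kappa>"
  proof (rule rtrancl_increment_bound[OF l(1,2) con, of _ "\<lambda>T. ln (h T)"])
    show "0 \<le> ln \<kappa>" using kappa_ge_1 by simp
    fix A B assume "(A, B) \<in> links (facets_at z)"
    then have "adj A B" using l(3) by blast
    then have AB: "h A \<le> \<kappa> * h B" "h B \<le> \<kappa> * h A" "A \<in> \<T>" "B \<in> \<T>" using adj_h adj_sym unfolding adj_def by blast+
    have p: "h A > 0" "h B > 0" using h_pos AB by auto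
    have "ln (h A) \<le> ln (\<kappa> * h B)" "ln (h B) \<le> ln (\<kappa> * h A)" using AB p by (auto intro: ln_mono)
    then show "\<bar>ln (h A) - ln (h B)\<bar> \<le> ln \<kappa>" using p kappa_ge_1 by (simp add: ln_mult)
  qed
  then have "ln (h T) \<le> ln (\<kappa> ^ P * h T')" using hp kappa_ge_1 by (simp add: ln_mult ln_realpow)
  then show "h T \<le> \<kappa> ^ P * h T'" using hp kappa_ge_1 by (subst (asm) ln_le_cancel_iff) auto
  fix u :: "(real^'n) set \<Rightarrow> real"
  define q where "q = (\<Sum>E\<in>facets_at z. (u (Tp E) - u (Tm E))\<^sup>2)"
  have fin: "finite (facets_at z)" using finite_facets unfolding facets_at_def by simp
  have q0: "q \<ge> 0" unfolding q_def by (intro sum_nonneg) auto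
  have "\<bar>u T - u T'\<bar> \<le> real P * sqrt q"
  proof (rule rtrancl_increment_bound[OF l(1,2) con])
    fix A B assume "(A, B) \<in> links (facets_at z)"
    then obtain E where E: "E \<in> facets_at z" "{Tp E, Tm E} = {A, B}" unfolding links_def by blast
    have "(u (Tp E) - u (Tm E))\<^sup>2 \<le> q" unfolding q_def using fin E by (intro member_le_sum) auto
    then have "\<bar>u (Tp E) - u (Tm E)\<bar> \<le> sqrt q" by (rule real_le_rsqrt[of "\<bar>_\<bar>", simplified])
    then show "\<bar>u A - u B\<bar> \<le> sqrt q" using E(2) by (auto simp: doubleton_eq_iff abs_minus_commute)
  qed (use q0 in auto)
  then have "\<bar>u T - u T'\<bar>\<^sup>2 \<le> (real P * sqrt q)\<^sup>2" by (rule power_mono) simp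
  then show "(u T - u T')\<^sup>2 \<le> (real P)\<^sup>2 * q" using q0 by (simp add: power_mult_distrib)
qed

abbreviation jump_energy where
  "jump_energy u \<equiv> (\<Sum>E\<in>\<E>. h (Tp E) ^ (CARD('n) - 2) * (u (Tp E) - u (Tm E))\<^sup>2)"

text \<open>In order: the scaling of the gradient, the contribution of the bubble correction,
  Cauchy-Schwarz over the vertices, the comparison of diameters in a patch, the length of chains,
  and the number of pairs of an element and one of its vertices at which a given facet is
  counted.\<close>

definition disc_const :: real where
  "disc_const = 2 ^ CARD('n) * \<kappa>\<^sup>2 * (1 + (real CARD('n) + 1) / bubble_const)\<^sup>2 * (real CARD('n) + 1) *
    (\<kappa> ^ P) ^ (CARD('n) - 2) * (real P)\<^sup>2 * ((real CARD('n) + 1) * real (nat \<lceil>8 ^ CARD('n) * \<gamma>\<rceil>))"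

lemma disc_const_nonneg: "disc_const \<ge> 0"
  unfolding disc_const_def using bubble_const_pos kappa_ge_1
  by (intro mult_nonneg_nonneg) auto

text \<open>Double counting: a facet is counted only at vertices of its element \<open>Tp E\<close>,
  and at each of them at most once per element of the patch.\<close>

lemma vertex_facet_sum:
  assumes F: "\<And>E. E \<in> \<E> \<Longrightarrow> F E \<ge> (0::real)"
  shows "(\<Sum>T\<in>\<T>. \<Sum>s\<in>verts T. \<Sum>E\<in>facets_at s. F E)
    \<le> (real CARD('n) + 1) * real (nat \<lceil>8 ^ CARD('n) * \<gamma>\<rceil>) * (\<Sum>E\<in>\<E>. F E)"
proof -
  let ?c = "\<lambda>s E. if s \<in> closure E then 1 else (0::real)"
  have "(\<Sum>E\<in>facets_at s. F E) = (\<Sum>E\<in>\<E>. ?c s E * F E)" for s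
    unfolding facets_at_def using finite_facets by (subst sum.inter_filter) (auto intro!: sum.cong)
  then have "(\<Sum>T\<in>\<T>. \<Sum>s\<in>verts T. \<Sum>E\<in>facets_at s. F E) = (\<Sum>T\<in>\<T>. \<Sum>s\<in>verts T. \<Sum>E\<in>\<E>. ?c s E * F E)" by simp
  also have "\<dots> = (\<Sum>T\<in>\<T>. \<Sum>E\<in>\<E>. \<Sum>s\<in>verts T. ?c s E * F E)" by (subst sum.swap) simp
  also have "\<dots> = (\<Sum>E\<in>\<E>. \<Sum>T\<in>\<T>. \<Sum>s\<in>verts T. ?c s E * F E)" by (rule sum.swap)
  also have "\<dots> = (\<Sum>E\<in>\<E>. F E * (\<Sum>T\<in>\<T>. \<Sum>s\<in>verts T. ?c s E))"
    by (simp add: sum_distrib_left mult.commute)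
  also have "\<dots> \<le> (\<Sum>E\<in>\<E>. F E * ((real CARD('n) + 1) * real (nat \<lceil>8 ^ CARD('n) * \<gamma>\<rceil>)))"
  proof (intro sum_mono mult_left_mono F)
    fix E assume E: "E \<in> \<E>"
    have Tp: "Tp E \<in> \<T>" "closure E \<subseteq> closure (Tp E)" using facet_props[OF E] unfolding adj_def by auto
    have "(\<Sum>s\<in>verts T. ?c s E) \<le> (\<Sum>s\<in>verts (Tp E). if s \<in> verts T then 1 else 0)" if T: "T \<in> \<T>" for T
    proof -
      have "(\<Sum>s\<in>verts T. ?c s E) = (\<Sum>s\<in>verts T \<inter> closure E. 1)"
        using finite_verts[OF T] by (subst sum.inter_restrict) auto
      also have "\<dots> \<le> (\<Sum>s\<in>verts (Tp E) \<inter> verts T. 1)"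
        using finite_verts[OF Tp(1)] shared_vertex[OF T Tp(1)] Tp(2) by (intro sum_mono2) auto
      also have "\<dots> = (\<Sum>s\<in>verts (Tp E). if s \<in> verts T then 1 else 0)"
        using finite_verts[OF Tp(1)] by (subst sum.inter_restrict) auto
      finally show ?thesis .
    qed
    then have "(\<Sum>T\<in>\<T>. \<Sum>s\<in>verts T. ?c s E) \<le> (\<Sum>T\<in>\<T>. \<Sum>s\<in>verts (Tp E). if s \<in> verts T then 1 else 0)"
      by (rule sum_mono)
    also have "\<dots> = (\<Sum>s\<in>verts (Tp E). \<Sum>T\<in>\<T>. if s \<in> verts T then 1 else 0)" by (rule sum.swap)
    also have "\<dots> = (\<Sum>s\<in>verts (Tp E). real (card (patch s)))"
      unfolding patch_def using finite_mesh by (simp add: sum.inter_filter[symmetric])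
    also have "\<dots> \<le> (\<Sum>s\<in>verts (Tp E). real (nat \<lceil>8 ^ CARD('n) * \<gamma>\<rceil>))"
      by (intro sum_mono of_nat_mono card_patch)
    also have "\<dots> = (real CARD('n) + 1) * real (nat \<lceil>8 ^ CARD('n) * \<gamma>\<rceil>)" using card_verts[OF Tp(1)] by simp
    finally show "(\<Sum>T\<in>\<T>. \<Sum>s\<in>verts T. ?c s E) \<le> (real CARD('n) + 1) * real (nat \<lceil>8 ^ CARD('n) * \<gamma>\<rceil>)" .
  qed
  also have "\<dots> = (real CARD('n) + 1) * real (nat \<lceil>8 ^ CARD('n) * \<gamma>\<rceil>) * (\<Sum>E\<in>\<E>. F E)"
    unfolding sum_distrib_right[symmetric] by (rule mult.commute)
  finally show ?thesis .
qed

text \<open>Every piecewise constant function has the same element averages as a conforming function whose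
  gradient is controlled by the jumps: the nodal value at a vertex is taken from one element of its
  patch, and the bubbles correct the averages.\<close>

lemma conforming_companion:
  obtains w g where "w \<in> L2 \<Omega>" "g \<in> L2 \<Omega>" "has_weak_gradient \<Omega> w g" "continuous_on (closure \<Omega>) w"
    "\<And>T. T \<in> \<T> \<Longrightarrow> (\<integral>x. indicator T x * w x \<partial>lebesgue_on \<Omega>) = u T * vol T"
    "(L2_norm \<Omega> g)\<^sup>2 \<le> disc_const * jump_energy u"
proof -
  let ?n = "CARD('n)"
  define U where "U s = u (SOME T. T \<in> patch s)" for s
  have U: "\<exists>R\<in>patch s. U s = u R" if "T \<in> \<T>" "s \<in> verts T" for T s
    using someI[of "\<lambda>T. T \<in> patch s" T] that unfolding U_def patch_def by blast
  define p where "p T x = (\<Sum>s\<in>verts T. U s * bary (verts T) s x)" for T x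
  define I where "I f T = (\<integral>x. indicator T x * f x \<partial>lebesgue_on \<Omega>)" for f :: "real^'n \<Rightarrow> real" and T
  \<comment> \<open>The multiple of the bubble that corrects the integral over \<open>T\<close> to
    \<open>u T * vol T\<close>.\<close>
  define \<beta> where "\<beta> T = (u T * vol T - I (p T) T) / I (bubble T) T" for T
  define m where "m T = (\<Sum>s\<in>verts T. \<bar>U s - u T\<bar>)" for T
  have pc: "continuous_on UNIV (p T)" for T unfolding p_def[abs_def] by (intro continuous_intros)
  have Ib: "bubble_const * vol T \<le> I (bubble T) T" "I (bubble T) T > 0" if T: "T \<in> \<T>" for T
    using bubble_integral[OF T] mult_pos_pos[OF bubble_const_pos vol_pos[OF T]] unfolding I_def by auto
  have Iconf: "I (conf U \<beta>) T = u T * vol T" if T: "T \<in> \<T>" for T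
  proof -
    have "I (conf U \<beta>) T = (\<integral>x. indicator T x * p T x + \<beta> T * (indicator T x * bubble T x) \<partial>lebesgue_on \<Omega>)"
      unfolding I_def
    proof (rule Bochner_Integration.integral_cong[OF refl])
      fix x
      show "indicator T x * conf U \<beta> x = indicator T x * p T x + \<beta> T * (indicator T x * bubble T x)"
        using conf_eq[OF T, of x U \<beta>] closure_subset[of T]
        unfolding conf_piece_def p_def by (auto simp: indicator_def)
    qed
    also have "\<dots> = I (p T) T + \<beta> T * I (bubble T) T"
      unfolding I_def
      using integrable_continuous_element[OF T pc] integrable_continuous_element[OF T continuous_bubble] by simp
    also have "\<dots> = u T * vol T" unfolding \<beta>_def using Ib(2)[OF T] by simp
    finally show ?thesis .
  qed
  have \<beta>b: "\<bar>\<beta> T\<bar> \<le> m T / bubble_const" if T: "T \<in> \<T>" for T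
  proof -
    have sT: "T \<in> sets lebesgue" using open_T[OF T] by auto
    have int1: "integrable (lebesgue_on \<Omega>) (\<lambda>x. indicator T x * c)" for c :: real
      by (rule integrable_continuous_element[OF T]) simp
    have v: "u T * vol T = (\<integral>x. indicator T x * u T \<partial>lebesgue_on \<Omega>)"
      using integral_indicator_\<Omega>[OF sT element_subset[OF T]] by simp
    have "u T * vol T - I (p T) T = (\<integral>x. indicator T x * u T - indicator T x * p T x \<partial>lebesgue_on \<Omega>)"
      unfolding v I_def using int1 integrable_continuous_element[OF T pc] by simp
    also have "\<bar>\<dots>\<bar> \<le> (\<integral>x. \<bar>indicator T x * u T - indicator T x * p T x\<bar> \<partial>lebesgue_on \<Omega>)"
      by (rule integral_abs_bound)
    also have "\<dots> \<le> (\<integral>x. indicator T x * m T \<partial>lebesgue_on \<Omega>)"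
    proof (rule integral_mono)
      show "integrable (lebesgue_on \<Omega>) (\<lambda>x. \<bar>indicator T x * u T - indicator T x * p T x\<bar>)"
        using int1 integrable_continuous_element[OF T pc] by (intro integrable_abs Bochner_Integration.integrable_diff)
      fix x
      show "\<bar>indicator T x * u T - indicator T x * p T x\<bar> \<le> indicator T x * m T"
      proof (cases "x \<in> T")
        case True
        then have xh: "x \<in> convex hull (verts T)" using closure_hull[OF T] closure_subset[of T] by auto
        \<comment> \<open>The coordinates sum to 1, so the deviation is an average of the deviations
          at the vertices.\<close>
        have "u T - p T x = (\<Sum>s\<in>verts T. (u T - U s) * bary (verts T) s x)"
          unfolding p_def using bary_sum[OF verts_full[OF T], of x]
          by (simp add: left_diff_distrib sum_subtractf sum_distrib_left[symmetric])
        also have "\<bar>\<dots>\<bar> \<le> (\<Sum>s\<in>verts T. \<bar>(u T - U s) * bary (verts T) s x\<bar>)" by (rule sum_abs)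
        also have "\<dots> \<le> m T" unfolding m_def
        proof (rule sum_mono)
          fix s assume s: "s \<in> verts T"
          have "\<bar>u T - U s\<bar> * \<bar>bary (verts T) s x\<bar> \<le> \<bar>u T - U s\<bar> * 1"
            using bary_nonneg_iff[OF verts_full[OF T]] bary_le_1[OF verts_full[OF T] xh s] xh s
            by (intro mult_left_mono) auto
          then show "\<bar>(u T - U s) * bary (verts T) s x\<bar> \<le> \<bar>U s - u T\<bar>" by (simp add: abs_mult abs_minus_commute)
        qed
        finally show ?thesis using True by simp
      qed simp
    qed (rule int1)
    also have "\<dots> = m T * vol T" using integral_indicator_\<Omega>[OF sT element_subset[OF T]] by simp
    finally have num: "\<bar>u T * vol T - I (p T) T\<bar> \<le> m T * vol T" .
    have m0: "m T \<ge> 0" unfolding m_def by (intro sum_nonneg) auto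
    have "\<bar>\<beta> T\<bar> = \<bar>u T * vol T - I (p T) T\<bar> / I (bubble T) T" unfolding \<beta>_def using Ib(2)[OF T] by simp
    also have "\<dots> \<le> (m T * vol T) / (bubble_const * vol T)"
      using num Ib[OF T] mult_pos_pos[OF bubble_const_pos vol_pos[OF T]] m0 vol_pos[OF T] by (intro frac_le) auto
    also have "\<dots> = m T / bubble_const" using vol_pos[OF T] by simp
    finally show ?thesis .
  qed
  define G where "G = 2 ^ ?n * \<kappa>\<^sup>2 * (1 + (real ?n + 1) / bubble_const)\<^sup>2"
  have G0: "G \<ge> 0" unfolding G_def by simp
  define W where "W = (\<kappa> ^ P) ^ (?n - 2)"
  have W0: "W \<ge> 0" unfolding W_def using kappa_ge_1 by simp
  have eT: "energy (conf_grad U \<beta>) T \<le> (G * (real ?n + 1) * W * (real P)\<^sup>2) *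
      (\<Sum>s\<in>verts T. \<Sum>E\<in>facets_at s. h (Tp E) ^ (?n - 2) * (u (Tp E) - u (Tm E))\<^sup>2)" if T: "T \<in> \<T>" for T
  proof -
    have hp: "h T > 0" by (rule h_pos[OF T])
    have m0: "m T \<ge> 0" unfolding m_def by (intro sum_nonneg) auto
    have "energy (conf_grad U \<beta>) T \<le> 2 ^ ?n * \<kappa>\<^sup>2 * h T ^ (?n - 2) * (m T + \<bar>\<beta> T\<bar> * (real ?n + 1))\<^sup>2"
      using conf_energy[OF T, of U \<beta> "u T"] unfolding m_def .
    also have "\<dots> \<le> 2 ^ ?n * \<kappa>\<^sup>2 * h T ^ (?n - 2) * (m T * (1 + (real ?n + 1) / bubble_const))\<^sup>2"
    proof (intro mult_left_mono power_mono)
      have "\<bar>\<beta> T\<bar> * (real ?n + 1) \<le> m T / bubble_const * (real ?n + 1)" using \<beta>b[OF T] by (intro mult_right_mono) auto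
      moreover have "m T * (1 + (real ?n + 1) / bubble_const) = m T + m T / bubble_const * (real ?n + 1)"
        using bubble_const_pos by (simp add: field_simps)
      ultimately show "m T + \<bar>\<beta> T\<bar> * (real ?n + 1) \<le> m T * (1 + (real ?n + 1) / bubble_const)" by linarith
    qed (use m0 hp in auto)
    also have "\<dots> = G * (h T ^ (?n - 2) * (m T)\<^sup>2)" unfolding G_def by (simp add: power_mult_distrib)
    finally have eG: "energy (conf_grad U \<beta>) T \<le> G * (h T ^ (?n - 2) * (m T)\<^sup>2)" .
    have m2: "(m T)\<^sup>2 \<le> (real ?n + 1) * (\<Sum>s\<in>verts T. (U s - u T)\<^sup>2)"
      using sum_squared_le_sum_of_squares[of "\<lambda>s. \<bar>U s - u T\<bar>" "verts T"] card_verts[OF T] finite_verts[OF T]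
      unfolding m_def by (simp add: mult.commute add.commute)
    have hS: "h T ^ (?n - 2) * ((real ?n + 1) * (\<Sum>s\<in>verts T. (U s - u T)\<^sup>2))
      \<le> ((real ?n + 1) * W * (real P)\<^sup>2) *
        (\<Sum>s\<in>verts T. \<Sum>E\<in>facets_at s. h (Tp E) ^ (?n - 2) * (u (Tp E) - u (Tm E))\<^sup>2)"
    proof -
      have "h T ^ (?n - 2) * (U s - u T)\<^sup>2 \<le> (W * (real P)\<^sup>2) *
          (\<Sum>E\<in>facets_at s. h (Tp E) ^ (?n - 2) * (u (Tp E) - u (Tm E))\<^sup>2)" if s: "s \<in> verts T" for s
      proof -
        obtain R where R: "R \<in> patch s" "U s = u R" using U[OF T s] by blast
        have Ts: "T \<in> patch s" using T s unfolding patch_def by blast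
        have "h T ^ (?n - 2) * (U s - u T)\<^sup>2
            \<le> h T ^ (?n - 2) * ((real P)\<^sup>2 * (\<Sum>E\<in>facets_at s. (u (Tp E) - u (Tm E))\<^sup>2))"
          unfolding R(2) using patch_estimates(2)[OF R(1) Ts] hp by (intro mult_left_mono) auto
        also have "\<dots> = (real P)\<^sup>2 * (\<Sum>E\<in>facets_at s. h T ^ (?n - 2) * (u (Tp E) - u (Tm E))\<^sup>2)"
          by (simp add: sum_distrib_left mult.left_commute)
        also have "\<dots> \<le> (real P)\<^sup>2 * (\<Sum>E\<in>facets_at s. W * (h (Tp E) ^ (?n - 2) * (u (Tp E) - u (Tm E))\<^sup>2))"
        proof (intro mult_left_mono sum_mono)
          fix E assume E: "E \<in> facets_at s"
          have "(Tp E, Tm E) \<in> links (facets_at s)" using E unfolding links_def by blast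
          then have "Tp E \<in> patch s" using links_at(3)[OF T s] by blast
          then have "h T ^ (?n - 2) \<le> (\<kappa> ^ P * h (Tp E)) ^ (?n - 2)"
            using patch_estimates(1)[OF Ts] hp by (intro power_mono) auto
          then have "h T ^ (?n - 2) \<le> W * h (Tp E) ^ (?n - 2)" unfolding W_def by (simp add: power_mult_distrib)
          then have "h T ^ (?n - 2) * (u (Tp E) - u (Tm E))\<^sup>2 \<le> (W * h (Tp E) ^ (?n - 2)) * (u (Tp E) - u (Tm E))\<^sup>2"
            by (rule mult_right_mono) simp
          then show "h T ^ (?n - 2) * (u (Tp E) - u (Tm E))\<^sup>2 \<le> W * (h (Tp E) ^ (?n - 2) * (u (Tp E) - u (Tm E))\<^sup>2)"
            by (simp add: mult.assoc)
        qed auto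
        also have "\<dots> = (W * (real P)\<^sup>2) * (\<Sum>E\<in>facets_at s. h (Tp E) ^ (?n - 2) * (u (Tp E) - u (Tm E))\<^sup>2)"
          by (simp add: sum_distrib_left[symmetric] mult_ac)
        finally show ?thesis .
      qed
      then have "(real ?n + 1) * (\<Sum>s\<in>verts T. h T ^ (?n - 2) * (U s - u T)\<^sup>2) \<le>
          (real ?n + 1) * (\<Sum>s\<in>verts T. (W * (real P)\<^sup>2) *
          (\<Sum>E\<in>facets_at s. h (Tp E) ^ (?n - 2) * (u (Tp E) - u (Tm E))\<^sup>2))"
        by (intro mult_left_mono sum_mono) auto
      then show ?thesis by (simp add: sum_distrib_left mult_ac)
    qed
    have "h T ^ (?n - 2) * (m T)\<^sup>2 \<le> h T ^ (?n - 2) * ((real ?n + 1) * (\<Sum>s\<in>verts T. (U s - u T)\<^sup>2))"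
      using m2 hp by (intro mult_left_mono) auto
    from mult_left_mono[OF order_trans[OF this hS] G0] show ?thesis
      using eG by (simp add: mult.assoc)
  qed
  show ?thesis
  proof (rule that[of "conf U \<beta>" "conf_grad U \<beta>"])
    show "(\<integral>x. indicator T x * conf U \<beta> x \<partial>lebesgue_on \<Omega>) = u T * vol T" if "T \<in> \<T>" for T
      using Iconf[OF that] unfolding I_def .
    have "(L2_norm \<Omega> (conf_grad U \<beta>))\<^sup>2 = (\<Sum>T\<in>\<T>. energy (conf_grad U \<beta>) T)" using energy_sum[OF conf_grad_L2] by simp
    also have "\<dots> \<le> (\<Sum>T\<in>\<T>. (G * (real ?n + 1) * W * (real P)\<^sup>2) *
      (\<Sum>s\<in>verts T. \<Sum>E\<in>facets_at s. h (Tp E) ^ (?n - 2) * (u (Tp E) - u (Tm E))\<^sup>2))"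
      by (rule sum_mono[OF eT])
    also have "\<dots> = (G * (real ?n + 1) * W * (real P)\<^sup>2) *
      (\<Sum>T\<in>\<T>. \<Sum>s\<in>verts T. \<Sum>E\<in>facets_at s. h (Tp E) ^ (?n - 2) * (u (Tp E) - u (Tm E))\<^sup>2)"
      by (rule sum_distrib_left[symmetric])
    also have "\<dots> \<le> (G * (real ?n + 1) * W * (real P)\<^sup>2) *
       ((real ?n + 1) * real (nat \<lceil>8 ^ ?n * \<gamma>\<rceil>) * jump_energy u)"
    proof (intro mult_left_mono vertex_facet_sum)
      fix E assume "E \<in> \<E>"
      then have "h (Tp E) > 0" using facet_props(1) h_pos unfolding adj_def by blast
      then show "0 \<le> h (Tp E) ^ (?n - 2) * (u (Tp E) - u (Tm E))\<^sup>2" by simp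
    qed (use G0 W0 in auto)
    also have "\<dots> = disc_const * jump_energy u" unfolding disc_const_def G_def W_def by (simp only: mult.assoc)
    finally show "(L2_norm \<Omega> (conf_grad U \<beta>))\<^sup>2 \<le> disc_const * jump_energy u" .
  qed (use conf_L2 conf_grad_L2 conf_weak_gradient continuous_conf in auto)
qed

section \<open>The Poincare inequality through a mesh\<close>

text \<open>Chains of facets through the whole mesh bound the differences of the element averages,
  the vanishing mean then bounds the averages themselves, and the inequality on each convex element
  does the rest. \<open>C\<close> may depend on the mesh, since it will be taken from a single
  one.\<close>

lemma Poincare_mesh:
  obtains C where "C \<ge> 0"
    "\<And>v g. v \<in> L2 \<Omega> \<Longrightarrow> g \<in> L2 \<Omega> \<Longrightarrow> has_weak_gradient \<Omega> v g \<Longrightarrow> continuous_on (closure \<Omega>) v \<Longrightarrow>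
      (\<integral>x. v x \<partial>lebesgue_on \<Omega>) = 0 \<Longrightarrow> (L2_norm \<Omega> v)\<^sup>2 \<le> C * (L2_norm \<Omega> g)\<^sup>2"
proof -
  let ?n = "CARD('n)"
  have hE: "h (Tp E) ^ (?n - 2) > 0" if "E \<in> \<E>" for E
    using facet_props(1)[OF that] h_pos unfolding adj_def by auto
  have nn: "0 \<le> 2 * jump_const / h (Tp E) ^ (?n - 2)" if "E \<in> \<E>" for E
    using jump_const_nonneg hE[OF that] by (intro divide_nonneg_pos) auto
  define J where "J = (\<Sum>E\<in>\<E>. 2 * jump_const / h (Tp E) ^ (?n - 2))"
  have J0: "J \<ge> 0" unfolding J_def using nn by (rule sum_nonneg)
  define M where "M = real (card (links \<E>)) * sqrt J"
  define C where "C = (\<Sum>T\<in>\<T>. 2 * vol T * M\<^sup>2 + 4 * 4 ^ ?n * (h T)\<^sup>2)"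
  have finl: "finite (links \<E>)"
  proof (rule finite_subset)
    show "links \<E> \<subseteq> \<T> \<times> \<T>"
    proof
      fix q assume "q \<in> links \<E>"
      then obtain A B E where q: "q = (A, B)" "E \<in> \<E>" "{Tp E, Tm E} = {A, B}" unfolding links_def by auto
      then show "q \<in> \<T> \<times> \<T>" using facet_props(1)[OF q(2)] unfolding adj_def by (auto simp: doubleton_eq_iff)
    qed
  qed (use finite_mesh in auto)
  show ?thesis
  proof (rule that[of C])
    show "C \<ge> 0" unfolding C_def by (intro sum_nonneg) auto
    fix v g assume v: "v \<in> L2 \<Omega>" and g: "g \<in> L2 \<Omega>" and wg: "has_weak_gradient \<Omega> v g"
      and vc: "continuous_on (closure \<Omega>) v" and v0: "(\<integral>x. v x \<partial>lebesgue_on \<Omega>) = 0"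
    define N where "N = L2_norm \<Omega> g"
    have N0: "N \<ge> 0" unfolding N_def L2_norm_def by (auto intro!: Bochner_Integration.integral_nonneg)
    have en: "energy g T \<le> N\<^sup>2" if "T \<in> \<T>" for T
      unfolding N_def energy_sum[OF g, symmetric] using finite_mesh that energy_nonneg by (intro member_le_sum) auto
    define a where "a T = avg \<Omega> T v" for T
    have step: "\<bar>a A - a B\<bar> \<le> sqrt J * N" if AB: "(A, B) \<in> links \<E>" for A B
    proof -
      obtain E where E: "E \<in> \<E>" "{Tp E, Tm E} = {A, B}" using AB unfolding links_def by auto
      have adj: "adj (Tp E) (Tm E)" by (rule facet_props(1)[OF E(1)])
      have "h (Tp E) ^ (?n - 2) * (a (Tp E) - a (Tm E))\<^sup>2 \<le> jump_const * (energy g (Tp E) + energy g (Tm E))"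
        unfolding a_def by (rule jump_bound[OF v g wg adj])
      also have "\<dots> \<le> jump_const * (2 * N\<^sup>2)"
      proof (rule mult_left_mono[OF _ jump_const_nonneg])
        show "energy g (Tp E) + energy g (Tm E) \<le> 2 * N\<^sup>2"
          using en[of "Tp E"] en[of "Tm E"] adj unfolding adj_def by linarith
      qed
      finally have "(a (Tp E) - a (Tm E))\<^sup>2 \<le> 2 * jump_const / h (Tp E) ^ (?n - 2) * N\<^sup>2"
        using hE[OF E(1)] by (simp add: field_simps)
      also have "2 * jump_const / h (Tp E) ^ (?n - 2) \<le> J"
        unfolding J_def using finite_facets E(1) nn
        by (intro member_le_sum[where f = "\<lambda>E. 2 * jump_const / h (Tp E) ^ (?n - 2)"]) auto
      finally have "(a (Tp E) - a (Tm E))\<^sup>2 \<le> (sqrt J * N)\<^sup>2"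
        using J0 by (simp add: power_mult_distrib mult_right_mono)
      then have "\<bar>a (Tp E) - a (Tm E)\<bar> \<le> \<bar>sqrt J * N\<bar>" unfolding abs_le_square_iff .
      then have "\<bar>a (Tp E) - a (Tm E)\<bar> \<le> sqrt J * N" using J0 N0 by simp
      then show ?thesis using E(2) by (auto simp: doubleton_eq_iff abs_minus_commute)
    qed
    have diff: "\<bar>a T - a T'\<bar> \<le> M * N" if "T \<in> \<T>" "T' \<in> \<T>" for T T'
      using rtrancl_increment_bound[OF finl order_refl mesh_linked[OF that] _ step] J0 N0
      unfolding M_def by (simp add: mult.assoc)
    have vi: "integrable (lebesgue_on \<Omega>) v" by (rule L2_integrable[OF \<Omega>_bounded \<Omega>_open v])
    have aT: "(\<integral>x. indicator T x * v x \<partial>lebesgue_on \<Omega>) = a T * vol T" if "T \<in> \<T>" for T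
      unfolding a_def avg_def using vol_pos[OF that] by (simp add: mult.commute)
    have sum0: "(\<Sum>T\<in>\<T>. a T * vol T) = 0" using integral_elements[OF vi] v0 aT by simp
    have ab: "\<bar>a T\<bar> \<le> M * N" if T: "T \<in> \<T>" for T
    proof -
      have vp: "(\<Sum>T'\<in>\<T>. vol T') > 0" using finite_mesh mesh_nonempty vol_pos by (intro sum_pos) auto
      \<comment> \<open>As the volume-weighted mean of the averages is zero, each average is a mean
        of differences.\<close>
      have "a T * (\<Sum>T'\<in>\<T>. vol T') = (\<Sum>T'\<in>\<T>. (a T - a T') * vol T')"
        using sum0 by (simp add: left_diff_distrib sum_subtractf sum_distrib_left)
      also have "\<bar>\<dots>\<bar> \<le> (\<Sum>T'\<in>\<T>. \<bar>(a T - a T') * vol T'\<bar>)" by (rule sum_abs)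
      also have "\<dots> \<le> (\<Sum>T'\<in>\<T>. (M * N) * vol T')"
        by (intro sum_mono) (auto simp: abs_mult intro!: mult_right_mono diff T)
      also have "\<dots> = (M * N) * (\<Sum>T'\<in>\<T>. vol T')" by (rule sum_distrib_left[symmetric])
      finally show ?thesis using vp by (simp add: abs_mult)
    qed
    have v2: "integrable (lebesgue_on \<Omega>) (\<lambda>x. (v x)\<^sup>2)" using v unfolding L2_def by simp
    have "(L2_norm \<Omega> v)\<^sup>2 = (\<integral>x. (v x)\<^sup>2 \<partial>lebesgue_on \<Omega>)"
      unfolding L2_norm_def by (simp add: Bochner_Integration.integral_nonneg)
    also have "\<dots> = (\<Sum>T\<in>\<T>. \<integral>x. indicator T x * (v x)\<^sup>2 \<partial>lebesgue_on \<Omega>)"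
      by (rule integral_elements[OF v2])
    also have "\<dots> \<le> (\<Sum>T\<in>\<T>. (2 * vol T * M\<^sup>2 + 4 * 4 ^ ?n * (h T)\<^sup>2) * N\<^sup>2)"
    proof (rule sum_mono)
      fix T assume T: "T \<in> \<T>"
      have cl: "closure T \<subseteq> closure \<Omega>" using T cover by auto
      have "(\<integral>x. indicator T x * (v x)\<^sup>2 \<partial>lebesgue_on \<Omega>) \<le> 2 * vol T * (a T)\<^sup>2 + 4 * 4 ^ ?n * (h T)\<^sup>2 * energy g T"
        unfolding a_def energy_def
      proof (rule Poincare_convex[OF \<Omega>_bounded \<Omega>_open v g wg convex_T[OF T] open_T[OF T] element_subset[OF T]])
        show "norm (x - z) \<le> h T" if "x \<in> T" "z \<in> T" for x z
          using norm_le_h[OF T] that closure_subset[of T] by blast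
      qed (use vol_pos[OF T] continuous_on_subset[OF vc cl] in auto)
      also have "\<dots> \<le> 2 * vol T * (M\<^sup>2 * N\<^sup>2) + 4 * 4 ^ ?n * (h T)\<^sup>2 * N\<^sup>2"
      proof (intro add_mono mult_left_mono en[OF T])
        show "(a T)\<^sup>2 \<le> M\<^sup>2 * N\<^sup>2" using power_mono[OF ab[OF T], of 2] by (simp add: power_mult_distrib)
      qed auto
      finally show "(\<integral>x. indicator T x * (v x)\<^sup>2 \<partial>lebesgue_on \<Omega>) \<le> (2 * vol T * M\<^sup>2 + 4 * 4 ^ ?n * (h T)\<^sup>2) * N\<^sup>2"
        by (simp add: distrib_right mult.assoc)
    qed
    also have "\<dots> = C * N\<^sup>2" unfolding C_def by (rule sum_distrib_right[symmetric])
    finally show "(L2_norm \<Omega> v)\<^sup>2 \<le> C * (L2_norm \<Omega> g)\<^sup>2" unfolding N_def .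
  qed
qed

end

section \<open>Positive measure of a facet\<close>

text \<open>In orthonormal coordinates a relatively open bounded set contains a small cube and lies
  in a large one. The large cube matters too, because a set of infinite measure would have
  \<open>measure\<close> 0. Positivity permits recovering a coefficient by division by the facet
  measure.\<close>

lemma flat_measure_pos:
  fixes E :: "(real^'n) set"
  assumes ne: "E \<noteq> {}" and bd: "bounded E" and op: "openin (top_of_set (affine hull E)) E"
  shows "flat_measure E > 0"
proof -
  define a where "a = (SOME a. a \<in> E)"
  have a: "a \<in> E" unfolding a_def using ne by (simp add: some_in_eq)
  define V where "V = span {x - y | x y. x \<in> E \<and> y \<in> E}"
  define B where "B = (SOME B. pairwise orthogonal B \<and> (\<forall>b\<in>B. norm b = 1) \<and> span B = V)"
  define M where "M = Pi\<^sub>M B (\<lambda>_. lborel :: real measure)"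
  have "\<exists>B. pairwise orthogonal B \<and> (\<forall>b\<in>B. norm b = 1) \<and> span B = V"
  proof -
    have "subspace V" unfolding V_def by (rule subspace_span)
    from orthonormal_basis_subspace[OF this] obtain B where
      "pairwise orthogonal B" "\<And>x. x \<in> B \<Longrightarrow> norm x = 1" "span B = V" by metis
    then show ?thesis by (intro exI[of _ B]) simp
  qed
  from someI_ex[OF this] have "pairwise orthogonal B \<and> (\<forall>b\<in>B. norm b = 1) \<and> span B = V" unfolding B_def .
  then have B: "pairwise orthogonal B" "\<And>b. b \<in> B \<Longrightarrow> norm b = 1" "span B = V" by auto
  have "0 \<notin> B" using B(2) by force
  then have "independent B" using pairwise_orthogonal_independent[OF B(1)] by blast
  then have fin: "finite B" by (rule independent_imp_finite)
  interpret finite_product_sigma_finite "\<lambda>_. lborel :: real measure" B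
    by standard (rule fin)
  define f where "f c = a + (\<Sum>b\<in>B. c b *\<^sub>R b)" for c :: "real^'n \<Rightarrow> real"
  define X where "X = {c \<in> space M. f c \<in> E}"
  have flat: "flat_measure E = measure M X"
    unfolding flat_measure_def Let_def X_def M_def B_def V_def a_def f_def ..
  have "(\<lambda>c. c b) \<in> borel_measurable M" if "b \<in> B" for b
    using measurable_component_singleton[OF that, of "\<lambda>_. lborel :: real measure"] unfolding M_def by simp
  then have fm: "f \<in> borel_measurable M"
    unfolding f_def[abs_def]
    by (intro borel_measurable_add borel_measurable_const borel_measurable_sum borel_measurable_scaleR)
  obtain O' where O': "open O'" "E = affine hull E \<inter> O'" using op by (auto simp: openin_open)
  have "closed (affine hull E)" by simp
  then have "affine hull E \<in> sets borel" "O' \<in> sets borel" using O'(1) by auto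
  then have "affine hull E \<inter> O' \<in> sets borel" by (rule sets.Int)
  then have Eb: "E \<in> sets borel" using O'(2) by simp
  have Xm: "X \<in> sets M" unfolding X_def using measurable_sets[OF fm Eb] by (simp add: vimage_def Int_def conj_commute)
  have hull: "f c \<in> affine hull E" for c
  proof -
    have "(\<Sum>b\<in>B. c b *\<^sub>R b) \<in> span B" by (intro span_sum span_scale span_base)
    also have "span B \<subseteq> span ((\<lambda>x. - a + x) ` E)" unfolding B(3) V_def
    proof (rule span_minimal)
      show "{x - y | x y. x \<in> E \<and> y \<in> E} \<subseteq> span ((\<lambda>x. - a + x) ` E)"
      proof safe
        fix x y assume "x \<in> E" "y \<in> E"
        then have "(- a + x) - (- a + y) \<in> span ((\<lambda>x. - a + x) ` E)" by (intro span_diff span_base) auto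
        then show "x - y \<in> span ((\<lambda>x. - a + x) ` E)" by simp
      qed
    qed (rule subspace_span)
    finally show ?thesis unfolding f_def affine_hull_span_gen[OF hull_inc[of a E affine, OF a]] by auto
  qed
  obtain e where e: "e > 0" "ball a e \<subseteq> O'" using O' a open_contains_ball by blast
  \<comment> \<open>A sum of \<open>card B\<close> vectors of length at most \<open>\<delta>\<close>
    then stays strictly inside the ball of radius \<open>e\<close>.\<close>
  define \<delta> where "\<delta> = e / (real (card B) + 1)"
  have d0: "\<delta> > 0" unfolding \<delta>_def using e by simp
  have box: "(\<Pi>\<^sub>E b\<in>B. {- \<delta><..<\<delta>}) \<subseteq> X"
  proof
    fix c assume c: "c \<in> (\<Pi>\<^sub>E b\<in>B. {- \<delta><..<\<delta>})"
    have "norm (\<Sum>b\<in>B. c b *\<^sub>R b) \<le> (\<Sum>b\<in>B. \<delta>)"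
    proof (rule sum_norm_le)
      fix b assume b: "b \<in> B"
      then have "c b \<in> {- \<delta><..<\<delta>}" using c by (auto simp: PiE_iff)
      then show "norm (c b *\<^sub>R b) \<le> \<delta>" using B(2)[OF b] by auto
    qed
    also have "\<dots> < e"
    proof -
      have "\<delta> * (real (card B) + 1) = e" unfolding \<delta>_def by (simp add: add_nonneg_eq_0_iff)
      then have "e = \<delta> * real (card B) + \<delta>" by (simp add: distrib_left)
      then show ?thesis using d0 by (simp add: mult.commute)
    qed
    finally have "f c \<in> ball a e" unfolding f_def by (simp add: dist_norm)
    then have "f c \<in> E" using hull[of c] O'(2) e(2) by blast
    moreover have "c \<in> space M" using c unfolding M_def by (auto simp: space_PiM PiE_iff)
    ultimately show "c \<in> X" unfolding X_def by blast
  qed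
  obtain R where R: "\<And>x. x \<in> E \<Longrightarrow> norm (x - a) \<le> R"
    using bounded_translation_minus[OF bd, of a] by (auto simp: bounded_iff)
  have X_sub: "X \<subseteq> (\<Pi>\<^sub>E b\<in>B. {- R..R})"
  proof
    fix c assume c: "c \<in> X"
    have "\<bar>c b\<bar> \<le> R" if b: "b \<in> B" for b
    proof -
      have "(\<Sum>b'\<in>B. c b' *\<^sub>R b') \<bullet> b = (\<Sum>b'\<in>B. if b' = b then c b else 0)"
        unfolding inner_sum_left
      proof (rule sum.cong[OF refl])
        fix b' assume b': "b' \<in> B"
        show "(c b' *\<^sub>R b') \<bullet> b = (if b' = b then c b else 0)"
          using B(1) b b' B(2)[OF b] unfolding pairwise_def orthogonal_def by (auto simp: dot_square_norm)
      qed
      also have "\<dots> = c b" using fin b by simp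
      finally have "c b = (f c - a) \<bullet> b" unfolding f_def by simp
      then have "\<bar>c b\<bar> \<le> norm (f c - a) * norm b" using Cauchy_Schwarz_ineq2 by metis
      moreover have "norm (f c - a) \<le> R" using R c unfolding X_def by blast
      ultimately show ?thesis using B(2)[OF b] by simp
    qed
    moreover have "c \<in> extensional B" using c unfolding X_def M_def by (auto simp: space_PiM PiE_iff)
    ultimately show "c \<in> (\<Pi>\<^sub>E b\<in>B. {- R..R})" by (auto simp: PiE_iff abs_le_iff minus_le_iff)
  qed
  have "emeasure M (\<Pi>\<^sub>E b\<in>B. {- \<delta><..<\<delta>}) = (\<Prod>b\<in>B. emeasure lborel {- \<delta><..<\<delta>})"
    unfolding M_def by (rule measure_times) auto
  also have "\<dots> = ennreal ((2 * \<delta>) ^ card B)" using d0 by (simp add: ennreal_power)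
  finally have "emeasure M (\<Pi>\<^sub>E b\<in>B. {- \<delta><..<\<delta>}) > 0" using d0 by simp
  also have "\<dots> \<le> emeasure M X" by (rule emeasure_mono[OF box Xm])
  finally have "emeasure M X > 0" .
  moreover have "emeasure M X < \<infinity>"
  proof -
    have "emeasure M X \<le> emeasure M (\<Pi>\<^sub>E b\<in>B. {- R..R})"
      unfolding M_def using X_sub by (intro emeasure_mono) (auto intro: sets_PiM_I_finite fin)
    also have "\<dots> = (\<Prod>b\<in>B. emeasure lborel {- R..R})" unfolding M_def by (rule measure_times) auto
    also have "\<dots> = ennreal ((2 * R) ^ card B)" using R[OF a] by (simp add: ennreal_power)
    also have "\<dots> < \<infinity>" by simp
    finally show ?thesis .
  qed
  ultimately show ?thesis unfolding flat by (simp add: measure_def enn2real_positive_iff)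
qed

subsection \<open>The dual norm\<close>

lemma L2_inner_bound:
  assumes "\<phi> \<in> L2 \<Omega>" "v \<in> L2 \<Omega>"
  shows "\<bar>L2_inner \<Omega> \<phi> v\<bar> \<le> L2_norm \<Omega> \<phi> * L2_norm \<Omega> v"
    "integrable (lebesgue_on \<Omega>) (\<lambda>x. \<phi> x * v x)"
  unfolding L2_inner_def L2_norm_def
  using assms Cauchy_Schwarz_integral[of \<phi> "lebesgue_on \<Omega>" v] integrable_mult_square[of \<phi> "lebesgue_on \<Omega>" v]
  unfolding L2_def by auto

lemma L2_norm_le_H1_norm: "L2_norm \<Omega> v \<le> H1_norm \<Omega> v" "L2_norm \<Omega> (weak_gradient \<Omega> v) \<le> H1_norm \<Omega> v"
  "0 \<le> H1_norm \<Omega> v" "0 \<le> L2_norm \<Omega> v"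
proof -
  show "0 \<le> L2_norm \<Omega> v" unfolding L2_norm_def by (auto intro!: Bochner_Integration.integral_nonneg)
  show "L2_norm \<Omega> v \<le> H1_norm \<Omega> v" "L2_norm \<Omega> (weak_gradient \<Omega> v) \<le> H1_norm \<Omega> v" "0 \<le> H1_norm \<Omega> v"
    unfolding H1_norm_def by (auto intro: real_le_rsqrt)
qed

lemma H1_norm_pos:
  assumes "v \<in> H1 \<Omega>" "\<not> (AE x in lebesgue_on \<Omega>. v x = 0)"
  shows "H1_norm \<Omega> v > 0"
proof -
  have v: "integrable (lebesgue_on \<Omega>) (\<lambda>x. (norm (v x))\<^sup>2)" using assms(1) unfolding H1_def L2_def by auto
  have "L2_norm \<Omega> v \<noteq> 0"
  proof
    assume "L2_norm \<Omega> v = 0"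
    then have "(\<integral>x. (norm (v x))\<^sup>2 \<partial>lebesgue_on \<Omega>) = 0" unfolding L2_norm_def by simp
    then have "AE x in lebesgue_on \<Omega>. (norm (v x))\<^sup>2 = 0"
      using integral_nonneg_eq_0_iff_AE[OF v] by simp
    then show False using assms(2) by simp
  qed
  then show ?thesis using L2_norm_le_H1_norm(1,4)[of \<Omega> v] by linarith
qed

text \<open>A real supremum dominates its members only if the set is bounded above; the L2 norm of
  \<phi> is such a bound.\<close>

lemma dual_norm_ge_nonzero:
  assumes \<phi>: "\<phi> \<in> L2 \<Omega>" and v: "v \<in> H1 \<Omega>" and nonzero: "\<not> (AE x in lebesgue_on \<Omega>. v x = 0)"
  shows "L2_inner \<Omega> \<phi> v \<le> dual_norm \<Omega> \<phi> * H1_norm \<Omega> v"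
proof -
  have pos: "H1_norm \<Omega> v > 0" by (rule H1_norm_pos[OF v nonzero])
  have "L2_inner \<Omega> \<phi> v / H1_norm \<Omega> v \<le> dual_norm \<Omega> \<phi>"
    unfolding dual_norm_def
  proof (rule cSUP_upper)
    show "bdd_above ((\<lambda>v. L2_inner \<Omega> \<phi> v / H1_norm \<Omega> v) ` {v \<in> H1 \<Omega>. \<not> (AE x in lebesgue_on \<Omega>. v x = 0)})"
    proof (rule bdd_aboveI2[of _ _ "L2_norm \<Omega> \<phi>"])
      fix w assume w: "w \<in> {v \<in> H1 \<Omega>. \<not> (AE x in lebesgue_on \<Omega>. v x = 0)}"
      then have p: "H1_norm \<Omega> w > 0" using H1_norm_pos by blast
      have "L2_inner \<Omega> \<phi> w \<le> L2_norm \<Omega> \<phi> * L2_norm \<Omega> w"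
        using L2_inner_bound(1)[OF \<phi>, of w] w unfolding H1_def by auto
      also have "\<dots> \<le> L2_norm \<Omega> \<phi> * H1_norm \<Omega> w"
        by (intro mult_left_mono L2_norm_le_H1_norm)
      finally show "L2_inner \<Omega> \<phi> w / H1_norm \<Omega> w \<le> L2_norm \<Omega> \<phi>" using p by (simp add: pos_divide_le_eq)
    qed
  qed (use v nonzero in auto)
  then show ?thesis using pos by (simp add: pos_divide_le_eq)
qed

text \<open>A linear form vanishing wherever all the \<open>j e\<close> vanish is represented by the quadratic form
  \<open>\<Sum>e. (j e)\<^sup>2\<close>. For \<open>j e\<close> the weighted jump across a facet, this solves a graph Laplace equation.\<close>

lemma quadratic_form_representation:
  fixes j :: "'e \<Rightarrow> ('v \<Rightarrow> real) \<Rightarrow> real" and f :: "('v \<Rightarrow> real) \<Rightarrow> real"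
  assumes "finite F"
    and "\<And>e a b s t. e \<in> F \<Longrightarrow> j e (\<lambda>x. a * s x + b * t x) = a * j e s + b * j e t"
    and "\<And>a b s t. f (\<lambda>x. a * s x + b * t x) = a * f s + b * f t"
    and "\<And>t. (\<And>e. e \<in> F \<Longrightarrow> j e t = 0) \<Longrightarrow> f t = 0"
  shows "\<exists>u. \<forall>t. (\<Sum>e\<in>F. j e u * j e t) = f t"
  using assms
proof (induction F arbitrary: f rule: finite_induct)
  case empty
  then show ?case by auto
next
  case (insert e F)
  note lin = insert.prems(1) and flin = insert.prems(2) and van = insert.prems(3)
  have linF: "\<And>e a b s t. e \<in> F \<Longrightarrow> j e (\<lambda>x. a * s x + b * t x) = a * j e s + b * j e t"
    and line: "\<And>a b s t. j e (\<lambda>x. a * s x + b * t x) = a * j e s + b * j e t" using lin by auto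
  have comb: "(\<Sum>d\<in>F. j d (\<lambda>x. a * s x + b * r x) * j d t)
      = a * (\<Sum>d\<in>F. j d s * j d t) + b * (\<Sum>d\<in>F. j d r * j d t)" for a b s r t
    using linF by (simp add: distrib_right sum.distrib sum_distrib_left mult.assoc)
  show ?case
  proof (cases "\<forall>t. (\<forall>d\<in>F. j d t = 0) \<longrightarrow> j e t = 0")
    case True
    have "\<And>t. (\<And>d. d \<in> F \<Longrightarrow> j d t = 0) \<Longrightarrow> f t = 0" using van True by blast
    then obtain uf where uf: "\<And>t. (\<Sum>d\<in>F. j d uf * j d t) = f t"
      using insert.IH[of f, OF linF flin] by blast
    obtain ue where ue: "\<And>t. (\<Sum>d\<in>F. j d ue * j d t) = j e t"
      using insert.IH[of "j e", OF linF line] True by blast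
    have pos: "j e ue \<ge> 0" unfolding ue[symmetric] by (intro sum_nonneg) auto
    \<comment> \<open>A rank-one correction: \<open>ue\<close> represents \<open>j e\<close> on
      \<open>F\<close>, and \<open>c\<close> cancels the term that the additional square brings in.
      The denominator is positive because \<open>j e ue\<close> is a sum of squares.\<close>
    define c where "c = - j e uf / (1 + j e ue)"
    have c: "c + (j e uf + c * j e ue) = 0" unfolding c_def using pos by (simp add: field_simps)
    define u where "u = (\<lambda>x. 1 * uf x + c * ue x)"
    have "(\<Sum>d\<in>insert e F. j d u * j d t) = f t" for t
    proof -
      have "(\<Sum>d\<in>insert e F. j d u * j d t) = j e u * j e t + (\<Sum>d\<in>F. j d u * j d t)"
        using insert.hyps by simp
      also have "\<dots> = (j e uf + c * j e ue) * j e t + (f t + c * j e t)"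
        unfolding u_def comb line uf ue by simp
      also have "\<dots> = f t + (c + (j e uf + c * j e ue)) * j e t" by (simp add: algebra_simps)
      also have "\<dots> = f t" unfolding c by simp
      finally show ?thesis .
    qed
    then show ?thesis by blast
  next
    case False
    then obtain n0 where n0: "\<forall>d\<in>F. j d n0 = 0" "j e n0 \<noteq> 0" by blast
    \<comment> \<open>A direction seen by \<open>j e\<close> alone, scaled to
      \<open>j e n = 1\<close>. The summand with factor 0 only matches the shape of the linearity
      assumption.\<close>
    define n where "n = (\<lambda>x. (1 / j e n0) * n0 x + 0 * n0 x)"
    have n: "\<And>d. d \<in> F \<Longrightarrow> j d n = 0" "j e n = 1" unfolding n_def using n0 by (simp_all only: linF line) simp_all
    \<comment> \<open>Subtracting the part of \<open>f\<close> along \<open>n\<close> leaves a form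
      that vanishes where all \<open>j d\<close> with \<open>d \<in> F\<close> do, so the induction
      hypothesis applies; the coefficient of \<open>n\<close> is adjusted afterwards.\<close>
    define f' where "f' t = f t - f n * j e t" for t
    have flin': "f' (\<lambda>x. a * s x + b * t x) = a * f' s + b * f' t" for a b s t
      unfolding f'_def flin line by (simp add: algebra_simps)
    have "f' t = 0" if t: "\<And>d. d \<in> F \<Longrightarrow> j d t = 0" for t
    proof -
      define r where "r = (\<lambda>x. 1 * t x + (- j e t) * n x)"
      have "j d r = 0" if "d \<in> insert e F" for d
      proof (cases "d = e")
        case True
        then show ?thesis unfolding r_def by (simp only: line n(2))
      next
        case False
        then have d: "d \<in> F" using that by simp
        show ?thesis unfolding r_def linF[OF d] t[OF d] n(1)[OF d] by simp
      qed
      then have "f r = 0" using van by blast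
      then show ?thesis unfolding r_def flin f'_def by (simp add: mult.commute)
    qed
    then obtain u' where u': "\<And>t. (\<Sum>d\<in>F. j d u' * j d t) = f' t"
      using insert.IH[of f', OF linF flin'] by blast
    define u where "u = (\<lambda>x. 1 * u' x + (f n - j e u') * n x)"
    have "(\<Sum>d\<in>insert e F. j d u * j d t) = f t" for t
    proof -
      have "(\<Sum>d\<in>F. j d n * j d t) = 0" using n(1) by simp
      then have "(\<Sum>d\<in>F. j d u * j d t) = f' t" unfolding u_def comb u' by simp
      moreover have "j e u = f n" unfolding u_def line n(2) by simp
      ultimately show ?thesis using insert.hyps by (simp add: f'_def)
    qed
    then show ?thesis by blast
  qed
qed

context mesh
begin

lemma const_H1: "(\<lambda>x. c) \<in> H1 \<Omega>" "H1_norm \<Omega> (\<lambda>x. c) = \<bar>c\<bar> * sqrt (vol \<Omega>)"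
  "(\<lambda>x. c) \<in> L2 \<Omega>" "L2_norm \<Omega> (\<lambda>x. c) = \<bar>c\<bar> * sqrt (vol \<Omega>)"
proof -
  have c: "(\<lambda>x. c) \<in> L2 \<Omega>" by (rule bounded_L2[of _ "\<bar>c\<bar>"]) auto
  have 0: "(\<lambda>x. 0 :: real^'n) \<in> L2 \<Omega>" by (rule bounded_L2[of _ 0]) auto
  have "has_weak_gradient \<Omega> (\<lambda>x. c) (\<lambda>x. 0)"
  proof (rule piecewise_smooth_weak_gradient[where I = \<T> and T = "\<lambda>T. T" and f = "\<lambda>_ _. c" and D = "\<lambda>_ _. 0"])
    show "\<Omega> \<subseteq> (\<Union>T\<in>\<T>. closure T)" using cover closure_subset by blast
    show "negligible (frontier T)" if "T \<in> \<T>" for T using convex_T[OF that] by (rule negligible_convex_frontier)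
  qed (use \<Omega>_bounded \<Omega>_open finite_mesh open_T c 0 in \<open>auto simp: GDERIV_const\<close>)
  note H = H1_norm_eq[OF \<Omega>_bounded \<Omega>_open c 0 this]
  have n: "L2_norm \<Omega> (\<lambda>x. c) = \<bar>c\<bar> * sqrt (vol \<Omega>)"
  proof -
    have "measure (lebesgue_on \<Omega>) (space (lebesgue_on \<Omega>)) = vol \<Omega>"
      using \<Omega>_sets by (simp add: measure_restrict_space)
    then show ?thesis unfolding L2_norm_def by (simp add: real_sqrt_mult mult.commute)
  qed
  have "L2_norm \<Omega> (\<lambda>x. 0 :: real^'n) = 0" unfolding L2_norm_def by simp
  then show "H1_norm \<Omega> (\<lambda>x. c) = \<bar>c\<bar> * sqrt (vol \<Omega>)" using H(2) L2_norm_le_H1_norm(4)[of \<Omega> "\<lambda>x. c"] n by simp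
  show "(\<lambda>x. c) \<in> H1 \<Omega>" "(\<lambda>x. c) \<in> L2 \<Omega>" "L2_norm \<Omega> (\<lambda>x. c) = \<bar>c\<bar> * sqrt (vol \<Omega>)" using H(1) c n by auto
qed

lemma vol_\<Omega>: "vol \<Omega> > 0" "(\<Sum>T\<in>\<T>. vol T) = vol \<Omega>"
proof -
  have "\<not> negligible \<Omega>" using open_not_negligible[OF \<Omega>_open \<Omega>_nonempty] .
  moreover have "\<Omega> \<in> lmeasurable" using \<Omega>_open \<Omega>_bounded by (intro lmeasurable_open) auto
  ultimately have "vol \<Omega> \<noteq> 0" using negligible_iff_measure0 by blast
  then show "vol \<Omega> > 0" using measure_nonneg[of lebesgue \<Omega>] by linarith
  interpret finite_measure "lebesgue_on \<Omega>" by (rule finite_measure_lebesgue_on_open[OF \<Omega>_bounded \<Omega>_open])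
  have "(\<integral>z. (1::real) \<partial>lebesgue_on \<Omega>) = (\<Sum>T\<in>\<T>. \<integral>z. indicator T z * 1 \<partial>lebesgue_on \<Omega>)"
    by (rule integral_elements) simp
  also have "\<dots> = (\<Sum>T\<in>\<T>. vol T)"
    using integral_indicator_\<Omega> open_T element_subset by (intro sum.cong) auto
  also have "(\<integral>z. (1::real) \<partial>lebesgue_on \<Omega>) = vol \<Omega>" using \<Omega>_sets by (simp add: measure_restrict_space)
  finally show "(\<Sum>T\<in>\<T>. vol T) = vol \<Omega>" by simp
qed

lemma not_AE_const: "c \<noteq> 0 \<Longrightarrow> \<not> (AE x in lebesgue_on \<Omega>. (c::real) = 0)"
proof
  assume "c \<noteq> 0" "AE x in lebesgue_on \<Omega>. c = 0"
  then have "AE x in lebesgue_on \<Omega>. (1::real) = 0" by simp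
  then have "(\<integral>x. (1::real) \<partial>lebesgue_on \<Omega>) = (\<integral>x. 0 \<partial>lebesgue_on \<Omega>)" by (intro integral_cong_AE) auto
  then show False using vol_\<Omega>(1) \<Omega>_sets by (simp add: measure_restrict_space)
qed

text \<open>The constants 1 and -1 give pairings of opposite sign, and the dual norm dominates
  both.\<close>

lemma dual_norm_nonneg: assumes "\<phi> \<in> L2 \<Omega>" shows "dual_norm \<Omega> \<phi> \<ge> 0"
proof -
  have "L2_inner \<Omega> \<phi> (\<lambda>x. c) \<le> dual_norm \<Omega> \<phi> * (\<bar>c\<bar> * sqrt (vol \<Omega>))" if "c \<noteq> 0" for c
    using dual_norm_ge_nonzero[OF assms const_H1(1) not_AE_const[OF that]] unfolding const_H1(2) .
  from this[of 1] this[of "-1"]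
  have "L2_inner \<Omega> \<phi> (\<lambda>x. 1) \<le> dual_norm \<Omega> \<phi> * sqrt (vol \<Omega>)"
    "L2_inner \<Omega> \<phi> (\<lambda>x. -1) \<le> dual_norm \<Omega> \<phi> * sqrt (vol \<Omega>)" by auto
  moreover have "L2_inner \<Omega> \<phi> (\<lambda>x. -1) = - L2_inner \<Omega> \<phi> (\<lambda>x. 1)" unfolding L2_inner_def by simp
  ultimately have "0 \<le> dual_norm \<Omega> \<phi> * sqrt (vol \<Omega>)" by linarith
  then show ?thesis using vol_\<Omega>(1) by (simp add: zero_le_mult_iff)
qed

lemma dual_norm_ge:
  assumes \<phi>: "\<phi> \<in> L2 \<Omega>" and v: "v \<in> H1 \<Omega>"
  shows "L2_inner \<Omega> \<phi> v \<le> dual_norm \<Omega> \<phi> * H1_norm \<Omega> v"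
proof (cases "AE x in lebesgue_on \<Omega>. v x = 0")
  case True
  have vL: "v \<in> L2 \<Omega>" using v unfolding H1_def by auto
  have "L2_inner \<Omega> \<phi> v = (\<integral>x. 0 \<partial>lebesgue_on \<Omega>)"
    unfolding L2_inner_def
  proof (rule integral_cong_AE)
    show "AE x in lebesgue_on \<Omega>. \<phi> x * v x = 0" using True by eventually_elim simp
  qed (use \<phi> vL in \<open>auto simp: L2_def\<close>)
  then show ?thesis using dual_norm_nonneg[OF \<phi>] L2_norm_le_H1_norm(3)[of \<Omega> v] by simp
qed (rule dual_norm_ge_nonzero[OF assms])

lemma dual_norm_le:
  assumes "\<And>v. v \<in> H1 \<Omega> \<Longrightarrow> L2_inner \<Omega> \<phi> v \<le> B * H1_norm \<Omega> v"
  shows "dual_norm \<Omega> \<phi> \<le> B"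
  unfolding dual_norm_def
proof (rule cSUP_least)
  have "\<not> (AE x in lebesgue_on \<Omega>. (1::real) = 0)" by (rule not_AE_const) simp
  then show "{v \<in> H1 \<Omega>. \<not> (AE x in lebesgue_on \<Omega>. v x = 0)} \<noteq> {}" using const_H1(1)[of 1] by blast
  fix v assume v: "v \<in> {v \<in> H1 \<Omega>. \<not> (AE x in lebesgue_on \<Omega>. v x = 0)}"
  then have "H1_norm \<Omega> v > 0" using H1_norm_pos by blast
  then show "L2_inner \<Omega> \<phi> v / H1_norm \<Omega> v \<le> B" using assms v by (simp add: pos_divide_le_eq)
qed

section \<open>Piecewise constant functions and facet functions\<close>

definition val :: "(real^'n \<Rightarrow> real) \<Rightarrow> (real^'n) set \<Rightarrow> real" where
  "val \<phi> T = \<phi> (SOME x. x \<in> T)"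

lemma P0_val: "\<phi> \<in> P0 \<T> \<Longrightarrow> T \<in> \<T> \<Longrightarrow> x \<in> T \<Longrightarrow> \<phi> x = val \<phi> T"
proof -
  assume "\<phi> \<in> P0 \<T>" and T: "T \<in> \<T>" and x: "x \<in> T"
  then obtain c where c: "\<And>y. y \<in> T \<Longrightarrow> \<phi> y = c" unfolding P0_def constant_on_def by blast
  have "(SOME x. x \<in> T) \<in> T" using x by (rule someI)
  then show "\<phi> x = val \<phi> T" unfolding val_def using c x by simp
qed

lemma val_eqI:
  assumes "T \<in> \<T>" "\<And>x. x \<in> T \<Longrightarrow> \<phi> x = c" shows "val \<phi> T = c"
  unfolding val_def using assms(2) some_in_eq nonempty_T[OF assms(1)] by blast

lemma P0_L2:
  assumes \<phi>: "\<phi> \<in> P0 \<T>" shows "\<phi> \<in> L2 \<Omega>"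
proof (rule bounded_L2)
  show "\<phi> \<in> borel_measurable (lebesgue_on \<Omega>)"
  proof (rule measurable_lebesgue_on_modify[OF \<Omega>_sets _ negligible_skel])
    show "(\<lambda>x. \<Sum>T\<in>\<T>. indicator T x *\<^sub>R val \<phi> T) \<in> borel_measurable (lebesgue_on \<Omega>)"
      using element_sets by (intro borel_measurable_sum borel_measurable_scaleR borel_measurable_indicator) auto
    fix x assume x: "x \<in> \<Omega>" "x \<notin> skel"
    then obtain T where T: "T \<in> \<T>" "x \<in> closure T" using cover closure_subset by blast
    then have xT: "x \<in> T" using x(2) open_T[OF T(1)] by (auto simp: frontier_def interior_open)
    show "(\<Sum>T\<in>\<T>. indicator T x *\<^sub>R val \<phi> T) = \<phi> x"
      unfolding sum_indicator_elements[OF T(1) xT] using P0_val[OF \<phi> T(1) xT] by simp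
  qed
  show "AE x in lebesgue_on \<Omega>. norm (\<phi> x) \<le> (\<Sum>T\<in>\<T>. \<bar>val \<phi> T\<bar>)"
  proof (rule AE_\<Omega>I)
    fix T x assume T: "T \<in> \<T>" "x \<in> T"
    then have "norm (\<phi> x) = \<bar>val \<phi> T\<bar>" using P0_val[OF \<phi>] by simp
    also have "\<dots> \<le> (\<Sum>T\<in>\<T>. \<bar>val \<phi> T\<bar>)" using finite_mesh T by (intro member_le_sum) auto
    finally show "norm (\<phi> x) \<le> (\<Sum>T\<in>\<T>. \<bar>val \<phi> T\<bar>)" .
  qed
qed

lemma avg_integral: "T \<in> \<T> \<Longrightarrow> (\<integral>x. indicator T x * v x \<partial>lebesgue_on \<Omega>) = vol T * avg \<Omega> T v"
  unfolding avg_def using vol_pos[of T] by (simp add: mult.commute)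

text \<open>A piecewise constant function perceives \<open>v\<close> only through its element
  averages; this reduces the norm equivalence to functions on the finite set of elements.\<close>

lemma P0_inner:
  assumes \<phi>: "\<phi> \<in> P0 \<T>" and v: "v \<in> L2 \<Omega>"
  shows "L2_inner \<Omega> \<phi> v = (\<Sum>T\<in>\<T>. val \<phi> T * vol T * avg \<Omega> T v)"
proof -
  have "L2_inner \<Omega> \<phi> v = (\<Sum>T\<in>\<T>. \<integral>x. indicator T x * (\<phi> x * v x) \<partial>lebesgue_on \<Omega>)"
    unfolding L2_inner_def by (rule integral_elements[OF L2_inner_bound(2)[OF P0_L2[OF \<phi>] v]])
  also have "\<dots> = (\<Sum>T\<in>\<T>. val \<phi> T * vol T * avg \<Omega> T v)"
  proof (rule sum.cong[OF refl])
    fix T assume T: "T \<in> \<T>"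
    have "(\<integral>x. indicator T x * (\<phi> x * v x) \<partial>lebesgue_on \<Omega>) = (\<integral>x. val \<phi> T * (indicator T x * v x) \<partial>lebesgue_on \<Omega>)"
      by (rule Bochner_Integration.integral_cong) (use P0_val[OF \<phi> T] in \<open>auto simp: indicator_def\<close>)
    then show "(\<integral>x. indicator T x * (\<phi> x * v x) \<partial>lebesgue_on \<Omega>) = val \<phi> T * vol T * avg \<Omega> T v"
      using avg_integral[OF T, of v] by simp
  qed
  finally show ?thesis .
qed

lemma facet_function_values:
  assumes E: "E \<in> \<E>" and T: "T \<in> \<T>" "x \<in> T"
  shows "divergence (rt_function (Tp E) (Tm E) E) x =
    flat_measure E * ((if T = Tp E then 1 else 0) - (if T = Tm E then 1 else 0)) / vol T"
proof -
  have TT: "Tp E \<in> \<T>" "Tm E \<in> \<T>" "Tp E \<noteq> Tm E" using facet_props(1)[OF E] unfolding adj_def by auto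
  have disj: "disjnt (Tp E) (Tm E)" using elements_disjoint[OF TT] unfolding disjnt_def .
  consider "T = Tp E" | "T = Tm E" | "T \<noteq> Tp E" "T \<noteq> Tm E" by blast
  then show ?thesis
  proof cases
    case 1
    then show ?thesis using divergence_rt_plus[OF open_T[OF TT(1)], of x "Tm E" E] T TT by simp
  next
    case 2
    then show ?thesis using divergence_rt_minus[OF open_T[OF TT(2)] _ disj, of x E] T TT by simp
  next
    case 3
    \<comment> \<open>The zero field, written with slope 0 so that \<open>divergence_affine\<close>
      applies.\<close>
    have "rt_function (Tp E) (Tm E) E y = 0 *\<^sub>R (y - 0)" if "y \<in> T" for y
      using that 3 elements_disjoint[OF T(1) TT(1)] elements_disjoint[OF T(1) TT(2)] unfolding rt_function_def by auto
    from divergence_affine[OF open_T[OF T(1)] T(2) this] show ?thesis using 3 by simp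
  qed
qed

lemma facet_function:
  assumes E: "E \<in> \<E>"
  defines "q \<equiv> \<lambda>c x. c * divergence (rt_function (Tp E) (Tm E) E) x"
  shows "q c \<in> P0 \<T>"
    and "T \<in> \<T> \<Longrightarrow> val (q c) T = c * flat_measure E * ((if T = Tp E then 1 else 0) - (if T = Tm E then 1 else 0)) / vol T"
    and "v \<in> L2 \<Omega> \<Longrightarrow> L2_inner \<Omega> (q c) v = c * flat_measure E * (avg \<Omega> (Tp E) v - avg \<Omega> (Tm E) v)"
proof -
  have TT: "Tp E \<in> \<T>" "Tm E \<in> \<T>" "Tp E \<noteq> Tm E" using facet_props(1)[OF E] unfolding adj_def by auto
  show P: "q c \<in> P0 \<T>"
    unfolding P0_def constant_on_def q_def using facet_function_values[OF E] by fastforce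
  show V: "val (q c) T = c * flat_measure E * ((if T = Tp E then 1 else 0) - (if T = Tm E then 1 else 0)) / vol T"
    if "T \<in> \<T>" for T
    by (rule val_eqI[OF that]) (simp only: q_def facet_function_values[OF E that] mult.assoc times_divide_eq_right)
  assume v: "v \<in> L2 \<Omega>"
  have "L2_inner \<Omega> (q c) v = (\<Sum>T\<in>\<T>. (if T = Tp E then c * flat_measure E * avg \<Omega> T v else 0)
      - (if T = Tm E then c * flat_measure E * avg \<Omega> T v else 0))"
    unfolding P0_inner[OF P v]
  proof (rule sum.cong[OF refl])
    fix T assume T: "T \<in> \<T>"
    show "val (q c) T * vol T * avg \<Omega> T v = (if T = Tp E then c * flat_measure E * avg \<Omega> T v else 0)
      - (if T = Tm E then c * flat_measure E * avg \<Omega> T v else 0)"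
      unfolding V[OF T] using vol_pos[OF T] by simp
  qed
  also have "\<dots> = c * flat_measure E * (avg \<Omega> (Tp E) v - avg \<Omega> (Tm E) v)"
    using TT finite_mesh by (simp add: sum_subtractf right_diff_distrib)
  finally show "L2_inner \<Omega> (q c) v = c * flat_measure E * (avg \<Omega> (Tp E) v - avg \<Omega> (Tm E) v)" .
qed

lemma flat_measure_facet: "E \<in> \<E> \<Longrightarrow> flat_measure E > 0"
proof (rule flat_measure_pos)
  assume E: "E \<in> \<E>"
  note fp = facet_props[OF E]
  show "E \<noteq> {}" by (rule fp(3))
  have Tp: "Tp E \<in> \<T>" "Tm E \<in> \<T>" using fp(1) unfolding adj_def by auto
  have "E \<subseteq> closure (Tp E)" using fp(2) closure_subset[of E] by blast
  then show "bounded E" using bounded_T[OF Tp(1)] bounded_closure bounded_subset by blast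
  have "convex (closure E)" unfolding fp(2) using convex_T[OF Tp(1)] convex_T[OF Tp(2)] by (intro convex_Int convex_closure)
  then have "affine hull (rel_interior (closure E)) = affine hull (closure E)" by (rule rel_interior_same_affine_hull)
  then have "affine hull E = affine hull (closure E)" using fp(4) by simp
  moreover have "openin (top_of_set (affine hull (closure E))) (rel_interior (closure E))" by (rule openin_rel_interior)
  ultimately show "openin (top_of_set (affine hull E)) E" using fp(4) by simp
qed

text \<open>Bounds the full squared norm of an element bubble in units of
  \<open>h ^ (n - 2)\<close>. The L2 part carries two more powers of the diameter, which the
  diameter of \<Omega> absorbs.\<close>

definition facet_const :: real where
  "facet_const = 2 ^ CARD('n) * \<kappa> ^ (CARD('n) - 2) * ((diameter \<Omega>)\<^sup>2 + \<kappa>\<^sup>2 * (real CARD('n) + 1)\<^sup>2)"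

lemma facet_const_nonneg: "facet_const \<ge> 0"
  unfolding facet_const_def using kappa_ge_1 by (intro mult_nonneg_nonneg add_nonneg_nonneg) auto

text \<open>The sign of the coefficient selects the element that carries the bubble, so that the
  pairing is positive. If this is \<open>Tm E\<close>, its diameter is compared with that of
  \<open>Tp E\<close>.\<close>

lemma facet_dual_lower:
  assumes E: "E \<in> \<E>"
  shows "(c * flat_measure E)\<^sup>2 * bubble_const\<^sup>2 \<le>
    (dual_norm \<Omega> (\<lambda>x. c * divergence (rt_function (Tp E) (Tm E) E) x))\<^sup>2 * (facet_const * h (Tp E) ^ (CARD('n) - 2))"
proof -
  let ?n = "CARD('n)" and ?q = "\<lambda>x. c * divergence (rt_function (Tp E) (Tm E) E) x"
  have adj: "adj (Tp E) (Tm E)" by (rule facet_props(1)[OF E])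
  have TT: "Tp E \<in> \<T>" "Tm E \<in> \<T>" "Tp E \<noteq> Tm E" using adj unfolding adj_def by auto
  define a where "a = c * flat_measure E"
  define T where "T = (if a \<ge> 0 then Tp E else Tm E)"
  have T: "T \<in> \<T>" using TT unfolding T_def by auto
  have hp: "h T > 0" "h (Tp E) > 0" using h_pos T TT by auto
  have hT: "h T \<le> \<kappa> * h (Tp E)"
    using adj_h[OF adj_sym[OF adj]] kappa_ge_1 hp unfolding T_def by auto
  define \<beta> where "\<beta> R = (if R = T then 1 else 0 :: real)" for R
  define w where "w = conf (\<lambda>_. 0) \<beta>"
  define g where "g = conf_grad (\<lambda>_. 0) \<beta>"
  have w: "w \<in> L2 \<Omega>" "g \<in> L2 \<Omega>" "has_weak_gradient \<Omega> w g"
    unfolding w_def g_def by (rule conf_L2 conf_grad_L2 conf_weak_gradient)+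
  have wR: "w x = (if R = T then bubble T x else 0)" if "R \<in> \<T>" "x \<in> R" for R x
  proof -
    have "x \<in> closure R" using that closure_subset[of R] by blast
    then have "w x = conf_piece (\<lambda>_. 0) \<beta> R x" unfolding w_def by (rule conf_eq[OF that(1)])
    then show ?thesis by (cases "R = T") (simp_all add: conf_piece_def \<beta>_def)
  qed
  note H = H1_norm_eq[OF \<Omega>_bounded \<Omega>_open w]
  have w2: "integrable (lebesgue_on \<Omega>) (\<lambda>x. (w x)\<^sup>2)" using w(1) unfolding L2_def by simp
  have "(L2_norm \<Omega> w)\<^sup>2 = (\<integral>x. (w x)\<^sup>2 \<partial>lebesgue_on \<Omega>)"
    unfolding L2_norm_def by (simp add: Bochner_Integration.integral_nonneg)
  also have "\<dots> \<le> (\<integral>x. indicator T x \<partial>lebesgue_on \<Omega>)"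
  proof (rule integral_mono_AE[OF w2])
    interpret finite_measure "lebesgue_on \<Omega>" by (rule finite_measure_lebesgue_on_open[OF \<Omega>_bounded \<Omega>_open])
    show "integrable (lebesgue_on \<Omega>) (indicator T :: _ \<Rightarrow> real)"
      using element_sets[OF T] by (intro integrable_real_indicator) (auto simp: less_top[symmetric])
    show "AE x in lebesgue_on \<Omega>. (w x)\<^sup>2 \<le> indicator T x"
    proof (rule AE_\<Omega>I)
      fix R x assume R: "R \<in> \<T>" "x \<in> R"
      show "(w x)\<^sup>2 \<le> indicator T x"
      proof (cases "R = T")
        case True
        have "0 \<le> bubble T x" "bubble T x \<le> 1" using bubble_range[OF T, of x] R True closure_subset[of T] by auto
        then show ?thesis using wR[OF R] True R by (simp add: power_le_one)
      qed (use wR[OF R] in simp)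
    qed
  qed
  also have "\<dots> = vol T" using integral_indicator_\<Omega> open_T[OF T] element_subset[OF T] by auto
  also have "\<dots> \<le> (2 * h T) ^ ?n" by (rule vol_le_h[OF T])
  also have "\<dots> = 2 ^ ?n * h T ^ (?n - 2) * (h T)\<^sup>2"
  proof -
    have "h T ^ ?n = h T ^ (?n - 2) * (h T)\<^sup>2" using dim2 by (simp only: power_add[symmetric] le_add_diff_inverse2)
    then show ?thesis by (simp add: power_mult_distrib)
  qed
  also have "\<dots> \<le> 2 ^ ?n * h T ^ (?n - 2) * (diameter \<Omega>)\<^sup>2"
    using hp diameter_subset[OF element_subset[OF T] \<Omega>_bounded] by (intro mult_left_mono power_mono) auto
  finally have n1: "(L2_norm \<Omega> w)\<^sup>2 \<le> 2 ^ ?n * h T ^ (?n - 2) * (diameter \<Omega>)\<^sup>2" .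
  have "(L2_norm \<Omega> g)\<^sup>2 = (\<Sum>R\<in>\<T>. energy g R)" using energy_sum[OF w(2)] by simp
  also have "\<dots> \<le> (\<Sum>R\<in>\<T>. if R = T then 2 ^ ?n * \<kappa>\<^sup>2 * h T ^ (?n - 2) * (real ?n + 1)\<^sup>2 else 0)"
  proof (rule sum_mono)
    fix R assume R: "R \<in> \<T>"
    show "energy g R \<le> (if R = T then 2 ^ ?n * \<kappa>\<^sup>2 * h T ^ (?n - 2) * (real ?n + 1)\<^sup>2 else 0)"
      using conf_energy[OF R, of "\<lambda>_. 0" \<beta> 0] unfolding g_def \<beta>_def by (auto split: if_splits)
  qed
  also have "\<dots> = 2 ^ ?n * \<kappa>\<^sup>2 * h T ^ (?n - 2) * (real ?n + 1)\<^sup>2" using finite_mesh T by simp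
  finally have n2: "(L2_norm \<Omega> g)\<^sup>2 \<le> 2 ^ ?n * \<kappa>\<^sup>2 * h T ^ (?n - 2) * (real ?n + 1)\<^sup>2" .
  have "(H1_norm \<Omega> w)\<^sup>2 = (L2_norm \<Omega> w)\<^sup>2 + (L2_norm \<Omega> g)\<^sup>2" unfolding H(2) by simp
  also have "\<dots> \<le> 2 ^ ?n * h T ^ (?n - 2) * ((diameter \<Omega>)\<^sup>2 + \<kappa>\<^sup>2 * (real ?n + 1)\<^sup>2)"
    using n1 n2 by (simp add: distrib_left mult_ac)
  also have "\<dots> \<le> 2 ^ ?n * (\<kappa> * h (Tp E)) ^ (?n - 2) * ((diameter \<Omega>)\<^sup>2 + \<kappa>\<^sup>2 * (real ?n + 1)\<^sup>2)"
    using hT hp by (intro mult_right_mono mult_left_mono power_mono) auto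
  also have "\<dots> = facet_const * h (Tp E) ^ (?n - 2)" unfolding facet_const_def by (simp add: power_mult_distrib)
  finally have Hw: "(H1_norm \<Omega> w)\<^sup>2 \<le> facet_const * h (Tp E) ^ (?n - 2)" .
  have av: "avg \<Omega> R w = (if R = T then (\<integral>x. indicator T x * bubble T x \<partial>lebesgue_on \<Omega>) / vol T else 0)" if R: "R \<in> \<T>" for R
  proof -
    have "(\<integral>x. w x * indicator R x \<partial>lebesgue_on \<Omega>) = (\<integral>x. (if R = T then indicator T x * bubble T x else 0) \<partial>lebesgue_on \<Omega>)"
    proof (rule Bochner_Integration.integral_cong)
      show "w x * indicator R x = (if R = T then indicator T x * bubble T x else 0)" for x
        using wR[OF R, of x] by (cases "x \<in> R"; cases "R = T") simp_all
    qed simp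
    then show ?thesis unfolding avg_def by simp
  qed
  have bi: "bubble_const \<le> (\<integral>x. indicator T x * bubble T x \<partial>lebesgue_on \<Omega>) / vol T"
    using bubble_integral[OF T] vol_pos[OF T] by (simp add: pos_le_divide_eq)
  have "\<bar>a\<bar> * bubble_const \<le> \<bar>a\<bar> * ((\<integral>x. indicator T x * bubble T x \<partial>lebesgue_on \<Omega>) / vol T)"
    using bi by (intro mult_left_mono) auto
  also have "\<dots> = L2_inner \<Omega> ?q w"
    unfolding facet_function(3)[OF E w(1)] av[OF TT(1)] av[OF TT(2)] a_def[symmetric] T_def using TT(3) by auto
  also have "\<dots> \<le> dual_norm \<Omega> ?q * H1_norm \<Omega> w"
    by (rule dual_norm_ge[OF P0_L2[OF facet_function(1)[OF E]] H(1)])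
  finally have "(\<bar>a\<bar> * bubble_const)\<^sup>2 \<le> (dual_norm \<Omega> ?q * H1_norm \<Omega> w)\<^sup>2"
    using bubble_const_pos by (intro power_mono) auto
  also have "\<dots> = (dual_norm \<Omega> ?q)\<^sup>2 * (H1_norm \<Omega> w)\<^sup>2" by (rule power_mult_distrib)
  also have "\<dots> \<le> (dual_norm \<Omega> ?q)\<^sup>2 * (facet_const * h (Tp E) ^ (?n - 2))" by (rule mult_left_mono[OF Hw]) simp
  finally show ?thesis unfolding a_def by (simp add: power_mult_distrib)
qed

text \<open>A facet is determined by the vertices shared by its two elements, so an element has at
  most as many facets as its vertex set has subsets. The crude count suffices, as it depends on the
  dimension only.\<close>

lemma facet_multiplicity:
  assumes e: "\<And>T. e T \<ge> (0::real)"
  shows "(\<Sum>E\<in>\<E>. e (Tp E) + e (Tm E)) \<le> 2 ^ Suc CARD('n) * (\<Sum>T\<in>\<T>. e T)"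
proof -
  have "e (Tp E) + e (Tm E) = (\<Sum>T\<in>\<T>. if T \<in> {Tp E, Tm E} then e T else 0)" if "E \<in> \<E>" for E
  proof -
    have TT: "Tp E \<in> \<T>" "Tm E \<in> \<T>" "Tp E \<noteq> Tm E" using facet_props(1)[OF that] unfolding adj_def by auto
    have "(\<Sum>T\<in>\<T>. if T \<in> {Tp E, Tm E} then e T else 0) = (\<Sum>T\<in>\<T> \<inter> {Tp E, Tm E}. e T)"
      using finite_mesh by (subst sum.inter_restrict) auto
    also have "\<T> \<inter> {Tp E, Tm E} = {Tp E, Tm E}" using TT by auto
    finally show ?thesis using TT(3) by simp
  qed
  then have "(\<Sum>E\<in>\<E>. e (Tp E) + e (Tm E)) = (\<Sum>E\<in>\<E>. \<Sum>T\<in>\<T>. if T \<in> {Tp E, Tm E} then e T else 0)"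
    by (rule sum.cong[OF refl])
  also have "\<dots> = (\<Sum>T\<in>\<T>. \<Sum>E\<in>\<E>. if T \<in> {Tp E, Tm E} then e T else 0)" by (rule sum.swap)
  also have "\<dots> = (\<Sum>T\<in>\<T>. real (card {E\<in>\<E>. T \<in> {Tp E, Tm E}}) * e T)"
    using finite_facets by (simp add: sum.inter_filter[symmetric])
  also have "\<dots> \<le> (\<Sum>T\<in>\<T>. 2 ^ Suc CARD('n) * e T)"
  proof (intro sum_mono mult_right_mono e)
    fix T assume T: "T \<in> \<T>"
    let ?A = "{E\<in>\<E>. T \<in> {Tp E, Tm E}}"
    have "inj_on (\<lambda>E. verts (Tp E) \<inter> verts (Tm E)) ?A"
    proof (rule inj_onI)
      fix E E' assume EE: "E \<in> ?A" "E' \<in> ?A" "verts (Tp E) \<inter> verts (Tm E) = verts (Tp E') \<inter> verts (Tm E')"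
      have "closure D = convex hull (verts (Tp D) \<inter> verts (Tm D))" if "D \<in> \<E>" for D
        using facet_props(1,2)[OF that] closure_Int unfolding adj_def by simp
      then have "closure E = closure E'" using EE by simp
      then show "E = E'" using facet_props(4)[of E] facet_props(4)[of E'] EE by simp
    qed
    then have "card ?A \<le> card (Pow (verts T))"
    proof (rule card_inj_on_le)
      show "(\<lambda>E. verts (Tp E) \<inter> verts (Tm E)) ` ?A \<subseteq> Pow (verts T)" by auto
      show "finite (Pow (verts T))" using finite_verts[OF T] by simp
    qed
    also have "\<dots> = 2 ^ Suc CARD('n)" using card_Pow[OF finite_verts[OF T]] card_verts[OF T] by simp
    finally have "real (card ?A) \<le> real (2 ^ Suc CARD('n))" by (simp only: of_nat_le_iff)
    then show "real (card ?A) \<le> 2 ^ Suc CARD('n)" by simp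
  qed
  also have "\<dots> = 2 ^ Suc CARD('n) * (\<Sum>T\<in>\<T>. e T)" by (rule sum_distrib_left[symmetric])
  finally show ?thesis .
qed

end

subsection \<open>The subspace decomposition\<close>

context mesh
begin

definition facet_jump_const :: real where
  "facet_jump_const = facet_const * jump_const / bubble_const\<^sup>2"

lemma facet_jump_const_nonneg: "facet_jump_const \<ge> 0"
  unfolding facet_jump_const_def using facet_const_nonneg jump_const_nonneg by simp

lemma facet_h_pos: "E \<in> \<E> \<Longrightarrow> h (Tp E) ^ (CARD('n) - 2) > 0"
  using facet_props(1)[of E] h_pos unfolding adj_def by auto

text \<open>The powers of the diameter in \<open>facet_dual_lower\<close> and
  \<open>jump_bound\<close> cancel. The gain over the definition of the dual norm is that only the
  energy on two elements appears, so the bounds can be summed over the facets.\<close>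

lemma facet_inner_bound:
  assumes E: "E \<in> \<E>" and v: "v \<in> L2 \<Omega>" and g: "g \<in> L2 \<Omega>" "has_weak_gradient \<Omega> v g"
    and \<xi>: "\<xi> \<in> XE (Tp E) (Tm E) E"
  shows "(L2_inner \<Omega> \<xi> v)\<^sup>2 \<le> (dual_norm \<Omega> \<xi>)\<^sup>2 * (facet_jump_const * (energy g (Tp E) + energy g (Tm E)))"
proof -
  obtain c where c: "\<xi> = (\<lambda>x. c * divergence (rt_function (Tp E) (Tm E) E) x)"
    using \<xi> unfolding XE_def by blast
  let ?d = "avg \<Omega> (Tp E) v - avg \<Omega> (Tm E) v" and ?D = "(dual_norm \<Omega> \<xi>)\<^sup>2"
    and ?H = "h (Tp E) ^ (CARD('n) - 2)" and ?e = "energy g (Tp E) + energy g (Tm E)"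
  have "(c * flat_measure E)\<^sup>2 * bubble_const\<^sup>2 \<le> ?D * (facet_const * ?H)"
    unfolding c by (rule facet_dual_lower[OF E])
  then have "(c * flat_measure E)\<^sup>2 \<le> ?D * (facet_const * ?H) / bubble_const\<^sup>2"
    using bubble_const_pos by (simp add: pos_le_divide_eq)
  then have "(c * flat_measure E)\<^sup>2 * ?d\<^sup>2 \<le> ?D * (facet_const * ?H) / bubble_const\<^sup>2 * ?d\<^sup>2"
    by (rule mult_right_mono) simp
  also have "\<dots> = ?D * facet_const / bubble_const\<^sup>2 * (?H * ?d\<^sup>2)" by simp
  also have "\<dots> \<le> ?D * facet_const / bubble_const\<^sup>2 * (jump_const * ?e)"
    using facet_const_nonneg by (intro mult_left_mono jump_bound[OF v g facet_props(1)[OF E]]) auto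
  also have "\<dots> = ?D * (facet_jump_const * ?e)" unfolding facet_jump_const_def by simp
  finally show ?thesis unfolding c facet_function(3)[OF E v] by (simp only: power_mult_distrib)
qed

definition upper_const :: real where
  "upper_const = 1 + facet_jump_const * 2 ^ Suc CARD('n)"

text \<open>The constant part is paired with the full norm of \<open>v\<close>, the facet parts with
  local energies, whose overlap is bounded by \<open>facet_multiplicity\<close>.\<close>

lemma dual_norm_decomposition_le:
  assumes \<phi>: "\<phi> \<in> P0 \<T>" and \<phi>0: "\<phi>0 \<in> X0" and \<phi>E: "\<And>E. E \<in> \<E> \<Longrightarrow> \<phi>E E \<in> XE (Tp E) (Tm E) E"
    and ae: "AE x in lebesgue_on \<Omega>. \<phi> x = \<phi>0 x + (\<Sum>E\<in>\<E>. \<phi>E E x)"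
  shows "(dual_norm \<Omega> \<phi>)\<^sup>2 \<le> upper_const * ((dual_norm \<Omega> \<phi>0)\<^sup>2 + (\<Sum>E\<in>\<E>. (dual_norm \<Omega> (\<phi>E E))\<^sup>2))"
proof -
  let ?S = "\<Sum>E\<in>\<E>. (dual_norm \<Omega> (\<phi>E E))\<^sup>2" and ?D0 = "dual_norm \<Omega> \<phi>0"
  let ?K = "facet_jump_const * 2 ^ Suc CARD('n)"
  have K: "?K \<ge> 0" using facet_jump_const_nonneg by simp
  obtain c0 where c0: "\<phi>0 = (\<lambda>x. c0)" using \<phi>0 unfolding X0_def by auto
  have \<phi>0L: "\<phi>0 \<in> L2 \<Omega>" unfolding c0 by (rule const_H1(3))
  have \<phi>EL: "\<phi>E E \<in> L2 \<Omega>" if E: "E \<in> \<E>" for E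
  proof -
    obtain c where "\<phi>E E = (\<lambda>x. c * divergence (rt_function (Tp E) (Tm E) E) x)"
      using \<phi>E[OF E] unfolding XE_def by blast
    then show ?thesis using P0_L2[OF facet_function(1)[OF E]] by simp
  qed
  have S0: "?S \<ge> 0" by (rule sum_nonneg) simp
  have D0: "?D0 \<ge> 0" by (rule dual_norm_nonneg[OF \<phi>0L])
  define Q where "Q = sqrt (upper_const * (?D0\<^sup>2 + ?S))"
  have uc: "upper_const \<ge> 0" unfolding upper_const_def using K by simp
  have "L2_inner \<Omega> \<phi> v \<le> Q * H1_norm \<Omega> v" if v: "v \<in> H1 \<Omega>" for v
  proof -
    define g where "g = weak_gradient \<Omega> v"
    have vL: "v \<in> L2 \<Omega>" using v unfolding H1_def by auto
    have g: "g \<in> L2 \<Omega>" "has_weak_gradient \<Omega> v g" unfolding g_def by (rule weak_gradient_props[OF v])+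
    let ?H = "H1_norm \<Omega> v"
    have H0: "?H \<ge> 0" by (rule L2_norm_le_H1_norm(3))
    have "L2_inner \<Omega> \<phi> v = (\<integral>x. \<phi>0 x * v x + (\<Sum>E\<in>\<E>. \<phi>E E x * v x) \<partial>lebesgue_on \<Omega>)"
      unfolding L2_inner_def
    proof (rule integral_cong_AE)
      show "AE x in lebesgue_on \<Omega>. \<phi> x * v x = \<phi>0 x * v x + (\<Sum>E\<in>\<E>. \<phi>E E x * v x)"
        using ae by eventually_elim (simp add: distrib_right sum_distrib_right)
      show "(\<lambda>x. \<phi> x * v x) \<in> borel_measurable (lebesgue_on \<Omega>)"
        using L2_inner_bound(2)[OF P0_L2[OF \<phi>] vL] by (rule borel_measurable_integrable)
      show "(\<lambda>x. \<phi>0 x * v x + (\<Sum>E\<in>\<E>. \<phi>E E x * v x)) \<in> borel_measurable (lebesgue_on \<Omega>)"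
        using L2_inner_bound(2)[OF \<phi>0L vL] L2_inner_bound(2)[OF \<phi>EL vL]
        by (intro borel_measurable_add borel_measurable_sum borel_measurable_integrable)
    qed
    also have "\<dots> = L2_inner \<Omega> \<phi>0 v + (\<Sum>E\<in>\<E>. L2_inner \<Omega> (\<phi>E E) v)"
      unfolding L2_inner_def using L2_inner_bound(2)[OF \<phi>0L vL] L2_inner_bound(2)[OF \<phi>EL vL]
      by (simp add: Bochner_Integration.integral_add Bochner_Integration.integral_sum)
    finally have split: "L2_inner \<Omega> \<phi> v = L2_inner \<Omega> \<phi>0 v + (\<Sum>E\<in>\<E>. L2_inner \<Omega> (\<phi>E E) v)" .
    define r where "r E = sqrt (facet_jump_const * (energy g (Tp E) + energy g (Tm E)))" for E
    have r2: "(r E)\<^sup>2 = facet_jump_const * (energy g (Tp E) + energy g (Tm E))" for E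
      unfolding r_def using facet_jump_const_nonneg energy_nonneg by (simp add: add_nonneg_nonneg)
    have "(\<Sum>E\<in>\<E>. (r E)\<^sup>2) = facet_jump_const * (\<Sum>E\<in>\<E>. energy g (Tp E) + energy g (Tm E))"
      unfolding r2 by (rule sum_distrib_left[symmetric])
    also have "\<dots> \<le> facet_jump_const * (2 ^ Suc CARD('n) * (\<Sum>T\<in>\<T>. energy g T))"
      by (intro mult_left_mono facet_multiplicity energy_nonneg facet_jump_const_nonneg)
    also have "\<dots> = ?K * (L2_norm \<Omega> g)\<^sup>2" unfolding energy_sum[OF g(1)] by simp
    also have "\<dots> \<le> ?K * ?H\<^sup>2"
      using K L2_norm_le_H1_norm(2)[of \<Omega> v] unfolding g_def
      by (intro mult_left_mono power_mono) (auto simp: L2_norm_def)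
    finally have r_sum: "(\<Sum>E\<in>\<E>. (r E)\<^sup>2) \<le> ?K * ?H\<^sup>2" .
    have "L2_inner \<Omega> (\<phi>E E) v \<le> dual_norm \<Omega> (\<phi>E E) * r E" if E: "E \<in> \<E>" for E
    proof (rule power2_le_imp_le[THEN order_trans[OF abs_ge_self]])
      show "\<bar>L2_inner \<Omega> (\<phi>E E) v\<bar>\<^sup>2 \<le> (dual_norm \<Omega> (\<phi>E E) * r E)\<^sup>2"
        using facet_inner_bound[OF E vL g \<phi>E[OF E]] unfolding power_mult_distrib r2 by simp
      show "0 \<le> dual_norm \<Omega> (\<phi>E E) * r E"
        using dual_norm_nonneg[OF \<phi>EL[OF E]] facet_jump_const_nonneg energy_nonneg
        unfolding r_def by (simp add: add_nonneg_nonneg)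
    qed
    then have "(\<Sum>E\<in>\<E>. L2_inner \<Omega> (\<phi>E E) v) \<le> (\<Sum>E\<in>\<E>. dual_norm \<Omega> (\<phi>E E) * r E)" by (rule sum_mono)
    also have "\<dots> \<le> sqrt (?S * (?K * ?H\<^sup>2))"
    proof (rule real_le_rsqrt)
      have "(\<Sum>E\<in>\<E>. dual_norm \<Omega> (\<phi>E E) * r E)\<^sup>2 \<le> ?S * (\<Sum>E\<in>\<E>. (r E)\<^sup>2)" by (rule Cauchy_Schwarz_ineq_sum)
      also have "\<dots> \<le> ?S * (?K * ?H\<^sup>2)" using r_sum S0 by (rule mult_left_mono)
      finally show "(\<Sum>E\<in>\<E>. dual_norm \<Omega> (\<phi>E E) * r E)\<^sup>2 \<le> ?S * (?K * ?H\<^sup>2)" .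
    qed
    also have "\<dots> = sqrt ?S * sqrt ?K * ?H" using H0 by (simp add: real_sqrt_mult)
    finally have facets: "(\<Sum>E\<in>\<E>. L2_inner \<Omega> (\<phi>E E) v) \<le> sqrt ?S * sqrt ?K * ?H" .
    have "L2_inner \<Omega> \<phi>0 v \<le> ?D0 * ?H" by (rule dual_norm_ge[OF \<phi>0L v])
    then have "L2_inner \<Omega> \<phi> v \<le> (?D0 + sqrt ?S * sqrt ?K) * ?H" using split facets by (simp add: distrib_right)
    also have "\<dots> \<le> Q * ?H"
    proof (rule mult_right_mono[OF _ H0])
      let ?s = "sqrt ?S" and ?k = "sqrt ?K"
      \<comment> \<open>Cauchy-Schwarz in the plane, for the vectors \<open>(1, ?k)\<close> and
        \<open>(?D0, ?s)\<close>.\<close>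
      have "(?D0 + ?s * ?k)\<^sup>2 \<le> (1 + ?k\<^sup>2) * (?D0\<^sup>2 + ?s\<^sup>2)"
      proof -
        have "(1 + ?k\<^sup>2) * (?D0\<^sup>2 + ?s\<^sup>2) - (?D0 + ?s * ?k)\<^sup>2 = (?k * ?D0 - ?s)\<^sup>2"
          by (simp only: power2_eq_square algebra_simps)
        then show ?thesis using zero_le_power2[of "?k * ?D0 - ?s"] by linarith
      qed
      also have "\<dots> = upper_const * (?D0\<^sup>2 + ?S)" unfolding upper_const_def using K S0 by simp
      finally show "?D0 + ?s * ?k \<le> Q" unfolding Q_def by (rule real_le_rsqrt)
    qed
    finally show ?thesis .
  qed
  then have "dual_norm \<Omega> \<phi> \<le> Q" by (rule dual_norm_le)
  then have "(dual_norm \<Omega> \<phi>)\<^sup>2 \<le> Q\<^sup>2" using dual_norm_nonneg[OF P0_L2[OF \<phi>]] by (intro power_mono)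
  then show ?thesis unfolding Q_def using uc S0 by simp
qed

section \<open>Existence of a stable decomposition\<close>

definition lower_const :: "real \<Rightarrow> real" where
  "lower_const CP = 1 + 2 * jump_const * ((CP + 1) * disc_const)"

text \<open>Testing \<phi> with the sign of its mean \<open>c0\<close> shows that the dual norm of
  \<phi> is at least the L2 norm of the constant \<open>c0\<close>, which in turn dominates its dual
  norm.\<close>

lemma dual_norm_const_le:
  assumes \<phi>: "\<phi> \<in> P0 \<T>"
  defines "c0 \<equiv> (\<Sum>T\<in>\<T>. val \<phi> T * vol T) / vol \<Omega>"
  shows "dual_norm \<Omega> (\<lambda>x. c0) \<le> dual_norm \<Omega> \<phi>"
proof -
  let ?I = "\<Sum>T\<in>\<T>. val \<phi> T * vol T"
  have "avg \<Omega> T (\<lambda>x. s) = s" if T: "T \<in> \<T>" for T s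
  proof -
    have "(\<integral>x. indicator T x \<partial>lebesgue_on \<Omega>) = vol T"
      using integral_indicator_\<Omega> open_T[OF T] element_subset[OF T] by auto
    then show ?thesis unfolding avg_def using vol_pos[OF T] by simp
  qed
  then have inner: "L2_inner \<Omega> \<phi> (\<lambda>x. s) = s * ?I" for s
    unfolding P0_inner[OF \<phi> const_H1(3)] by (simp add: sum_distrib_left mult_ac)
  have I: "?I = c0 * vol \<Omega>" unfolding c0_def using vol_\<Omega>(1) by simp
  have "(\<bar>c0\<bar> * sqrt (vol \<Omega>)) * sqrt (vol \<Omega>) = sgn c0 * ?I"
    unfolding I using vol_\<Omega>(1) by (simp add: abs_sgn mult_ac)
  also have "\<dots> \<le> dual_norm \<Omega> \<phi> * (\<bar>sgn c0\<bar> * sqrt (vol \<Omega>))"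
    using dual_norm_ge[OF P0_L2[OF \<phi>] const_H1(1)[of "sgn c0"]] unfolding inner const_H1(2) .
  also have "\<dots> \<le> dual_norm \<Omega> \<phi> * (1 * sqrt (vol \<Omega>))"
    using dual_norm_nonneg[OF P0_L2[OF \<phi>]] vol_\<Omega>(1) by (intro mult_left_mono mult_right_mono) (auto simp: sgn_if)
  finally have "(\<bar>c0\<bar> * sqrt (vol \<Omega>)) * sqrt (vol \<Omega>) \<le> dual_norm \<Omega> \<phi> * sqrt (vol \<Omega>)"
    by simp
  then have le: "\<bar>c0\<bar> * sqrt (vol \<Omega>) \<le> dual_norm \<Omega> \<phi>" using vol_\<Omega>(1) by simp
  show ?thesis
  proof (rule dual_norm_le)
    fix v assume v: "v \<in> H1 \<Omega>"
    then have "v \<in> L2 \<Omega>" unfolding H1_def by auto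
    from L2_inner_bound(1)[OF const_H1(3) this, of c0]
    have "L2_inner \<Omega> (\<lambda>x. c0) v \<le> \<bar>c0\<bar> * sqrt (vol \<Omega>) * L2_norm \<Omega> v" unfolding const_H1(4) by linarith
    also have "\<dots> \<le> dual_norm \<Omega> \<phi> * H1_norm \<Omega> v"
      using le L2_norm_le_H1_norm(1,4)[of \<Omega> v] dual_norm_nonneg[OF P0_L2[OF \<phi>]] by (intro mult_mono) auto
    finally show "L2_inner \<Omega> (\<lambda>x. c0) v \<le> dual_norm \<Omega> \<phi> * H1_norm \<Omega> v" .
  qed
qed

text \<open>The hypothesis says that the coefficient times the facet measure is a weighted jump
  \<open>a\<close>; its contribution is then one term of the jump energy.\<close>

lemma facet_dual_upper:
  assumes E: "E \<in> \<E>" and c: "c * flat_measure E = h (Tp E) ^ (CARD('n) - 2) * a"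
  shows "(dual_norm \<Omega> (\<lambda>x. c * divergence (rt_function (Tp E) (Tm E) E) x))\<^sup>2
    \<le> 2 * jump_const * (h (Tp E) ^ (CARD('n) - 2) * a\<^sup>2)"
proof -
  let ?q = "\<lambda>x. c * divergence (rt_function (Tp E) (Tm E) E) x" and ?H = "h (Tp E) ^ (CARD('n) - 2)"
  have H: "?H > 0" by (rule facet_h_pos[OF E])
  have TT: "Tp E \<in> \<T>" "Tm E \<in> \<T>" using facet_props(1)[OF E] unfolding adj_def by auto
  define B where "B = sqrt (2 * jump_const * (?H * a\<^sup>2))"
  have B0: "2 * jump_const * (?H * a\<^sup>2) \<ge> 0" using H jump_const_nonneg by simp
  have "dual_norm \<Omega> ?q \<le> B"
  proof (rule dual_norm_le)
    fix v assume v: "v \<in> H1 \<Omega>"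
    define g where "g = weak_gradient \<Omega> v"
    have vL: "v \<in> L2 \<Omega>" using v unfolding H1_def by auto
    have g: "g \<in> L2 \<Omega>" "has_weak_gradient \<Omega> v g" unfolding g_def by (rule weak_gradient_props[OF v])+
    let ?d = "avg \<Omega> (Tp E) v - avg \<Omega> (Tm E) v"
    have "energy g T \<le> (H1_norm \<Omega> v)\<^sup>2" if "T \<in> \<T>" for T
    proof -
      have "energy g T \<le> (\<Sum>T\<in>\<T>. energy g T)" using finite_mesh that energy_nonneg by (intro member_le_sum) auto
      also have "\<dots> \<le> (H1_norm \<Omega> v)\<^sup>2" unfolding energy_sum[OF g(1)]
        using L2_norm_le_H1_norm(2)[of \<Omega> v] unfolding g_def by (intro power_mono) (auto simp: L2_norm_def)
      finally show ?thesis .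
    qed
    from this[OF TT(1)] this[OF TT(2)]
    have en: "energy g (Tp E) + energy g (Tm E) \<le> 2 * (H1_norm \<Omega> v)\<^sup>2" by linarith
    \<comment> \<open>The squared weight is split evenly: one factor belongs to the coefficient, the
      other to the jump of \<open>v\<close>.\<close>
    have "(L2_inner \<Omega> ?q v)\<^sup>2 = (?H * a\<^sup>2) * (?H * ?d\<^sup>2)"
      unfolding facet_function(3)[OF E vL] c by (simp add: power2_eq_square)
    also have "\<dots> \<le> (?H * a\<^sup>2) * (jump_const * (energy g (Tp E) + energy g (Tm E)))"
      using H by (intro mult_left_mono jump_bound[OF vL g facet_props(1)[OF E]]) auto
    also have "\<dots> \<le> (?H * a\<^sup>2) * (jump_const * (2 * (H1_norm \<Omega> v)\<^sup>2))"
      using H jump_const_nonneg en by (intro mult_left_mono) auto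
    also have "\<dots> = (B * H1_norm \<Omega> v)\<^sup>2" unfolding B_def power_mult_distrib using B0 by simp
    finally have "\<bar>L2_inner \<Omega> ?q v\<bar> \<le> \<bar>B * H1_norm \<Omega> v\<bar>" by (simp only: abs_le_square_iff)
    moreover have "B * H1_norm \<Omega> v \<ge> 0"
      unfolding B_def by (rule mult_nonneg_nonneg[OF real_sqrt_ge_zero[OF B0] L2_norm_le_H1_norm(3)])
    ultimately show "L2_inner \<Omega> ?q v \<le> B * H1_norm \<Omega> v" by linarith
  qed
  then have "(dual_norm \<Omega> ?q)\<^sup>2 \<le> B\<^sup>2"
    using dual_norm_nonneg[OF P0_L2[OF facet_function(1)[OF E]]] by (intro power_mono)
  then show ?thesis unfolding B_def using B0 by simp
qed

text \<open>The coefficients are the weighted jumps of the solution \<open>u\<close> of the discrete Laplace equation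
  with right-hand side \<open>\<phi>\<close> minus its mean. Testing \<open>\<phi>\<close> with the conforming companion of \<open>u\<close> bounds
  the energy of \<open>u\<close> by the dual norm of \<open>\<phi>\<close>.\<close>

lemma stable_decomposition:
  assumes CP: "CP \<ge> 0" and Poincare: "\<And>v g. v \<in> L2 \<Omega> \<Longrightarrow> g \<in> L2 \<Omega> \<Longrightarrow> has_weak_gradient \<Omega> v g \<Longrightarrow>
      continuous_on (closure \<Omega>) v \<Longrightarrow> (\<integral>x. v x \<partial>lebesgue_on \<Omega>) = 0 \<Longrightarrow> (L2_norm \<Omega> v)\<^sup>2 \<le> CP * (L2_norm \<Omega> g)\<^sup>2"
    and \<phi>: "\<phi> \<in> P0 \<T>"
  obtains \<phi>0 \<phi>E where "\<phi>0 \<in> X0" "\<And>E. E \<in> \<E> \<Longrightarrow> \<phi>E E \<in> XE (Tp E) (Tm E) E"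
    "AE x in lebesgue_on \<Omega>. \<phi> x = \<phi>0 x + (\<Sum>E\<in>\<E>. \<phi>E E x)"
    "(dual_norm \<Omega> \<phi>0)\<^sup>2 + (\<Sum>E\<in>\<E>. (dual_norm \<Omega> (\<phi>E E))\<^sup>2) \<le> lower_const CP * (dual_norm \<Omega> \<phi>)\<^sup>2"
proof -
  let ?D = "dual_norm \<Omega> \<phi>" and ?H = "\<lambda>E. h (Tp E) ^ (CARD('n) - 2)"
  have D0: "?D \<ge> 0" by (rule dual_norm_nonneg[OF P0_L2[OF \<phi>]])
  define c0 where "c0 = (\<Sum>T\<in>\<T>. val \<phi> T * vol T) / vol \<Omega>"
  define F where "F t = (\<Sum>T\<in>\<T>. (val \<phi> T - c0) * vol T * t T)" for t
  define K where "K = (CP + 1) * disc_const"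
  have K: "K \<ge> 0" unfolding K_def using CP disc_const_nonneg by simp
  have je0: "jump_energy t \<ge> 0" for t
    by (rule sum_nonneg) (rule mult_nonneg_nonneg[OF less_imp_le[OF facet_h_pos] zero_le_power2])
  have "(\<Sum>T\<in>\<T>. val \<phi> T * vol T) = c0 * vol \<Omega>" unfolding c0_def using vol_\<Omega>(1) by simp
  then have mean: "(\<Sum>T\<in>\<T>. (val \<phi> T - c0) * vol T) = 0"
    unfolding left_diff_distrib sum_subtractf sum_distrib_left[symmetric] vol_\<Omega>(2) by simp
  \<comment> \<open>The companion of \<open>t\<close> turns \<open>F t\<close> into a pairing of
    \<phi> with a function whose full norm is bounded by the jump energy.\<close>
  have F_le: "F t \<le> ?D * sqrt (K * jump_energy t)" for t
  proof -
    \<comment> \<open>Subtracting the mean leaves jumps unchanged, does not alter \<open>F\<close>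
      because its weights sum to zero, and provides the zero mean for the Poincare
      inequality.\<close>
    define m where "m = (\<Sum>T\<in>\<T>. t T * vol T) / vol \<Omega>"
    define t' where "t' T = t T - m" for T
    have jt: "jump_energy t' = jump_energy t" unfolding t'_def by simp
    have "(\<Sum>T\<in>\<T>. t T * vol T) = m * vol \<Omega>" unfolding m_def using vol_\<Omega>(1) by simp
    then have t'0: "(\<Sum>T\<in>\<T>. t' T * vol T) = 0"
      unfolding t'_def left_diff_distrib sum_subtractf sum_distrib_left[symmetric] vol_\<Omega>(2) by simp
    obtain w g where w: "w \<in> L2 \<Omega>" "g \<in> L2 \<Omega>" "has_weak_gradient \<Omega> w g" "continuous_on (closure \<Omega>) w"
      and wT: "\<And>T. T \<in> \<T> \<Longrightarrow> (\<integral>x. indicator T x * w x \<partial>lebesgue_on \<Omega>) = t' T * vol T"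
      and wg: "(L2_norm \<Omega> g)\<^sup>2 \<le> disc_const * jump_energy t'"
      using conforming_companion[of t'] by blast
    have av: "avg \<Omega> T w = t' T" if "T \<in> \<T>" for T
      using avg_integral[OF that, of w] wT[OF that] vol_pos[OF that] by simp
    have "integrable (lebesgue_on \<Omega>) w" using L2_inner_bound(2)[OF const_H1(3)[of 1] w(1)] by simp
    from integral_elements[OF this] have "(\<integral>x. w x \<partial>lebesgue_on \<Omega>) = 0" using wT t'0 by simp
    from Poincare[OF w this] have P: "(L2_norm \<Omega> w)\<^sup>2 \<le> CP * (L2_norm \<Omega> g)\<^sup>2" .
    note H = H1_norm_eq[OF \<Omega>_bounded \<Omega>_open w(1-3)]
    have "(L2_norm \<Omega> w)\<^sup>2 + (L2_norm \<Omega> g)\<^sup>2 \<le> (CP + 1) * (L2_norm \<Omega> g)\<^sup>2" using P by (simp add: distrib_right)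
    also have "\<dots> \<le> (CP + 1) * (disc_const * jump_energy t')" using CP by (intro mult_left_mono wg) auto
    also have "\<dots> = K * jump_energy t" unfolding K_def jt by simp
    finally have Hw: "H1_norm \<Omega> w \<le> sqrt (K * jump_energy t)" unfolding H(2) by simp
    have "F t = (\<Sum>T\<in>\<T>. (val \<phi> T - c0) * vol T * t' T) + m * (\<Sum>T\<in>\<T>. (val \<phi> T - c0) * vol T)"
      unfolding F_def t'_def by (simp add: sum_distrib_left sum.distrib[symmetric] algebra_simps)
    also have "\<dots> = (\<Sum>T\<in>\<T>. val \<phi> T * vol T * t' T) - c0 * (\<Sum>T\<in>\<T>. t' T * vol T)"
      unfolding mean by (simp add: sum_distrib_left sum_subtractf[symmetric] algebra_simps)
    also have "\<dots> = L2_inner \<Omega> \<phi> w" unfolding t'0 P0_inner[OF \<phi> w(1)] using av by simp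
    also have "\<dots> \<le> ?D * H1_norm \<Omega> w" by (rule dual_norm_ge[OF P0_L2[OF \<phi>] H(1)])
    also have "\<dots> \<le> ?D * sqrt (K * jump_energy t)" by (rule mult_left_mono[OF Hw D0])
    finally show ?thesis .
  qed
  have F_lin: "F (\<lambda>x. a * s x + b * t x) = a * F s + b * F t" for a b s t
    unfolding F_def by (simp add: sum_distrib_left sum.distrib[symmetric] algebra_simps)
  \<comment> \<open>The root of the weight makes the sum of products \<open>j E s * j E t\<close>
    the weighted graph Laplace form.\<close>
  define j where "j E t = sqrt (?H E) * (t (Tp E) - t (Tm E))" for E and t :: "(real^'n) set \<Rightarrow> real"
  have j_lin: "j E (\<lambda>x. a * s x + b * t x) = a * j E s + b * j E t" for E a b s t
    unfolding j_def by (simp add: algebra_simps)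
  have jj: "j E s * j E t = ?H E * ((s (Tp E) - s (Tm E)) * (t (Tp E) - t (Tm E)))" if "E \<in> \<E>" for E s t
  proof -
    have "sqrt (?H E) * sqrt (?H E) = ?H E" using facet_h_pos[OF that] by simp
    moreover have "j E s * j E t = (sqrt (?H E) * sqrt (?H E)) * ((s (Tp E) - s (Tm E)) * (t (Tp E) - t (Tm E)))"
      unfolding j_def by simp
    ultimately show ?thesis by simp
  qed
  have je: "jump_energy t = (\<Sum>E\<in>\<E>. j E t * j E t)" for t
    by (rule sum.cong[OF refl]) (simp only: jj power2_eq_square)
  \<comment> \<open>The upper bound by the jump energy applies to \<open>t\<close> and to its
    negative; this is the solvability condition.\<close>
  have "F t = 0" if "\<And>E. E \<in> \<E> \<Longrightarrow> j E t = 0" for t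
  proof -
    have "jump_energy t = 0" unfolding je using that by simp
    then have F0: "F t \<le> 0" using F_le[of t] by simp
    have "jump_energy (\<lambda>x. (-1) * t x + 0 * t x) = 0" 
      using je[of "\<lambda>x. (-1) * t x + 0 * t x"] unfolding j_lin using that by simp
    then have "F (\<lambda>x. (-1) * t x + 0 * t x) \<le> 0" using F_le[of "\<lambda>x. (-1) * t x + 0 * t x"] by simp
    then show ?thesis using F0 unfolding F_lin by simp
  qed
  with quadratic_form_representation[of \<E> j F, OF finite_facets j_lin F_lin]
  obtain u where u: "\<And>t. (\<Sum>E\<in>\<E>. j E u * j E t) = F t" by blast
  have "jump_energy u \<le> ?D * sqrt (K * jump_energy u)" using F_le[of u] u[of u] unfolding je by simp
  \<comment> \<open>Testing the equation with \<open>u\<close> itself bounds its energy by the root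
    of the energy, and one root cancels.\<close>
  then have ju: "jump_energy u \<le> K * ?D\<^sup>2"
  proof (cases "jump_energy u = 0")
    case False
    have "(jump_energy u)\<^sup>2 \<le> (?D * sqrt (K * jump_energy u))\<^sup>2"
      using \<open>jump_energy u \<le> ?D * sqrt (K * jump_energy u)\<close> je0 by (intro power_mono) auto
    also have "\<dots> = (K * ?D\<^sup>2) * jump_energy u" using K je0[of u] by (simp add: power_mult_distrib)
    finally show ?thesis using False je0[of u] by (simp add: power2_eq_square)
  qed (use K in simp)
  define c where "c E = ?H E * (u (Tp E) - u (Tm E)) / flat_measure E" for E
  have c: "c E * flat_measure E = ?H E * (u (Tp E) - u (Tm E))" if "E \<in> \<E>" for E
    unfolding c_def using flat_measure_facet[OF that] by simp
  define \<phi>E where "\<phi>E E = (\<lambda>x. c E * divergence (rt_function (Tp E) (Tm E) E) x)" for E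
  show thesis
  proof (rule that[of "\<lambda>x. c0 * 1" \<phi>E])
    show "(\<lambda>x. c0 * 1) \<in> X0" unfolding X0_def by blast
    show "\<phi>E E \<in> XE (Tp E) (Tm E) E" for E unfolding \<phi>E_def XE_def by blast
    show "AE x in lebesgue_on \<Omega>. \<phi> x = c0 * 1 + (\<Sum>E\<in>\<E>. \<phi>E E x)"
    proof (rule AE_\<Omega>I)
      fix T x assume T: "T \<in> \<T>" "x \<in> T"
      \<comment> \<open>Testing the equation with the unit vector of \<open>T\<close> reads off the
        divergence of the discrete flux on this element.\<close>
      let ?t = "\<lambda>R. if R = T then 1 else 0 :: real"
      have "(\<Sum>E\<in>\<E>. \<phi>E E x) = (\<Sum>E\<in>\<E>. j E u * j E ?t) / vol T"
        unfolding sum_divide_distrib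
      proof (rule sum.cong[OF refl])
        fix E assume E: "E \<in> \<E>"
        have "\<phi>E E x = c E * flat_measure E * ((if T = Tp E then 1 else 0) - (if T = Tm E then 1 else 0)) / vol T"
          unfolding \<phi>E_def facet_function_values[OF E T] by simp
        also have "\<dots> = j E u * j E ?t / vol T" unfolding c[OF E] jj[OF E] by auto
        finally show "\<phi>E E x = j E u * j E ?t / vol T" .
      qed
      also have "\<dots> = F ?t / vol T" unfolding u ..
      also have "F ?t = (val \<phi> T - c0) * vol T"
      proof -
        have "F ?t = (\<Sum>R\<in>\<T>. if R = T then (val \<phi> T - c0) * vol T else 0)"
          unfolding F_def by (rule sum.cong) auto
        then show ?thesis using finite_mesh T by simp
      qed
      finally have "(\<Sum>E\<in>\<E>. \<phi>E E x) = val \<phi> T - c0" using vol_pos[OF T(1)] by simp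
      then show "\<phi> x = c0 * 1 + (\<Sum>E\<in>\<E>. \<phi>E E x)" using P0_val[OF \<phi> T] by simp
    qed
    have "(\<Sum>E\<in>\<E>. (dual_norm \<Omega> (\<phi>E E))\<^sup>2) \<le> (\<Sum>E\<in>\<E>. 2 * jump_const * (?H E * (u (Tp E) - u (Tm E))\<^sup>2))"
      unfolding \<phi>E_def by (intro sum_mono facet_dual_upper c)
    also have "\<dots> = 2 * jump_const * jump_energy u" by (rule sum_distrib_left[symmetric])
    also have "\<dots> \<le> 2 * jump_const * (K * ?D\<^sup>2)" using ju jump_const_nonneg by (intro mult_left_mono) auto
    finally have facets: "(\<Sum>E\<in>\<E>. (dual_norm \<Omega> (\<phi>E E))\<^sup>2) \<le> 2 * jump_const * (K * ?D\<^sup>2)" .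
    have "dual_norm \<Omega> (\<lambda>x. c0) \<le> ?D" unfolding c0_def by (rule dual_norm_const_le[OF \<phi>])
    then have "(dual_norm \<Omega> (\<lambda>x. c0))\<^sup>2 \<le> ?D\<^sup>2" using dual_norm_nonneg[OF const_H1(3)] by (intro power_mono)
    then show "(dual_norm \<Omega> (\<lambda>x. c0 * 1))\<^sup>2 + (\<Sum>E\<in>\<E>. (dual_norm \<Omega> (\<phi>E E))\<^sup>2) \<le> lower_const CP * ?D\<^sup>2"
      using facets unfolding lower_const_def K_def by (simp add: distrib_right mult.assoc)
  qed
qed

text \<open>The stable decomposition bounds the infimum from above and shows that the set is
  nonempty; the estimate for arbitrary decompositions makes the scaled dual norm a lower bound.
  Attainment of the infimum does not enter.\<close>

lemma norm_equivalence:
  assumes CP: "CP \<ge> 0" and Poincare: "\<And>v g. v \<in> L2 \<Omega> \<Longrightarrow> g \<in> L2 \<Omega> \<Longrightarrow> has_weak_gradient \<Omega> v g \<Longrightarrow>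
      continuous_on (closure \<Omega>) v \<Longrightarrow> (\<integral>x. v x \<partial>lebesgue_on \<Omega>) = 0 \<Longrightarrow> (L2_norm \<Omega> v)\<^sup>2 \<le> CP * (L2_norm \<Omega> g)\<^sup>2"
    and \<phi>: "\<phi> \<in> P0 \<T>" and C: "C > 0" "upper_const \<le> C\<^sup>2" "lower_const CP \<le> C\<^sup>2"
  shows "inverse C * Y_norm \<Omega> \<T> Tp Tm \<phi> \<le> dual_norm \<Omega> \<phi>" "dual_norm \<Omega> \<phi> \<le> C * Y_norm \<Omega> \<T> Tp Tm \<phi>"
proof -
  let ?D = "dual_norm \<Omega> \<phi>"
  define S where "S = {(dual_norm \<Omega> \<phi>0)\<^sup>2 + (\<Sum>E\<in>\<E>. (dual_norm \<Omega> (\<phi>E E))\<^sup>2) | \<phi>0 \<phi>E.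
        \<phi>0 \<in> X0 \<and> (\<forall>E\<in>\<E>. \<phi>E E \<in> XE (Tp E) (Tm E) E) \<and>
        (AE x in lebesgue_on \<Omega>. \<phi> x = \<phi>0 x + (\<Sum>E\<in>\<E>. \<phi>E E x))}"
  have Y: "Y_norm \<Omega> \<T> Tp Tm \<phi> = sqrt (Inf S)" unfolding Y_norm_def S_def ..
  have D0: "?D \<ge> 0" by (rule dual_norm_nonneg[OF P0_L2[OF \<phi>]])
  have nonneg: "s \<ge> 0" if "s \<in> S" for s using that unfolding S_def by (auto intro!: add_nonneg_nonneg sum_nonneg)
  have bdd: "bdd_below S" using nonneg by (rule bdd_belowI)
  obtain \<phi>0 \<phi>E where d: "\<phi>0 \<in> X0" "\<And>E. E \<in> \<E> \<Longrightarrow> \<phi>E E \<in> XE (Tp E) (Tm E) E"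
    "AE x in lebesgue_on \<Omega>. \<phi> x = \<phi>0 x + (\<Sum>E\<in>\<E>. \<phi>E E x)"
    and le: "(dual_norm \<Omega> \<phi>0)\<^sup>2 + (\<Sum>E\<in>\<E>. (dual_norm \<Omega> (\<phi>E E))\<^sup>2) \<le> lower_const CP * ?D\<^sup>2"
    using stable_decomposition[OF CP Poincare \<phi>] by blast
  have mem: "(dual_norm \<Omega> \<phi>0)\<^sup>2 + (\<Sum>E\<in>\<E>. (dual_norm \<Omega> (\<phi>E E))\<^sup>2) \<in> S" unfolding S_def using d by blast
  have "Inf S \<le> lower_const CP * ?D\<^sup>2" using cInf_lower[OF mem bdd] le by linarith
  also have "\<dots> \<le> C\<^sup>2 * ?D\<^sup>2" by (rule mult_right_mono[OF C(3)]) simp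
  also have "\<dots> = (C * ?D)\<^sup>2" by (simp add: power_mult_distrib)
  finally have "sqrt (Inf S) \<le> C * ?D" using C(1) D0 by (intro real_le_lsqrt) auto
  then show "inverse C * Y_norm \<Omega> \<T> Tp Tm \<phi> \<le> ?D" unfolding Y using C(1) by (simp add: field_simps)
  have "?D\<^sup>2 / C\<^sup>2 \<le> Inf S"
  proof (rule cInf_greatest)
    fix s assume s: "s \<in> S"
    then have "?D\<^sup>2 \<le> upper_const * s" unfolding S_def using dual_norm_decomposition_le[OF \<phi>] by blast
    also have "\<dots> \<le> C\<^sup>2 * s" using C(2) nonneg[OF s] by (rule mult_right_mono)
    finally show "?D\<^sup>2 / C\<^sup>2 \<le> s" using C(1) by (simp add: pos_divide_le_eq mult.commute)
  qed (use mem in blast)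
  then have "(?D / C)\<^sup>2 \<le> Inf S" by (simp add: power_divide)
  then have "?D / C \<le> sqrt (Inf S)" by (rule real_le_rsqrt)
  then show "?D \<le> C * Y_norm \<Omega> \<T> Tp Tm \<phi>" unfolding Y using C(1) by (simp add: pos_divide_le_eq mult.commute)
qed

end

theorem theorem4:
  fixes \<Omega> :: "(real^'n) set" and \<gamma> :: real
  assumes "CARD('n) \<ge> 2" and "polyhedral_lipschitz_domain \<Omega>"
  shows "\<exists>C>0. \<forall>\<T> Tp Tm.
    regular_mesh \<Omega> \<T> \<and> shape_regular \<gamma> \<T> \<and> facet_labelling \<Omega> \<T> Tp Tm \<longrightarrow>
    (\<forall>\<phi>\<in>P0 \<T>. inverse C * Y_norm \<Omega> \<T> Tp Tm \<phi> \<le> dual_norm \<Omega> \<phi> \<and>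
               dual_norm \<Omega> \<phi> \<le> C * Y_norm \<Omega> \<T> Tp Tm \<phi>)"
proof (cases "\<exists>\<T> Tp Tm. regular_mesh \<Omega> \<T> \<and> shape_regular \<gamma> \<T> \<and> facet_labelling \<Omega> \<T> Tp Tm")
  case True
  define \<kappa> where "\<kappa> = 10 ^ CARD('n) * \<gamma>"
  define P where "P = (nat \<lceil>8 ^ CARD('n) * \<gamma>\<rceil>)\<^sup>2"
  have mesh: "mesh \<Omega> \<T> Tp Tm \<gamma> \<kappa> P"
    if "regular_mesh \<Omega> \<T> \<and> shape_regular \<gamma> \<T> \<and> facet_labelling \<Omega> \<T> Tp Tm" for \<T> Tp Tm
    using that assms \<kappa>_def P_def by unfold_locales auto
  from True obtain \<T>0 Tp0 Tm0 where m0: "mesh \<Omega> \<T>0 Tp0 Tm0 \<gamma> \<kappa> P" using mesh by blast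
  \<comment> \<open>The Poincare constant of one admissible mesh serves for all meshes, as it concerns only \<open>\<Omega>\<close>.\<close>
  interpret m0: mesh \<Omega> \<T>0 Tp0 Tm0 \<gamma> \<kappa> P by (rule m0)
  obtain CP where CP: "CP \<ge> 0" and Poincare: "\<And>v g. v \<in> L2 \<Omega> \<Longrightarrow> g \<in> L2 \<Omega> \<Longrightarrow> has_weak_gradient \<Omega> v g \<Longrightarrow>
      continuous_on (closure \<Omega>) v \<Longrightarrow> (\<integral>x. v x \<partial>lebesgue_on \<Omega>) = 0 \<Longrightarrow> (L2_norm \<Omega> v)\<^sup>2 \<le> CP * (L2_norm \<Omega> g)\<^sup>2"
    using m0.Poincare_mesh by blast
  \<comment> \<open>\<open>upper_const\<close> and \<open>lower_const CP\<close> depend only on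
    \<Omega>, the dimension and the numbers \<open>\<gamma>\<close>, \<open>\<kappa>\<close>,
    \<open>P\<close>, \<open>CP\<close>, so their values for this mesh are those for every mesh. The
    summand 1 gives \<open>C \<le> C\<^sup>2\<close>, as the estimates concern squares.\<close>
  define C where "C = 1 + \<bar>m0.upper_const\<bar> + \<bar>m0.lower_const CP\<bar>"
  have "1 \<le> C" unfolding C_def by simp
  then have C: "C > 0" "C \<le> C\<^sup>2" by (auto simp: power2_eq_square)
  have "m0.upper_const \<le> C\<^sup>2" "m0.lower_const CP \<le> C\<^sup>2" using C(2) unfolding C_def by linarith+
  then show ?thesis
    using C(1) mesh.norm_equivalence[OF mesh CP Poincare] by (intro exI[of _ C]) blast
next
  case False
  \<comment> \<open>Without an admissible mesh there is nothing to show, and any positive constant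
    will do.\<close>
  then show ?thesis by (intro exI[of _ 1]) auto
qed

end
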